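(* Let $(B(t))_{t\in\mathbb{R}}$ be a centered complex-valued, mean square continuous, wide sense stationary process with spectral measure $\mu$ on $\mathbb{R}$, and let $f_a$ be the density (with respect to Lebesgue measure) of the absolutely continuous component of $\mu$. Let $L$ be a linear filter with measurable frequency characteristic $\ell:\mathbb{R}\to\mathbb{C}$. Then for every fixed $t\in\mathbb{R}$ the equality $$\sigma^2(t)=\sigma^2(\infty)=\int_{\mathbb{R}}\frac{|\ell(u)|^2}{1+|\ell(u)|^2}\,\mu(du)$$ holds if and only if one of the following holds: (a) $\displaystyle\int_{-\infty}^{\infty}\frac{|\ln f_a(u)|}{1+u^2}\,du=\infty$; (b) $\displaystyle\int_{-\infty}^{\infty}\frac{|\ln f_a(u)|}{1+u^2}\,du<\infty$, $t>0$, and $\frac{1}{1+|\ell(u)|^2}$ coincides Lebesgue-a.e. with the restriction to $\mathbb{R}$ of an entire analytic function of exponential type not exceeding $t$; (c) $\displaystyle\int_{-\infty}^{\infty}\frac{|\ln f_a(u)|}{1+u^2}\,du<\infty$, $t=0$, and $|\ell(\cdot)|$ is Lebesgue-a.e. equal to a constant.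
   Context: A centered complex-valued process $(B(t))_{t\in\mathbb{R}}$ is wide sense stationary if $\mathbb{E}B(t)=0$, $\mathbb{E}|B(t)|^2<\infty$ and $\mathbb{E}B(t+s)\overline{B(s)}=:K(t)$ does not depend on $s$. Its spectral measure (for mean square continuous $B$) is the finite measure $\mu$ on $\mathbb{R}$ with $K(t)=\int_{\mathbb{R}} e^{itu}\mu(du)$; one has $B(t)=\int e^{itu}\,\mathcal{W}(du)$ with an orthogonal random measure $\mathcal{W}$, $\mathbb{E}|\mathcal{W}(A)|^2=\mu(A)$. $H$ is the closed linear span of $\{B(s):s\in\mathbb{R}\}$ in the Hilbert space of square integrable random variables, and $H_t$ is the closed linear span of $\{B(s):s\le t\}$. The stochastic integral $\phi\mapsto\int\phi\,d\mathcal{W}$ is a linear isometry of $L_2(\mu)$ onto $H$; for $\xi\in H$ write $\xi=\int\phi_\xi\,d\mathcal{W}$. The linear filter $L$ with frequency characteristic $\ell$ is $L\xi=\int\ell(u)\phi_\xi(u)\,\mathcal{W}(du)$ with domain $\mathcal{D}(L)=\{\xi\in H:\int|\ell\phi_\xi|^2d\mu<\infty\}$. The prediction errors are $$\sigma^2(t):=\inf_{Y\in H_t\cap\mathcal{D}(L)}\{\mathbb{E}|Y-B(0)|^2+\mathbb{E}|LY|^2\},\quad t\in\mathbb{R},$$ and $\sigma^2(\infty)$ is the same quantity with $H_t$ replaced by $H$. Convention: $|\ln 0|=\infty$. An entire function $V$ is of exponential type not exceeding $t$ if for every $\varepsilon>0$ there is $C_\varepsilon$ with $|V(z)|\le C_\varepsilon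 e^{(t+\varepsilon)|z|}$ for all $z\in\mathbb{C}$. *)

theory Defs
  imports "HOL-Probability.Probability" "HOL-Complex_Analysis.Complex_Analysis"
begin

text \<open>Square integrable functions are handled as representatives; two of them are the same
  element of \<open>L\<^sub>2(M)\<close> iff their \<open>L2_dist_sq\<close> is zero.\<close>

definition L2 :: "'a measure \<Rightarrow> ('a \<Rightarrow> complex) set" where
  "L2 M = {X \<in> borel_measurable M. integrable M (\<lambda>\<omega>. (cmod (X \<omega>))\<^sup>2)}"

definition L2_dist_sq :: "'a measure \<Rightarrow> ('a \<Rightarrow> complex) \<Rightarrow> ('a \<Rightarrow> complex) \<Rightarrow> real" where
  "L2_dist_sq M X Y = (\<integral>\<omega>. (cmod (X \<omega> - Y \<omega>))\<^sup>2 \<partial>M)"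

definition complex_lin_span :: "('a \<Rightarrow> complex) set \<Rightarrow> ('a \<Rightarrow> complex) set" where
  "complex_lin_span S = {\<lambda>\<omega>. \<Sum>Z\<in>F. c Z * Z \<omega> | F c. finite F \<and> F \<subseteq> S}"

definition closed_lin_span :: "'a measure \<Rightarrow> ('a \<Rightarrow> complex) set \<Rightarrow> ('a \<Rightarrow> complex) set" where
  "closed_lin_span M S =
     {X \<in> L2 M. \<forall>\<epsilon>>0. \<exists>Y\<in>complex_lin_span S. L2_dist_sq M X Y < \<epsilon>}"


definition wide_sense_stationary :: "'a measure \<Rightarrow> (real \<Rightarrow> 'a \<Rightarrow> complex) \<Rightarrow> bool" where
  "wide_sense_stationary M B \<longleftrightarrow>
     (\<forall>t. B t \<in> L2 M) \<and>
     (\<forall>t. (\<integral>\<omega>. B t \<omega> \<partial>M) = 0) \<and>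
     (\<forall>t s s'. (\<integral>\<omega>. B (t + s) \<omega> * cnj (B s \<omega>) \<partial>M) = (\<integral>\<omega>. B (t + s') \<omega> * cnj (B s' \<omega>) \<partial>M))"

definition mean_square_continuous :: "'a measure \<Rightarrow> (real \<Rightarrow> 'a \<Rightarrow> complex) \<Rightarrow> bool" where
  "mean_square_continuous M B \<longleftrightarrow> (\<forall>s. ((\<lambda>t. L2_dist_sq M (B t) (B s)) \<longlongrightarrow> 0) (at s))"

text \<open>\<open>char \<mu> t\<close> is \<open>\<integral>exp(itu) \<mu>(du)\<close>.\<close>

definition spectral_measure :: "'a measure \<Rightarrow> (real \<Rightarrow> 'a \<Rightarrow> complex) \<Rightarrow> real measure \<Rightarrow> bool" where
  "spectral_measure M B \<mu> \<longleftrightarrow>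
     finite_measure \<mu> \<and> sets \<mu> = sets borel \<and>
     (\<forall>t s. (\<integral>\<omega>. B (t + s) \<omega> * cnj (B s \<omega>) \<partial>M) = char \<mu> t)"


definition orthogonal_random_measure ::
    "'a measure \<Rightarrow> real measure \<Rightarrow> (real set \<Rightarrow> 'a \<Rightarrow> complex) \<Rightarrow> bool" where
  "orthogonal_random_measure M \<mu> W \<longleftrightarrow>
     (\<forall>A\<in>sets \<mu>. W A \<in> L2 M \<and> (\<integral>\<omega>. (cmod (W A \<omega>))\<^sup>2 \<partial>M) = measure \<mu> A) \<and>
     (\<forall>A\<in>sets \<mu>. \<forall>C\<in>sets \<mu>. A \<inter> C = {} \<longrightarrow> (\<integral>\<omega>. W A \<omega> * cnj (W C \<omega>) \<partial>M) = 0) \<and>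
     (\<forall>A::nat \<Rightarrow> real set. range A \<subseteq> sets \<mu> \<and> disjoint_family A \<longrightarrow>
        (\<lambda>n. L2_dist_sq M (W (\<Union>k. A k)) (\<lambda>\<omega>. \<Sum>k<n. W (A k) \<omega>)) \<longlonglongrightarrow> 0)"

definition simple_stoch_integral ::
    "real measure \<Rightarrow> (real set \<Rightarrow> 'a \<Rightarrow> complex) \<Rightarrow> (real \<Rightarrow> complex) \<Rightarrow> 'a \<Rightarrow> complex" where
  "simple_stoch_integral \<mu> W g = (\<lambda>\<omega>. \<Sum>z\<in>g ` space \<mu>. z * W (g -` {z} \<inter> space \<mu>) \<omega>)"

text \<open>The integral of a general \<open>\<phi>\<close> in \<open>L\<^sub>2(\<mu>)\<close> is the isometric extension from simple functions;
  it is determined up to equality almost surely.\<close>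

definition has_stoch_integral ::
    "'a measure \<Rightarrow> real measure \<Rightarrow> (real set \<Rightarrow> 'a \<Rightarrow> complex) \<Rightarrow> (real \<Rightarrow> complex) \<Rightarrow>
     ('a \<Rightarrow> complex) \<Rightarrow> bool" where
  "has_stoch_integral M \<mu> W \<phi> \<xi> \<longleftrightarrow>
     \<phi> \<in> L2 \<mu> \<and> \<xi> \<in> L2 M \<and>
     (\<forall>\<epsilon>>0. \<exists>g. simple_function \<mu> g \<and> L2_dist_sq \<mu> \<phi> g < \<epsilon> \<and>
        L2_dist_sq M \<xi> (simple_stoch_integral \<mu> W g) < \<epsilon>)"

definition stoch_integral ::
    "'a measure \<Rightarrow> real measure \<Rightarrow> (real set \<Rightarrow> 'a \<Rightarrow> complex) \<Rightarrow> (real \<Rightarrow> complex) \<Rightarrow>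
     'a \<Rightarrow> complex" where
  "stoch_integral M \<mu> W \<phi> = (SOME \<xi>. has_stoch_integral M \<mu> W \<phi> \<xi>)"

text \<open>The random measure \<open>W\<close> with \<open>B(t) = \<integral>exp(itu) W(du)\<close>. It exists by the spectral representation
  theorem, and each \<open>W(A)\<close> is unique up to equality almost surely.\<close>

definition spectral_random_measure ::
    "'a measure \<Rightarrow> (real \<Rightarrow> 'a \<Rightarrow> complex) \<Rightarrow> real measure \<Rightarrow> (real set \<Rightarrow> 'a \<Rightarrow> complex)" where
  "spectral_random_measure M B \<mu> =
     (SOME W. orthogonal_random_measure M \<mu> W \<and>
        (\<forall>t. has_stoch_integral M \<mu> W (\<lambda>u. iexp (t * u)) (B t)))"


definition process_space :: "'a measure \<Rightarrow> (real \<Rightarrow> 'a \<Rightarrow> complex) \<Rightarrow> ('a \<Rightarrow> complex) set" where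
  "process_space M B = closed_lin_span M (range B)"

definition past_space ::
    "'a measure \<Rightarrow> (real \<Rightarrow> 'a \<Rightarrow> complex) \<Rightarrow> real \<Rightarrow> ('a \<Rightarrow> complex) set" where
  "past_space M B t = closed_lin_span M (B ` {..t})"

text \<open>The function \<open>\<phi>\<^sub>\<xi>\<close> with \<open>\<xi> = \<integral>\<phi>\<^sub>\<xi> dW\<close>, unique up to equality \<open>\<mu>\<close>-almost everywhere.\<close>

definition spectral_repr ::
    "'a measure \<Rightarrow> (real \<Rightarrow> 'a \<Rightarrow> complex) \<Rightarrow> real measure \<Rightarrow> ('a \<Rightarrow> complex) \<Rightarrow> real \<Rightarrow> complex" where
  "spectral_repr M B \<mu> \<xi> =
     (SOME \<phi>. has_stoch_integral M \<mu> (spectral_random_measure M B \<mu>) \<phi> \<xi>)"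

definition filter_domain ::
    "'a measure \<Rightarrow> (real \<Rightarrow> 'a \<Rightarrow> complex) \<Rightarrow> real measure \<Rightarrow> (real \<Rightarrow> complex) \<Rightarrow>
     ('a \<Rightarrow> complex) set" where
  "filter_domain M B \<mu> \<ll> =
     {\<xi> \<in> process_space M B. integrable \<mu> (\<lambda>u. (cmod (\<ll> u * spectral_repr M B \<mu> \<xi> u))\<^sup>2)}"

definition linear_filter ::
    "'a measure \<Rightarrow> (real \<Rightarrow> 'a \<Rightarrow> complex) \<Rightarrow> real measure \<Rightarrow> (real \<Rightarrow> complex) \<Rightarrow>
     ('a \<Rightarrow> complex) \<Rightarrow> 'a \<Rightarrow> complex" where
  "linear_filter M B \<mu> \<ll> \<xi> =
     stoch_integral M \<mu> (spectral_random_measure M B \<mu>) (\<lambda>u. \<ll> u * spectral_repr M B \<mu> \<xi> u)"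

definition prediction_error_over ::
    "'a measure \<Rightarrow> (real \<Rightarrow> 'a \<Rightarrow> complex) \<Rightarrow> real measure \<Rightarrow> (real \<Rightarrow> complex) \<Rightarrow>
     ('a \<Rightarrow> complex) set \<Rightarrow> real" where
  "prediction_error_over M B \<mu> \<ll> G =
     (INF Y\<in>G \<inter> filter_domain M B \<mu> \<ll>.
        (\<integral>\<omega>. (cmod (Y \<omega> - B 0 \<omega>))\<^sup>2 \<partial>M) +
        (\<integral>\<omega>. (cmod (linear_filter M B \<mu> \<ll> Y \<omega>))\<^sup>2 \<partial>M))"

definition prediction_error ::
    "'a measure \<Rightarrow> (real \<Rightarrow> 'a \<Rightarrow> complex) \<Rightarrow> real measure \<Rightarrow> (real \<Rightarrow> complex) \<Rightarrow> real \<Rightarrow> real" where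
  "prediction_error M B \<mu> \<ll> t = prediction_error_over M B \<mu> \<ll> (past_space M B t)"

definition prediction_error_infinity ::
    "'a measure \<Rightarrow> (real \<Rightarrow> 'a \<Rightarrow> complex) \<Rightarrow> real measure \<Rightarrow> (real \<Rightarrow> complex) \<Rightarrow> real" where
  "prediction_error_infinity M B \<mu> \<ll> = prediction_error_over M B \<mu> \<ll> (process_space M B)"


text \<open>\<open>f\<close> is (a version of) the density of the absolutely continuous component in the Lebesgue
  decomposition of \<open>\<mu>\<close>; \<open>\<nu>\<close> is the singular component.\<close>

definition ac_density :: "real measure \<Rightarrow> (real \<Rightarrow> real) \<Rightarrow> bool" where
  "ac_density \<mu> f \<longleftrightarrow>
     f \<in> borel_measurable borel \<and> (\<forall>u. 0 \<le> f u) \<and>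
     (\<exists>\<nu>. sets \<nu> = sets borel \<and> (\<exists>N\<in>null_sets lborel. emeasure \<nu> (- N) = 0) \<and>
        (\<forall>A\<in>sets borel. emeasure \<mu> A = emeasure (density lborel (\<lambda>u. ennreal (f u))) A + emeasure \<nu> A))"

text \<open>The convention \<open>|ln 0| = \<infinity>\<close> has to be made explicit, since \<open>ln 0 = 0\<close> in HOL.\<close>

definition abs_ln :: "real \<Rightarrow> ennreal" where
  "abs_ln x = (if x = 0 then \<infinity> else ennreal \<bar>ln x\<bar>)"

definition log_integral :: "(real \<Rightarrow> real) \<Rightarrow> ennreal" where
  "log_integral f = (\<integral>\<^sup>+u. abs_ln (f u) / ennreal (1 + u\<^sup>2) \<partial>lborel)"

definition entire_of_exp_type :: "real \<Rightarrow> (complex \<Rightarrow> complex) \<Rightarrow> bool" where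
  "entire_of_exp_type t V \<longleftrightarrow>
     V holomorphic_on UNIV \<and>
     (\<forall>\<epsilon>>0. \<exists>C. \<forall>z. cmod (V z) \<le> C * exp ((t + \<epsilon>) * cmod z))"

end

theory Submission
  imports Defs "HOL-Real_Asymp.Real_Asymp"
begin

text \<open>With \<open>m = 1 / (1 + |\<ll>|\<^sup>2)\<close> one has \<open>|\<phi> - 1|\<^sup>2 + |\<ll> \<phi>|\<^sup>2 = (1 - m) + |\<phi> - m|\<^sup>2 / m\<close> pointwise. Hence, in the
  spectral domain, the equality says that \<open>m\<close> belongs to the closed span of \<open>exp (i s u)\<close>, \<open>s \<le> t\<close>, in
  \<open>L\<^sub>2(\<mu>)\<close>; since \<open>m\<close> is real, conjugation and multiplication by \<open>exp (i t u)\<close> turn this into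
  \<open>exp (i t u) m \<in> hardy \<mu>\<close>, the closed span of \<open>exp (i s u)\<close> with \<open>s \<ge> 0\<close>.

  If the logarithmic integral is infinite, exponentials \<open>G\<close> of analytic polynomials in the Cayley
  variable \<open>w\<close> satisfy \<open>G(0) = 1\<close> and have arbitrarily small norm in \<open>L\<^sub>2(\<mu>)\<close>, so \<open>hardy \<mu>\<close> contains \<open>1 / w\<close>
  and is all of \<open>L\<^sub>2(\<mu>)\<close>.

  If it is finite, every bounded \<open>\<phi> \<in> hardy \<mu>\<close> annihilates with respect to Lebesgue measure the entire functions
  that decay quadratically in the upper half-plane. Thus \<open>m\<close> multiplied by \<open>sinc\<^sup>2(\<delta> u)\<close> is band limited, and
  \<open>\<delta> \<rightarrow> 0\<close> together with Montel's theorem gives the entire extension of \<open>m\<close>, constant for \<open>t = 0\<close> by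
  Liouville's theorem. Conversely, for an entire extension \<open>V\<close> of type \<open>t\<close> the
  Phragmen-Lindelof principle bounds \<open>exp (i (t + \<epsilon>) z) V(z)\<close> in the upper half-plane. Functions
  supported on Lebesgue null sets always belong to \<open>hardy \<mu>\<close>, so the singular part of \<open>\<mu>\<close> plays no role.\<close>

section \<open>Square integrable functions\<close>

text \<open>Membership in \<open>hardy \<mu>\<close> is known only through approximation in
  L2(\<open>\<mu>\<close>), and \<open>\<mu>\<close> itself is arbitrary apart from its logarithmic
  integral, so outer functions and boundary values are replaced by exp(P(w)) with a polynomial P in
  the Cayley variable w. On the real line Re P can be prescribed up to a small L1 error for two
  measures at once, and the mean value property identifies the Cauchy integral of Re P with Re P(0).
  Different targets for Re P then give the small norms in the infinite case, the indicators of null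
  sets, and the passage from \<open>\<mu>\<close> back to Lebesgue measure in the finite case. The
  factor sinc^2 is forced by the fact that m is bounded but possibly not integrable. Since m sinc^2
  is nonnegative and integrable, it is a multiple of a probability density, and Levy inversion
  recovers it from its characteristic function. On the side of the process, \<open>W\<close>, the
  integrals and the representing functions are arbitrary choices, determined only almost everywhere.
  The spectral isometry is therefore a relation that preserves inner products rather than a
  map.\<close>

definition L2_inner :: "'a measure \<Rightarrow> ('a \<Rightarrow> complex) \<Rightarrow> ('a \<Rightarrow> complex) \<Rightarrow> complex" where
  "L2_inner M X Y = (\<integral>\<omega>. X \<omega> * cnj (Y \<omega>) \<partial>M)"

lemma L2_measurable [measurable_dest]: "X \<in> L2 M \<Longrightarrow> X \<in> borel_measurable M"
  by (simp add: L2_def)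

lemma L2_integrable: "X \<in> L2 M \<Longrightarrow> integrable M (\<lambda>\<omega>. (cmod (X \<omega>))\<^sup>2)"
  by (simp add: L2_def)

lemma cmod_add_sq_le: "(cmod (a + b))\<^sup>2 \<le> 2 * (cmod a)\<^sup>2 + 2 * (cmod b)\<^sup>2"
proof -
  have "(cmod (a + b))\<^sup>2 \<le> (cmod a + cmod b)\<^sup>2"
    by (simp add: norm_triangle_ineq power_mono)
  also have "\<dots> \<le> 2 * (cmod a)\<^sup>2 + 2 * (cmod b)\<^sup>2"
    using sum_squares_bound[of "cmod a" "cmod b"] by (simp add: power2_sum)
  finally show ?thesis .
qed

lemma borel_measurable_cnj [measurable]:
  "f \<in> borel_measurable M \<Longrightarrow> (\<lambda>x. cnj (f x)) \<in> borel_measurable M"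
  by (rule borel_measurable_continuous_on[where f=cnj]) (auto intro: continuous_intros)

lemma L2_zero [simp]: "(\<lambda>\<omega>. 0) \<in> L2 M"
  by (simp add: L2_def)

lemma L2_add:
  assumes "X \<in> L2 M" "Y \<in> L2 M" shows "(\<lambda>\<omega>. X \<omega> + Y \<omega>) \<in> L2 M"
proof -
  have "integrable M (\<lambda>\<omega>. (cmod (X \<omega> + Y \<omega>))\<^sup>2)"
  proof (rule Bochner_Integration.integrable_bound)
    show "integrable M (\<lambda>\<omega>. 2 * (cmod (X \<omega>))\<^sup>2 + 2 * (cmod (Y \<omega>))\<^sup>2)"
      using assms by (auto simp: L2_def)
  qed (use assms in \<open>auto simp: L2_def cmod_add_sq_le\<close>)
  then show ?thesis using assms by (auto simp: L2_def)
qed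

lemma L2_mult_bounded:
  assumes "X \<in> L2 M" "b \<in> borel_measurable M" "\<And>\<omega>. \<omega> \<in> space M \<Longrightarrow> cmod (b \<omega>) \<le> C"
  shows "(\<lambda>\<omega>. b \<omega> * X \<omega>) \<in> L2 M"
proof -
  have "integrable M (\<lambda>\<omega>. (cmod (b \<omega> * X \<omega>))\<^sup>2)"
  proof (rule Bochner_Integration.integrable_bound)
    show "integrable M (\<lambda>\<omega>. C\<^sup>2 * (cmod (X \<omega>))\<^sup>2)"
      using assms by (auto simp: L2_def)
    show "AE \<omega> in M. norm ((cmod (b \<omega> * X \<omega>))\<^sup>2) \<le> norm (C\<^sup>2 * (cmod (X \<omega>))\<^sup>2)"
      using assms(3) by (auto simp: norm_mult power_mult_distrib intro!: mult_right_mono power_mono)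
  qed (use assms in \<open>auto simp: L2_def\<close>)
  then show ?thesis using assms by (auto simp: L2_def)
qed

lemma L2_scale: "X \<in> L2 M \<Longrightarrow> (\<lambda>\<omega>. c * X \<omega>) \<in> L2 M"
  by (rule L2_mult_bounded[where C="cmod c"]) auto

lemma L2_diff:
  assumes "X \<in> L2 M" "Y \<in> L2 M" shows "(\<lambda>\<omega>. X \<omega> - Y \<omega>) \<in> L2 M"
  using L2_add[OF assms(1) L2_scale[OF assms(2), of "-1"]] by simp

lemma L2_sum: "(\<And>i. i \<in> I \<Longrightarrow> X i \<in> L2 M) \<Longrightarrow> (\<lambda>\<omega>. \<Sum>i\<in>I. X i \<omega>) \<in> L2 M"
  by (induction I rule: infinite_finite_induct) (auto intro: L2_add)

lemma L2_cnj: "X \<in> L2 M \<Longrightarrow> (\<lambda>\<omega>. cnj (X \<omega>)) \<in> L2 M"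
  by (auto simp: L2_def)

lemma (in finite_measure) L2_bounded:
  assumes "b \<in> borel_measurable M" "\<And>\<omega>. \<omega> \<in> space M \<Longrightarrow> cmod (b \<omega>) \<le> C"
  shows "b \<in> L2 M"
  using L2_mult_bounded[of "\<lambda>_. 1" M b C] assms by (auto simp: L2_def)

lemma L2_integrable_mult:
  assumes "X \<in> L2 M" "Y \<in> L2 M" shows "integrable M (\<lambda>\<omega>. X \<omega> * Y \<omega>)"
proof (rule Bochner_Integration.integrable_bound)
  show "integrable M (\<lambda>\<omega>. (cmod (X \<omega>))\<^sup>2 + (cmod (Y \<omega>))\<^sup>2)"
    using assms by (auto simp: L2_def)
  have "a * b \<le> a\<^sup>2 + b\<^sup>2" if "a \<ge> 0" "b \<ge> 0" for a b :: real
  proof -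
    have "0 \<le> a * b" using that by simp
    with sum_squares_bound[of a b] show ?thesis by linarith
  qed
  then show "AE \<omega> in M. norm (X \<omega> * Y \<omega>) \<le> norm ((cmod (X \<omega>))\<^sup>2 + (cmod (Y \<omega>))\<^sup>2)"
    by (auto simp: norm_mult)
qed (use assms in \<open>auto simp: L2_def\<close>)

lemma L2_integrable_inner:
  "X \<in> L2 M \<Longrightarrow> Y \<in> L2 M \<Longrightarrow> integrable M (\<lambda>\<omega>. X \<omega> * cnj (Y \<omega>))"
  by (intro L2_integrable_mult L2_cnj)

lemma L2_inner_add_left:
  assumes "X \<in> L2 M" "Y \<in> L2 M" "Z \<in> L2 M"
  shows "L2_inner M (\<lambda>\<omega>. X \<omega> + Y \<omega>) Z = L2_inner M X Z + L2_inner M Y Z"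
  using assms by (simp add: L2_inner_def algebra_simps L2_integrable_inner)

lemma L2_inner_diff_left:
  assumes "X \<in> L2 M" "Y \<in> L2 M" "Z \<in> L2 M"
  shows "L2_inner M (\<lambda>\<omega>. X \<omega> - Y \<omega>) Z = L2_inner M X Z - L2_inner M Y Z"
  using assms by (simp add: L2_inner_def algebra_simps L2_integrable_inner)

lemma L2_inner_scale_left: "L2_inner M (\<lambda>\<omega>. c * X \<omega>) Z = c * L2_inner M X Z"
  by (simp add: L2_inner_def mult.assoc)

lemma L2_inner_cnj: "L2_inner M X Y = cnj (L2_inner M Y X)"
  unfolding L2_inner_def
  by (subst Bochner_Integration.integral_cnj[symmetric]) (simp add: mult.commute)

lemma L2_inner_add_right:
  assumes "X \<in> L2 M" "Y \<in> L2 M" "Z \<in> L2 M"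
  shows "L2_inner M Z (\<lambda>\<omega>. X \<omega> + Y \<omega>) = L2_inner M Z X + L2_inner M Z Y"
  using L2_inner_add_left[OF assms] by (metis L2_inner_cnj complex_cnj_add)

lemma L2_inner_diff_right:
  assumes "X \<in> L2 M" "Y \<in> L2 M" "Z \<in> L2 M"
  shows "L2_inner M Z (\<lambda>\<omega>. X \<omega> - Y \<omega>) = L2_inner M Z X - L2_inner M Z Y"
  using L2_inner_diff_left[OF assms] by (metis L2_inner_cnj complex_cnj_diff)

lemma L2_inner_self: "L2_inner M X X = of_real (\<integral>\<omega>. (cmod (X \<omega>))\<^sup>2 \<partial>M)"
  unfolding L2_inner_def complex_norm_square[symmetric] by (simp flip: of_real_power)

lemma L2_dist_sq_inner: "of_real (L2_dist_sq M X Y) = L2_inner M (\<lambda>\<omega>. X \<omega> - Y \<omega>) (\<lambda>\<omega>. X \<omega> - Y \<omega>)"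
  by (simp add: L2_inner_self L2_dist_sq_def)

lemma L2_dist_sq_nonneg [simp]: "0 \<le> L2_dist_sq M X Y"
  by (simp add: L2_dist_sq_def)

lemma L2_dist_sq_commute: "L2_dist_sq M X Y = L2_dist_sq M Y X"
  by (simp add: L2_dist_sq_def norm_minus_commute)

lemma L2_dist_sq_self [simp]: "L2_dist_sq M X X = 0"
  by (simp add: L2_dist_sq_def)

lemma L2_dist_sq_triangle:
  assumes "X \<in> L2 M" "Y \<in> L2 M" "Z \<in> L2 M"
  shows "L2_dist_sq M X Z \<le> 2 * L2_dist_sq M X Y + 2 * L2_dist_sq M Y Z"
proof -
  note [simp] = L2_integrable[OF L2_diff]
  have "L2_dist_sq M X Z \<le> (\<integral>\<omega>. 2 * (cmod (X \<omega> - Y \<omega>))\<^sup>2 + 2 * (cmod (Y \<omega> - Z \<omega>))\<^sup>2 \<partial>M)"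
    unfolding L2_dist_sq_def
  proof (intro integral_mono)
    fix \<omega> show "(cmod (X \<omega> - Z \<omega>))\<^sup>2 \<le> 2 * (cmod (X \<omega> - Y \<omega>))\<^sup>2 + 2 * (cmod (Y \<omega> - Z \<omega>))\<^sup>2"
      using cmod_add_sq_le[of "X \<omega> - Y \<omega>" "Y \<omega> - Z \<omega>"] by simp
  qed (use assms in auto)
  then show ?thesis using assms by (simp add: L2_dist_sq_def)
qed

lemma L2_dist_sq_add:
  assumes "X \<in> L2 M" "Y \<in> L2 M" "X' \<in> L2 M" "Y' \<in> L2 M"
  shows "L2_dist_sq M (\<lambda>\<omega>. X \<omega> + Y \<omega>) (\<lambda>\<omega>. X' \<omega> + Y' \<omega>) \<le> 2 * L2_dist_sq M X X' + 2 * L2_dist_sq M Y Y'"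
proof -
  note [simp] = L2_integrable[OF L2_diff]
  have "L2_dist_sq M (\<lambda>\<omega>. X \<omega> + Y \<omega>) (\<lambda>\<omega>. X' \<omega> + Y' \<omega>)
      \<le> (\<integral>\<omega>. 2 * (cmod (X \<omega> - X' \<omega>))\<^sup>2 + 2 * (cmod (Y \<omega> - Y' \<omega>))\<^sup>2 \<partial>M)"
    unfolding L2_dist_sq_def
  proof (intro integral_mono)
    fix \<omega> show "(cmod (X \<omega> + Y \<omega> - (X' \<omega> + Y' \<omega>)))\<^sup>2 \<le> 2 * (cmod (X \<omega> - X' \<omega>))\<^sup>2 + 2 * (cmod (Y \<omega> - Y' \<omega>))\<^sup>2"
      using cmod_add_sq_le[of "X \<omega> - X' \<omega>" "Y \<omega> - Y' \<omega>"] by (simp add: algebra_simps)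
    show "integrable M (\<lambda>\<omega>. (cmod (X \<omega> + Y \<omega> - (X' \<omega> + Y' \<omega>)))\<^sup>2)"
      using assms by (intro L2_integrable L2_diff L2_add)
  qed (use assms in auto)
  then show ?thesis using assms by (simp add: L2_dist_sq_def)
qed

lemma L2_dist_sq_scale: "L2_dist_sq M (\<lambda>\<omega>. c * X \<omega>) (\<lambda>\<omega>. c * Y \<omega>) = (cmod c)\<^sup>2 * L2_dist_sq M X Y"
  by (simp add: L2_dist_sq_def norm_mult power_mult_distrib flip: right_diff_distrib)

lemma L2_dist_sq_mult_bounded:
  assumes "X \<in> L2 M" "Y \<in> L2 M" "b \<in> borel_measurable M" "\<And>\<omega>. \<omega> \<in> space M \<Longrightarrow> cmod (b \<omega>) \<le> C"
  shows "L2_dist_sq M (\<lambda>\<omega>. b \<omega> * X \<omega>) (\<lambda>\<omega>. b \<omega> * Y \<omega>) \<le> C\<^sup>2 * L2_dist_sq M X Y"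
proof -
  have "L2_dist_sq M (\<lambda>\<omega>. b \<omega> * X \<omega>) (\<lambda>\<omega>. b \<omega> * Y \<omega>) \<le> (\<integral>\<omega>. C\<^sup>2 * (cmod (X \<omega> - Y \<omega>))\<^sup>2 \<partial>M)"
    unfolding L2_dist_sq_def
  proof (intro integral_mono)
    show "integrable M (\<lambda>\<omega>. (cmod (b \<omega> * X \<omega> - b \<omega> * Y \<omega>))\<^sup>2)"
      using assms by (intro L2_integrable L2_diff L2_mult_bounded) auto
    show "integrable M (\<lambda>\<omega>. C\<^sup>2 * (cmod (X \<omega> - Y \<omega>))\<^sup>2)"
      using assms by (simp add: L2_integrable[OF L2_diff])
  qed (use assms in \<open>auto simp: norm_mult power_mult_distrib simp flip: right_diff_distrib intro!: mult_right_mono power_mono\<close>)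
  then show ?thesis by (simp add: L2_dist_sq_def)
qed

lemma L2_dist_sq_eq_0_iff:
  assumes "X \<in> L2 M" "Y \<in> L2 M"
  shows "L2_dist_sq M X Y = 0 \<longleftrightarrow> (AE \<omega> in M. X \<omega> = Y \<omega>)"
  unfolding L2_dist_sq_def
  by (subst integral_nonneg_eq_0_iff_AE) (use L2_integrable[OF L2_diff[OF assms]] in auto)

lemma L2_inner_cong_AE:
  assumes "AE \<omega> in M. X \<omega> = X' \<omega>" "AE \<omega> in M. Y \<omega> = Y' \<omega>"
    and [measurable]: "X \<in> borel_measurable M" "Y \<in> borel_measurable M"
      "X' \<in> borel_measurable M" "Y' \<in> borel_measurable M"
  shows "L2_inner M X Y = L2_inner M X' Y'"
  unfolding L2_inner_def by (intro integral_cong_AE) (use assms(1,2) in auto)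

lemma L2_dist_sq_cong_AE:
  assumes "AE \<omega> in M. X \<omega> = X' \<omega>" "AE \<omega> in M. Y \<omega> = Y' \<omega>"
    and [measurable]: "X \<in> borel_measurable M" "Y \<in> borel_measurable M"
      "X' \<in> borel_measurable M" "Y' \<in> borel_measurable M"
  shows "L2_dist_sq M X Y = L2_dist_sq M X' Y'"
  unfolding L2_dist_sq_def by (intro integral_cong_AE) (use assms(1,2) in auto)

text \<open>Bilinear rather than sesquilinear, because it is applied to integrands that are split
  into a product of two factors.\<close>

lemma L2_Cauchy_Schwarz:
  assumes "X \<in> L2 M" "Y \<in> L2 M"
  shows "(cmod (\<integral>\<omega>. X \<omega> * Y \<omega> \<partial>M))\<^sup>2
    \<le> (\<integral>\<omega>. (cmod (X \<omega>))\<^sup>2 \<partial>M) * (\<integral>\<omega>. (cmod (Y \<omega>))\<^sup>2 \<partial>M)"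
proof -
  note [measurable] = assms[THEN L2_measurable]
  have i: "integrable M (\<lambda>\<omega>. X \<omega> * Y \<omega>)" by (rule L2_integrable_mult[OF assms])
  define J where "J = (\<integral>\<omega>. cmod (X \<omega>) * cmod (Y \<omega>) \<partial>M)"
  have iJ: "integrable M (\<lambda>\<omega>. cmod (X \<omega>) * cmod (Y \<omega>))"
    using integrable_norm[OF i] by (simp add: norm_mult)
  have "ennreal (J\<^sup>2) = (\<integral>\<^sup>+\<omega>. ennreal (cmod (X \<omega>)) * ennreal (cmod (Y \<omega>)) \<partial>M)\<^sup>2"
    unfolding J_def using iJ
    by (subst ennreal_power[symmetric]) (simp_all add: nn_integral_eq_integral flip: ennreal_mult)
  also have "\<dots> \<le> (\<integral>\<^sup>+\<omega>. (ennreal (cmod (X \<omega>)))\<^sup>2 \<partial>M) * (\<integral>\<^sup>+\<omega>. (ennreal (cmod (Y \<omega>)))\<^sup>2 \<partial>M)"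
    by (rule Cauchy_Schwarz_nn_integral) auto
  also have "\<dots> = ennreal ((\<integral>\<omega>. (cmod (X \<omega>))\<^sup>2 \<partial>M) * (\<integral>\<omega>. (cmod (Y \<omega>))\<^sup>2 \<partial>M))"
    using assms by (simp add: ennreal_power nn_integral_eq_integral L2_integrable ennreal_mult)
  finally have *: "J\<^sup>2 \<le> (\<integral>\<omega>. (cmod (X \<omega>))\<^sup>2 \<partial>M) * (\<integral>\<omega>. (cmod (Y \<omega>))\<^sup>2 \<partial>M)"
    by (simp add: ennreal_le_iff)
  have "cmod (\<integral>\<omega>. X \<omega> * Y \<omega> \<partial>M) \<le> J"
    unfolding J_def using integral_norm_bound[of M "\<lambda>\<omega>. X \<omega> * Y \<omega>"] by (simp add: norm_mult)
  then have "(cmod (\<integral>\<omega>. X \<omega> * Y \<omega> \<partial>M))\<^sup>2 \<le> J\<^sup>2" by (intro power_mono) auto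
  with * show ?thesis by linarith
qed

lemma L2_inner_Cauchy_Schwarz:
  assumes "X \<in> L2 M" "Y \<in> L2 M"
  shows "(cmod (L2_inner M X Y))\<^sup>2 \<le> (\<integral>\<omega>. (cmod (X \<omega>))\<^sup>2 \<partial>M) * (\<integral>\<omega>. (cmod (Y \<omega>))\<^sup>2 \<partial>M)"
  using L2_Cauchy_Schwarz[OF assms(1) L2_cnj[OF assms(2)]] by (simp add: L2_inner_def)

text \<open>The difference is expanded around the limits into one term with both errors and two
  terms with a single error; Cauchy-Schwarz bounds each of them.\<close>

lemma L2_inner_tendsto:
  assumes "\<And>n. X n \<in> L2 M" "\<And>n. Y n \<in> L2 M" "X' \<in> L2 M" "Y' \<in> L2 M"
    and "(\<lambda>n. L2_dist_sq M (X n) X') \<longlonglongrightarrow> 0" "(\<lambda>n. L2_dist_sq M (Y n) Y') \<longlonglongrightarrow> 0"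
  shows "(\<lambda>n. L2_inner M (X n) (Y n)) \<longlonglongrightarrow> L2_inner M X' Y'"
proof -
  let ?d = "\<lambda>n \<omega>. X n \<omega> - X' \<omega>" and ?e = "\<lambda>n \<omega>. Y n \<omega> - Y' \<omega>"
  let ?nX = "\<integral>\<omega>. (cmod (X' \<omega>))\<^sup>2 \<partial>M" and ?nY = "\<integral>\<omega>. (cmod (Y' \<omega>))\<^sup>2 \<partial>M"
  have mem: "?d n \<in> L2 M" "?e n \<in> L2 M" for n by (intro L2_diff assms)+
  have eq: "L2_inner M (X n) (Y n) - L2_inner M X' Y' =
    L2_inner M (?d n) (?e n) + L2_inner M (?d n) Y' + L2_inner M X' (?e n)" for n
    using assms(1-4) mem by (simp add: L2_inner_diff_left L2_inner_diff_right algebra_simps)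
  have sq0: "(\<lambda>n. f n) \<longlonglongrightarrow> 0" if "(\<lambda>n. b n) \<longlonglongrightarrow> (0::real)" "\<And>n. (cmod (f n))\<^sup>2 \<le> b n" for f b
  proof -
    have "(\<lambda>n. (cmod (f n))\<^sup>2) \<longlonglongrightarrow> 0"
      by (rule tendsto_sandwich[OF _ _ tendsto_const that(1)]) (use that(2) in auto)
    then have "(\<lambda>n. sqrt ((cmod (f n))\<^sup>2)) \<longlonglongrightarrow> sqrt 0" by (intro tendsto_intros)
    then show ?thesis by (simp add: tendsto_norm_zero_iff)
  qed
  have "(\<lambda>n. L2_inner M (?d n) (?e n)) \<longlonglongrightarrow> 0"
    by (rule sq0[OF _ L2_inner_Cauchy_Schwarz[OF mem]])
       (use tendsto_mult[OF assms(5,6)] in \<open>simp add: L2_dist_sq_def\<close>)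
  moreover have "(\<lambda>n. L2_inner M (?d n) Y') \<longlonglongrightarrow> 0"
    by (rule sq0[OF _ L2_inner_Cauchy_Schwarz[OF mem(1) assms(4)]])
       (use tendsto_mult[OF assms(5) tendsto_const[of ?nY]] in \<open>simp add: L2_dist_sq_def\<close>)
  moreover have "(\<lambda>n. L2_inner M X' (?e n)) \<longlonglongrightarrow> 0"
    by (rule sq0[OF _ L2_inner_Cauchy_Schwarz[OF assms(3) mem(2)]])
       (use tendsto_mult[OF tendsto_const[of ?nX] assms(6)] in \<open>simp add: L2_dist_sq_def\<close>)
  ultimately have "(\<lambda>n. L2_inner M (X n) (Y n) - L2_inner M X' Y') \<longlonglongrightarrow> 0 + 0 + 0"
    unfolding eq by (intro tendsto_add)
  then show ?thesis by (simp add: LIM_zero_iff)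
qed

section \<open>Completeness of L2\<close>

lemma ennreal_suminf_finite_bound:
  fixes f :: "nat \<Rightarrow> ennreal"
  assumes "suminf f \<noteq> \<infinity>"
  obtains C where "C > 0" "\<And>k. f k \<le> ennreal C"
proof -
  obtain c where c: "suminf f = ennreal c" "c \<ge> 0"
    using assms by (cases "suminf f") auto
  have "f k \<le> ennreal (c + 1)" for k
  proof -
    have "sum f {k} \<le> suminf f" by (intro sum_le_suminf) auto
    also have "\<dots> \<le> ennreal (c + 1)" unfolding c by (intro ennreal_leI) simp
    finally show ?thesis by simp
  qed
  then show ?thesis using that[of "c + 1"] c by auto
qed

text \<open>The Riesz-Fischer argument for representatives: a rapidly Cauchy subsequence converges
  almost everywhere, and Fatou's lemma bounds the distance of the whole sequence to its
  limit.\<close>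

lemma L2_complete:
  assumes X: "\<And>n. X n \<in> L2 M"
    and Cauchy: "\<And>\<epsilon>. \<epsilon> > 0 \<Longrightarrow> \<exists>n0. \<forall>m\<ge>n0. \<forall>n\<ge>n0. L2_dist_sq M (X m) (X n) < \<epsilon>"
  obtains Y where "Y \<in> L2 M" "(\<lambda>n. L2_dist_sq M (X n) Y) \<longlonglongrightarrow> 0"
proof -
  note [measurable] = X[THEN L2_measurable]
  \<comment> \<open>The rate 8^-k leaves room for the weights 4^k below: the weighted squared
    increments have a finite integral, so almost everywhere they are bounded and the increments are
    of order 2^-k.\<close>
  have "\<forall>k. \<exists>n0. \<forall>m\<ge>n0. \<forall>n\<ge>n0. L2_dist_sq M (X m) (X n) < (1/8)^k"
    by (intro allI Cauchy) simp
  then obtain N where N: "\<And>k m n. m \<ge> N k \<Longrightarrow> n \<ge> N k \<Longrightarrow> L2_dist_sq M (X m) (X n) < (1/8)^k"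
    by metis
  \<comment> \<open>Partial sums make the indices monotone while keeping
    \<open>N k \<le> r k\<close>.\<close>
  define r where "r = (\<lambda>k. \<Sum>i\<le>k. N i)"
  have rN: "N k \<le> r k" for k unfolding r_def by (rule member_le_sum) auto
  have rS: "N k \<le> r (Suc k)" for k unfolding r_def using rN[of k] by (simp add: r_def)
  define Z where "Z k = X (r k)" for k
  have ZL: "Z k \<in> L2 M" for k by (simp add: Z_def X)
  note [measurable] = ZL[THEN L2_measurable]
  have d: "L2_dist_sq M (Z (Suc k)) (Z k) < (1/8)^k" for k
    unfolding Z_def by (rule N[OF rS rN])
  have iZ: "integrable M (\<lambda>\<omega>. (cmod (Z a \<omega> - Z b \<omega>))\<^sup>2)" for a b
    by (intro L2_integrable L2_diff ZL)
  have "(\<integral>\<^sup>+\<omega>. (\<Sum>k. ennreal (4^k * (cmod (Z (Suc k) \<omega> - Z k \<omega>))\<^sup>2)) \<partial>M)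
      = (\<Sum>k. \<integral>\<^sup>+\<omega>. ennreal (4^k * (cmod (Z (Suc k) \<omega> - Z k \<omega>))\<^sup>2) \<partial>M)"
    by (rule nn_integral_suminf) simp
  also have "\<dots> = (\<Sum>k. ennreal (4^k * L2_dist_sq M (Z (Suc k)) (Z k)))"
    using iZ by (simp add: nn_integral_eq_integral L2_dist_sq_def)
  also have "\<dots> \<le> (\<Sum>k. ennreal ((1/2)^k))"
  proof (intro suminf_le ennreal_leI)
    fix k :: nat
    have "4^k * L2_dist_sq M (Z (Suc k)) (Z k) \<le> 4^k * (1/8)^k"
      using d[of k] by (intro mult_left_mono) auto
    also have "\<dots> = (1/2)^k" by (simp flip: power_mult_distrib)
    finally show "4^k * L2_dist_sq M (Z (Suc k)) (Z k) \<le> (1/2)^k" .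
  qed auto
  also have "\<dots> = ennreal (\<Sum>k. (1/2)^k)" by (rule suminf_ennreal2) (auto intro: summable_geometric)
  also have "\<dots> < \<infinity>" by simp
  finally have "AE \<omega> in M. (\<Sum>k. ennreal (4^k * (cmod (Z (Suc k) \<omega> - Z k \<omega>))\<^sup>2)) \<noteq> \<infinity>"
    by (intro nn_integral_noteq_infinite) auto
  then have conv: "AE \<omega> in M. convergent (\<lambda>n. Z n \<omega>)"
  proof eventually_elim
    case (elim \<omega>)
    let ?a = "\<lambda>k. cmod (Z (Suc k) \<omega> - Z k \<omega>)"
    obtain C where C: "C > 0" "\<And>k. 4^k * (?a k)\<^sup>2 \<le> C"
    proof -
      obtain C where C: "C > 0" "\<And>k. ennreal (4^k * (?a k)\<^sup>2) \<le> ennreal C"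
        using elim by (rule ennreal_suminf_finite_bound) auto
      have "4^k * (?a k)\<^sup>2 \<le> C" for k
        using C(2)[of k] C(1) by (subst (asm) ennreal_le_iff) auto
      with C(1) show ?thesis by (rule that)
    qed
    have "?a k \<le> sqrt C * (1/2)^k" for k
    proof (rule power2_le_imp_le)
      have "((2::real)^k)\<^sup>2 = 4^k" by (simp add: power2_eq_square flip: power_mult_distrib)
      then have eq: "(sqrt C * (1/2)^k)\<^sup>2 = C / 4^k"
        using C(1) by (simp add: power_mult_distrib power_divide)
      then show "(?a k)\<^sup>2 \<le> (sqrt C * (1/2)^k)\<^sup>2" using C(2)[of k] by (subst eq) (subst pos_le_divide_eq, simp_all add: mult.commute)
    qed (use C(1) in auto)
    then have "norm (Z (Suc k) \<omega> - Z k \<omega>) \<le> sqrt C * (1/2)^k" for k by simp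
    moreover have "summable (\<lambda>k. sqrt C * (1/2)^k)"
      by (intro summable_mult summable_geometric) simp
    ultimately have "summable (\<lambda>k. Z (Suc k) \<omega> - Z k \<omega>)"
      using summable_comparison_test'[of "\<lambda>k. sqrt C * (1/2)^k" 0 "\<lambda>k. Z (Suc k) \<omega> - Z k \<omega>"]
      by blast
    then have "convergent (\<lambda>n. \<Sum>k<n. (Z (Suc k) \<omega> - Z k \<omega>))"
      by (simp add: summable_iff_convergent)
    then have "convergent (\<lambda>n. (\<Sum>k<n. (Z (Suc k) \<omega> - Z k \<omega>)) + Z 0 \<omega>)"
      by (intro convergent_add convergent_const)
    moreover have "(\<Sum>k<n. (Z (Suc k) \<omega> - Z k \<omega>)) + Z 0 \<omega> = Z n \<omega>" for n
      using sum_lessThan_telescope[of "\<lambda>k. Z k \<omega>" n] by simp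
    ultimately show ?case by simp
  qed
  define Y where "Y \<omega> = lim (\<lambda>n. Z n \<omega>)" for \<omega>
  have Ym[measurable]: "Y \<in> borel_measurable M"
    unfolding Y_def by (rule borel_measurable_lim_metric) simp
  have ZY: "AE \<omega> in M. (\<lambda>n. Z n \<omega>) \<longlonglongrightarrow> Y \<omega>"
    using conv by eventually_elim (simp add: Y_def convergent_LIMSEQ_iff)
  \<comment> \<open>Fatou's lemma along the subsequence. The bound is on the nonnegative integral,
    so that integrability of the difference can be deduced from it afterwards.\<close>
  have F: "(\<integral>\<^sup>+\<omega>. ennreal ((cmod (X n \<omega> - Y \<omega>))\<^sup>2) \<partial>M) \<le> ennreal ((1/8)^k)" if n: "n \<ge> N k" for n k
  proof -
    have "(\<integral>\<^sup>+\<omega>. ennreal ((cmod (X n \<omega> - Y \<omega>))\<^sup>2) \<partial>M)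
        = (\<integral>\<^sup>+\<omega>. liminf (\<lambda>j. ennreal ((cmod (X n \<omega> - Z j \<omega>))\<^sup>2)) \<partial>M)"
    proof (rule nn_integral_cong_AE, use ZY in eventually_elim)
      case (elim \<omega>)
      have "(\<lambda>j. ennreal ((cmod (X n \<omega> - Z j \<omega>))\<^sup>2)) \<longlonglongrightarrow> ennreal ((cmod (X n \<omega> - Y \<omega>))\<^sup>2)"
        by (intro tendsto_ennrealI tendsto_intros elim)
      then show ?case by (rule lim_imp_Liminf[OF trivial_limit_sequentially, symmetric])
    qed
    also have "\<dots> \<le> liminf (\<lambda>j. \<integral>\<^sup>+\<omega>. ennreal ((cmod (X n \<omega> - Z j \<omega>))\<^sup>2) \<partial>M)"
      by (rule nn_integral_liminf) simp
    also have "\<dots> \<le> liminf (\<lambda>j::nat. ennreal ((1/8)^k))"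
    proof (rule Liminf_mono)
      show "\<forall>\<^sub>F j in sequentially. (\<integral>\<^sup>+\<omega>. ennreal ((cmod (X n \<omega> - Z j \<omega>))\<^sup>2) \<partial>M) \<le> ennreal ((1/8)^k)"
        using eventually_ge_at_top[of k]
      proof eventually_elim
        case (elim j)
        have "r k \<le> r j" unfolding r_def using elim by (intro sum_mono2) auto
        then have "N k \<le> r j" using rN[of k] by simp
        then have "L2_dist_sq M (X n) (Z j) < (1/8)^k" unfolding Z_def by (intro N n)
        then show ?case using L2_integrable[OF L2_diff[OF X[of n] ZL[of j]]]
          by (simp add: nn_integral_eq_integral L2_dist_sq_def ennreal_le_iff)
      qed
    qed
    finally show ?thesis by (simp add: Liminf_const)
  qed
  have XY: "(\<lambda>\<omega>. X n \<omega> - Y \<omega>) \<in> L2 M" if "n \<ge> N k" for n k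
  proof -
    have "integrable M (\<lambda>\<omega>. (cmod (X n \<omega> - Y \<omega>))\<^sup>2)"
      by (rule integrableI_nonneg) (use le_less_trans[OF F[OF that]] in auto)
    then show ?thesis by (simp add: L2_def)
  qed
  have "Y \<in> L2 M" using L2_diff[OF X[of "N 0"] XY[of 0 "N 0"]] by simp
  moreover have "(\<lambda>n. L2_dist_sq M (X n) Y) \<longlonglongrightarrow> 0"
  proof (rule LIMSEQ_I)
    fix e :: real assume "e > 0"
    then obtain k where k: "(1/8::real)^k < e" using real_arch_pow_inv[of e "1/8"] by auto
    have "L2_dist_sq M (X n) Y < e" if "n \<ge> N k" for n
    proof -
      have "ennreal (L2_dist_sq M (X n) Y) \<le> ennreal ((1/8)^k)"
        using F[OF that] L2_integrable[OF XY[OF that]] by (simp add: nn_integral_eq_integral L2_dist_sq_def)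
      then show ?thesis using k by (simp add: ennreal_le_iff)
    qed
    then show "\<exists>no. \<forall>n\<ge>no. norm (L2_dist_sq M (X n) Y - 0) < e" by auto
  qed
  ultimately show ?thesis by (rule that)
qed

section \<open>Integrals over the real line by contour deformation\<close>

text \<open>The bound K / u^2 is useless near 0, where compactness of [-1, 1] takes over; the
  outcome is the integrable majorant C / (1 + u^2).\<close>

lemma quadratic_decay_real_line:
  fixes f :: "real \<Rightarrow> complex"
  assumes cont: "continuous_on UNIV f"
    and bound: "\<And>u. \<bar>u\<bar> \<ge> 1 \<Longrightarrow> cmod (f u) \<le> K / u\<^sup>2"
  obtains C where "C \<ge> 0" "\<And>u. (1 + u\<^sup>2) * cmod (f u) \<le> C"
proof -
  have K0: "K \<ge> 0" using order_trans[OF norm_ge_zero bound[of 1]] by simp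
  obtain K1 where K1: "\<And>u. u \<in> {-1..1} \<Longrightarrow> cmod (f u) \<le> K1"
    using compact_imp_bounded[OF compact_continuous_image[OF continuous_on_subset[OF cont] compact_Icc], of "-1" 1]
    unfolding bounded_iff by (auto intro: that)
  have K10: "K1 \<ge> 0" using order_trans[OF norm_ge_zero K1[of 0]] by simp
  have "(1 + u\<^sup>2) * cmod (f u) \<le> max (2 * K1) (2 * K)" for u
  proof (cases "\<bar>u\<bar> \<le> 1")
    case True
    then have "u\<^sup>2 \<le> 1" by (simp add: abs_square_le_1)
    then have "(1 + u\<^sup>2) * cmod (f u) \<le> 2 * K1"
      using True K10 by (intro mult_mono K1) auto
    then show ?thesis by simp
  next
    case False
    then have u: "u\<^sup>2 \<ge> 1" using abs_square_le_1[of u] by linarith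
    have "cmod (f u) \<le> K / u\<^sup>2" using bound[of u] False by simp
    moreover have "0 < u\<^sup>2" using u by linarith
    ultimately have "u\<^sup>2 * cmod (f u) \<le> K" by (simp add: pos_le_divide_eq mult.commute del: zero_less_power2)
    moreover have "(1 + u\<^sup>2) * cmod (f u) \<le> (2 * u\<^sup>2) * cmod (f u)"
      using u by (intro mult_right_mono) auto
    ultimately show ?thesis by simp
  qed
  then show ?thesis by (rule that[rotated]) (use K0 in auto)
qed

text \<open>Cauchy's theorem for the segment [-R, R] closed by the upper half circle: quadratic
  decay makes the arc contribute O(1/R). Holomorphy down to height c < 0 places the closed contour
  inside an open convex domain.\<close>

lemma integral_real_line_eq_0:
  fixes f :: "complex \<Rightarrow> complex"
  assumes c: "c < 0" and hol: "f holomorphic_on {z. Im z > c}"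
    and bound: "\<And>z. Im z \<ge> 0 \<Longrightarrow> cmod z \<ge> 1 \<Longrightarrow> cmod (f z) \<le> K / (cmod z)\<^sup>2"
  shows "integrable lborel (\<lambda>u. f (of_real u))" "(\<integral>u. f (of_real u) \<partial>lborel) = 0"
proof -
  let ?S = "{z. Im z > c}"
  have S: "convex ?S" "open ?S" by (auto simp: convex_halfspace_Im_gt open_halfspace_Im_gt)
  have cont: "continuous_on UNIV (\<lambda>u. f (of_real u))"
    by (rule continuous_on_compose2[OF holomorphic_on_imp_continuous_on[OF hol]])
       (use c in \<open>auto intro!: continuous_intros\<close>)
  have meas[measurable]: "(\<lambda>u. f (of_real u)) \<in> borel_measurable borel"
    by (rule borel_measurable_continuous_onI[OF cont])
  have K0: "K \<ge> 0" using order_trans[OF norm_ge_zero bound[of 1]] by simp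
  have decay: "cmod (f (of_real u)) \<le> K / u\<^sup>2" if "\<bar>u\<bar> \<ge> 1" for u
    using bound[of "of_real u"] that by simp
  obtain K2 where K2: "\<And>u. (1 + u\<^sup>2) * cmod (f (of_real u)) \<le> K2"
    using quadratic_decay_real_line[OF cont decay] by blast
  have bnd: "cmod (f (of_real u)) \<le> K2 * inverse (1 + u\<^sup>2)" for u :: real
    using K2[of u] by (simp add: pos_le_divide_eq add_pos_nonneg mult.commute flip: divide_inverse)
  have cint: "integrable lborel (\<lambda>u::real. inverse (1 + u\<^sup>2))"
    using integrable_inverse_1_plus_square
    by (auto simp: set_integrable_def)
  show int: "integrable lborel (\<lambda>u. f (of_real u))"
  proof (rule Bochner_Integration.integrable_bound)
    show "integrable lborel (\<lambda>u. K2 * inverse (1 + u\<^sup>2))" using cint by simp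
    show "AE u in lborel. norm (f (of_real u)) \<le> norm (K2 * inverse (1 + u\<^sup>2))"
      using bnd by (auto intro: order_trans[OF _ abs_ge_self])
  qed simp
  define I where "I R = (\<integral>u. indicator {-R..R} u *\<^sub>R f (of_real u) \<partial>lborel)" for R :: real
  have lim: "((\<lambda>n. I (real n)) \<longlonglongrightarrow> (\<integral>u. f (of_real u) \<partial>lborel))"
    unfolding I_def
  proof (rule integral_dominated_convergence[where w="\<lambda>u. cmod (f (of_real u))"])
    show "AE u in lborel. (\<lambda>n. indicator {- real n..real n} u *\<^sub>R f (of_real u)) \<longlonglongrightarrow> f (of_real u)"
    proof (intro AE_I2 tendsto_eventually)
      fix u :: real
      show "\<forall>\<^sub>F n in sequentially. indicator {- real n..real n} u *\<^sub>R f (of_real u) = f (of_real u)"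
        using eventually_ge_at_top[of "nat \<lceil>\<bar>u\<bar>\<rceil>"] by eventually_elim (auto simp: indicator_def)
    qed
  qed (use int in \<open>auto simp: indicator_def\<close>)
  have bd: "cmod (I R) \<le> K / R * pi" if R: "R \<ge> 1" for R
  proof -
    let ?arc = "part_circlepath 0 R 0 pi" and ?line = "linepath (of_real (-R)) (of_real R) :: real \<Rightarrow> complex"
    have arc: "path_image ?arc \<subseteq> {z. Im z \<ge> 0 \<and> cmod z = R}"
      using R by (auto simp: path_image_part_circlepath Im_exp sin_ge_zero norm_mult)
    have linS: "path_image ?line \<subseteq> ?S"
      using c by (auto simp: closed_segment_def)
    have ends: "pathfinish ?line = pathstart ?arc" "pathfinish ?arc = pathstart ?line"
      by (simp_all add: exp_Euler)
    have ci: "f contour_integrable_on ?line" "f contour_integrable_on ?arc"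
      using holomorphic_on_imp_continuous_on[OF hol] linS arc c S hol
      by (auto intro!: contour_integrable_holomorphic_simple[where S="?S"])
    have "(f has_contour_integral 0) (?line +++ ?arc)"
      by (rule Cauchy_theorem_convex_simple[OF hol S(1)])
         (use ends linS arc c in \<open>auto simp: path_image_join\<close>)
    then have "contour_integral ?line f = - contour_integral ?arc f"
      using ci ends by (simp add: contour_integral_unique[symmetric] eq_neg_iff_add_eq_0) (metis contour_integral_join contour_integral_unique valid_path_linepath valid_path_part_circlepath)
    moreover have "cmod (contour_integral ?arc f) \<le> K / R\<^sup>2 * R * \<bar>pi - 0\<bar>"
    proof (rule contour_integral_bound_part_circlepath[OF ci(2)])
      fix z assume "z \<in> path_image ?arc"
      with arc have "0 \<le> Im z" "cmod z = R" by auto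
      with bound[of z] R show "cmod (f z) \<le> K / R\<^sup>2" by simp
    qed (use K0 R in auto)
    moreover have "contour_integral ?line f = I R"
    proof -
      have "(f has_contour_integral contour_integral ?line f) ?line"
        by (rule has_contour_integral_integral[OF ci(1)])
      then have "((\<lambda>x. f (of_real x)) has_integral contour_integral ?line f) {-R..R}"
        using R by (subst (asm) has_contour_integral_linepath_Reals_iff) auto
      moreover have "set_integrable lborel {-R..R} (\<lambda>x. f (of_real x))"
        using int unfolding set_integrable_def by (intro integrable_mult_indicator) auto
      ultimately show ?thesis
        unfolding I_def set_lebesgue_integral_def[symmetric]
        by (metis set_borel_integral_eq_integral(2) integral_unique)
    qed
    ultimately have "cmod (I R) \<le> K / R\<^sup>2 * R * \<bar>pi - 0\<bar>" by (metis norm_minus_cancel)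
    then show ?thesis using R by (simp add: power2_eq_square)
  qed
  have "(\<lambda>n. I (real n)) \<longlonglongrightarrow> 0"
  proof (rule Lim_null_comparison)
    show "\<forall>\<^sub>F n in sequentially. norm (I (real n)) \<le> K / real n * pi"
      using eventually_ge_at_top[of 1] by eventually_elim (rule bd, simp)
    show "(\<lambda>n. K / real n * pi) \<longlonglongrightarrow> 0"
      using tendsto_mult_right[OF lim_const_over_n[of K], of pi] by simp
  qed
  with lim show "(\<integral>u. f (of_real u) \<partial>lborel) = 0" by (rule LIMSEQ_unique)
qed

section \<open>Closed linear spans, multipliers and isometric relations\<close>

lemma complex_lin_span_zero: "(\<lambda>\<omega>. 0) \<in> complex_lin_span S"
  unfolding complex_lin_span_def by (intro CollectI exI[of _ "{}"]) auto

lemma complex_lin_span_add_scale: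
  assumes "X \<in> complex_lin_span S" "Z \<in> S"
  shows "(\<lambda>\<omega>. X \<omega> + a * Z \<omega>) \<in> complex_lin_span S"
proof -
  obtain F c where F: "finite F" "F \<subseteq> S" "X = (\<lambda>\<omega>. \<Sum>Y\<in>F. c Y * Y \<omega>)"
    using assms(1) by (auto simp: complex_lin_span_def)
  \<comment> \<open>\<open>Z\<close> may already belong to \<open>F\<close>, in which case the two
    coefficients add up.\<close>
  define d where "d Y = (if Y \<in> F then c Y else 0) + (if Y = Z then a else 0)" for Y
  have "X \<omega> + a * Z \<omega> = (\<Sum>Y\<in>insert Z F. d Y * Y \<omega>)" for \<omega>
  proof -
    have "(\<Sum>Y\<in>insert Z F. d Y * Y \<omega>) =
        (\<Sum>Y\<in>insert Z F. (if Y \<in> F then c Y else 0) * Y \<omega>) + (\<Sum>Y\<in>insert Z F. (if Y = Z then a else 0) * Y \<omega>)"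
      by (simp only: d_def distrib_right sum.distrib)
    also have "(\<Sum>Y\<in>insert Z F. (if Y \<in> F then c Y else 0) * Y \<omega>) = (\<Sum>Y\<in>F. c Y * Y \<omega>)"
      using F(1) by (intro sum.mono_neutral_cong_right) auto
    also have "(\<Sum>Y\<in>insert Z F. (if Y = Z then a else 0) * Y \<omega>) = (\<Sum>Y\<in>{Z}. a * Y \<omega>)"
      using F(1) by (intro sum.mono_neutral_cong_right) auto
    finally show ?thesis using F(3) by simp
  qed
  then show ?thesis unfolding complex_lin_span_def using F assms(2)
    by (intro CollectI exI[of _ "insert Z F"] exI[of _ d]) auto
qed

lemma complex_lin_span_induct [consumes 1, case_names zero step]:
  assumes "X \<in> complex_lin_span S" and zero: "P (\<lambda>\<omega>. 0)"
    and step: "\<And>X Z a. X \<in> complex_lin_span S \<Longrightarrow> P X \<Longrightarrow> Z \<in> S \<Longrightarrow> P (\<lambda>\<omega>. X \<omega> + a * Z \<omega>)"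
  shows "P X"
proof -
  obtain F c where F: "finite F" "F \<subseteq> S" "X = (\<lambda>\<omega>. \<Sum>Y\<in>F. c Y * Y \<omega>)"
    using assms(1) by (auto simp: complex_lin_span_def)
  have "P (\<lambda>\<omega>. \<Sum>Y\<in>F. c Y * Y \<omega>) \<and> (\<lambda>\<omega>. \<Sum>Y\<in>F. c Y * Y \<omega>) \<in> complex_lin_span S"
    using F(1,2)
  proof (induction F rule: finite_induct)
    case empty
    show ?case using zero complex_lin_span_zero by simp
  next
    case (insert Z F)
    have eq: "(\<lambda>\<omega>. \<Sum>Y\<in>insert Z F. c Y * Y \<omega>) = (\<lambda>\<omega>. (\<Sum>Y\<in>F. c Y * Y \<omega>) + c Z * Z \<omega>)"
      using insert(1,2) by (simp add: add.commute)
    have IH: "P (\<lambda>\<omega>. \<Sum>Y\<in>F. c Y * Y \<omega>)" "(\<lambda>\<omega>. \<Sum>Y\<in>F. c Y * Y \<omega>) \<in> complex_lin_span S" "Z \<in> S"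
      using insert by auto
    show ?case
      unfolding eq using step[OF IH(2,1,3)] complex_lin_span_add_scale[OF IH(2,3)] by blast
  qed
  then show ?thesis using F(3) by simp
qed

lemma complex_lin_span_base: "X \<in> S \<Longrightarrow> X \<in> complex_lin_span S"
  using complex_lin_span_add_scale[OF complex_lin_span_zero, of X S 1] by simp

lemma complex_lin_span_add:
  assumes "Y \<in> complex_lin_span S" "X \<in> complex_lin_span S"
  shows "(\<lambda>\<omega>. X \<omega> + Y \<omega>) \<in> complex_lin_span S"
  using assms(1)
proof (induction rule: complex_lin_span_induct)
  case zero then show ?case using assms(2) by simp
next
  case (step Y Z a)
  show ?case using complex_lin_span_add_scale[OF step(3,2), of a] by (simp add: add.assoc)
qed

lemma complex_lin_span_scale:
  assumes "X \<in> complex_lin_span S"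
  shows "(\<lambda>\<omega>. b * X \<omega>) \<in> complex_lin_span S"
  using assms
proof (induction rule: complex_lin_span_induct)
  case zero then show ?case using complex_lin_span_zero by simp
next
  case (step Y Z a)
  show ?case using complex_lin_span_add_scale[OF step(3,2), of "b * a"] by (simp add: algebra_simps)
qed

lemma complex_lin_span_L2:
  assumes "S \<subseteq> L2 M" "X \<in> complex_lin_span S" shows "X \<in> L2 M"
  using assms(2)
  by (induction rule: complex_lin_span_induct) (use assms(1) in \<open>auto intro!: L2_add L2_scale\<close>)

lemma complex_lin_span_mono: "S \<subseteq> T \<Longrightarrow> complex_lin_span S \<subseteq> complex_lin_span T"
  by (auto simp: complex_lin_span_def)

lemma closed_lin_span_mono: "S \<subseteq> T \<Longrightarrow> closed_lin_span M S \<subseteq> closed_lin_span M T"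
  using complex_lin_span_mono[of S T] unfolding closed_lin_span_def by blast

lemma closed_lin_span_L2: "X \<in> closed_lin_span M S \<Longrightarrow> X \<in> L2 M"
  by (simp add: closed_lin_span_def)

lemma closed_lin_span_span:
  "S \<subseteq> L2 M \<Longrightarrow> X \<in> complex_lin_span S \<Longrightarrow> X \<in> closed_lin_span M S"
  using complex_lin_span_L2[of S M X] by (auto simp: closed_lin_span_def intro!: bexI[of _ X])

lemma closed_lin_span_base: "S \<subseteq> L2 M \<Longrightarrow> X \<in> S \<Longrightarrow> X \<in> closed_lin_span M S"
  by (intro closed_lin_span_span complex_lin_span_base)

text \<open>Two approximations, each within e/4, are chained; the triangle inequality for squared
  distances costs a factor 2.\<close>

lemma closed_lin_span_closed:
  assumes S: "S \<subseteq> L2 M" and X: "X \<in> L2 M"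
    and "\<And>\<epsilon>. \<epsilon> > 0 \<Longrightarrow> \<exists>Y\<in>closed_lin_span M S. L2_dist_sq M X Y < \<epsilon>"
  shows "X \<in> closed_lin_span M S"
  unfolding closed_lin_span_def
proof (intro CollectI conjI X allI impI)
  fix e :: real assume "e > 0"
  then obtain Y where Y: "Y \<in> closed_lin_span M S" "L2_dist_sq M X Y < e / 4"
    using assms(3)[of "e/4"] by auto
  then obtain Z where Z: "Z \<in> complex_lin_span S" "L2_dist_sq M Y Z < e / 4"
    using \<open>e > 0\<close> unfolding closed_lin_span_def by (auto dest!: spec[of _ "e/4"])
  have "L2_dist_sq M X Z \<le> 2 * L2_dist_sq M X Y + 2 * L2_dist_sq M Y Z"
    by (intro L2_dist_sq_triangle X closed_lin_span_L2[OF Y(1)] complex_lin_span_L2[OF S Z(1)])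
  then show "\<exists>Z\<in>complex_lin_span S. L2_dist_sq M X Z < e" using Y Z by (intro bexI[of _ Z]) auto
qed

lemma closed_lin_span_limit:
  assumes S: "S \<subseteq> L2 M" and X: "X \<in> L2 M" and Y: "\<And>n. Y n \<in> closed_lin_span M S"
    and lim: "(\<lambda>n. L2_dist_sq M X (Y n)) \<longlonglongrightarrow> 0"
  shows "X \<in> closed_lin_span M S"
proof (rule closed_lin_span_closed[OF S X])
  fix e :: real assume "e > 0"
  then have "\<forall>\<^sub>F n in sequentially. L2_dist_sq M X (Y n) < e"
    using lim by (simp add: order_tendsto_iff)
  then obtain n where "L2_dist_sq M X (Y n) < e" using eventually_happens'[OF sequentially_bot] by blast
  then show "\<exists>Y\<in>closed_lin_span M S. L2_dist_sq M X Y < e" using Y by blast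
qed

lemma closed_lin_span_add:
  assumes S: "S \<subseteq> L2 M" and X: "X \<in> closed_lin_span M S" and Y: "Y \<in> closed_lin_span M S"
  shows "(\<lambda>\<omega>. X \<omega> + Y \<omega>) \<in> closed_lin_span M S"
proof -
  note L = closed_lin_span_L2[OF X] closed_lin_span_L2[OF Y]
  show ?thesis
    unfolding closed_lin_span_def
  proof (intro CollectI conjI L2_add L allI impI)
    fix e :: real assume "e > 0"
    then obtain X' Y' where X': "X' \<in> complex_lin_span S" "L2_dist_sq M X X' < e / 4"
      and Y': "Y' \<in> complex_lin_span S" "L2_dist_sq M Y Y' < e / 4"
      using X Y unfolding closed_lin_span_def by (auto dest!: spec[of _ "e/4"])
    have "L2_dist_sq M (\<lambda>\<omega>. X \<omega> + Y \<omega>) (\<lambda>\<omega>. X' \<omega> + Y' \<omega>) < e"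
      using L2_dist_sq_add[OF L complex_lin_span_L2[OF S X'(1)] complex_lin_span_L2[OF S Y'(1)]] X' Y'
      by linarith
    then show "\<exists>Z\<in>complex_lin_span S. L2_dist_sq M (\<lambda>\<omega>. X \<omega> + Y \<omega>) Z < e"
      using complex_lin_span_add[OF Y'(1) X'(1)] by blast
  qed
qed

lemma closed_lin_span_scale:
  assumes S: "S \<subseteq> L2 M" and X: "X \<in> closed_lin_span M S"
  shows "(\<lambda>\<omega>. c * X \<omega>) \<in> closed_lin_span M S"
  unfolding closed_lin_span_def
proof (intro CollectI conjI L2_scale closed_lin_span_L2[OF X] allI impI)
  fix e :: real assume e: "e > 0"
  define d where "d = e / ((cmod c)\<^sup>2 + 1)"
  have C: "0 < (cmod c)\<^sup>2 + 1" by (simp add: add_nonneg_pos)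
  then have "d > 0" using e by (simp add: d_def)
  then obtain Y where Y: "Y \<in> complex_lin_span S" "L2_dist_sq M X Y < d"
    using X unfolding closed_lin_span_def by auto
  have "(cmod c)\<^sup>2 * L2_dist_sq M X Y \<le> (cmod c)\<^sup>2 * d" using Y(2) by (intro mult_left_mono) auto
  also have "\<dots> < ((cmod c)\<^sup>2 + 1) * d" using \<open>d > 0\<close> by (simp add: algebra_simps)
  also have "\<dots> = e" using C by (simp add: d_def)
  finally have "L2_dist_sq M (\<lambda>\<omega>. c * X \<omega>) (\<lambda>\<omega>. c * Y \<omega>) < e" by (simp add: L2_dist_sq_scale)
  then show "\<exists>Z\<in>complex_lin_span S. L2_dist_sq M (\<lambda>\<omega>. c * X \<omega>) Z < e"
    using complex_lin_span_scale[OF Y(1)] by blast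
qed

text \<open>Multiplication by a bounded function is Lipschitz in L2, so its effect on the closed
  span is decided on the generators.\<close>

lemma closed_lin_span_multI:
  assumes S: "S \<subseteq> L2 M" and T: "T \<subseteq> L2 M"
    and b: "b \<in> borel_measurable M" "\<And>\<omega>. \<omega> \<in> space M \<Longrightarrow> cmod (b \<omega>) \<le> C"
    and base: "\<And>Z. Z \<in> S \<Longrightarrow> (\<lambda>\<omega>. b \<omega> * Z \<omega>) \<in> closed_lin_span M T"
    and X: "X \<in> closed_lin_span M S"
  shows "(\<lambda>\<omega>. b \<omega> * X \<omega>) \<in> closed_lin_span M T"
proof (rule closed_lin_span_closed[OF T L2_mult_bounded[OF closed_lin_span_L2[OF X] b]])
  fix e :: real assume e: "e > 0"
  define d where "d = e / (C\<^sup>2 + 1)"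
  have C: "0 < C\<^sup>2 + 1" by (simp add: add_nonneg_pos)
  then have "d > 0" using e by (simp add: d_def)
  then obtain Y where Y: "Y \<in> complex_lin_span S" "L2_dist_sq M X Y < d"
    using X unfolding closed_lin_span_def by auto
  have "C\<^sup>2 * L2_dist_sq M X Y \<le> C\<^sup>2 * d" using Y(2) by (intro mult_left_mono) auto
  also have "\<dots> < (C\<^sup>2 + 1) * d" using \<open>d > 0\<close> by (simp add: algebra_simps)
  also have "\<dots> = e" using C by (simp add: d_def)
  finally have 1: "C\<^sup>2 * L2_dist_sq M X Y < e" .
  have "L2_dist_sq M (\<lambda>\<omega>. b \<omega> * X \<omega>) (\<lambda>\<omega>. b \<omega> * Y \<omega>) < e"
    using L2_dist_sq_mult_bounded[OF closed_lin_span_L2[OF X] complex_lin_span_L2[OF S Y(1)] b] 1 by linarith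
  moreover have "(\<lambda>\<omega>. b \<omega> * Y \<omega>) \<in> closed_lin_span M T"
    using Y(1)
  proof (induction rule: complex_lin_span_induct)
    case zero
    then show ?case using closed_lin_span_span[OF T complex_lin_span_zero] by simp
  next
    case (step X Z a)
    have "(\<lambda>\<omega>. a * (b \<omega> * Z \<omega>)) \<in> closed_lin_span M T"
      by (rule closed_lin_span_scale[OF T base[OF step(2)]])
    from closed_lin_span_add[OF T step(3) this] show ?case by (simp add: algebra_simps)
  qed
  ultimately show "\<exists>Y\<in>closed_lin_span M T. L2_dist_sq M (\<lambda>\<omega>. b \<omega> * X \<omega>) Y < e" by blast
qed

lemma closed_lin_span_cong_AE:
  assumes "X \<in> closed_lin_span M S" and S: "S \<subseteq> L2 M" and Y: "Y \<in> L2 M" "AE \<omega> in M. X \<omega> = Y \<omega>"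
  shows "Y \<in> closed_lin_span M S"
proof (rule closed_lin_span_closed[OF S Y(1)])
  have "L2_dist_sq M X Y = 0" using L2_dist_sq_eq_0_iff[OF closed_lin_span_L2[OF assms(1)] Y(1)] Y(2) by simp
  then show "\<exists>Z\<in>closed_lin_span M S. L2_dist_sq M Y Z < \<epsilon>" if "\<epsilon> > 0" for \<epsilon>
    using that assms(1) by (auto simp: L2_dist_sq_commute intro!: bexI[of _ X])
qed

lemma complex_lin_span_cnj:
  "X \<in> complex_lin_span S \<Longrightarrow> (\<lambda>\<omega>. cnj (X \<omega>)) \<in> complex_lin_span ((\<lambda>Z \<omega>. cnj (Z \<omega>)) ` S)"
  by (induction rule: complex_lin_span_induct)
     (auto intro: complex_lin_span_zero complex_lin_span_add_scale)

text \<open>Conjugation reverses the sign of every frequency; this is the tool for exchanging past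
  and future.\<close>

lemma closed_lin_span_cnj:
  assumes "X \<in> closed_lin_span M S"
  shows "(\<lambda>\<omega>. cnj (X \<omega>)) \<in> closed_lin_span M ((\<lambda>Z \<omega>. cnj (Z \<omega>)) ` S)"
  unfolding closed_lin_span_def
proof (intro CollectI conjI L2_cnj closed_lin_span_L2[OF assms] allI impI)
  fix e :: real assume "e > 0"
  then obtain Y where Y: "Y \<in> complex_lin_span S" "L2_dist_sq M X Y < e"
    using assms unfolding closed_lin_span_def by auto
  then have "L2_dist_sq M (\<lambda>\<omega>. cnj (X \<omega>)) (\<lambda>\<omega>. cnj (Y \<omega>)) < e"
    by (simp add: L2_dist_sq_def flip: complex_cnj_diff)
  then show "\<exists>Z\<in>complex_lin_span ((\<lambda>Z \<omega>. cnj (Z \<omega>)) ` S). L2_dist_sq M (\<lambda>\<omega>. cnj (X \<omega>)) Z < e"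
    using complex_lin_span_cnj[OF Y(1)] by blast
qed

text \<open>Dominated convergence with majorant (2 C |X|)^2. It turns bounded pointwise convergence
  of multipliers into L2 convergence of the products.\<close>

lemma L2_dist_sq_tendsto_mult:
  assumes X: "X \<in> L2 M" and b[measurable]: "\<And>n. b n \<in> borel_measurable M" "b' \<in> borel_measurable M"
    and bd: "\<And>n \<omega>. \<omega> \<in> space M \<Longrightarrow> cmod (b n \<omega>) \<le> C"
    and lim: "AE \<omega> in M. (\<lambda>n. b n \<omega>) \<longlonglongrightarrow> b' \<omega>"
  shows "(\<lambda>n. L2_dist_sq M (\<lambda>\<omega>. b' \<omega> * X \<omega>) (\<lambda>\<omega>. b n \<omega> * X \<omega>)) \<longlonglongrightarrow> 0"
proof -
  note [measurable] = L2_measurable[OF X]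
  have bd': "AE \<omega> in M. cmod (b' \<omega>) \<le> C"
    using lim AE_space
  proof eventually_elim
    case (elim \<omega>)
    show ?case by (rule LIMSEQ_le_const2[OF tendsto_norm[OF elim(1)]]) (use bd elim(2) in auto)
  qed
  have "(\<lambda>n. \<integral>\<omega>. (cmod (b' \<omega> * X \<omega> - b n \<omega> * X \<omega>))\<^sup>2 \<partial>M) \<longlonglongrightarrow> (\<integral>\<omega>. 0 \<partial>M)"
  proof (rule integral_dominated_convergence[where w="\<lambda>\<omega>. (2 * C)\<^sup>2 * (cmod (X \<omega>))\<^sup>2"])
    show "integrable M (\<lambda>\<omega>. (2 * C)\<^sup>2 * (cmod (X \<omega>))\<^sup>2)" using L2_integrable[OF X] by simp
    show "AE \<omega> in M. (\<lambda>n. (cmod (b' \<omega> * X \<omega> - b n \<omega> * X \<omega>))\<^sup>2) \<longlonglongrightarrow> 0"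
      using lim
    proof eventually_elim
      case (elim \<omega>)
      have "(\<lambda>n. (cmod (b' \<omega> * X \<omega> - b n \<omega> * X \<omega>))\<^sup>2) \<longlonglongrightarrow> (cmod (b' \<omega> * X \<omega> - b' \<omega> * X \<omega>))\<^sup>2"
        by (intro tendsto_intros elim)
      then show ?case by simp
    qed
    show "AE \<omega> in M. norm ((cmod (b' \<omega> * X \<omega> - b n \<omega> * X \<omega>))\<^sup>2) \<le> (2 * C)\<^sup>2 * (cmod (X \<omega>))\<^sup>2" for n
      using bd' AE_space
    proof eventually_elim
      case (elim \<omega>)
      have "cmod (b' \<omega> - b n \<omega>) \<le> 2 * C"
        using norm_triangle_ineq4[of "b' \<omega>" "b n \<omega>"] bd[OF elim(2), of n] elim(1) by linarith
      then have "(cmod (b' \<omega> - b n \<omega>) * cmod (X \<omega>))\<^sup>2 \<le> (2 * C * cmod (X \<omega>))\<^sup>2"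
        by (intro power_mono mult_right_mono) auto
      then show ?case by (simp add: power_mult_distrib norm_mult flip: left_diff_distrib)
    qed
  qed simp_all
  then show ?thesis by (simp add: L2_dist_sq_def)
qed

section \<open>Bounded multipliers of a closed span\<close>

text \<open>A closed span need not be stable under products. The bounded functions that map it into
  itself form an algebra, closed under bounded pointwise limits, and when the span contains 1 they
  are elements of it; memberships are therefore proved for multipliers whenever possible.\<close>

definition multipliers :: "'a measure \<Rightarrow> ('a \<Rightarrow> complex) set \<Rightarrow> ('a \<Rightarrow> complex) set" where
  "multipliers M S = {b \<in> borel_measurable M. (\<exists>C. \<forall>\<omega>\<in>space M. cmod (b \<omega>) \<le> C) \<and>
     (\<forall>X\<in>closed_lin_span M S. (\<lambda>\<omega>. b \<omega> * X \<omega>) \<in> closed_lin_span M S)}"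

lemma multipliersD: "b \<in> multipliers M S \<Longrightarrow> X \<in> closed_lin_span M S \<Longrightarrow> (\<lambda>\<omega>. b \<omega> * X \<omega>) \<in> closed_lin_span M S"
  by (simp add: multipliers_def)

lemma multipliersI:
  assumes "S \<subseteq> L2 M" "b \<in> borel_measurable M" "\<And>\<omega>. \<omega> \<in> space M \<Longrightarrow> cmod (b \<omega>) \<le> C"
    and "\<And>Z. Z \<in> S \<Longrightarrow> (\<lambda>\<omega>. b \<omega> * Z \<omega>) \<in> closed_lin_span M S"
  shows "b \<in> multipliers M S"
  using closed_lin_span_multI[OF assms(1,1) assms(2,3,4)] assms(2,3) unfolding multipliers_def by blast

lemma multipliers_const: "S \<subseteq> L2 M \<Longrightarrow> (\<lambda>\<omega>. c) \<in> multipliers M S"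
  by (auto simp: multipliers_def intro: closed_lin_span_scale)

lemma multipliers_add:
  assumes S: "S \<subseteq> L2 M" and a: "a \<in> multipliers M S" and b: "b \<in> multipliers M S"
  shows "(\<lambda>\<omega>. a \<omega> + b \<omega>) \<in> multipliers M S"
proof -
  obtain C D where C: "\<And>\<omega>. \<omega>\<in>space M \<Longrightarrow> cmod (a \<omega>) \<le> C" and D: "\<And>\<omega>. \<omega>\<in>space M \<Longrightarrow> cmod (b \<omega>) \<le> D"
    using a b unfolding multipliers_def by blast
  have "cmod (a \<omega> + b \<omega>) \<le> C + D" if "\<omega> \<in> space M" for \<omega>
    using norm_triangle_ineq[of "a \<omega>" "b \<omega>"] C[OF that] D[OF that] by linarith
  moreover have "(\<lambda>\<omega>. (a \<omega> + b \<omega>) * X \<omega>) \<in> closed_lin_span M S" if "X \<in> closed_lin_span M S" for X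
    using closed_lin_span_add[OF S multipliersD[OF a that] multipliersD[OF b that]]
    by (simp add: distrib_right)
  ultimately show ?thesis using a b unfolding multipliers_def by auto
qed

lemma multipliers_mult:
  assumes a: "a \<in> multipliers M S" and b: "b \<in> multipliers M S"
  shows "(\<lambda>\<omega>. a \<omega> * b \<omega>) \<in> multipliers M S"
proof -
  obtain C D where C: "\<And>\<omega>. \<omega>\<in>space M \<Longrightarrow> cmod (a \<omega>) \<le> C" and D: "\<And>\<omega>. \<omega>\<in>space M \<Longrightarrow> cmod (b \<omega>) \<le> D"
    using a b unfolding multipliers_def by blast
  have "cmod (a \<omega> * b \<omega>) \<le> C * D" if "\<omega> \<in> space M" for \<omega>
    using C[OF that] D[OF that] by (auto simp: norm_mult intro!: mult_mono order_trans[OF norm_ge_zero C[OF that]])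
  moreover have "(\<lambda>\<omega>. (a \<omega> * b \<omega>) * X \<omega>) \<in> closed_lin_span M S" if "X \<in> closed_lin_span M S" for X
    using multipliersD[OF a multipliersD[OF b that]] by (simp add: mult.assoc)
  ultimately show ?thesis using a b unfolding multipliers_def by auto
qed

lemma multipliers_power: "S \<subseteq> L2 M \<Longrightarrow> a \<in> multipliers M S \<Longrightarrow> (\<lambda>\<omega>. a \<omega> ^ n) \<in> multipliers M S"
  by (induction n) (auto intro: multipliers_const multipliers_mult)

lemma multipliers_sum:
  "S \<subseteq> L2 M \<Longrightarrow> (\<And>i. i \<in> I \<Longrightarrow> a i \<in> multipliers M S) \<Longrightarrow> (\<lambda>\<omega>. \<Sum>i\<in>I. a i \<omega>) \<in> multipliers M S"
  by (induction I rule: infinite_finite_induct) (auto intro: multipliers_const multipliers_add)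

lemma multipliers_LIMSEQ:
  assumes S: "S \<subseteq> L2 M" and b: "\<And>n. b n \<in> multipliers M S"
    and bd: "\<And>n \<omega>. \<omega> \<in> space M \<Longrightarrow> cmod (b n \<omega>) \<le> C"
    and lim: "\<And>\<omega>. \<omega> \<in> space M \<Longrightarrow> (\<lambda>n. b n \<omega>) \<longlonglongrightarrow> b' \<omega>"
  shows "b' \<in> multipliers M S"
proof -
  have m: "b n \<in> borel_measurable M" for n using b by (simp add: multipliers_def)
  have m': "b' \<in> borel_measurable M" by (rule borel_measurable_LIMSEQ_metric[OF m lim])
  have bd': "cmod (b' \<omega>) \<le> C" if "\<omega> \<in> space M" for \<omega>
    by (rule LIMSEQ_le_const2[OF tendsto_norm[OF lim[OF that]]]) (use bd that in auto)
  have "(\<lambda>\<omega>. b' \<omega> * X \<omega>) \<in> closed_lin_span M S" if X: "X \<in> closed_lin_span M S" for X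
  proof (rule closed_lin_span_limit[OF S])
    show "(\<lambda>\<omega>. b' \<omega> * X \<omega>) \<in> L2 M" by (rule L2_mult_bounded[OF closed_lin_span_L2[OF X] m' bd'])
    show "(\<lambda>\<omega>. b n \<omega> * X \<omega>) \<in> closed_lin_span M S" for n by (rule multipliersD[OF b X])
    show "(\<lambda>n. L2_dist_sq M (\<lambda>\<omega>. b' \<omega> * X \<omega>) (\<lambda>\<omega>. b n \<omega> * X \<omega>)) \<longlonglongrightarrow> 0"
      by (rule L2_dist_sq_tendsto_mult[OF closed_lin_span_L2[OF X] m m' bd]) (auto intro: lim)
  qed
  then show ?thesis using m' bd' unfolding multipliers_def by auto
qed

section \<open>Isometric relations\<close>

text \<open>The graph of an isometry between spaces of representatives: an element has many images,
  all equal almost everywhere, so a relation is used. Linearity is supplied by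
  \<open>rel_span\<close>, limits by \<open>rel_closure\<close>, and both keep the relation
  isometric.\<close>

definition isometric_on :: "'a measure \<Rightarrow> 'b measure \<Rightarrow> (('a \<Rightarrow> complex) \<times> ('b \<Rightarrow> complex)) set \<Rightarrow> bool" where
  "isometric_on N M R \<longleftrightarrow> (\<forall>(\<phi>, \<xi>)\<in>R. \<phi> \<in> L2 N \<and> \<xi> \<in> L2 M \<and>
     (\<forall>(\<psi>, \<eta>)\<in>R. L2_inner N \<phi> \<psi> = L2_inner M \<xi> \<eta>))"

inductive_set rel_span :: "(('a \<Rightarrow> complex) \<times> ('b \<Rightarrow> complex)) set \<Rightarrow> (('a \<Rightarrow> complex) \<times> ('b \<Rightarrow> complex)) set"
  for R where
  rel_span_zero: "(\<lambda>x. 0, \<lambda>\<omega>. 0) \<in> rel_span R"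
| rel_span_step: "(\<phi>, \<xi>) \<in> rel_span R \<Longrightarrow> (\<psi>, \<eta>) \<in> R \<Longrightarrow>
    (\<lambda>x. \<phi> x + c * \<psi> x, \<lambda>\<omega>. \<xi> \<omega> + c * \<eta> \<omega>) \<in> rel_span R"

definition rel_closure :: "'a measure \<Rightarrow> 'b measure \<Rightarrow> (('a \<Rightarrow> complex) \<times> ('b \<Rightarrow> complex)) set \<Rightarrow>
    (('a \<Rightarrow> complex) \<times> ('b \<Rightarrow> complex)) set" where
  "rel_closure N M R = {(\<phi>, \<xi>). \<phi> \<in> L2 N \<and> \<xi> \<in> L2 M \<and>
     (\<forall>\<epsilon>>0. \<exists>(\<psi>, \<eta>)\<in>R. L2_dist_sq N \<phi> \<psi> < \<epsilon> \<and> L2_dist_sq M \<xi> \<eta> < \<epsilon>)}"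

lemma isometric_onD:
  assumes "isometric_on N M R" "(\<phi>, \<xi>) \<in> R"
  shows "\<phi> \<in> L2 N" "\<xi> \<in> L2 M" "(\<psi>, \<eta>) \<in> R \<Longrightarrow> L2_inner N \<phi> \<psi> = L2_inner M \<xi> \<eta>"
  using assms unfolding isometric_on_def by blast+

lemma isometric_onI:
  assumes "\<And>\<phi> \<xi>. (\<phi>, \<xi>) \<in> R \<Longrightarrow> \<phi> \<in> L2 N" "\<And>\<phi> \<xi>. (\<phi>, \<xi>) \<in> R \<Longrightarrow> \<xi> \<in> L2 M"
    and "\<And>\<phi> \<xi> \<psi> \<eta>. (\<phi>, \<xi>) \<in> R \<Longrightarrow> (\<psi>, \<eta>) \<in> R \<Longrightarrow> L2_inner N \<phi> \<psi> = L2_inner M \<xi> \<eta>"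
  shows "isometric_on N M R"
  using assms unfolding isometric_on_def by blast

lemma isometric_on_subset: "isometric_on N M R \<Longrightarrow> R' \<subseteq> R \<Longrightarrow> isometric_on N M R'"
  unfolding isometric_on_def by blast

lemma isometric_on_dist:
  assumes R: "isometric_on N M R" "(\<phi>, \<xi>) \<in> R" "(\<psi>, \<eta>) \<in> R"
  shows "L2_dist_sq N \<phi> \<psi> = L2_dist_sq M \<xi> \<eta>"
proof -
  note L = isometric_onD(1,2)[OF R(1,2)] isometric_onD(1,2)[OF R(1,3)]
  note I = isometric_onD(3)[OF R(1)]
  have "complex_of_real (L2_dist_sq N \<phi> \<psi>) = complex_of_real (L2_dist_sq M \<xi> \<eta>)"
    unfolding L2_dist_sq_inner using L R(2,3)
    by (simp add: L2_inner_diff_left L2_inner_diff_right L2_diff I)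
  then show ?thesis by simp
qed

lemma isometric_on_norm:
  assumes "isometric_on N M R" "(\<phi>, \<xi>) \<in> R"
  shows "(\<integral>x. (cmod (\<phi> x))\<^sup>2 \<partial>N) = (\<integral>\<omega>. (cmod (\<xi> \<omega>))\<^sup>2 \<partial>M)"
  using isometric_onD(3)[OF assms assms(2)] by (simp add: L2_inner_self)

lemma rel_span_base: "(\<phi>, \<xi>) \<in> R \<Longrightarrow> (\<phi>, \<xi>) \<in> rel_span R"
  using rel_span_step[OF rel_span_zero, of \<phi> \<xi> R 1] by simp

lemma rel_span_sum:
  assumes "finite I" "\<And>i. i \<in> I \<Longrightarrow> (\<phi> i, \<xi> i) \<in> R"
  shows "(\<lambda>x. \<Sum>i\<in>I. c i * \<phi> i x, \<lambda>\<omega>. \<Sum>i\<in>I. c i * \<xi> i \<omega>) \<in> rel_span R"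
  using assms
proof (induction I rule: finite_induct)
  case empty show ?case using rel_span_zero by simp
next
  case (insert i I)
  then show ?case
    using rel_span_step[of "\<lambda>x. \<Sum>i\<in>I. c i * \<phi> i x" "\<lambda>\<omega>. \<Sum>i\<in>I. c i * \<xi> i \<omega>" R "\<phi> i" "\<xi> i" "c i"]
    by (simp add: add.commute)
qed

text \<open>Induction extends the identity in the first argument while the second is fixed;
  conjugate symmetry lets the same induction run over the second argument.\<close>

lemma isometric_rel_span:
  assumes R: "isometric_on N M R"
  shows "isometric_on N M (rel_span R)"
proof -
  have L: "\<phi> \<in> L2 N \<and> \<xi> \<in> L2 M" if "(\<phi>, \<xi>) \<in> rel_span R" for \<phi> \<xi>
    using that
  proof induction
    case (rel_span_step \<phi> \<xi> \<psi> \<eta> c)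
    then show ?case using isometric_onD(1,2)[OF R rel_span_step(2)] by (auto intro: L2_add L2_scale)
  qed auto
  have one: "L2_inner N \<phi> \<psi> = L2_inner M \<xi> \<eta>"
    if "(\<phi>, \<xi>) \<in> rel_span R" "\<psi> \<in> L2 N" "\<eta> \<in> L2 M"
      "\<And>\<phi> \<xi>. (\<phi>, \<xi>) \<in> R \<Longrightarrow> L2_inner N \<phi> \<psi> = L2_inner M \<xi> \<eta>" for \<phi> \<xi> \<psi> \<eta>
    using that(1)
  proof induction
    case rel_span_zero then show ?case by (simp add: L2_inner_def)
  next
    case (rel_span_step \<phi> \<xi> \<psi>' \<eta>' c)
    then show ?case using that L[OF rel_span_step(1)] isometric_onD(1,2)[OF R rel_span_step(2)]
      by (simp add: L2_inner_add_left L2_inner_scale_left L2_scale)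
  qed
  have "L2_inner N \<phi> \<psi> = L2_inner M \<xi> \<eta>" if 1: "(\<phi>, \<xi>) \<in> rel_span R" and 2: "(\<psi>, \<eta>) \<in> rel_span R" for \<phi> \<xi> \<psi> \<eta>
  proof (rule one[OF 1])
    fix \<phi>' \<xi>' assume 3: "(\<phi>', \<xi>') \<in> R"
    have "L2_inner N \<psi> \<phi>' = L2_inner M \<eta> \<xi>'"
      by (rule one[OF 2]) (use isometric_onD[OF R] 3 in blast)+
    then show "L2_inner N \<phi>' \<psi> = L2_inner M \<xi>' \<eta>" by (metis L2_inner_cnj)
  qed (use L[OF 2] in auto)
  then show ?thesis using L unfolding isometric_on_def by blast
qed

lemma rel_closure_sequence:
  assumes "(\<phi>, \<xi>) \<in> rel_closure N M R"
  obtains \<psi> \<eta> where "\<And>n. (\<psi> n, \<eta> n) \<in> R" "(\<lambda>n. L2_dist_sq N (\<psi> n) \<phi>) \<longlonglongrightarrow> 0" "(\<lambda>n. L2_dist_sq M (\<eta> n) \<xi>) \<longlonglongrightarrow> 0"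
proof -
  have "\<forall>n. \<exists>p. p \<in> R \<and> L2_dist_sq N \<phi> (fst p) < inverse (Suc n) \<and> L2_dist_sq M \<xi> (snd p) < inverse (Suc n)"
  proof
    fix n
    show "\<exists>p. p \<in> R \<and> L2_dist_sq N \<phi> (fst p) < inverse (Suc n) \<and> L2_dist_sq M \<xi> (snd p) < inverse (Suc n)"
      using assms unfolding rel_closure_def by (auto dest!: spec[of _ "inverse (real (Suc n))"] simp del: of_nat_Suc intro!: bexI)
  qed
  then obtain p where p: "\<And>n. p n \<in> R" "\<And>n. L2_dist_sq N \<phi> (fst (p n)) < inverse (Suc n)"
    "\<And>n. L2_dist_sq M \<xi> (snd (p n)) < inverse (Suc n)" by metis
  show ?thesis
  proof (rule that[of "\<lambda>n. fst (p n)" "\<lambda>n. snd (p n)"])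
    show "(\<lambda>n. L2_dist_sq N (fst (p n)) \<phi>) \<longlonglongrightarrow> 0"
      by (rule tendsto_sandwich[OF _ _ tendsto_const LIMSEQ_inverse_real_of_nat])
         (use p(2) in \<open>auto simp: L2_dist_sq_commute less_imp_le simp del: of_nat_Suc\<close>)
    show "(\<lambda>n. L2_dist_sq M (snd (p n)) \<xi>) \<longlonglongrightarrow> 0"
      by (rule tendsto_sandwich[OF _ _ tendsto_const LIMSEQ_inverse_real_of_nat])
         (use p(3) in \<open>auto simp: L2_dist_sq_commute less_imp_le simp del: of_nat_Suc\<close>)
  qed (use p(1) in auto)
qed

lemma isometric_rel_closure:
  assumes R: "isometric_on N M R"
  shows "isometric_on N M (rel_closure N M R)"
proof -
  have "L2_inner N \<phi> \<psi> = L2_inner M \<xi> \<eta>"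
    if 1: "(\<phi>, \<xi>) \<in> rel_closure N M R" and 2: "(\<psi>, \<eta>) \<in> rel_closure N M R" for \<phi> \<xi> \<psi> \<eta>
  proof -
    obtain \<phi>' \<xi>' where r1: "\<And>n. (\<phi>' n, \<xi>' n) \<in> R" "(\<lambda>n. L2_dist_sq N (\<phi>' n) \<phi>) \<longlonglongrightarrow> 0" "(\<lambda>n. L2_dist_sq M (\<xi>' n) \<xi>) \<longlonglongrightarrow> 0"
      by (rule rel_closure_sequence[OF 1]) (rule that)
    obtain \<psi>' \<eta>' where r2: "\<And>n. (\<psi>' n, \<eta>' n) \<in> R" "(\<lambda>n. L2_dist_sq N (\<psi>' n) \<psi>) \<longlonglongrightarrow> 0" "(\<lambda>n. L2_dist_sq M (\<eta>' n) \<eta>) \<longlonglongrightarrow> 0"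
      by (rule rel_closure_sequence[OF 2]) (rule that)
    have L: "\<phi> \<in> L2 N" "\<psi> \<in> L2 N" "\<xi> \<in> L2 M" "\<eta> \<in> L2 M" using 1 2 by (auto simp: rel_closure_def)
    note D = isometric_onD[OF R]
    have "(\<lambda>n. L2_inner N (\<phi>' n) (\<psi>' n)) \<longlonglongrightarrow> L2_inner N \<phi> \<psi>"
      by (rule L2_inner_tendsto) (use L r1 r2 D in blast)+
    moreover have "(\<lambda>n. L2_inner M (\<xi>' n) (\<eta>' n)) \<longlonglongrightarrow> L2_inner M \<xi> \<eta>"
      by (rule L2_inner_tendsto) (use L r1 r2 D in blast)+
    moreover have "L2_inner N (\<phi>' n) (\<psi>' n) = L2_inner M (\<xi>' n) (\<eta>' n)" for n
      by (rule D(3)[OF r1(1) r2(1)])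
    ultimately show ?thesis by (simp add: LIMSEQ_unique)
  qed
  then show ?thesis by (intro isometric_onI) (auto simp: rel_closure_def)
qed

lemma rel_closure_subset:
  assumes "isometric_on N M R" shows "R \<subseteq> rel_closure N M R"
proof (clarify)
  fix \<phi> \<xi> assume p: "(\<phi>, \<xi>) \<in> R"
  then show "(\<phi>, \<xi>) \<in> rel_closure N M R"
    unfolding rel_closure_def using isometric_onD(1,2)[OF assms p] by (auto intro!: bexI[OF _ p])
qed

text \<open>The isometry turns an approximating sequence in L2(N) into a Cauchy sequence in L2(M),
  and completeness supplies an image of the limit.\<close>

lemma rel_closure_total:
  assumes R: "isometric_on N M R" and \<phi>: "\<phi> \<in> L2 N"
    and approx: "\<And>\<epsilon>. \<epsilon> > 0 \<Longrightarrow> \<exists>(\<psi>, \<eta>)\<in>R. L2_dist_sq N \<phi> \<psi> < \<epsilon>"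
  obtains \<xi> where "(\<phi>, \<xi>) \<in> rel_closure N M R"
proof -
  have "\<forall>n. \<exists>p. p \<in> R \<and> L2_dist_sq N \<phi> (fst p) < inverse (Suc n)"
  proof
    fix n show "\<exists>p. p \<in> R \<and> L2_dist_sq N \<phi> (fst p) < inverse (Suc n)"
      using approx[of "inverse (Suc n)"] by fastforce
  qed
  then obtain p where p: "\<And>n. p n \<in> R" "\<And>n. L2_dist_sq N \<phi> (fst (p n)) < inverse (Suc n)" by metis
  define \<psi> \<eta> where "\<psi> n = fst (p n)" and "\<eta> n = snd (p n)" for n
  have R': "(\<psi> n, \<eta> n) \<in> R" for n using p(1)[of n] by (simp add: \<psi>_def \<eta>_def)
  note L = isometric_onD(1,2)[OF R R']
  have lim: "(\<lambda>n. L2_dist_sq N \<phi> (\<psi> n)) \<longlonglongrightarrow> 0"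
    by (rule tendsto_sandwich[OF _ _ tendsto_const LIMSEQ_inverse_real_of_nat])
       (use p(2) in \<open>auto simp: \<psi>_def less_imp_le simp del: of_nat_Suc\<close>)
  obtain \<xi> where \<xi>: "\<xi> \<in> L2 M" "(\<lambda>n. L2_dist_sq M (\<eta> n) \<xi>) \<longlonglongrightarrow> 0"
  proof (rule L2_complete[of \<eta> M])
    fix e :: real assume "e > 0"
    then have "\<forall>\<^sub>F n in sequentially. L2_dist_sq N \<phi> (\<psi> n) < e / 4"
      by (intro order_tendstoD(2)[OF lim]) simp
    then obtain n0 where n0: "\<And>n. n \<ge> n0 \<Longrightarrow> L2_dist_sq N \<phi> (\<psi> n) < e / 4"
      by (auto simp: eventually_sequentially)
    have "L2_dist_sq M (\<eta> m) (\<eta> n) < e" if "m \<ge> n0" "n \<ge> n0" for m n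
    proof -
      have "L2_dist_sq M (\<eta> m) (\<eta> n) = L2_dist_sq N (\<psi> m) (\<psi> n)"
        using isometric_on_dist[OF R R'[of m] R'[of n]] by simp
      also have "\<dots> \<le> 2 * L2_dist_sq N (\<psi> m) \<phi> + 2 * L2_dist_sq N \<phi> (\<psi> n)"
        by (rule L2_dist_sq_triangle[OF L(1) \<phi> L(1)])
      also have "\<dots> < e" using n0[OF that(1)] n0[OF that(2)] by (simp add: L2_dist_sq_commute)
      finally show ?thesis .
    qed
    then show "\<exists>n0. \<forall>m\<ge>n0. \<forall>n\<ge>n0. L2_dist_sq M (\<eta> m) (\<eta> n) < e" by blast
  qed (use L in auto)
  have "(\<phi>, \<xi>) \<in> rel_closure N M R"
    unfolding rel_closure_def
  proof (intro CollectI case_prodI conjI \<phi> \<xi>(1) allI impI)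
    fix e :: real assume "e > 0"
    then have "\<forall>\<^sub>F n in sequentially. L2_dist_sq N \<phi> (\<psi> n) < e" "\<forall>\<^sub>F n in sequentially. L2_dist_sq M (\<eta> n) \<xi> < e"
      using lim \<xi>(2) by (auto simp: order_tendsto_iff)
    then have "\<forall>\<^sub>F n in sequentially. L2_dist_sq N \<phi> (\<psi> n) < e \<and> L2_dist_sq M (\<eta> n) \<xi> < e"
      by (rule eventually_conj)
    then obtain n where "L2_dist_sq N \<phi> (\<psi> n) < e \<and> L2_dist_sq M (\<eta> n) \<xi> < e"
      using eventually_happens'[OF sequentially_bot] by blast
    then show "\<exists>(\<psi>, \<eta>)\<in>R. L2_dist_sq N \<phi> \<psi> < e \<and> L2_dist_sq M \<xi> \<eta> < e"
      using R'[of n] by (auto simp: L2_dist_sq_commute intro!: bexI[of _ "(\<psi> n, \<eta> n)"])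
  qed
  then show ?thesis by (rule that)
qed

lemma isometric_on_converse: "isometric_on N M R \<Longrightarrow> isometric_on M N (R\<inverse>)"
  by (rule isometric_onI) (auto dest: isometric_onD(1,2) isometric_onD(3)[symmetric])

lemma complex_lin_span_transfer:
  assumes "\<And>Z. Z \<in> S \<Longrightarrow> \<exists>Z'\<in>S'. (Z, Z') \<in> R" and "X \<in> complex_lin_span S"
  shows "\<exists>Y\<in>complex_lin_span S'. (X, Y) \<in> rel_span R"
  using assms(2)
proof (induction rule: complex_lin_span_induct)
  case zero
  then show ?case using rel_span_zero complex_lin_span_zero by blast
next
  case (step X Z a)
  then obtain Y where Y: "Y \<in> complex_lin_span S'" "(X, Y) \<in> rel_span R" by blast
  obtain Z' where Z': "Z' \<in> S'" "(Z, Z') \<in> R" using assms(1)[OF step(2)] by blast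
  show ?case using rel_span_step[OF Y(2) Z'(2)] complex_lin_span_add_scale[OF Y(1) Z'(1)] by blast
qed

text \<open>The approximant of \<phi> is a combination of generators and is related to its image
  only through \<open>rel_span R\<close>; distances are therefore compared in that larger isometric
  relation.\<close>

lemma isometric_on_closed_lin_span:
  assumes R: "isometric_on N M R" and S: "\<And>Z. Z \<in> S \<Longrightarrow> \<exists>Z'\<in>S'. (Z, Z') \<in> R"
    and p: "(\<phi>, \<xi>) \<in> R" and \<phi>: "\<phi> \<in> closed_lin_span N S"
  shows "\<xi> \<in> closed_lin_span M S'"
  unfolding closed_lin_span_def
proof (intro CollectI conjI allI impI)
  show "\<xi> \<in> L2 M" by (rule isometric_onD(2)[OF R p])
  fix e :: real assume "e > 0"
  then obtain X where X: "X \<in> complex_lin_span S" "L2_dist_sq N \<phi> X < e"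
    using \<phi> unfolding closed_lin_span_def by auto
  obtain Y where Y: "Y \<in> complex_lin_span S'" "(X, Y) \<in> rel_span R"
    using complex_lin_span_transfer[OF S X(1)] by blast
  have "L2_dist_sq M \<xi> Y = L2_dist_sq N \<phi> X"
    using isometric_on_dist[OF isometric_rel_span[OF R] rel_span_base[OF p] Y(2)] by simp
  with X Y show "\<exists>Y\<in>complex_lin_span S'. L2_dist_sq M \<xi> Y < e" by (intro bexI[of _ Y]) simp_all
qed

section \<open>The Cayley transform and the Cauchy distribution\<close>

text \<open>\<open>cayley\<close> maps the closed upper half-plane onto the closed unit disc without the point \<open>1\<close>;
  \<open>cauchy_measure\<close> is the preimage of the normalized arc length of the circle.\<close>

definition cayley :: "complex \<Rightarrow> complex" where
  "cayley z = (z - \<i>) / (z + \<i>)"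

definition cauchy_measure :: "real measure" where
  "cauchy_measure = density lborel (\<lambda>u. ennreal (1 / (pi * (1 + u\<^sup>2))))"

lemma one_plus_sq_pos [simp]: "0 < 1 + (u::real)\<^sup>2"
  by (simp add: add_pos_nonneg)

lemma one_plus_sq_neq_0 [simp]: "1 + (u::real)\<^sup>2 \<noteq> 0"
  using one_plus_sq_pos[of u] by linarith

lemma integrable_inverse_one_plus_sq: "integrable lborel (\<lambda>u::real. 1 / (1 + u\<^sup>2))"
  using integrable_inverse_1_plus_square by (simp add: set_integrable_def inverse_eq_divide)

lemma integral_inverse_one_plus_sq: "(\<integral>u. 1 / (1 + (u::real)\<^sup>2) \<partial>lborel) = pi"
  using LBINT_inverse_1_plus_square
  by (simp add: interval_lebesgue_integral_def set_lebesgue_integral_def inverse_eq_divide)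

lemma space_cauchy [simp]: "space cauchy_measure = UNIV"
  and sets_cauchy [simp, measurable_cong]: "sets cauchy_measure = sets borel"
  by (simp_all add: cauchy_measure_def)

lemma integrable_cauchy_iff:
  fixes f :: "real \<Rightarrow> 'b::{banach, second_countable_topology}"
  assumes "f \<in> borel_measurable borel"
  shows "integrable cauchy_measure f \<longleftrightarrow> integrable lborel (\<lambda>u. (1 / (pi * (1 + u\<^sup>2))) *\<^sub>R f u)"
  unfolding cauchy_measure_def
  by (rule integrable_density) (use assms in \<open>auto intro!: divide_nonneg_nonneg mult_nonneg_nonneg\<close>)

lemma integral_cauchy:
  fixes f :: "real \<Rightarrow> 'b::{banach, second_countable_topology}"
  assumes "f \<in> borel_measurable borel"
  shows "(\<integral>u. f u \<partial>cauchy_measure) = (\<integral>u. (1 / (pi * (1 + u\<^sup>2))) *\<^sub>R f u \<partial>lborel)"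
  unfolding cauchy_measure_def
  by (rule integral_density) (use assms in \<open>auto intro!: divide_nonneg_nonneg mult_nonneg_nonneg\<close>)

lemma AE_cauchy_iff: "(AE u in cauchy_measure. P u) \<longleftrightarrow> (AE u in lborel. P u)"
  unfolding cauchy_measure_def by (subst AE_density) auto

lemma null_sets_cauchy: "null_sets cauchy_measure = null_sets lborel"
proof -
  have "N \<in> null_sets cauchy_measure \<longleftrightarrow> N \<in> null_sets lborel" for N
  proof (cases "N \<in> sets borel")
    case True
    then show ?thesis
      using AE_iff_null_sets[of N cauchy_measure] AE_iff_null_sets[of N lborel] AE_cauchy_iff[of "\<lambda>u. u \<notin> N"]
      by simp
  qed (auto simp: null_sets_def)
  then show ?thesis by blast
qed

interpretation cauchy: prob_space cauchy_measure
proof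
  have "emeasure cauchy_measure (space cauchy_measure) = (\<integral>\<^sup>+u. ennreal (1 / pi * (1 / (1 + u\<^sup>2))) \<partial>lborel)"
    unfolding cauchy_measure_def by (subst emeasure_density) auto
  also have "\<dots> = ennreal (\<integral>u. 1 / pi * (1 / (1 + u\<^sup>2)) \<partial>lborel)"
    by (rule nn_integral_eq_integral, rule integrable_mult_right, rule integrable_inverse_one_plus_sq)
       (auto intro!: AE_I2 divide_nonneg_nonneg mult_nonneg_nonneg)
  also have "(\<integral>u. 1 / pi * (1 / (1 + u\<^sup>2)) \<partial>lborel) = 1 / pi * (\<integral>u. 1 / (1 + u\<^sup>2) \<partial>lborel)"
    by (rule integral_mult_right_zero)
  also have "\<dots> = 1" using integral_inverse_one_plus_sq by simp
  finally show "emeasure cauchy_measure (space cauchy_measure) = 1" by simp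
qed

lemma of_real_add_ii_neq_0 [simp]: "complex_of_real u + \<i> \<noteq> 0" "complex_of_real u - \<i> \<noteq> 0"
  by (auto simp: complex_eq_iff)

lemma of_real_neq_ii [simp]: "complex_of_real u \<noteq> \<i>" "\<i> \<noteq> complex_of_real u"
  by (auto simp: complex_eq_iff)

lemma cmod_cayley_le_1:
  assumes "Im z \<ge> 0" shows "cmod (cayley z) \<le> 1"
proof -
  have "(cmod (z - \<i>))\<^sup>2 \<le> (cmod (z + \<i>))\<^sup>2"
    using assms by (simp add: cmod_power2) (simp add: power2_eq_square algebra_simps)
  then have "cmod (z - \<i>) \<le> cmod (z + \<i>)" by (rule power2_le_imp_le) simp
  moreover have "z + \<i> \<noteq> 0" using assms by (auto simp: complex_eq_iff)
  ultimately show ?thesis by (simp add: cayley_def norm_divide divide_le_eq_1)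
qed

lemma cmod_cayley_of_real [simp]: "cmod (cayley (of_real u)) = 1"
proof -
  have "cmod (of_real u - \<i>) = cmod (of_real u + \<i>)" by (simp add: cmod_def)
  then show ?thesis by (simp add: cayley_def norm_divide)
qed

lemma cayley_holomorphic: "cayley holomorphic_on {z. Im z > -1}"
proof -
  have "z + \<i> \<noteq> 0" if "Im z > -1" for z using that by (auto simp: complex_eq_iff)
  then show ?thesis unfolding cayley_def by (intro holomorphic_intros) auto
qed

lemma continuous_cayley_of_real: "continuous_on UNIV (\<lambda>u. cayley (of_real u))"
  unfolding cayley_def by (intro continuous_intros) simp

lemma measurable_cayley_of_real [measurable]: "(\<lambda>u. cayley (of_real u)) \<in> borel_measurable borel"
  by (rule borel_measurable_continuous_onI[OF continuous_cayley_of_real])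

lemma measurable_entire_cayley:
  assumes "G holomorphic_on UNIV" shows "(\<lambda>u. G (cayley (of_real u))) \<in> borel_measurable borel"
  by (rule borel_measurable_continuous_onI)
     (rule continuous_on_compose2[OF holomorphic_on_imp_continuous_on[OF assms] continuous_cayley_of_real], simp)

lemma entire_bounded_disc:
  assumes "G holomorphic_on UNIV"
  obtains C where "C \<ge> 0" "\<And>z. cmod z \<le> 1 \<Longrightarrow> cmod (G z) \<le> C"
proof -
  have "compact (G ` cball 0 1)"
    by (intro compact_continuous_image continuous_on_subset[OF holomorphic_on_imp_continuous_on[OF assms]]) auto
  then obtain C where C: "\<And>z. z \<in> cball 0 1 \<Longrightarrow> cmod (G z) \<le> C"
    by (metis bounded_iff compact_imp_bounded imageI)
  show ?thesis
  proof (rule that)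
    show "C \<ge> 0" using order_trans[OF norm_ge_zero C[of 0]] by simp
    show "cmod (G z) \<le> C" if "cmod z \<le> 1" for z using C that by simp
  qed
qed

text \<open>After splitting off the value at \<open>0\<close>, the zero at \<open>\<i>\<close> cancels the pole of the Cauchy density
  in the upper half-plane.\<close>

lemma integral_cauchy_entire:
  assumes G: "G holomorphic_on UNIV"
  shows "integrable cauchy_measure (\<lambda>u. G (cayley (of_real u)))"
    and "(\<integral>u. G (cayley (of_real u)) \<partial>cauchy_measure) = G 0"
proof -
  note [measurable] = measurable_entire_cayley[OF G]
  obtain C where C: "C \<ge> 0" "\<And>z. cmod z \<le> 1 \<Longrightarrow> cmod (G z) \<le> C"
    using entire_bounded_disc[OF G] by blast
  show int: "integrable cauchy_measure (\<lambda>u. G (cayley (of_real u)))"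
    by (rule cauchy.integrable_const_bound[where B=C]) (auto intro!: AE_I2 C(2))
  define Q where "Q z = (if z = 0 then deriv G 0 else (G z - G 0) / z)" for z
  have Q: "Q holomorphic_on UNIV"
  proof -
    have "(\<lambda>z. if z = 0 then deriv G 0 else (G z - G 0) / (z - 0)) holomorphic_on UNIV"
      by (rule pole_lemma_open[OF G]) auto
    then show ?thesis by (simp add: Q_def[abs_def] cong: if_cong)
  qed
  have QG: "G z = G 0 + z * Q z" for z by (simp add: Q_def)
  obtain D where D: "D \<ge> 0" "\<And>z. cmod z \<le> 1 \<Longrightarrow> cmod (Q z) \<le> D"
    using entire_bounded_disc[OF Q] by blast
  define h where "h z = Q (cayley z) / (of_real pi * (z + \<i>)\<^sup>2)" for z
  have nz: "z + \<i> \<noteq> 0" if "Im z > -1" for z using that by (auto simp: complex_eq_iff)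
  have "h holomorphic_on {z. Im z > -1}"
    unfolding h_def
    by (intro holomorphic_intros holomorphic_on_compose_gen[OF cayley_holomorphic Q, unfolded o_def])
       (use nz in auto)
  moreover have "cmod (h z) \<le> (D / pi) / (cmod z)\<^sup>2" if z: "Im z \<ge> 0" "cmod z \<ge> 1" for z
  proof -
    have "(cmod z)\<^sup>2 \<le> (cmod (z + \<i>))\<^sup>2"
      using z(1) by (simp add: cmod_power2)
    moreover have "0 < (cmod z)\<^sup>2" using z(2) by (intro zero_less_power) linarith
    ultimately have "cmod (Q (cayley z)) / (pi * (cmod (z + \<i>))\<^sup>2) \<le> D / (pi * (cmod z)\<^sup>2)"
      by (intro frac_le D cmod_cayley_le_1 z mult_left_mono mult_pos_pos) simp_all
    then show ?thesis by (simp add: h_def norm_divide norm_mult norm_power)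
  qed
  ultimately have h: "integrable lborel (\<lambda>u. h (of_real u))" "(\<integral>u. h (of_real u) \<partial>lborel) = 0"
    using integral_real_line_eq_0[of "-1" h "D / pi"] by auto
  have eq: "(1 / (pi * (1 + u\<^sup>2))) *\<^sub>R (G (cayley (of_real u)) - G 0) = h (of_real u)" for u
  proof -
    have "complex_of_real (1 + u\<^sup>2) = (of_real u - \<i>) * (of_real u + \<i>)"
      by (simp add: algebra_simps power2_eq_square)
    then have "(1 / (pi * (1 + u\<^sup>2))) *\<^sub>R (cayley (of_real u) * Q (cayley (of_real u)))
      = cayley (of_real u) * Q (cayley (of_real u)) / (of_real pi * ((of_real u - \<i>) * (of_real u + \<i>)))"
      by (simp add: scaleR_conv_of_real)
    also have "\<dots> = h (of_real u)" by (simp add: h_def cayley_def power2_eq_square)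
    finally show ?thesis using QG[of "cayley (of_real u)"] by simp
  qed
  have "(\<integral>u. G (cayley (of_real u)) - G 0 \<partial>cauchy_measure) = 0"
    by (subst integral_cauchy) (auto simp: eq h(2))
  then show "(\<integral>u. G (cayley (of_real u)) \<partial>cauchy_measure) = G 0"
    using int by (simp add: cauchy.prob_space[simplified])
qed

section \<open>Approximation by real parts of analytic polynomials\<close>

text \<open>On the circle the conjugate of z is 1/z, so the product is a Laurent polynomial.
  Conjugating its terms with negative exponents makes it analytic and changes only the imaginary
  part.\<close>

lemma Re_laurent_eq_Re_poly:
  assumes z: "cmod z = 1"
  shows "Re (poly P z * cnj (poly Q z)) = Re (\<Sum>i\<le>degree P. \<Sum>j\<le>degree Q.
     (if j \<le> i then coeff P i * cnj (coeff Q j) * z ^ (i - j) else cnj (coeff P i) * coeff Q j * z ^ (j - i)))"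
proof -
  have zz: "z ^ k * cnj (z ^ k) = 1" for k
  proof -
    have "z * cnj z = 1" using z by (simp flip: complex_norm_square)
    then show ?thesis by (simp flip: power_mult_distrib)
  qed
  have 1: "z ^ i * cnj (z ^ j) = (if j \<le> i then z ^ (i - j) else cnj (z ^ (j - i)))" for i j
  proof (cases "j \<le> i")
    case True
    then obtain k where "i = k + j" by (metis le_add_diff_inverse2)
    then show ?thesis using zz[of j] by (simp add: power_add mult.assoc)
  next
    case False
    then obtain k where k: "j = k + i" by (metis le_add_diff_inverse2 nat_le_linear)
    have "z ^ i * cnj (z ^ j) = cnj (z ^ k) * (z ^ i * cnj (z ^ i))" by (simp add: k power_add)
    then have "z ^ i * cnj (z ^ j) = cnj (z ^ k)" by (simp only: zz mult_1_right)
    moreover have "k = j - i" using k by simp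
    ultimately show ?thesis using False by (simp only: if_False)
  qed
  have 2: "Re (a * cnj b * cnj w) = Re (cnj a * b * w)" for a b w
    by (simp add: algebra_simps)
  have 3: "Re (coeff P i * cnj (coeff Q j) * (z ^ i * cnj (z ^ j))) =
    Re (if j \<le> i then coeff P i * cnj (coeff Q j) * z ^ (i - j) else cnj (coeff P i) * coeff Q j * z ^ (j - i))" for i j
    unfolding 1 by (cases "j \<le> i") (simp_all only: if_True if_False 2)
  have "poly P z * cnj (poly Q z) = (\<Sum>i\<le>degree P. \<Sum>j\<le>degree Q. coeff P i * cnj (coeff Q j) * (z ^ i * cnj (z ^ j)))"
    by (simp add: poly_altdef sum_product algebra_simps)
  then show ?thesis by (simp only: Re_sum 3)
qed

text \<open>Stone-Weierstrass provides polynomials in Re z and Im z, while analytic polynomials are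
  wanted. On the circle these are real trigonometric polynomials, and each of them is the real part
  of an analytic one.\<close>

lemma real_polynomial_function_circle:
  assumes "real_polynomial_function (f :: complex \<Rightarrow> real)"
  shows "\<exists>P. \<forall>z. cmod z = 1 \<longrightarrow> f z = Re (poly P z)"
  using assms
proof (induction f rule: real_polynomial_function.induct)
  case (linear f)
  interpret bounded_linear f by fact
  \<comment> \<open>A real linear form on the plane is Re (a z) with a = f 1 - \<i> f \<i>.\<close>
  have "f z = Re (poly [:0, Complex (f 1) (- f \<i>):] z)" for z
  proof -
    have "f z = f (Re z *\<^sub>R 1 + Im z *\<^sub>R \<i>)"
      by (rule arg_cong[of _ _ f]) (simp add: complex_eq_iff)
    also have "\<dots> = Re z * f 1 + Im z * f \<i>" by (simp only: add scaleR real_scaleR_def)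
    finally show ?thesis by simp
  qed
  then show ?case by blast
next
  case (const c)
  have "c = Re (poly [:of_real c:] z)" for z by simp
  then show ?case by blast
next
  case (add f g)
  then obtain P Q where "\<forall>z. cmod z = 1 \<longrightarrow> f z = Re (poly P z)" "\<forall>z. cmod z = 1 \<longrightarrow> g z = Re (poly Q z)" by blast
  then have "\<forall>z. cmod z = 1 \<longrightarrow> f z + g z = Re (poly (P + Q) z)" by simp
  then show ?case by blast
next
  case (mult f g)
  then obtain P Q where PQ: "\<And>z. cmod z = 1 \<Longrightarrow> f z = Re (poly P z)" "\<And>z. cmod z = 1 \<Longrightarrow> g z = Re (poly Q z)" by blast
  \<comment> \<open>From Re p Re q = Re (p q + p cnj q) / 2; \<open>L\<close> is the analytic
    replacement of p cnj q.\<close>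
  define L where "L = (\<Sum>i\<le>degree P. \<Sum>j\<le>degree Q.
     (if j \<le> i then monom (coeff P i * cnj (coeff Q j)) (i - j) else monom (cnj (coeff P i) * coeff Q j) (j - i)))"
  have "f z * g z = Re (poly (smult (1/2) (P * Q + L)) z)" if z: "cmod z = 1" for z
  proof -
    have "poly L z = (\<Sum>i\<le>degree P. \<Sum>j\<le>degree Q.
     (if j \<le> i then coeff P i * cnj (coeff Q j) * z ^ (i - j) else cnj (coeff P i) * coeff Q j * z ^ (j - i)))"
      unfolding L_def by (simp add: poly_sum poly_monom if_distrib[of "\<lambda>p. poly p z"] cong: if_cong)
    then have "Re (poly L z) = Re (poly P z * cnj (poly Q z))"
      using Re_laurent_eq_Re_poly[OF z, of P Q] by simp
    then show ?thesis using PQ[OF z] by (simp add: field_simps)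
  qed
  then show ?case by blast
qed

text \<open>The approximant is a continuous function of the Cayley variable, hence also continuous
  at the point 1 that corresponds to infinity; this prepares Stone-Weierstrass on the compact
  circle. The sets that can be approximated form a Dynkin system, and closed intervals belong to it
  because their images are compact and tent functions of the distance decrease to the
  indicator.\<close>

lemma continuous_approx_indicator:
  fixes \<nu> :: "real measure"
  assumes \<nu>: "finite_measure \<nu>" "sets \<nu> = sets borel" and A: "A \<in> sets borel" and "e > 0"
  shows "\<exists>h::complex \<Rightarrow> real. continuous_on UNIV h \<and> (\<forall>z. 0 \<le> h z \<and> h z \<le> 1) \<and>
    (\<integral>u. \<bar>indicator A u - h (cayley (of_real u))\<bar> \<partial>\<nu>) < e"
proof -
  interpret finite_measure \<nu> by fact
  note [measurable_cong] = \<nu>(2)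
  have sp: "space \<nu> = UNIV" using sets_eq_imp_space_eq[OF \<nu>(2)] by simp
  have hm[measurable]: "(\<lambda>u. h (cayley (of_real u))) \<in> borel_measurable borel" if "continuous_on UNIV h" for h :: "complex \<Rightarrow> real"
    by (rule borel_measurable_continuous_onI) (rule continuous_on_compose2[OF that continuous_cayley_of_real], simp)
  have int: "integrable \<nu> (\<lambda>u. \<bar>indicator A u - h (cayley (of_real u))\<bar>)"
    if "continuous_on UNIV h" "\<forall>z. 0 \<le> h z \<and> h z \<le> 1" "A \<in> sets borel" for h :: "complex \<Rightarrow> real" and A
  proof (rule integrable_const_bound[where B=1])
    show "AE u in \<nu>. norm \<bar>indicator A u - h (cayley (of_real u))\<bar> \<le> 1"
      using that(2) by (auto simp: indicator_def intro!: AE_I2)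
    show "(\<lambda>u. \<bar>indicator A u - h (cayley (of_real u))\<bar>) \<in> borel_measurable \<nu>"
      using hm[OF that(1)] that(3) by measurable
  qed
  have borel: "sets borel = sigma_sets UNIV (range (\<lambda>(a, b). {a..b::real}))"
    by (simp add: borel_eq_atLeastAtMost)
  have "Int_stable (range (\<lambda>(a, b). {a..b::real}))"
    by (auto simp: Int_stable_def Int_atLeastAtMost intro!: image_eqI)
  moreover have "range (\<lambda>(a, b). {a..b::real}) \<subseteq> Pow UNIV" by simp
  moreover have "A \<in> sigma_sets UNIV (range (\<lambda>(a, b). {a..b::real}))" using A borel by simp
  ultimately have "\<forall>e>0. \<exists>h::complex \<Rightarrow> real. continuous_on UNIV h \<and> (\<forall>z. 0 \<le> h z \<and> h z \<le> 1) \<and>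
    (\<integral>u. \<bar>indicator A u - h (cayley (of_real u))\<bar> \<partial>\<nu>) < e"
  proof (induction rule: sigma_sets_induct_disjoint)
    case (basic A)
    then obtain a b where A: "A = {a..b::real}" by auto
    show ?case
    proof (cases "A = {}")
      case True
      then show ?thesis by (intro allI impI exI[of _ "\<lambda>_. 0"]) auto
    next
      case False
      define K where "K = (\<lambda>u. cayley (of_real u)) ` A"
      have K: "compact K" "K \<noteq> {}"
        unfolding K_def A using False A
        by (auto intro!: compact_continuous_image continuous_on_subset[OF continuous_cayley_of_real])
      define h where "h n z = max 0 (1 - real n * infdist z K)" for n z
      have ch: "continuous_on UNIV (h n)" for n
        unfolding h_def by (intro continuous_intros)
      have inj: "cayley (of_real u) \<in> K \<longleftrightarrow> u \<in> A" for u
      proof -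
        have "u = v" if "cayley (of_real u) = cayley (of_real v)" for v
        proof -
          have "(of_real u - \<i>) * (of_real v + \<i>) = (of_real v - \<i>) * (complex_of_real u + \<i>)"
            using that by (simp add: cayley_def divide_simps)
          then have "of_real u = complex_of_real v" by (simp add: algebra_simps complex_eq_iff)
          then show ?thesis by simp
        qed
        then show ?thesis by (auto simp: K_def)
      qed
      have lim: "(\<lambda>n. h n (cayley (of_real u))) \<longlonglongrightarrow> indicator A u" for u
      proof (cases "u \<in> A")
        case True
        then have "infdist (cayley (of_real u)) K = 0" by (intro infdist_zero) (simp add: inj)
        then show ?thesis using True by (simp add: h_def)
      next
        case False
        then have "infdist (cayley (of_real u)) K > 0"
          using K by (metis compact_imp_closed in_closed_iff_infdist_zero inj infdist_nonneg less_eq_real_def)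
        then have "\<forall>\<^sub>F n in sequentially. 1 \<le> real n * infdist (cayley (of_real u)) K"
          by real_asymp
        then have "\<forall>\<^sub>F n in sequentially. h n (cayley (of_real u)) = indicator A u"
          by eventually_elim (use False in \<open>auto simp: h_def\<close>)
        then show ?thesis by (rule tendsto_eventually)
      qed
      have 01: "0 \<le> h n z" "h n z \<le> 1" for n z by (auto simp: h_def infdist_nonneg)
      have [measurable]: "A \<in> sets borel" using A by simp
      have "(\<lambda>n. \<integral>u. \<bar>indicator A u - h n (cayley (of_real u))\<bar> \<partial>\<nu>) \<longlonglongrightarrow> (\<integral>u. 0 \<partial>\<nu>)"
      proof (rule integral_dominated_convergence[where w="\<lambda>_. 1"])
        show "AE u in \<nu>. (\<lambda>n. \<bar>indicator A u - h n (cayley (of_real u))\<bar>) \<longlonglongrightarrow> 0"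
        proof (rule AE_I2)
          fix u
          have "(\<lambda>n. \<bar>indicator A u - h n (cayley (of_real u))\<bar>) \<longlonglongrightarrow> \<bar>indicator A u - indicator A u :: real\<bar>"
            by (intro tendsto_intros lim)
          then show "(\<lambda>n. \<bar>indicator A u - h n (cayley (of_real u))\<bar>) \<longlonglongrightarrow> 0" by simp
        qed
        show "AE u in \<nu>. norm \<bar>indicator A u - h n (cayley (of_real u))\<bar> \<le> 1" for n
        proof (rule AE_I2)
          fix u show "norm \<bar>indicator A u - h n (cayley (of_real u))\<bar> \<le> 1"
            using 01[of n "cayley (of_real u)"] by (auto simp: indicator_def)
        qed
        show "(\<lambda>u. \<bar>indicator A u - h n (cayley (of_real u))\<bar>) \<in> borel_measurable \<nu>" for n
          using hm[OF ch[of n]] by measurable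
      qed simp_all
      then have *: "(\<lambda>n. \<integral>u. \<bar>indicator A u - h n (cayley (of_real u))\<bar> \<partial>\<nu>) \<longlonglongrightarrow> 0" by simp
      show ?thesis
      proof (intro allI impI)
        fix e :: real assume "e > 0"
        from eventually_happens'[OF sequentially_bot order_tendstoD(2)[OF * this]]
        obtain n where "(\<integral>u. \<bar>indicator A u - h n (cayley (of_real u))\<bar> \<partial>\<nu>) < e" by blast
        then show "\<exists>h::complex \<Rightarrow> real. continuous_on UNIV h \<and> (\<forall>z. 0 \<le> h z \<and> h z \<le> 1) \<and>
          (\<integral>u. \<bar>indicator A u - h (cayley (of_real u))\<bar> \<partial>\<nu>) < e"
          using ch 01 by blast
      qed
    qed
  next
    case empty
    show ?case by (intro allI impI exI[of _ "\<lambda>_. 0"]) auto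
  next
    case (compl A)
    show ?case
    proof (intro allI impI)
      fix e :: real assume "e > 0"
      then obtain h :: "complex \<Rightarrow> real" where h: "continuous_on UNIV h" "\<forall>z. 0 \<le> h z \<and> h z \<le> 1"
        "(\<integral>u. \<bar>indicator A u - h (cayley (of_real u))\<bar> \<partial>\<nu>) < e" using compl by blast
      have "\<bar>indicator (UNIV - A) u - (1 - h (cayley (of_real u)))\<bar> = \<bar>indicator A u - h (cayley (of_real u))\<bar>" for u
        by (auto simp: indicator_def)
      then show "\<exists>h::complex \<Rightarrow> real. continuous_on UNIV h \<and> (\<forall>z. 0 \<le> h z \<and> h z \<le> 1) \<and>
          (\<integral>u. \<bar>indicator (UNIV - A) u - h (cayley (of_real u))\<bar> \<partial>\<nu>) < e"
        using h by (intro exI[of _ "\<lambda>z. 1 - h z"]) (auto intro: continuous_intros)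
    qed
  next
    case (union A)
    have Am[measurable]: "A i \<in> sets borel" for i using union(2) borel by auto
    show ?case
    proof (intro allI impI)
      fix e :: real assume e: "e > 0"
      have fin: "(\<lambda>n. measure \<nu> (\<Union>i<n. A i)) \<longlonglongrightarrow> measure \<nu> (\<Union>i. \<Union>j<i. A j)"
        by (rule finite_Lim_measure_incseq) (auto simp: incseq_def intro: order_less_le_trans)
      have UU: "(\<Union>i. \<Union>j<i. A j) = (\<Union>i. A i)" by auto
      obtain n where n: "\<bar>measure \<nu> (\<Union>i<n. A i) - measure \<nu> (\<Union>i. A i)\<bar> < e / 2"
        using LIMSEQ_D[OF fin, of "e/2"] e UU by auto
      define e' where "e' = e / (2 * (real n + 1))"
      have e': "e' > 0" using e by (simp add: e'_def)
      have "\<forall>i. \<exists>h::complex \<Rightarrow> real. continuous_on UNIV h \<and> (\<forall>z. 0 \<le> h z \<and> h z \<le> 1) \<and>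
          (\<integral>u. \<bar>indicator (A i) u - h (cayley (of_real u))\<bar> \<partial>\<nu>) < e'"
        using union(3) e' by blast
      then obtain h :: "nat \<Rightarrow> complex \<Rightarrow> real" where h: "\<And>i. continuous_on UNIV (h i)" "\<And>i. \<forall>z. 0 \<le> h i z \<and> h i z \<le> 1"
          "\<And>i. (\<integral>u. \<bar>indicator (A i) u - h i (cayley (of_real u))\<bar> \<partial>\<nu>) < e'" by metis
      \<comment> \<open>For disjoint sets the indicator of a finite union is the sum of the
        indicators; cutting the sum of the \<open>h i\<close> at 1 restores the bound without
        enlarging the error.\<close>
      define H where "H z = min 1 (\<Sum>i<n. h i z)" for z
      have H: "continuous_on UNIV H" "\<forall>z. 0 \<le> H z \<and> H z \<le> 1"
        unfolding H_def using h by (auto intro!: continuous_intros sum_nonneg)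
      have ind: "indicator (\<Union>i<n. A i) u = (\<Sum>i<n. indicator (A i) u :: real)" for u
        by (rule indicator_UN_disjoint) (use union(1) in \<open>auto simp: disjoint_family_on_def\<close>)
      have ind01: "indicator (\<Union>i<n. A i) u \<le> (1::real)" for u by (simp add: indicator_def)
      have le: "\<bar>indicator (\<Union>i. A i) u - H (cayley (of_real u))\<bar> \<le>
          (indicator (\<Union>i. A i) u - indicator (\<Union>i<n. A i) u) + (\<Sum>i<n. \<bar>indicator (A i) u - h i (cayley (of_real u))\<bar>)" for u
      proof -
        have "\<bar>(\<Sum>i<n. indicator (A i) u) - (\<Sum>i<n. h i (cayley (of_real u)))\<bar> \<le> (\<Sum>i<n. \<bar>indicator (A i) u - h i (cayley (of_real u))\<bar>)"
          unfolding sum_subtractf[symmetric] by (rule sum_abs)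
        moreover have "\<bar>indicator (\<Union>i<n. A i) u - H (cayley (of_real u))\<bar> \<le> \<bar>(\<Sum>i<n. indicator (A i) u) - (\<Sum>i<n. h i (cayley (of_real u)))\<bar>"
          using ind01[of u] unfolding H_def ind by linarith
        moreover have "indicator (\<Union>i<n. A i) u \<le> (indicator (\<Union>i. A i) u :: real)"
          by (auto simp: indicator_def)
        ultimately show ?thesis by linarith
      qed
      have i1: "integrable \<nu> (\<lambda>u. indicator (\<Union>i. A i) u :: real)" "integrable \<nu> (\<lambda>u. indicator (\<Union>i<n. A i) u :: real)"
        by (auto intro!: integrable_const_bound[where B=1] AE_I2 simp: indicator_def)
      have i2: "integrable \<nu> (\<lambda>u. \<bar>indicator (A i) u - h i (cayley (of_real u))\<bar>)" for i
        by (rule int[OF h(1,2)]) simp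
      have "(\<integral>u. \<bar>indicator (\<Union>i. A i) u - H (cayley (of_real u))\<bar> \<partial>\<nu>) \<le>
          (\<integral>u. (indicator (\<Union>i. A i) u - indicator (\<Union>i<n. A i) u) + (\<Sum>i<n. \<bar>indicator (A i) u - h i (cayley (of_real u))\<bar>) \<partial>\<nu>)"
        by (rule integral_mono) (use int[OF H] i1 i2 le in auto)
      also have "\<dots> = (measure \<nu> (\<Union>i. A i) - measure \<nu> (\<Union>i<n. A i)) + (\<Sum>i<n. \<integral>u. \<bar>indicator (A i) u - h i (cayley (of_real u))\<bar> \<partial>\<nu>)"
        using i1 i2 by (simp add: sp)
      also have "\<dots> \<le> e / 2 + (\<Sum>i<n. e')"
      proof (intro add_mono sum_mono)
        show "measure \<nu> (\<Union>i. A i) - measure \<nu> (\<Union>i<n. A i) \<le> e / 2" using n by linarith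
      qed (use h(3) less_imp_le in blast)
      also have "(\<Sum>i<n. e') < e / 2"
        using e by (simp add: e'_def field_simps)
      finally have "(\<integral>u. \<bar>indicator (\<Union>i. A i) u - H (cayley (of_real u))\<bar> \<partial>\<nu>) < e" by simp
      then show "\<exists>h::complex \<Rightarrow> real. continuous_on UNIV h \<and> (\<forall>z. 0 \<le> h z \<and> h z \<le> 1) \<and>
          (\<integral>u. \<bar>indicator (\<Union>i. A i) u - h (cayley (of_real u))\<bar> \<partial>\<nu>) < e" using H by blast
    qed
  qed
  then show ?thesis using \<open>e > 0\<close> by blast
qed

lemma continuous_approx_integrable:
  fixes \<nu> :: "real measure" and v :: "real \<Rightarrow> real"
  assumes \<nu>: "finite_measure \<nu>" "sets \<nu> = sets borel" and v: "integrable \<nu> v" and "e > 0"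
  shows "\<exists>h::complex \<Rightarrow> real. continuous_on UNIV h \<and>
    integrable \<nu> (\<lambda>u. h (cayley (of_real u))) \<and> (\<integral>u. \<bar>v u - h (cayley (of_real u))\<bar> \<partial>\<nu>) < e"
proof -
  interpret finite_measure \<nu> by fact
  note [measurable_cong] = \<nu>(2)
  have hm[measurable]: "(\<lambda>u. h (cayley (of_real u))) \<in> borel_measurable borel" if "continuous_on UNIV h" for h :: "complex \<Rightarrow> real"
    by (rule borel_measurable_continuous_onI) (rule continuous_on_compose2[OF that continuous_cayley_of_real], simp)
  have "\<forall>e>0. \<exists>h::complex \<Rightarrow> real. continuous_on UNIV h \<and>
    integrable \<nu> (\<lambda>u. h (cayley (of_real u))) \<and> (\<integral>u. \<bar>v u - h (cayley (of_real u))\<bar> \<partial>\<nu>) < e"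
    using v
  proof (induction rule: integrable_induct)
    case (base A c)
    show ?case
    proof (intro allI impI)
      fix e :: real assume "e > 0"
      have "e / (\<bar>c\<bar> + 1) > 0" using \<open>e > 0\<close> by simp
      then obtain h :: "complex \<Rightarrow> real" where h: "continuous_on UNIV h" "\<forall>z. 0 \<le> h z \<and> h z \<le> 1"
        "(\<integral>u. \<bar>indicator A u - h (cayley (of_real u))\<bar> \<partial>\<nu>) < e / (\<bar>c\<bar> + 1)"
        using continuous_approx_indicator[OF \<nu>, of A] base(1) \<nu>(2) by blast
      have "(\<integral>u. \<bar>indicator A u *\<^sub>R c - c * h (cayley (of_real u))\<bar> \<partial>\<nu>)
          = (\<integral>u. \<bar>c\<bar> * \<bar>indicator A u - h (cayley (of_real u))\<bar> \<partial>\<nu>)"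
        by (intro Bochner_Integration.integral_cong) (auto simp: abs_mult[symmetric] algebra_simps)
      also have "\<dots> = \<bar>c\<bar> * (\<integral>u. \<bar>indicator A u - h (cayley (of_real u))\<bar> \<partial>\<nu>)" by simp
      also have "\<dots> \<le> \<bar>c\<bar> * (e / (\<bar>c\<bar> + 1))" using h(3) by (intro mult_left_mono) auto
      also have "\<dots> < e" using \<open>e > 0\<close> by (simp add: field_simps)
      finally have "(\<integral>u. \<bar>indicator A u *\<^sub>R c - c * h (cayley (of_real u))\<bar> \<partial>\<nu>) < e" .
      moreover have "integrable \<nu> (\<lambda>u. h (cayley (of_real u)))"
        by (rule integrable_const_bound[where B=1]) (use h hm[OF h(1)] in auto)
      ultimately show "\<exists>h::complex \<Rightarrow> real. continuous_on UNIV h \<and> integrable \<nu> (\<lambda>u. h (cayley (of_real u))) \<and>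
          (\<integral>u. \<bar>indicator A u *\<^sub>R c - h (cayley (of_real u))\<bar> \<partial>\<nu>) < e"
        using h(1) by (intro exI[of _ "\<lambda>z. c * h z"]) (auto intro: continuous_intros)
    qed
  next
    case (add f g)
    show ?case
    proof (intro allI impI)
      fix e :: real assume "e > 0"
      then have "e / 2 > 0" by simp
      then obtain h k :: "complex \<Rightarrow> real" where h: "continuous_on UNIV h" "integrable \<nu> (\<lambda>u. h (cayley (of_real u)))"
          "(\<integral>u. \<bar>f u - h (cayley (of_real u))\<bar> \<partial>\<nu>) < e / 2"
        and k: "continuous_on UNIV k" "integrable \<nu> (\<lambda>u. k (cayley (of_real u)))"
          "(\<integral>u. \<bar>g u - k (cayley (of_real u))\<bar> \<partial>\<nu>) < e / 2"
        using add by blast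
      have "(\<integral>u. \<bar>f u + g u - (h (cayley (of_real u)) + k (cayley (of_real u)))\<bar> \<partial>\<nu>) \<le>
          (\<integral>u. \<bar>f u - h (cayley (of_real u))\<bar> + \<bar>g u - k (cayley (of_real u))\<bar> \<partial>\<nu>)"
        by (rule integral_mono) (use add h k in auto)
      also have "\<dots> = (\<integral>u. \<bar>f u - h (cayley (of_real u))\<bar> \<partial>\<nu>) + (\<integral>u. \<bar>g u - k (cayley (of_real u))\<bar> \<partial>\<nu>)"
        using add h k by simp
      also have "\<dots> < e" using h k by simp
      finally show "\<exists>h::complex \<Rightarrow> real. continuous_on UNIV h \<and> integrable \<nu> (\<lambda>u. h (cayley (of_real u))) \<and>
          (\<integral>u. \<bar>f u + g u - h (cayley (of_real u))\<bar> \<partial>\<nu>) < e"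
        using h k by (intro exI[of _ "\<lambda>z. h z + k z"]) (auto intro: continuous_intros)
    qed
  next
    case (lim f s)
    have "(\<lambda>i. \<integral>u. \<bar>f u - s i u\<bar> \<partial>\<nu>) \<longlonglongrightarrow> (\<integral>u. 0 \<partial>\<nu>)"
    proof (rule integral_dominated_convergence[where w="\<lambda>u. 3 * \<bar>f u\<bar>"])
      show "AE u in \<nu>. (\<lambda>i. \<bar>f u - s i u\<bar>) \<longlonglongrightarrow> 0"
      proof (rule AE_I2)
        fix u assume "u \<in> space \<nu>"
        then have "(\<lambda>i. \<bar>f u - s i u\<bar>) \<longlonglongrightarrow> \<bar>f u - f u\<bar>" by (intro tendsto_intros lim(2))
        then show "(\<lambda>i. \<bar>f u - s i u\<bar>) \<longlonglongrightarrow> 0" by simp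
      qed
      show "AE u in \<nu>. norm \<bar>f u - s i u\<bar> \<le> 3 * \<bar>f u\<bar>" for i
      proof (rule AE_I2)
        fix u assume "u \<in> space \<nu>"
        then have "\<bar>s i u\<bar> \<le> 2 * \<bar>f u\<bar>" using lim(3)[of u i] by simp
        then show "norm \<bar>f u - s i u\<bar> \<le> 3 * \<bar>f u\<bar>" by simp
      qed
    qed (use lim in auto)
    then have *: "(\<lambda>i. \<integral>u. \<bar>f u - s i u\<bar> \<partial>\<nu>) \<longlonglongrightarrow> 0" by simp
    show ?case
    proof (intro allI impI)
      fix e :: real assume "e > 0"
      then have e2: "e / 2 > 0" by simp
      from eventually_happens'[OF sequentially_bot order_tendstoD(2)[OF * this]]
      obtain i where i: "(\<integral>u. \<bar>f u - s i u\<bar> \<partial>\<nu>) < e / 2" by blast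
      obtain h :: "complex \<Rightarrow> real" where h: "continuous_on UNIV h" "integrable \<nu> (\<lambda>u. h (cayley (of_real u)))"
          "(\<integral>u. \<bar>s i u - h (cayley (of_real u))\<bar> \<partial>\<nu>) < e / 2"
        using lim(5)[of i] e2 by blast
      have "(\<integral>u. \<bar>f u - h (cayley (of_real u))\<bar> \<partial>\<nu>) \<le> (\<integral>u. \<bar>f u - s i u\<bar> + \<bar>s i u - h (cayley (of_real u))\<bar> \<partial>\<nu>)"
        by (rule integral_mono) (use lim(1) lim(4) h in auto)
      also have "\<dots> = (\<integral>u. \<bar>f u - s i u\<bar> \<partial>\<nu>) + (\<integral>u. \<bar>s i u - h (cayley (of_real u))\<bar> \<partial>\<nu>)"
        using lim(1) lim(4) h by simp
      also have "\<dots> < e" using h i by simp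
      finally show "\<exists>h::complex \<Rightarrow> real. continuous_on UNIV h \<and> integrable \<nu> (\<lambda>u. h (cayley (of_real u))) \<and>
          (\<integral>u. \<bar>f u - h (cayley (of_real u))\<bar> \<partial>\<nu>) < e" using h by blast
    qed
  qed
  then show ?thesis using \<open>e > 0\<close> by blast
qed

lemma measurable_poly_cayley [measurable]: "(\<lambda>u. poly P (cayley (of_real u))) \<in> borel_measurable borel"
  by (rule measurable_entire_cayley) (intro holomorphic_intros)

text \<open>Besides L1-closeness, pointwise bounds are needed since Re P is going to be
  exponentiated, and P(0) must be real so that exp(P(0)) is determined by Re P(0). The bounds come
  from clamping the continuous approximant to [a, b], which only moves it closer to v, before a
  polynomial replaces it.\<close>

lemma Re_poly_approx:
  fixes \<nu> :: "real measure" and v :: "real \<Rightarrow> real"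
  assumes \<nu>: "finite_measure \<nu>" "sets \<nu> = sets borel" and v[measurable]: "v \<in> borel_measurable borel"
    and ab: "\<And>u. a \<le> v u" "\<And>u. v u \<le> b" and "e > 0"
  obtains P where "Im (poly P 0) = 0"
    "\<And>u. a - e \<le> Re (poly P (cayley (of_real u)))" "\<And>u. Re (poly P (cayley (of_real u))) \<le> b + e"
    "(\<integral>u. \<bar>v u - Re (poly P (cayley (of_real u)))\<bar> \<partial>\<nu>) < e"
proof -
  interpret finite_measure \<nu> by fact
  note [measurable_cong] = \<nu>(2)
  have vi: "integrable \<nu> v"
    by (rule integrable_const_bound[where B="max \<bar>a\<bar> \<bar>b\<bar>"]) (use ab in \<open>auto intro!: AE_I2 simp: abs_le_iff le_max_iff_disj\<close>, (smt (verit) ab)+)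
  obtain h where h: "continuous_on UNIV h" "integrable \<nu> (\<lambda>u. h (cayley (of_real u)))"
    "(\<integral>u. \<bar>v u - h (cayley (of_real u))\<bar> \<partial>\<nu>) < e / 2"
    using continuous_approx_integrable[OF \<nu> vi, of "e / 2"] \<open>e > 0\<close> by auto
  define k where "k z = max a (min b (h z))" for z
  have ck: "continuous_on UNIV k" unfolding k_def by (intro continuous_intros h)
  define m where "m = measure \<nu> (space \<nu>) + 1"
  \<comment> \<open>A uniform error d adds at most d times the total mass; with m = mass + 1 this
    stays below e/2, and m \<ge> 1 gives d \<le> e for the pointwise bounds.\<close>
  define d where "d = e / (2 * m)"
  have mp: "m \<ge> 1" by (simp add: m_def)
  have d: "d > 0" "d \<le> e" "d * measure \<nu> (space \<nu>) < e / 2"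
  proof -
    show "d > 0" using \<open>e > 0\<close> mp by (simp add: d_def)
    have "e * 1 \<le> e * (2 * m)" using \<open>e > 0\<close> mp by (intro mult_left_mono) auto
    then show "d \<le> e" using mp by (simp add: d_def divide_le_eq)
    have "d * m = e / 2" using mp by (simp add: d_def)
    then show "d * measure \<nu> (space \<nu>) < e / 2" using \<open>d > 0\<close> by (simp add: m_def distrib_left)
  qed
  obtain g where g: "real_polynomial_function g" "\<And>z. z \<in> sphere 0 1 \<Longrightarrow> \<bar>k z - g z\<bar> < d"
    by (rule Stone_Weierstrass_real_polynomial_function[of "sphere 0 (1::real)" k d])
       (use d continuous_on_subset[OF ck] in auto)
  obtain P where P: "\<And>z. cmod z = 1 \<Longrightarrow> g z = Re (poly P z)"
    using real_polynomial_function_circle[OF g(1)] by blast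
  \<comment> \<open>Subtracting an imaginary constant makes the value at 0 real and leaves the real
    part unchanged.\<close>
  define P' where "P' = P - [:\<i> * of_real (Im (poly P 0)):]"
  have ReP: "Re (poly P' z) = Re (poly P z)" for z by (simp add: P'_def)
  have close: "\<bar>k (cayley (of_real u)) - Re (poly P' (cayley (of_real u)))\<bar> < d" for u
    using g(2)[of "cayley (of_real u)"] P[of "cayley (of_real u)"] ReP by simp
  have kab: "a \<le> k z" "k z \<le> b" for z using ab[of 0] by (auto simp: k_def)
  have vk: "\<bar>v u - k (cayley (of_real u))\<bar> \<le> \<bar>v u - h (cayley (of_real u))\<bar>" for u
    using ab[of u] by (auto simp: k_def)
  have i1: "integrable \<nu> (\<lambda>u. \<bar>v u - h (cayley (of_real u))\<bar>)" using vi h by simp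
  show ?thesis
  proof (rule that)
    show "Im (poly P' 0) = 0" by (simp add: P'_def)
    show "a - e \<le> Re (poly P' (cayley (of_real u)))" for u
      using close[of u] kab(1)[of "cayley (of_real u)"] d by linarith
    show "Re (poly P' (cayley (of_real u))) \<le> b + e" for u
      using close[of u] kab(2)[of "cayley (of_real u)"] d by linarith
    have "(\<integral>u. \<bar>v u - Re (poly P' (cayley (of_real u)))\<bar> \<partial>\<nu>) \<le> (\<integral>u. \<bar>v u - h (cayley (of_real u))\<bar> + d \<partial>\<nu>)"
    proof (rule integral_mono')
      show "integrable \<nu> (\<lambda>u. \<bar>v u - h (cayley (of_real u))\<bar> + d)" using i1 by simp
      show "\<bar>v u - Re (poly P' (cayley (of_real u)))\<bar> \<le> \<bar>v u - h (cayley (of_real u))\<bar> + d" for u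
        using vk[of u] close[of u] by linarith
    qed (use d(1) in auto)
    also have "\<dots> = (\<integral>u. \<bar>v u - h (cayley (of_real u))\<bar> \<partial>\<nu>) + d * measure \<nu> (space \<nu>)"
      using i1 by (simp add: mult.commute)
    also have "\<dots> < e" using h(3) d(3) by simp
    finally show "(\<integral>u. \<bar>v u - Re (poly P' (cayley (of_real u)))\<bar> \<partial>\<nu>) < e" .
  qed
qed

section \<open>The closed span of exponentials with nonnegative frequencies\<close>

definition expfun :: "real \<Rightarrow> real \<Rightarrow> complex" where
  "expfun s u = iexp (s * u)"

text \<open>Named after the Hardy space of the upper half-plane, where exp(\<i> s z) is bounded for
  s \<ge> 0.\<close>

definition hardy :: "real measure \<Rightarrow> (real \<Rightarrow> complex) set" where
  "hardy \<mu> = closed_lin_span \<mu> (expfun ` {0..})"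

lemma cmod_expfun [simp]: "cmod (expfun s u) = 1"
  by (simp add: expfun_def)

lemma measurable_expfun [measurable]: "expfun s \<in> borel_measurable borel"
  unfolding expfun_def[abs_def] by (intro borel_measurable_continuous_onI continuous_intros)

lemma expfun_add: "expfun (s + r) u = expfun s u * expfun r u"
  by (simp add: expfun_def distrib_right ring_distribs exp_add)

lemma expfun_0 [simp]: "expfun 0 u = 1"
  by (simp add: expfun_def)

lemma cnj_expfun: "cnj (expfun s u) = expfun (- s) u"
  by (simp add: expfun_def exp_cnj)

text \<open>A radius beyond 1 makes the Taylor coefficients absolutely summable, so the partial sums
  are bounded uniformly on the closed disc, as a bounded limit of multipliers requires.\<close>

lemma powser_radius_gt_1:
  fixes f :: "complex \<Rightarrow> complex"
  assumes R: "R > 1" and f: "f holomorphic_on ball 0 R"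
  shows "summable (\<lambda>n. cmod ((deriv ^^ n) f 0 / fact n))"
    and "cmod z \<le> 1 \<Longrightarrow> (\<lambda>n. (deriv ^^ n) f 0 / fact n * z ^ n) sums f z"
proof -
  obtain r where r: "1 < r" "r < R" using dense[OF R] by blast
  have S: "(\<lambda>n. (deriv ^^ n) f 0 / fact n * w ^ n) sums f w" if "w \<in> ball 0 R" for w
    using holomorphic_power_series[OF f that] by simp
  show "(\<lambda>n. (deriv ^^ n) f 0 / fact n * z ^ n) sums f z" if "cmod z \<le> 1"
    using that R by (intro S) auto
  have "summable (\<lambda>n. (deriv ^^ n) f 0 / fact n * (of_real r) ^ n)"
    using S[of "of_real r"] r by (auto simp: sums_iff)
  then have "summable (\<lambda>n. norm ((deriv ^^ n) f 0 / fact n * 1 ^ n))"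
    by (rule powser_insidea) (use r in auto)
  then show "summable (\<lambda>n. cmod ((deriv ^^ n) f 0 / fact n))" by simp
qed

locale borel_finite_measure = finite_measure \<mu> for \<mu> :: "real measure" +
  assumes sets_eq [measurable_cong]: "sets \<mu> = sets borel"
begin

lemma space_eq [simp]: "space \<mu> = UNIV"
  using sets_eq_imp_space_eq[OF sets_eq] by simp

lemma measurable_eq: "borel_measurable \<mu> = borel_measurable borel"
  by (rule measurable_cong_sets) (simp_all add: sets_eq)

lemma bounded_L2: "b \<in> borel_measurable borel \<Longrightarrow> (\<And>u. cmod (b u) \<le> C) \<Longrightarrow> b \<in> L2 \<mu>"
  using L2_bounded[of b C] by (simp add: measurable_eq)

lemma expfun_L2: "expfun ` S \<subseteq> L2 \<mu>"
  by (auto intro!: bounded_L2[where C=1])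

text \<open>Real and imaginary part of a truncation of \<phi> are each close to the real part of an
  analytic polynomial, hence the antianalytic summand. The truncation makes L1-closeness imply
  L2-closeness.\<close>

lemma L2_poly_dense:
  assumes \<phi>: "\<phi> \<in> L2 \<mu>" and "e > 0"
  shows "\<exists>P Q. L2_dist_sq \<mu> \<phi> (\<lambda>u. poly P (cayley (of_real u)) + cnj (poly Q (cayley (of_real u)))) < e"
proof -
  have \<phi>m[measurable]: "\<phi> \<in> borel_measurable borel" using L2_measurable[OF \<phi>] by (simp add: measurable_eq)
  have polyL2: "(\<lambda>u. poly P (cayley (of_real u))) \<in> L2 \<mu>" for P
  proof -
    obtain C where "C \<ge> 0" "\<And>z. cmod z \<le> 1 \<Longrightarrow> cmod (poly P z) \<le> C"
      by (rule entire_bounded_disc[of "poly P"]) (auto intro: holomorphic_intros)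
    then show ?thesis by (intro bounded_L2[where C=C]) auto
  qed
  define b :: "nat \<Rightarrow> real \<Rightarrow> complex" where "b n u = indicator {u. cmod (\<phi> u) \<le> real n} u" for n :: nat and u :: real
  define trunc where "trunc n u = b n u * \<phi> u" for n u
  have "(\<lambda>n. L2_dist_sq \<mu> (\<lambda>u. 1 * \<phi> u) (\<lambda>u. b n u * \<phi> u)) \<longlonglongrightarrow> 0"
  proof (rule L2_dist_sq_tendsto_mult[OF \<phi>, where C=1])
    show "b n \<in> borel_measurable \<mu>" for n unfolding b_def by measurable
    show "AE u in \<mu>. (\<lambda>n. b n u) \<longlonglongrightarrow> 1"
    proof (rule AE_I2)
      fix u
      have "\<forall>\<^sub>F n in sequentially. b n u = 1"
        using eventually_ge_at_top[of "nat \<lceil>cmod (\<phi> u)\<rceil>"] by eventually_elim (auto simp: b_def indicator_def)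
      then show "(\<lambda>n. b n u) \<longlonglongrightarrow> 1" by (rule tendsto_eventually)
    qed
  qed (auto simp: b_def indicator_def)
  then have "(\<lambda>n. L2_dist_sq \<mu> \<phi> (trunc n)) \<longlonglongrightarrow> 0" by (simp add: trunc_def[abs_def])
  from eventually_happens'[OF sequentially_bot order_tendstoD(2)[OF this, of "e / 4"]] \<open>e > 0\<close>
  obtain n where n: "L2_dist_sq \<mu> \<phi> (trunc n) < e / 4" by auto
  have tm[measurable]: "trunc n \<in> borel_measurable borel" unfolding trunc_def[abs_def] b_def by measurable
  have tb: "cmod (trunc n u) \<le> real n" for u by (auto simp: trunc_def b_def indicator_def)
  \<comment> \<open>Errors are bounded by 2 n + 1, so a squared error is at most 2 n + 1 times the
    L1 error. The constant 16 brings the errors of real and imaginary part together to at most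
    e/4.\<close>
  define d where "d = min 1 (e / (16 * (real n + 1)))"
  have d: "d > 0" "d \<le> 1" "2 * ((2 * real n + 1) * d) \<le> e / 4"
  proof -
    show "d > 0" "d \<le> 1" using \<open>e > 0\<close> by (auto simp: d_def)
    have "(2 * real n + 1) * d \<le> (2 * (real n + 1)) * (e / (16 * (real n + 1)))"
      using \<open>e > 0\<close> by (intro mult_mono) (auto simp: d_def)
    also have "\<dots> = e / 8" by (simp add: divide_simps)
    finally show "2 * ((2 * real n + 1) * d) \<le> e / 4" by simp
  qed
  have fin: "finite_measure \<mu>" by unfold_locales
  have approx: "\<exists>P. (\<integral>u. (v u - Re (poly P (cayley (of_real u))))\<^sup>2 \<partial>\<mu>) \<le> (2 * real n + 1) * d \<and>
      integrable \<mu> (\<lambda>u. (v u - Re (poly P (cayley (of_real u))))\<^sup>2)"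
    if v[measurable]: "v \<in> borel_measurable borel" and vb: "\<And>u. \<bar>v u\<bar> \<le> real n" for v
  proof -
    have "- real n \<le> v u" "v u \<le> real n" for u using vb[of u] by auto
    then obtain P where P: "\<And>u. - real n - d \<le> Re (poly P (cayley (of_real u)))"
      "\<And>u. Re (poly P (cayley (of_real u))) \<le> real n + d"
      "(\<integral>u. \<bar>v u - Re (poly P (cayley (of_real u)))\<bar> \<partial>\<mu>) < d"
      by (rule Re_poly_approx[OF fin sets_eq v _ _ d(1)]) (use that in blast)+
    have Pb: "\<bar>v u - Re (poly P (cayley (of_real u)))\<bar> \<le> 2 * real n + 1" for u
      using P(1,2)[of u] vb[of u] d(2) by linarith
    have i1: "integrable \<mu> (\<lambda>u. \<bar>v u - Re (poly P (cayley (of_real u)))\<bar>)"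
      by (rule integrable_const_bound[where B="2 * real n + 1"]) (use Pb in auto)
    have sq: "(v u - Re (poly P (cayley (of_real u))))\<^sup>2 \<le> (2 * real n + 1) * \<bar>v u - Re (poly P (cayley (of_real u)))\<bar>" for u
    proof -
      have "(v u - Re (poly P (cayley (of_real u))))\<^sup>2 = \<bar>v u - Re (poly P (cayley (of_real u)))\<bar> * \<bar>v u - Re (poly P (cayley (of_real u)))\<bar>"
        by (simp add: power2_eq_square)
      also have "\<dots> \<le> (2 * real n + 1) * \<bar>v u - Re (poly P (cayley (of_real u)))\<bar>"
        by (intro mult_right_mono Pb) simp
      finally show ?thesis .
    qed
    have i2: "integrable \<mu> (\<lambda>u. (v u - Re (poly P (cayley (of_real u))))\<^sup>2)"
      by (rule Bochner_Integration.integrable_bound[OF integrable_mult_right[OF i1, of "2 * real n + 1"]])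
         (use sq in auto)
    have "(\<integral>u. (v u - Re (poly P (cayley (of_real u))))\<^sup>2 \<partial>\<mu>) \<le> (\<integral>u. (2 * real n + 1) * \<bar>v u - Re (poly P (cayley (of_real u)))\<bar> \<partial>\<mu>)"
      by (intro integral_mono i2 integrable_mult_right i1 sq)
    also have "\<dots> = (2 * real n + 1) * (\<integral>u. \<bar>v u - Re (poly P (cayley (of_real u)))\<bar> \<partial>\<mu>)" by simp
    also have "\<dots> \<le> (2 * real n + 1) * d" using P(3) by (intro mult_left_mono) auto
    finally show ?thesis using i2 by blast
  qed
  obtain P1 where P1: "(\<integral>u. (Re (trunc n u) - Re (poly P1 (cayley (of_real u))))\<^sup>2 \<partial>\<mu>) \<le> (2 * real n + 1) * d"
      "integrable \<mu> (\<lambda>u. (Re (trunc n u) - Re (poly P1 (cayley (of_real u))))\<^sup>2)"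
    using approx[of "\<lambda>u. Re (trunc n u)"] order_trans[OF abs_Re_le_cmod tb] by auto
  obtain P2 where P2: "(\<integral>u. (Im (trunc n u) - Re (poly P2 (cayley (of_real u))))\<^sup>2 \<partial>\<mu>) \<le> (2 * real n + 1) * d"
      "integrable \<mu> (\<lambda>u. (Im (trunc n u) - Re (poly P2 (cayley (of_real u))))\<^sup>2)"
    using approx[of "\<lambda>u. Im (trunc n u)"] order_trans[OF abs_Im_le_cmod tb] by auto
  \<comment> \<open>These solve P + cnj Q = Re P1 + \<i> Re P2, by Re z = (z + cnj z) / 2.\<close>
  define P Q where "P = smult (1/2) (P1 + smult \<i> P2)" and "Q = smult (1/2) (P1 - smult \<i> P2)"
  have PQ: "poly P z + cnj (poly Q z) = Complex (Re (poly P1 z)) (Re (poly P2 z))" for z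
    by (simp add: P_def Q_def complex_eq_iff field_simps)
  have "L2_dist_sq \<mu> (trunc n) (\<lambda>u. poly P (cayley (of_real u)) + cnj (poly Q (cayley (of_real u))))
     = (\<integral>u. (Re (trunc n u) - Re (poly P1 (cayley (of_real u))))\<^sup>2 + (Im (trunc n u) - Re (poly P2 (cayley (of_real u))))\<^sup>2 \<partial>\<mu>)"
    unfolding L2_dist_sq_def PQ by (simp add: cmod_power2)
  also have "\<dots> \<le> 2 * ((2 * real n + 1) * d)"
    using P1 P2 by simp
  also have "\<dots> \<le> e / 4" by (rule d(3))
  finally have 2: "L2_dist_sq \<mu> (trunc n) (\<lambda>u. poly P (cayley (of_real u)) + cnj (poly Q (cayley (of_real u)))) \<le> e / 4" .
  have "L2_dist_sq \<mu> \<phi> (\<lambda>u. poly P (cayley (of_real u)) + cnj (poly Q (cayley (of_real u))))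
    \<le> 2 * L2_dist_sq \<mu> \<phi> (trunc n) + 2 * L2_dist_sq \<mu> (trunc n) (\<lambda>u. poly P (cayley (of_real u)) + cnj (poly Q (cayley (of_real u))))"
    by (intro L2_dist_sq_triangle \<phi> bounded_L2[OF tm tb] L2_add L2_cnj polyL2)
  also have "\<dots> < e" using n 2 \<open>e > 0\<close> by linarith
  finally show ?thesis by blast
qed

lemma expfun_multiplier: "s \<ge> 0 \<Longrightarrow> expfun s \<in> multipliers \<mu> (expfun ` {0..})"
proof (rule multipliersI[OF expfun_L2, where C=1])
  fix Z assume s: "s \<ge> 0" and "Z \<in> expfun ` {0..}"
  then obtain r where r: "r \<ge> 0" "Z = expfun r" by auto
  then have "(\<lambda>u. expfun s u * Z u) = expfun (s + r)" by (simp add: expfun_add[abs_def])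
  then show "(\<lambda>u. expfun s u * Z u) \<in> closed_lin_span \<mu> (expfun ` {0..})"
    using s r by (auto intro!: closed_lin_span_base expfun_L2)
qed auto

lemma one_in_hardy: "(\<lambda>u. 1) \<in> hardy \<mu>"
proof -
  have "expfun 0 = (\<lambda>u. 1)" by (simp add: fun_eq_iff)
  moreover have "expfun 0 \<in> expfun ` {0..}" by simp
  ultimately show ?thesis using closed_lin_span_base[OF expfun_L2, of "expfun 0" "{0..}"] by (simp add: hardy_def)
qed

lemma multiplier_in_hardy: "b \<in> multipliers \<mu> (expfun ` {0..}) \<Longrightarrow> b \<in> hardy \<mu>"
  using multipliersD[of b \<mu> _ "\<lambda>u. 1"] one_in_hardy by (auto simp: hardy_def)

text \<open>Geometric sums are Riemann sums of \<open>\<integral>\<^bsub>0\<^esub>\<^bsup>\<infinity>\<^esup> exp (i u r - r) dr = 1 / (1 - i u)\<close>, and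
  \<open>cayley u = 1 - 2 / (1 - i u)\<close>.\<close>

lemma cayley_multiplier: "(\<lambda>u. cayley (of_real u)) \<in> multipliers \<mu> (expfun ` {0..})"
proof -
  let ?Mu = "multipliers \<mu> (expfun ` {0..})"
  define q where "q n u = exp ((\<i> * of_real u - 1) / of_nat n)" for n :: nat and u :: real
  \<comment> \<open>The mesh is 1/n and the n^2 terms reach up to frequency n, so refinement and
    cut-off happen together; all frequencies k/n are nonnegative.\<close>
  define b where "b n u = (\<Sum>k<n\<^sup>2. of_real (exp (- (real k / real n)) / real n) * expfun (real k / real n) u)" for n :: nat and u :: real
  have bq: "b n u = (1 / of_nat n) * (\<Sum>k<n\<^sup>2. q n u ^ k)" for n u
    unfolding b_def sum_distrib_left
  proof (intro sum.cong refl)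
    fix k
    have "q n u ^ k = exp (of_real (- (real k / real n)) + \<i> * of_real (real k / real n * u))"
      unfolding q_def exp_of_nat_mult[symmetric]
      by (rule arg_cong[of _ _ exp]) (simp add: diff_divide_distrib algebra_simps)
    then show "of_real (exp (- (real k / real n)) / real n) * expfun (real k / real n) u = 1 / of_nat n * q n u ^ k"
      by (simp only: exp_add exp_of_real expfun_def) simp
  qed
  have bM: "b n \<in> ?Mu" for n
    unfolding b_def[abs_def]
    by (intro multipliers_sum multipliers_mult multipliers_const expfun_multiplier expfun_L2) auto
  \<comment> \<open>With x = 1/n the moduli form a geometric series of ratio exp(-x), and 1 -
    exp(-x) \<ge> x/2 on (0, 1] gives the constant 2.\<close>
  have b2: "cmod (b n u) \<le> 2" for n u
  proof (cases "n = 0")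
    case False
    define x where "x = 1 / real n"
    have x: "0 < x" "x \<le> 1" using False by (auto simp: x_def)
    have "exp (- x) \<le> 1 / (1 + x)"
      using exp_ge_add_one_self[of x] x by (simp add: exp_minus inverse_eq_divide frac_le)
    also have "\<dots> \<le> 1 - x / 2" using x by (simp add: divide_simps algebra_simps)
    finally have e: "exp (- x) \<le> 1 - x / 2" .
    have "cmod (b n u) \<le> (\<Sum>k<n\<^sup>2. cmod (of_real (exp (- (real k / real n)) / real n) * expfun (real k / real n) u))"
      unfolding b_def by (rule norm_sum)
    also have "\<dots> = (\<Sum>k<n\<^sup>2. x * exp (- x) ^ k)"
      by (intro sum.cong refl) (simp add: x_def norm_mult norm_divide exp_of_nat_mult[symmetric])
    also have "\<dots> = x * ((1 - exp (- x) ^ n\<^sup>2) / (1 - exp (- x)))"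
      unfolding sum_distrib_left[symmetric] using x by (subst sum_gp_strict) auto
    also have "\<dots> \<le> x * (1 / (x / 2))"
      using x e by (intro mult_left_mono frac_le) auto
    also have "\<dots> = 2" using x by simp
    finally show ?thesis .
  qed (simp add: b_def)
  have bl: "(\<lambda>n. b n u) \<longlonglongrightarrow> 1 / (1 - \<i> * of_real u)" for u
  proof -
    define z where "z = \<i> * complex_of_real u - 1"
    have z: "z \<noteq> 0" "Re z = -1" by (auto simp: z_def complex_eq_iff)
    have inv0: "filterlim (\<lambda>n. inverse (complex_of_nat n)) (at 0) sequentially"
      by (auto simp: filterlim_at lim_inverse_n intro!: eventually_sequentiallyI[of 1])
    \<comment> \<open>The derivative at 0, taken along x = 1/n, gives n (q - 1) -> z, the limit of
      the denominator of the geometric sum.\<close>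
    have "((\<lambda>x. exp (x * z)) has_field_derivative z) (at 0)"
      by (auto intro!: derivative_eq_intros)
    then have "((\<lambda>x. (exp (x * z) - 1) / x) \<longlongrightarrow> z) (at 0)"
      by (simp add: has_field_derivative_iff)
    from filterlim_compose[OF this inv0]
    have 1: "(\<lambda>n. of_nat n * (q n u - 1)) \<longlonglongrightarrow> z"
      by (simp add: q_def z_def divide_inverse mult.commute)
    have nn: "(\<lambda>n. exp (- real n)) \<longlonglongrightarrow> 0" by real_asymp
    have "norm (q n u ^ n\<^sup>2) = exp (- real n)" if "n > 0" for n
      using that by (simp add: q_def exp_of_nat_mult[symmetric] power2_eq_square)
    then have "\<forall>\<^sub>F n in sequentially. norm (q n u ^ n\<^sup>2) \<le> exp (- real n)"
      by (intro eventually_sequentiallyI[of 1]) simp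
    then have 2: "(\<lambda>n. q n u ^ n\<^sup>2) \<longlonglongrightarrow> 0"
      by (rule Lim_null_comparison[OF _ nn])
    have "(\<lambda>n. (q n u ^ n\<^sup>2 - 1) / (of_nat n * (q n u - 1))) \<longlonglongrightarrow> (0 - 1) / z"
      by (intro tendsto_intros 1 2 z)
    moreover have "\<forall>\<^sub>F n in sequentially. (q n u ^ n\<^sup>2 - 1) / (of_nat n * (q n u - 1)) = b n u"
      using eventually_ge_at_top[of 1]
    proof eventually_elim
      case (elim n)
      have "cmod (q n u) < 1" using elim by (simp add: q_def)
      then have "q n u \<noteq> 1" by auto
      then show ?case unfolding bq by (subst sum_gp_strict) (simp_all add: divide_simps, simp add: algebra_simps)
    qed
    ultimately have "(\<lambda>n. b n u) \<longlonglongrightarrow> (0 - 1) / z"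
      by (rule Lim_transform_eventually)
    moreover have "(0 - 1) / z = 1 / (1 - \<i> * of_real u)"
      by (simp add: z_def divide_simps)
    ultimately show ?thesis by simp
  qed
  have 1: "(\<lambda>u. 1 / (1 - \<i> * complex_of_real u)) \<in> ?Mu"
    by (rule multipliers_LIMSEQ[OF expfun_L2 bM b2 bl])
  have "(\<lambda>u. (-2) * (1 / (1 - \<i> * complex_of_real u))) \<in> ?Mu"
    by (rule multipliers_mult[OF multipliers_const[OF expfun_L2] 1])
  from multipliers_add[OF expfun_L2 multipliers_const[OF expfun_L2, of 1] this]
  have "(\<lambda>u. 1 + (-2) * (1 / (1 - \<i> * complex_of_real u))) \<in> ?Mu" by simp
  moreover have "1 + (-2) * (1 / (1 - \<i> * complex_of_real u)) = cayley (of_real u)" for u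
  proof -
    have "1 - \<i> * complex_of_real u \<noteq> 0" by (auto simp: complex_eq_iff)
    then show ?thesis by (simp add: cayley_def divide_simps) (simp add: algebra_simps)
  qed
  ultimately show ?thesis by simp
qed

text \<open>Taylor polynomials in w are multipliers because w is one, and they converge boundedly on
  the circle.\<close>

lemma disc_function_multiplier:
  assumes R: "R > 1" and f: "f holomorphic_on ball 0 R"
  shows "(\<lambda>u. f (cayley (of_real u))) \<in> multipliers \<mu> (expfun ` {0..})"
proof (rule multipliers_LIMSEQ[OF expfun_L2])
  let ?a = "\<lambda>n. (deriv ^^ n) f 0 / fact n"
  show "(\<lambda>u. \<Sum>n<N. ?a n * cayley (of_real u) ^ n) \<in> multipliers \<mu> (expfun ` {0..})" for N
    by (intro multipliers_sum multipliers_mult multipliers_power multipliers_const cayley_multiplier expfun_L2)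
  show "cmod (\<Sum>n<N. ?a n * cayley (of_real u) ^ n) \<le> (\<Sum>n. cmod (?a n))" for N u
  proof -
    have "cmod (\<Sum>n<N. ?a n * cayley (of_real u) ^ n) \<le> (\<Sum>n<N. cmod (?a n * cayley (of_real u) ^ n))"
      by (rule norm_sum)
    also have "\<dots> = (\<Sum>n<N. cmod (?a n))" by (intro sum.cong refl) (simp only: norm_mult norm_power cmod_cayley_of_real power_one mult_1_right)
    also have "\<dots> \<le> (\<Sum>n. cmod (?a n))" by (intro sum_le_suminf powser_radius_gt_1[OF R f]) auto
    finally show ?thesis .
  qed
  show "(\<lambda>N. \<Sum>n<N. ?a n * cayley (of_real u) ^ n) \<longlonglongrightarrow> f (cayley (of_real u))" for u
    using powser_radius_gt_1(2)[OF R f, of "cayley (of_real u)"] by (simp add: sums_def)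
qed

lemma entire_cayley_multiplier:
  "G holomorphic_on UNIV \<Longrightarrow> (\<lambda>u. G (cayley (of_real u))) \<in> multipliers \<mu> (expfun ` {0..})"
  by (rule disc_function_multiplier[of 2]) (auto intro: holomorphic_on_subset)

text \<open>In the disc variable F is bounded but may be singular at the boundary point 1. Dilation
  by r < 1 gives functions that are holomorphic on the disc of radius 1/r and obey the same bound on
  the circle, and r -> 1 is a bounded pointwise limit on the real line.\<close>

lemma bounded_upper_half_plane_multiplier:
  assumes F: "F holomorphic_on UNIV" and bd: "\<And>z. Im z > 0 \<Longrightarrow> cmod (F z) \<le> C"
  shows "(\<lambda>u. F (of_real u)) \<in> multipliers \<mu> (expfun ` {0..})"
proof -
  \<comment> \<open>The inverse of \<open>cayley\<close>; on the open disc Im (k z) = (1 - |z|^2) /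
    |1 - z|^2 > 0.\<close>
  define k where "k z = \<i> * (1 + z) / (1 - z)" for z :: complex
  have Imk: "Im (k z) > 0" if "cmod z < 1" for z
  proof -
    have "z \<noteq> 1" using that by auto
    then have "(cmod (1 - z))\<^sup>2 > 0" by simp
    have "(cmod z)\<^sup>2 < 1" using that by (simp add: abs_square_less_1)
    have "k z = \<i> * (1 + z) * cnj (1 - z) / of_real ((cmod (1 - z))\<^sup>2)"
      using \<open>z \<noteq> 1\<close> by (simp add: k_def complex_norm_square del: of_real_power)
    then have "Im (k z) = Im (\<i> * (1 + z) * cnj (1 - z)) / (cmod (1 - z))\<^sup>2"
      by (simp only: Im_divide_of_real)
    also have "Im (\<i> * (1 + z) * cnj (1 - z)) = 1 - (cmod z)\<^sup>2"
      by (simp add: cmod_power2) (simp add: power2_eq_square algebra_simps)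
    finally show ?thesis using \<open>(cmod z)\<^sup>2 < 1\<close> \<open>(cmod (1 - z))\<^sup>2 > 0\<close> by simp
  qed
  have kc1: "1 - cayley (of_real u) = 2 * \<i> / (of_real u + \<i>)" for u
    by (simp add: cayley_def divide_simps)
  have kc: "k (cayley (of_real u)) = of_real u" for u
  proof -
    have "1 + cayley (of_real u) = 2 * of_real u / (of_real u + \<i>)"
      by (simp add: cayley_def divide_simps)
    then show ?thesis by (simp add: k_def kc1)
  qed
  define r where "r n = 1 - 1 / (real n + 2)" for n
  have r: "0 < r n" "r n < 1" for n by (auto simp: r_def)
  have rl: "r \<longlonglongrightarrow> 1" unfolding r_def by real_asymp
  show ?thesis
  proof (rule multipliers_LIMSEQ[OF expfun_L2])
    fix n
    have sub: "cmod (of_real (r n) * z) < 1" if "z \<in> ball 0 (1 / r n)" for z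
      using that r[of n] by (simp add: norm_mult field_simps)
    have "(\<lambda>z. F (k (of_real (r n) * z))) holomorphic_on ball 0 (1 / r n)"
    proof (rule holomorphic_on_compose_gen[of _ _ F UNIV, unfolded o_def])
      show "(\<lambda>z. k (of_real (r n) * z)) holomorphic_on ball 0 (1 / r n)"
        unfolding k_def using sub by (intro holomorphic_intros) force
    qed (use F in auto)
    then show "(\<lambda>u. F (k (of_real (r n) * cayley (of_real u)))) \<in> multipliers \<mu> (expfun ` {0..})"
      by (rule disc_function_multiplier[rotated]) (use r in auto)
    show "cmod (F (k (of_real (r n) * cayley (of_real u)))) \<le> C" for u
      using r[of n] by (intro bd Imk) (simp add: norm_mult)
  next
    fix u
    have "cayley (of_real u) \<noteq> 1" using kc1[of u] by auto
    then have "(\<lambda>n. k (of_real (r n) * cayley (of_real u))) \<longlonglongrightarrow> k (of_real 1 * cayley (of_real u))"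
      unfolding k_def by (intro tendsto_intros rl) auto
    then have "(\<lambda>n. k (of_real (r n) * cayley (of_real u))) \<longlonglongrightarrow> of_real u" by (simp add: kc)
    moreover have "isCont F (of_real u)"
      using holomorphic_on_imp_continuous_on[OF F] by (simp add: continuous_on_eq_continuous_at)
    ultimately show "(\<lambda>n. F (k (of_real (r n) * cayley (of_real u)))) \<longlonglongrightarrow> F (of_real u)"
      by (rule isCont_tendsto_compose[rotated])
  qed
qed

end

section \<open>Infinite logarithmic integral\<close>

definition sum_measure :: "'a measure \<Rightarrow> 'a measure \<Rightarrow> 'a measure" where
  "sum_measure A B = measure_of (space A) (sets A) (\<lambda>X. emeasure A X + emeasure B X)"

lemma sets_sum_measure [simp]: "sets (sum_measure A B) = sets A"
  by (simp add: sum_measure_def)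

lemma emeasure_sum_measure:
  assumes "sets A = sets B" "X \<in> sets A"
  shows "emeasure (sum_measure A B) X = emeasure A X + emeasure B X"
proof -
  have "countably_additive (sets A) (\<lambda>X. emeasure A X + emeasure B X)"
  proof (rule countably_additiveI)
    fix F :: "nat \<Rightarrow> _ set" assume F: "range F \<subseteq> sets A" "disjoint_family F"
    have "(\<Sum>i. emeasure A (F i)) = emeasure A (\<Union>i. F i)"
      by (rule suminf_emeasure[OF F])
    moreover have "(\<Sum>i. emeasure B (F i)) = emeasure B (\<Union>i. F i)"
      using suminf_emeasure[of F B] F assms(1) by simp
    ultimately show "(\<Sum>i. emeasure A (F i) + emeasure B (F i)) = emeasure A (\<Union>i. F i) + emeasure B (\<Union>i. F i)"
      by (subst suminf_add[symmetric]) auto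
  qed
  then show ?thesis
    unfolding sum_measure_def using assms(2)
    by (intro emeasure_measure_of_sigma) (auto simp: positive_def sets.sigma_algebra_axioms)
qed

text \<open>Approximation in L1 of the sum of the two measures serves both, as each is dominated by
  the sum.\<close>

lemma Re_poly_approx2:
  fixes \<mu> \<nu> :: "real measure" and v :: "real \<Rightarrow> real"
  assumes \<mu>: "finite_measure \<mu>" "sets \<mu> = sets borel" and \<nu>: "finite_measure \<nu>" "sets \<nu> = sets borel"
    and v[measurable]: "v \<in> borel_measurable borel"
    and ab: "\<And>u. a \<le> v u" "\<And>u. v u \<le> b" and e: "e > 0"
  obtains P where "Im (poly P 0) = 0"
    "\<And>u. a - e \<le> Re (poly P (cayley (of_real u)))" "\<And>u. Re (poly P (cayley (of_real u))) \<le> b + e"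
    "(\<integral>u. \<bar>v u - Re (poly P (cayley (of_real u)))\<bar> \<partial>\<mu>) < e"
    "(\<integral>u. \<bar>v u - Re (poly P (cayley (of_real u)))\<bar> \<partial>\<nu>) < e"
proof -
  interpret \<mu>: finite_measure \<mu> by fact
  interpret \<nu>: finite_measure \<nu> by fact
  let ?S = "sum_measure \<mu> \<nu>"
  have S: "sets ?S = sets borel" using \<mu>(2) by simp
  have em: "emeasure ?S X = emeasure \<mu> X + emeasure \<nu> X" if "X \<in> sets borel" for X
    using that \<mu>(2) \<nu>(2) by (intro emeasure_sum_measure) auto
  have finS: "finite_measure ?S"
  proof
    have "space ?S = UNIV" using sets_eq_imp_space_eq[OF S] by simp
    then show "emeasure ?S (space ?S) \<noteq> \<infinity>" using em[of UNIV] by (simp add: \<mu>.emeasure_eq_measure \<nu>.emeasure_eq_measure)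
  qed
  interpret S: finite_measure ?S by fact
  obtain P where P: "Im (poly P 0) = 0"
    "\<And>u. a - e \<le> Re (poly P (cayley (of_real u)))" "\<And>u. Re (poly P (cayley (of_real u))) \<le> b + e"
    "(\<integral>u. \<bar>v u - Re (poly P (cayley (of_real u)))\<bar> \<partial>?S) < e"
    by (rule Re_poly_approx[OF finS S v ab e]) (use that in blast)
  let ?f = "\<lambda>u. \<bar>v u - Re (poly P (cayley (of_real u)))\<bar>"
  have fb: "?f u \<le> b - a + e" for u using P(2,3)[of u] ab[of u] by linarith
  have less: "(\<integral>u. ?f u \<partial>\<rho>) < e" if \<rho>: "finite_measure \<rho>" "sets \<rho> = sets borel" "\<And>X. X \<in> sets borel \<Longrightarrow> emeasure \<rho> X \<le> emeasure ?S X" for \<rho>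
  proof -
    interpret \<rho>: finite_measure \<rho> by fact
    have m: "?f \<in> borel_measurable borel" by measurable
    have i1: "integrable \<rho> ?f"
      by (rule \<rho>.integrable_const_bound[where B="b - a + e"]) (use fb m \<rho>(2) in \<open>auto simp: measurable_cong_sets[OF \<rho>(2) refl]\<close>)
    have i2: "integrable ?S ?f"
      by (rule S.integrable_const_bound[where B="b - a + e"]) (use fb m S in \<open>auto simp: measurable_cong_sets[OF S refl]\<close>)
    have "\<rho> \<le> ?S" using \<rho> S by (simp add: le_measure)
    then have "(\<integral>\<^sup>+u. ennreal (?f u) \<partial>\<rho>) \<le> (\<integral>\<^sup>+u. ennreal (?f u) \<partial>?S)"
      using \<rho> S by (intro nn_integral_mono_measure) auto
    then have "(\<integral>u. ?f u \<partial>\<rho>) \<le> (\<integral>u. ?f u \<partial>?S)"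
      using i1 i2 by (simp add: nn_integral_eq_integral)
    then show ?thesis using P(4) by simp
  qed
  show ?thesis
    by (rule that[OF P(1-3) less[OF \<mu>] less[OF \<nu>]]) (simp_all add: em)
qed

text \<open>The mean value property at the centre of the disc, transported to the line.\<close>

lemma Re_poly_0_eq_integral:
  "Re (poly P 0) = (\<integral>u. Re (poly P (cayley (of_real u))) \<partial>cauchy_measure)"
  "integrable cauchy_measure (\<lambda>u. Re (poly P (cayley (of_real u))))"
proof -
  have "poly P holomorphic_on UNIV" by (intro holomorphic_intros)
  note I = integral_cauchy_entire[OF this]
  show "integrable cauchy_measure (\<lambda>u. Re (poly P (cayley (of_real u))))" using I(1) by simp
  show "Re (poly P 0) = (\<integral>u. Re (poly P (cayley (of_real u))) \<partial>cauchy_measure)"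
    using integral_Re[OF I(1)] I(2) by simp
qed

text \<open>Converts L1-closeness of exponents that are bounded above into control of the integrated
  exponentials.\<close>

lemma exp_diff_le:
  fixes x y :: real
  assumes "x \<le> b" "y \<le> b" shows "exp x \<le> exp y + exp b * \<bar>y - x\<bar>"
proof (cases "x \<le> y")
  case True then have "exp x \<le> exp y" by simp
  then show ?thesis by (smt (verit) exp_gt_zero mult_nonneg_nonneg abs_ge_zero)
next
  case False
  have "1 - (x - y) \<le> exp (y - x)" using exp_ge_add_one_self[of "y - x"] by linarith
  then have "exp x * (1 - (x - y)) \<le> exp x * exp (y - x)" by (intro mult_left_mono) auto
  also have "\<dots> = exp y" by (simp add: exp_diff)
  finally have "exp x \<le> exp y + exp x * (x - y)" by (simp add: algebra_simps)
  also have "exp x * (x - y) \<le> exp b * (x - y)" using assms False by (intro mult_right_mono) auto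
  finally show ?thesis using False by simp
qed

text \<open>The \<open>L\<^sub>2\<close> distance of an exponential of an analytic polynomial to \<open>1\<close> only involves the real part
  of the exponent, so no conjugate functions have to be controlled.\<close>

lemma exp_poly_near_1:
  assumes "Im (poly P 0) = 0" and b: "\<And>u. Re (poly P (cayley (of_real u))) \<le> b"
  shows "(\<integral>u. (cmod (exp (poly P (cayley (of_real u))) - 1))\<^sup>2 \<partial>cauchy_measure) \<le> exp (2 * b) + 1 - 2 * exp (Re (poly P 0))"
    and "integrable cauchy_measure (\<lambda>u. (cmod (exp (poly P (cayley (of_real u))) - 1))\<^sup>2)"
proof -
  let ?G = "\<lambda>u. exp (poly P (cayley (of_real u)))"
  have hol: "(\<lambda>z. exp (poly P z)) holomorphic_on UNIV" by (intro holomorphic_intros)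
  note I = integral_cauchy_entire[OF hol]
  have Gm[measurable]: "?G \<in> borel_measurable borel" by measurable
  have sq: "(cmod (?G u))\<^sup>2 \<le> exp (2 * b)" for u
    using b[of u] by (simp flip: exp_double)
  have i1: "integrable cauchy_measure (\<lambda>u. (cmod (?G u))\<^sup>2)"
    by (rule cauchy.integrable_const_bound[where B="exp (2 * b)"]) (use sq in auto)
  have eq: "(cmod (?G u - 1))\<^sup>2 = (cmod (?G u))\<^sup>2 - 2 * Re (?G u) + 1" for u
    by (simp only: cmod_power2) (simp add: power2_eq_square algebra_simps)
  have iR: "integrable cauchy_measure (\<lambda>u. Re (?G u))" using I(1) by (rule integrable_Re)
  show "integrable cauchy_measure (\<lambda>u. (cmod (?G u - 1))\<^sup>2)"
    unfolding eq using i1 iR by simp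
  have "(\<integral>u. (cmod (?G u - 1))\<^sup>2 \<partial>cauchy_measure) = (\<integral>u. (cmod (?G u))\<^sup>2 \<partial>cauchy_measure) - 2 * (\<integral>u. Re (?G u) \<partial>cauchy_measure) + 1"
    unfolding eq using i1 iR by (simp add: cauchy.prob_space[simplified])
  also have "(\<integral>u. Re (?G u) \<partial>cauchy_measure) = Re (\<integral>u. ?G u \<partial>cauchy_measure)" using I(1) by simp
  also have "\<dots> = exp (Re (poly P 0))"
    unfolding I(2) using assms(1) by (simp add: Re_exp)
  also have "(\<integral>u. (cmod (?G u))\<^sup>2 \<partial>cauchy_measure) \<le> (\<integral>u. exp (2 * b) \<partial>cauchy_measure)"
    by (intro integral_mono i1 sq) simp
  finally show "(\<integral>u. (cmod (?G u - 1))\<^sup>2 \<partial>cauchy_measure) \<le> exp (2 * b) + 1 - 2 * exp (Re (poly P 0))"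
    by (simp add: cauchy.prob_space[simplified])
qed

lemma entire_split_at_0:
  assumes G: "G holomorphic_on UNIV"
  obtains Q where "Q holomorphic_on UNIV" "\<And>z::complex. G z = G 0 + z * Q z"
proof
  let ?Q = "\<lambda>z. if z = 0 then deriv G 0 else (G z - G 0) / (z - 0)"
  show "?Q holomorphic_on UNIV" by (rule pole_lemma_open[OF G]) auto
  show "G z = G 0 + z * ?Q z" for z by simp
qed

text \<open>\<open>N\<close> carries the singular part of \<open>\<mu>\<close>, and \<open>g\<close> is the density of the absolutely continuous part
  with respect to the Cauchy measure.\<close>

locale decomposed_measure = borel_finite_measure +
  fixes g :: "real \<Rightarrow> real" and N :: "real set"
  assumes g_measurable [measurable]: "g \<in> borel_measurable borel"
    and g_nonneg: "\<And>u. 0 \<le> g u"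
    and N_null: "N \<in> null_sets lborel"
    and dens: "density \<mu> (\<lambda>u. ennreal (indicator (- N) u)) = density cauchy_measure (\<lambda>u. ennreal (g u))"
begin

lemma N_borel [measurable]: "N \<in> sets borel"
  using N_null by auto

lemma AE_not_N: "AE u in cauchy_measure. u \<notin> N"
  using N_null null_sets_cauchy by (intro AE_not_in) simp

lemma integral_off_N:
  fixes f :: "real \<Rightarrow> real"
  assumes [measurable]: "f \<in> borel_measurable borel" and f: "integrable \<mu> f"
  shows "integrable cauchy_measure (\<lambda>u. g u * f u)"
    and "(\<integral>u. indicator (- N) u * f u \<partial>\<mu>) = (\<integral>u. g u * f u \<partial>cauchy_measure)"
proof -
  have m: "f \<in> borel_measurable \<mu>" by (simp add: measurable_eq)
  have mN: "(\<lambda>u. indicator (- N) u :: real) \<in> borel_measurable \<mu>" by (simp add: measurable_eq)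
  have "integrable \<mu> (\<lambda>u. indicator (- N) u *\<^sub>R f u)"
    by (rule integrable_mult_indicator[OF _ f]) (simp add: sets_eq)
  then have "integrable (density \<mu> (\<lambda>u. ennreal (indicator (- N) u))) f"
    by (subst integrable_density[OF m mN]) auto
  then show "integrable cauchy_measure (\<lambda>u. g u * f u)"
    unfolding dens by (subst (asm) integrable_density) (auto simp: g_nonneg)
  have "(\<integral>u. indicator (- N) u * f u \<partial>\<mu>) = (\<integral>u. f u \<partial>density \<mu> (\<lambda>u. ennreal (indicator (- N) u)))"
    by (subst integral_density[OF m mN]) auto
  also have "\<dots> = (\<integral>u. g u * f u \<partial>cauchy_measure)"
    unfolding dens by (subst integral_density) (auto simp: g_nonneg)
  finally show "(\<integral>u. indicator (- N) u * f u \<partial>\<mu>) = (\<integral>u. g u * f u \<partial>cauchy_measure)" .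
qed

lemma AE_off_N:
  assumes "AE u in cauchy_measure. p u" shows "AE u in \<mu>. u \<notin> N \<longrightarrow> p u"
proof -
  have "AE u in density cauchy_measure (\<lambda>u. ennreal (g u)). p u"
    using assms by (subst AE_density) (auto elim: eventually_mono)
  then have "AE u in \<mu>. 0 < ennreal (indicator (- N) u) \<longrightarrow> p u"
    unfolding dens[symmetric] by (subst (asm) AE_density) (simp_all add: measurable_eq)
  then show ?thesis by eventually_elim (auto simp: indicator_def)
qed

lemma g_integrable: "integrable cauchy_measure g"
  using integral_off_N(1)[of "\<lambda>_. 1"] by simp

lemma integral_g_le: "(\<integral>u. g u \<partial>cauchy_measure) \<le> measure \<mu> UNIV"
proof -
  have "(\<integral>u. g u \<partial>cauchy_measure) = (\<integral>u. indicator (- N) u \<partial>\<mu>)"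
    using integral_off_N(2)[of "\<lambda>_. 1"] by simp
  also have "\<dots> = measure \<mu> (- N)" by (simp add: sets_eq)
  also have "\<dots> \<le> measure \<mu> UNIV" by (rule finite_measure_mono) (simp_all add: sets_eq)
  finally show ?thesis .
qed

lemma fin_\<mu>: "finite_measure \<mu>" by unfold_locales

text \<open>One half of Szego's theorem: the infimum of the squared norm over G(0) = 1 is governed
  by the geometric mean of the density. With Re P close to - ln of the truncated density, exp(Re P)
  has a bounded integral, while the normalization G(0) = 1 divides by exp(Re P(0)), and Re P(0) is
  nearly the logarithmic mean, which can be made arbitrarily large.\<close>

lemma szego_infimum_zero:
  assumes log: "\<And>C. \<exists>\<delta>>0. \<delta> \<le> 1 \<and> C \<le> (\<integral>u. - ln (max \<delta> (min 1 (g u))) \<partial>cauchy_measure)"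
    and "e > 0"
  obtains G where "G holomorphic_on UNIV" "G 0 = 1" "(\<integral>u. (cmod (G (cayley (of_real u))))\<^sup>2 \<partial>\<mu>) < e"
proof -
  \<comment> \<open>Bounds the integral of exp(Re P): 1 plus twice the total mass comes from exp(v),
    another 1 from the error of approximation.\<close>
  define C0 where "C0 = 2 + 2 * measure \<mu> UNIV"
  have C0: "C0 > 0" by (simp add: C0_def add_pos_nonneg)
  \<comment> \<open>One unit is lost in Re P(0) \<ge> C - 1, the other leaves the factor exp(-1) < 1
    at the end.\<close>
  define C where "C = 2 + ln (C0 / e)"
  obtain \<delta> where \<delta>: "\<delta> > 0" "\<delta> \<le> 1" "C \<le> (\<integral>u. - ln (max \<delta> (min 1 (g u))) \<partial>cauchy_measure)"
    using log by blast
  define c where "c u = max \<delta> (min 1 (g u))" for u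
  have c: "\<delta> \<le> c u" "c u \<le> 1" "0 < c u" for u using \<delta> by (auto simp: c_def)
  have cm[measurable]: "c \<in> borel_measurable borel" unfolding c_def[abs_def] by measurable
  \<comment> \<open>With target 0 on \<open>N\<close> the singular part contributes only its mass;
    for the Cauchy integral \<open>N\<close> is a null set.\<close>
  define v where "v u = (if u \<in> N then 0 else - ln (c u))" for u
  have vm[measurable]: "v \<in> borel_measurable borel" unfolding v_def[abs_def] by measurable
  define b where "b = - ln \<delta>"
  have v: "0 \<le> v u" "v u \<le> b" for u
    using c[of u] \<delta> by (auto simp: v_def b_def)
  \<comment> \<open>Makes the cost \<open>exp (b + 1) * \<eta>\<close> of \<open>exp_diff_le\<close>
    at most 1.\<close>
  define \<eta> where "\<eta> = min 1 (exp (- (b + 1)))"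
  have \<eta>: "\<eta> > 0" "\<eta> \<le> 1" "exp (b + 1) * \<eta> \<le> 1"
  proof -
    have "exp (b + 1) * \<eta> \<le> exp (b + 1) * exp (- (b + 1))" by (intro mult_left_mono) (auto simp: \<eta>_def)
    also have "\<dots> = 1" by (simp flip: exp_add)
    finally show "exp (b + 1) * \<eta> \<le> 1" .
  qed (auto simp: \<eta>_def)
  obtain P where P: "Im (poly P 0) = 0"
    "\<And>u. 0 - \<eta> \<le> Re (poly P (cayley (of_real u)))" "\<And>u. Re (poly P (cayley (of_real u))) \<le> b + \<eta>"
    "(\<integral>u. \<bar>v u - Re (poly P (cayley (of_real u)))\<bar> \<partial>\<mu>) < \<eta>"
    "(\<integral>u. \<bar>v u - Re (poly P (cayley (of_real u)))\<bar> \<partial>cauchy_measure) < \<eta>"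
    by (rule Re_poly_approx2[OF fin_\<mu> sets_eq cauchy.finite_measure_axioms sets_cauchy vm v \<eta>(1)]) (use that in blast)
  have "norm (v u) \<le> b" for u using v[of u] by simp
  then have vi: "integrable cauchy_measure v"
    by (intro cauchy.integrable_const_bound[where B=b]) auto
  have "C \<le> (\<integral>u. v u \<partial>cauchy_measure)"
  proof -
    have "(\<integral>u. v u \<partial>cauchy_measure) = (\<integral>u. - ln (max \<delta> (min 1 (g u))) \<partial>cauchy_measure)"
      by (rule integral_cong_AE) (use AE_not_N in \<open>auto simp: v_def c_def elim: eventually_mono\<close>)
    then show ?thesis using \<delta>(3) by simp
  qed
  moreover have "(\<integral>u. v u \<partial>cauchy_measure) - Re (poly P 0) \<le> \<eta>"
  proof -
    have "(\<integral>u. v u \<partial>cauchy_measure) - Re (poly P 0) = (\<integral>u. v u - Re (poly P (cayley (of_real u))) \<partial>cauchy_measure)"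
      using vi Re_poly_0_eq_integral by simp
    also have "\<dots> \<le> (\<integral>u. \<bar>v u - Re (poly P (cayley (of_real u)))\<bar> \<partial>cauchy_measure)"
      using vi Re_poly_0_eq_integral(2) by (intro integral_mono) auto
    finally show ?thesis using P(5) by linarith
  qed
  ultimately have P0: "C - 1 \<le> Re (poly P 0)" using \<eta>(2) by linarith
  have "norm (1 / c u) \<le> 1 / \<delta>" for u using c[of u] \<delta>(1) by (simp add: frac_le)
  then have ic: "integrable \<mu> (\<lambda>u. 1 / c u)"
    by (intro integrable_const_bound[where B="1 / \<delta>"]) (auto simp: measurable_eq)
  have iv: "integrable \<mu> (\<lambda>u. exp (v u))"
    by (rule integrable_const_bound[where B="exp b"]) (use v in \<open>auto simp: measurable_eq\<close>)
  have ev: "(\<integral>u. exp (v u) \<partial>\<mu>) \<le> 1 + 2 * measure \<mu> UNIV"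
  proof -
    have "exp (v u) = indicator N u + indicator (- N) u * (1 / c u)" for u
      using c[of u] by (auto simp: v_def exp_minus inverse_eq_divide)
    then have "(\<integral>u. exp (v u) \<partial>\<mu>) = (\<integral>u. indicator N u + indicator (- N) u * (1 / c u) \<partial>\<mu>)" by simp
    also have "\<dots> = (\<integral>u. indicator N u \<partial>\<mu>) + (\<integral>u. indicator (- N) u * (1 / c u) \<partial>\<mu>)"
      by (rule Bochner_Integration.integral_add)
         (use integrable_mult_indicator[OF _ ic, of "- N"] in \<open>auto simp: sets_eq less_top[symmetric]\<close>)
    also have "(\<integral>u. indicator (- N) u * (1 / c u) \<partial>\<mu>) = (\<integral>u. g u * (1 / c u) \<partial>cauchy_measure)"
      by (rule integral_off_N(2)[OF _ ic]) simp
    also have "\<dots> \<le> (\<integral>u. 1 + g u \<partial>cauchy_measure)"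
    proof (intro integral_mono integral_off_N(1)[OF _ ic])
      fix u
      \<comment> \<open>This gives g / c \<le> 1 + g with no trace of \<delta>; hence
        \<open>C0\<close> can be fixed before \<delta> is chosen.\<close>
      have "g u \<le> (1 + g u) * c u"
      proof (cases "g u \<le> 1")
        case True then have "g u \<le> c u" by (simp add: c_def)
        also have "\<dots> \<le> (1 + g u) * c u" using g_nonneg[of u] c(3)[of u] by (simp add: distrib_right)
        finally show ?thesis .
      next
        case False
        then have "c u = 1" using \<delta> by (simp add: c_def)
        then show ?thesis by simp
      qed
      then show "g u * (1 / c u) \<le> 1 + g u" using c(3)[of u] by (simp add: pos_divide_le_eq)
    qed (auto intro: g_integrable)
    also have "\<dots> = 1 + (\<integral>u. g u \<partial>cauchy_measure)" using g_integrable by (simp add: cauchy.prob_space[simplified])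
    also have "\<dots> \<le> 1 + measure \<mu> UNIV" using integral_g_le by simp
    also have "(\<integral>u. indicator N u \<partial>\<mu>) = measure \<mu> N" by (simp add: sets_eq)
    also have "measure \<mu> N \<le> measure \<mu> UNIV" by (rule finite_measure_mono) (simp_all add: sets_eq)
    finally show ?thesis by simp
  qed
  define G where "G z = exp ((poly P z - poly P 0) / 2)" for z
  have G2: "(cmod (G z))\<^sup>2 = exp (- Re (poly P 0)) * exp (Re (poly P z))" for z
    by (simp add: G_def flip: exp_double exp_add)
  have iP: "integrable \<mu> (\<lambda>u. exp (Re (poly P (cayley (of_real u)))))"
    by (rule integrable_const_bound[where B="exp (b + \<eta>)"]) (use P(3) in \<open>auto simp: measurable_eq\<close>)
  have iD: "integrable \<mu> (\<lambda>u. \<bar>v u - Re (poly P (cayley (of_real u)))\<bar>)"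
  proof (rule integrable_const_bound[where B="b + \<eta>"])
    show "AE u in \<mu>. norm \<bar>v u - Re (poly P (cayley (of_real u)))\<bar> \<le> b + \<eta>"
    proof (rule AE_I2)
      fix u show "norm \<bar>v u - Re (poly P (cayley (of_real u)))\<bar> \<le> b + \<eta>"
        using P(2,3)[of u] v[of u] by simp
    qed
  qed (simp add: measurable_eq)
  have "(\<integral>u. exp (Re (poly P (cayley (of_real u)))) \<partial>\<mu>) \<le> (\<integral>u. exp (v u) + exp (b + 1) * \<bar>v u - Re (poly P (cayley (of_real u)))\<bar> \<partial>\<mu>)"
  proof (intro integral_mono iP)
    fix u
    show "exp (Re (poly P (cayley (of_real u)))) \<le> exp (v u) + exp (b + 1) * \<bar>v u - Re (poly P (cayley (of_real u)))\<bar>"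
      by (rule exp_diff_le) (use P(3)[of u] v(2)[of u] \<eta> in auto)
  qed (use iv iD in auto)
  also have "\<dots> = (\<integral>u. exp (v u) \<partial>\<mu>) + exp (b + 1) * (\<integral>u. \<bar>v u - Re (poly P (cayley (of_real u)))\<bar> \<partial>\<mu>)"
    using iv iD by simp
  also have "\<dots> \<le> (1 + 2 * measure \<mu> UNIV) + exp (b + 1) * \<eta>"
    using ev P(4) by (intro add_mono mult_left_mono) auto
  also have "\<dots> \<le> C0" using \<eta>(3) by (simp add: C0_def)
  finally have 1: "(\<integral>u. exp (Re (poly P (cayley (of_real u)))) \<partial>\<mu>) \<le> C0" .
  show ?thesis
  proof (rule that)
    show "G holomorphic_on UNIV" unfolding G_def[abs_def] by (intro holomorphic_intros) auto
    show "G 0 = 1" by (simp add: G_def)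
    have "(\<integral>u. (cmod (G (cayley (of_real u))))\<^sup>2 \<partial>\<mu>) = exp (- Re (poly P 0)) * (\<integral>u. exp (Re (poly P (cayley (of_real u)))) \<partial>\<mu>)"
      unfolding G2 by simp
    also have "\<dots> \<le> exp (1 - C) * C0"
      using P0 1 C0 by (intro mult_mono) auto
    also have "\<dots> = exp (-1) * e"
      using C0 \<open>e > 0\<close> by (simp add: C_def exp_diff exp_minus ln_div exp_add divide_simps)
    also have "\<dots> < 1 * e" using \<open>e > 0\<close> by (intro mult_strict_right_mono) auto
    finally show "(\<integral>u. (cmod (G (cayley (of_real u))))\<^sup>2 \<partial>\<mu>) < e" by simp
  qed
qed

text \<open>G = 1 + w Q with small norm means that - Q(w) is close to 1/w = cnj w, because |w| = 1
  on the line. Then cnj w is a multiplier as well, and the multipliers contain the dense set of sums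
  P(w) + cnj (Q(w)).\<close>

lemma hardy_eq_L2:
  assumes log: "\<And>C. \<exists>\<delta>>0. \<delta> \<le> 1 \<and> C \<le> (\<integral>u. - ln (max \<delta> (min 1 (g u))) \<partial>cauchy_measure)"
  shows "hardy \<mu> = L2 \<mu>"
proof -
  let ?E = "expfun ` {0..}"
  have wm: "(\<lambda>u. cnj (cayley (of_real u))) \<in> borel_measurable borel" by measurable
  have cw: "(\<lambda>u. cnj (cayley (of_real u))) \<in> hardy \<mu>"
    unfolding hardy_def
  proof (rule closed_lin_span_closed[OF expfun_L2])
    show "(\<lambda>u. cnj (cayley (of_real u))) \<in> L2 \<mu>" by (rule bounded_L2[OF wm, where C=1]) simp
    fix e :: real assume "e > 0"
    then obtain G where G: "G holomorphic_on UNIV" "G 0 = 1" "(\<integral>u. (cmod (G (cayley (of_real u))))\<^sup>2 \<partial>\<mu>) < e"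
      by (rule szego_infimum_zero[OF log])
    obtain Q where Q: "Q holomorphic_on UNIV" "\<And>z. G z = G 0 + z * Q z"
      by (rule entire_split_at_0[OF G(1)]) (rule that)
    have "(\<lambda>u. - Q (cayley (of_real u))) \<in> hardy \<mu>"
      by (intro multiplier_in_hardy entire_cayley_multiplier[of "\<lambda>z. - Q z"] holomorphic_intros Q)
    moreover have "cmod (cnj (cayley (of_real u)) - - Q (cayley (of_real u))) = cmod (G (cayley (of_real u)))" for u
    proof -
      let ?w = "cayley (of_real u)"
      have "?w * cnj ?w = 1" by (simp flip: complex_norm_square)
      then have "G ?w = ?w * (cnj ?w + Q ?w)" using Q(2)[of ?w] G(2) by (simp add: distrib_left)
      then show ?thesis by (simp add: norm_mult)
    qed
    ultimately show "\<exists>Y\<in>closed_lin_span \<mu> ?E. L2_dist_sq \<mu> (\<lambda>u. cnj (cayley (of_real u))) Y < e"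
      using G(3) by (intro bexI[of _ "\<lambda>u. - Q (cayley (of_real u))"]) (auto simp: L2_dist_sq_def hardy_def)
  qed
  have cwM: "(\<lambda>u. cnj (cayley (of_real u))) \<in> multipliers \<mu> ?E"
  proof (rule multipliersI[OF expfun_L2, where C=1])
    fix Z assume "Z \<in> ?E"
    then have "(\<lambda>u. Z u * cnj (cayley (of_real u))) \<in> hardy \<mu>"
      using multipliersD[OF expfun_multiplier, of _ "\<lambda>u. cnj (cayley (of_real u))"] cw by (auto simp: hardy_def)
    then show "(\<lambda>u. cnj (cayley (of_real u)) * Z u) \<in> closed_lin_span \<mu> ?E"
      by (simp add: hardy_def mult.commute)
  qed (use wm in \<open>simp_all add: measurable_eq\<close>)
  have "\<phi> \<in> hardy \<mu>" if \<phi>: "\<phi> \<in> L2 \<mu>" for \<phi>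
    unfolding hardy_def
  proof (rule closed_lin_span_closed[OF expfun_L2 \<phi>])
    fix e :: real assume "e > 0"
    then obtain P Q where PQ: "L2_dist_sq \<mu> \<phi> (\<lambda>u. poly P (cayley (of_real u)) + cnj (poly Q (cayley (of_real u)))) < e"
      using L2_poly_dense[OF \<phi>] by blast
    have "(\<lambda>u. poly P (cayley (of_real u))) \<in> multipliers \<mu> ?E"
      by (rule entire_cayley_multiplier) (intro holomorphic_intros)
    moreover have "(\<lambda>u. \<Sum>i\<le>degree Q. cnj (coeff Q i) * cnj (cayley (of_real u)) ^ i) \<in> multipliers \<mu> ?E"
      by (intro multipliers_sum multipliers_mult multipliers_power multipliers_const cwM expfun_L2)
    then have "(\<lambda>u. cnj (poly Q (cayley (of_real u)))) \<in> multipliers \<mu> ?E"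
      by (simp add: poly_altdef)
    ultimately have "(\<lambda>u. poly P (cayley (of_real u)) + cnj (poly Q (cayley (of_real u)))) \<in> hardy \<mu>"
      by (intro multiplier_in_hardy multipliers_add expfun_L2)
    then show "\<exists>Y\<in>closed_lin_span \<mu> ?E. L2_dist_sq \<mu> \<phi> Y < e" using PQ by (auto simp: hardy_def)
  qed
  then show ?thesis using closed_lin_span_L2 by (auto simp: hardy_def)
qed

end

section \<open>Finite logarithmic integral: annihilators\<close>

text \<open>Nonnegative frequencies give |exp(\<i> s z)| \<le> 1 in the upper half-plane. The
  extension is available for finite combinations, so contour deformation is carried out before
  passing to the closure.\<close>

lemma expfun_span_entire:
  assumes "X \<in> complex_lin_span (expfun ` {0..})"
  shows "\<exists>p C. p holomorphic_on UNIV \<and> (\<forall>u. p (of_real u) = X u) \<and> (\<forall>z. Im z \<ge> 0 \<longrightarrow> cmod (p z) \<le> C)"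
  using assms
proof (induction rule: complex_lin_span_induct)
  case zero
  then show ?case by (intro exI[of _ "\<lambda>_. 0"] exI[of _ 0]) auto
next
  case (step X Z a)
  then obtain p C where p: "p holomorphic_on UNIV" "\<And>u. p (of_real u) = X u" "\<And>z. Im z \<ge> 0 \<Longrightarrow> cmod (p z) \<le> C"
    by blast
  obtain s where s: "s \<ge> 0" "Z = expfun s" using step(2) by auto
  define q where "q z = p z + a * exp (\<i> * of_real s * z)" for z
  have "cmod (q z) \<le> C + cmod a" if "Im z \<ge> 0" for z
  proof -
    have "cmod (exp (\<i> * of_real s * z)) \<le> 1" using s that by simp
    then have "cmod (a * exp (\<i> * of_real s * z)) \<le> cmod a"
      by (simp add: norm_mult mult_left_le)
    then show ?thesis using p(3)[OF that] unfolding q_def by norm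
  qed
  moreover have "q holomorphic_on UNIV" unfolding q_def[abs_def] by (intro holomorphic_intros p)
  moreover have "q (of_real u) = X u + a * Z u" for u
    by (simp add: q_def p s expfun_def mult.assoc)
  ultimately show ?case by blast
qed

context decomposed_measure
begin

section \<open>Functions supported on Lebesgue null sets\<close>

text \<open>Re (P k) is driven towards - k on \<open>N\<close> and towards 0 elsewhere, so G k =
  exp(P k) dies out on \<open>N\<close>. Since \<open>N\<close> is Cauchy-null, Re (P k)(0) is close
  to 0; together with the upper bound 1 / (k + 1) for Re (P k) this forces G k -> 1 in the Cauchy
  mean square. Along a subsequence the limit in L2(\<open>\<mu>\<close>) is the indicator of the
  complement of \<open>N\<close>.\<close>

lemma null_indicator_in_hardy: "(\<lambda>u. indicator N u :: complex) \<in> hardy \<mu>"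
proof -
  let ?w = "\<lambda>u. cayley (complex_of_real u)"
  define v where "v k u = - real k * indicator N u" for k u
  define good where "good k P \<longleftrightarrow> Im (poly P 0) = 0 \<and> (\<forall>u. Re (poly P (?w u)) \<le> 1 / (real k + 1)) \<and>
    (\<integral>u. \<bar>v k u - Re (poly P (?w u))\<bar> \<partial>\<mu>) < 1 / (real k + 1) \<and>
    (\<integral>u. \<bar>v k u - Re (poly P (?w u))\<bar> \<partial>cauchy_measure) < 1 / (real k + 1) \<and>
    (\<forall>u. - real k - 1 / (real k + 1) \<le> Re (poly P (?w u)))" for k P
  have "\<exists>P. good k P" for k
  proof -
    have vm: "v k \<in> borel_measurable borel" unfolding v_def[abs_def] by measurable
    have vb: "- real k \<le> v k u" "v k u \<le> 0" for u by (auto simp: v_def indicator_def)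
    have e: "0 < 1 / (real k + 1)" by simp
    obtain P where "Im (poly P 0) = 0"
      "\<And>u. - real k - 1 / (real k + 1) \<le> Re (poly P (?w u))" "\<And>u. Re (poly P (?w u)) \<le> 0 + 1 / (real k + 1)"
      "(\<integral>u. \<bar>v k u - Re (poly P (?w u))\<bar> \<partial>\<mu>) < 1 / (real k + 1)"
      "(\<integral>u. \<bar>v k u - Re (poly P (?w u))\<bar> \<partial>cauchy_measure) < 1 / (real k + 1)"
      by (rule Re_poly_approx2[OF fin_\<mu> sets_eq cauchy.finite_measure_axioms sets_cauchy vm vb e]) (use that in blast)
    then have "good k P" by (simp add: good_def)
    then show ?thesis by blast
  qed
  then obtain P where "good k (P k)" for k by metis
  then have P: "\<And>k. Im (poly (P k) 0) = 0" "\<And>k u. Re (poly (P k) (?w u)) \<le> 1 / (real k + 1)"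
    "\<And>k. (\<integral>u. \<bar>v k u - Re (poly (P k) (?w u))\<bar> \<partial>\<mu>) < 1 / (real k + 1)"
    "\<And>k. (\<integral>u. \<bar>v k u - Re (poly (P k) (?w u))\<bar> \<partial>cauchy_measure) < 1 / (real k + 1)"
    "\<And>k u. - real k - 1 / (real k + 1) \<le> Re (poly (P k) (?w u))"
    by (simp_all add: good_def)
  have k1: "1 / (real k + 1) \<le> 1" for k by simp
  define G where "G k u = exp (poly (P k) (?w u))" for k u
  have Gm[measurable]: "G k \<in> borel_measurable borel" for k unfolding G_def[abs_def] by measurable
  have Gb: "cmod (G k u) \<le> exp 1" for k u
    using order_trans[OF P(2)[of k u] k1[of k]] by (simp add: G_def)
  have ReP0: "- (1 / (real k + 1)) \<le> Re (poly (P k) 0)" for k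
  proof -
    have vz: "AE u in cauchy_measure. v k u = 0"
      using AE_not_N by eventually_elim (auto simp: v_def)
    have "- Re (poly (P k) 0) = (\<integral>u. - Re (poly (P k) (?w u)) \<partial>cauchy_measure)"
      using Re_poly_0_eq_integral by simp
    also have "(\<integral>u. - Re (poly (P k) (?w u)) \<partial>cauchy_measure) \<le> (\<integral>u. \<bar>- Re (poly (P k) (?w u))\<bar> \<partial>cauchy_measure)"
      using Re_poly_0_eq_integral(2)[of "P k"] by (intro integral_mono) auto
    also have "(\<integral>u. \<bar>- Re (poly (P k) (?w u))\<bar> \<partial>cauchy_measure) = (\<integral>u. \<bar>v k u - Re (poly (P k) (?w u))\<bar> \<partial>cauchy_measure)"
      by (rule integral_cong_AE) (use vz in \<open>auto simp: v_def elim: eventually_mono\<close>)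
    finally show ?thesis using P(4)[of k] by linarith
  qed
  have a: "(\<integral>u. (cmod (G k u - 1))\<^sup>2 \<partial>cauchy_measure) \<le> exp (2 * (1 / (real k + 1))) + 1 - 2 * exp (- (1 / (real k + 1)))" for k
    using exp_poly_near_1(1)[OF P(1) P(2), of k] ReP0[of k] unfolding G_def
    by (smt (verit) exp_le_cancel_iff)
  have "(\<lambda>k. exp (2 * (1 / (real k + 1))) + 1 - 2 * exp (- (1 / (real k + 1)))) \<longlonglongrightarrow> 0" by real_asymp
  then have "(\<lambda>k. \<integral>u. (cmod (G k u - 1))\<^sup>2 \<partial>cauchy_measure) \<longlonglongrightarrow> 0"
    by (rule tendsto_sandwich[OF _ _ tendsto_const, rotated 2]) (use a in auto)
  moreover have "integrable cauchy_measure (\<lambda>u. (cmod (G k u - 1))\<^sup>2)" for k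
    using exp_poly_near_1(2)[OF P(1) P(2), of k] unfolding G_def .
  \<comment> \<open>Cauchy mean convergence does not pass directly to the possibly unbounded weight
    g; an almost everywhere convergent subsequence with dominated convergence does.\<close>
  ultimately obtain r :: "nat \<Rightarrow> nat" where r: "strict_mono r"
    "AE u in cauchy_measure. (\<lambda>n. (cmod (G (r n) u - 1))\<^sup>2) \<longlonglongrightarrow> 0"
    using tendsto_L1_AE_subseq[of cauchy_measure "\<lambda>k u. (cmod (G k u - 1))\<^sup>2"] by auto
  have conv: "AE u in \<mu>. u \<notin> N \<longrightarrow> (\<lambda>n. (cmod (G (r n) u - 1))\<^sup>2) \<longlonglongrightarrow> 0"
    by (rule AE_off_N[OF r(2)])
  have "(\<lambda>n. \<integral>u. indicator (- N) u * (cmod (G (r n) u - 1))\<^sup>2 \<partial>\<mu>) \<longlonglongrightarrow> (\<integral>u. 0 \<partial>\<mu>)"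
  proof (rule integral_dominated_convergence[where w="\<lambda>_. (exp 1 + 1)\<^sup>2"])
    show "AE u in \<mu>. (\<lambda>n. indicator (- N) u * (cmod (G (r n) u - 1))\<^sup>2) \<longlonglongrightarrow> 0"
      using conv by eventually_elim (auto simp: indicator_def)
    show "AE u in \<mu>. norm (indicator (- N) u * (cmod (G (r n) u - 1))\<^sup>2) \<le> (exp 1 + 1)\<^sup>2" for n
    proof (rule AE_I2)
      fix u
      have "cmod (G (r n) u - 1) \<le> exp 1 + 1"
        using norm_triangle_ineq4[of "G (r n) u" 1] Gb[of "r n" u] by simp
      then have "(cmod (G (r n) u - 1))\<^sup>2 \<le> (exp 1 + 1)\<^sup>2" by (intro power_mono) auto
      then show "norm (indicator (- N) u * (cmod (G (r n) u - 1))\<^sup>2) \<le> (exp 1 + 1)\<^sup>2"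
        by (auto simp: indicator_def)
    qed
  qed (auto simp: measurable_eq)
  then have lim1: "(\<lambda>n. \<integral>u. indicator (- N) u * (cmod (G (r n) u - 1))\<^sup>2 \<partial>\<mu>) \<longlonglongrightarrow> 0" by simp
  have G2: "(cmod (G k u))\<^sup>2 = exp (2 * Re (poly (P k) (?w u)))" for k u
    by (simp add: G_def exp_double)
  have iG: "integrable \<mu> (\<lambda>u. (cmod (G k u))\<^sup>2)" for k
    by (rule integrable_const_bound[where B="(exp 1)\<^sup>2"]) (use Gb in \<open>auto simp: measurable_eq intro!: AE_I2 power_mono\<close>)
  have iD: "integrable \<mu> (\<lambda>u. \<bar>v k u - Re (poly (P k) (?w u))\<bar>)" for k
  proof (rule integrable_const_bound[where B="2 * real k + 2"])
    show "AE u in \<mu>. norm \<bar>v k u - Re (poly (P k) (?w u))\<bar> \<le> 2 * real k + 2"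
    proof (rule AE_I2)
      fix u
      have "- real k \<le> v k u" "v k u \<le> 0" by (auto simp: v_def indicator_def)
      then have "\<bar>v k u - Re (poly (P k) (?w u))\<bar> \<le> 2 * real k + 2"
        using P(2)[of k u] P(5)[of k u] k1[of k] by linarith
      then show "norm \<bar>v k u - Re (poly (P k) (?w u))\<bar> \<le> 2 * real k + 2" by simp
    qed
    show "(\<lambda>u. \<bar>v k u - Re (poly (P k) (?w u))\<bar>) \<in> borel_measurable \<mu>"
      unfolding measurable_eq v_def by measurable
  qed
  have iN: "integrable \<mu> (\<lambda>u. indicator N u * (cmod (G k u))\<^sup>2)" for k
    using integrable_mult_indicator[OF _ iG, of N] by (simp add: sets_eq)
  have b: "(\<integral>u. indicator N u * (cmod (G k u))\<^sup>2 \<partial>\<mu>) \<le> exp (- 2 * real k) * measure \<mu> UNIV + exp 2 * (2 * (1 / (real k + 1)))" for k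
  proof -
    have "(\<integral>u. indicator N u * (cmod (G k u))\<^sup>2 \<partial>\<mu>) \<le> (\<integral>u. exp (- 2 * real k) + exp 2 * (2 * \<bar>v k u - Re (poly (P k) (?w u))\<bar>) \<partial>\<mu>)"
    proof (intro integral_mono iN)
      fix u
      show "indicator N u * (cmod (G k u))\<^sup>2 \<le> exp (- 2 * real k) + exp 2 * (2 * \<bar>v k u - Re (poly (P k) (?w u))\<bar>)"
      proof (cases "u \<in> N")
        case True
        have "exp (2 * Re (poly (P k) (?w u))) \<le> exp (2 * v k u) + exp 2 * \<bar>2 * v k u - 2 * Re (poly (P k) (?w u))\<bar>"
          by (rule exp_diff_le) (use order_trans[OF P(2)[of k u] k1[of k]] True in \<open>auto simp: v_def\<close>)
        moreover have "\<bar>2 * v k u - 2 * Re (poly (P k) (?w u))\<bar> = 2 * \<bar>v k u - Re (poly (P k) (?w u))\<bar>"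
          using abs_mult[of 2 "v k u - Re (poly (P k) (?w u))"] by (simp add: right_diff_distrib)
        ultimately show ?thesis using True by (simp add: G2 v_def)
      qed simp
    qed (use iD in auto)
    also have "\<dots> = exp (- 2 * real k) * measure \<mu> UNIV + exp 2 * (2 * (\<integral>u. \<bar>v k u - Re (poly (P k) (?w u))\<bar> \<partial>\<mu>))"
      using iD by (simp add: mult.commute)
    also have "\<dots> \<le> exp (- 2 * real k) * measure \<mu> UNIV + exp 2 * (2 * (1 / (real k + 1)))"
      using P(3)[of k] by (intro add_left_mono mult_left_mono) auto
    finally show ?thesis .
  qed
  have "(\<lambda>k. exp (- 2 * real k) * measure \<mu> UNIV + exp 2 * (2 * (1 / (real k + 1)))) \<longlonglongrightarrow> 0 * measure \<mu> UNIV + exp 2 * (2 * 0)"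
    by (intro tendsto_intros; real_asymp)
  then have "(\<lambda>k. exp (- 2 * real k) * measure \<mu> UNIV + exp 2 * (2 * (1 / (real k + 1)))) \<longlonglongrightarrow> 0" by simp
  then have "(\<lambda>k. \<integral>u. indicator N u * (cmod (G k u))\<^sup>2 \<partial>\<mu>) \<longlonglongrightarrow> 0"
    by (rule tendsto_sandwich[OF _ _ tendsto_const, rotated 2]) (use b in auto)
  from LIMSEQ_subseq_LIMSEQ[OF this r(1)]
  have lim2: "(\<lambda>n. \<integral>u. indicator N u * (cmod (G (r n) u))\<^sup>2 \<partial>\<mu>) \<longlonglongrightarrow> 0" by (simp add: o_def)
  have i1: "integrable \<mu> (\<lambda>u. indicator (- N) u * (cmod (G k u - 1))\<^sup>2)" for k
  proof -
    have "(\<lambda>u. G k u - 1) \<in> L2 \<mu>" by (intro L2_diff bounded_L2[OF Gm Gb] bounded_L2[where C=1]) auto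
    from integrable_mult_indicator[OF _ L2_integrable[OF this], of "- N"] show ?thesis by (simp add: sets_eq)
  qed
  have dist: "L2_dist_sq \<mu> (\<lambda>u. indicator (- N) u) (G k) =
    (\<integral>u. indicator (- N) u * (cmod (G k u - 1))\<^sup>2 \<partial>\<mu>) + (\<integral>u. indicator N u * (cmod (G k u))\<^sup>2 \<partial>\<mu>)" for k
  proof -
    have "(cmod (indicator (- N) u - G k u))\<^sup>2 = indicator (- N) u * (cmod (G k u - 1))\<^sup>2 + indicator N u * (cmod (G k u))\<^sup>2" for u
      by (auto simp: indicator_def norm_minus_commute)
    then show ?thesis unfolding L2_dist_sq_def using i1 iN by simp
  qed
  have lim: "(\<lambda>n. L2_dist_sq \<mu> (\<lambda>u. indicator (- N) u) (G (r n))) \<longlonglongrightarrow> 0"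
    unfolding dist using tendsto_add[OF lim1 lim2] by simp
  have GH: "G k \<in> hardy \<mu>" for k
    unfolding G_def[abs_def]
    by (intro multiplier_in_hardy entire_cayley_multiplier[of "\<lambda>z. exp (poly (P k) z)"] holomorphic_intros)
  have "(\<lambda>u. indicator (- N) u :: complex) \<in> hardy \<mu>"
    unfolding hardy_def
  proof (rule closed_lin_span_limit[OF expfun_L2 _ _ lim])
    show "(\<lambda>u. indicator (- N) u :: complex) \<in> L2 \<mu>" by (rule bounded_L2[where C=1]) (auto simp: indicator_def)
    show "G (r n) \<in> closed_lin_span \<mu> (expfun ` {0..})" for n using GH by (simp add: hardy_def)
  qed
  then have "(\<lambda>u. 1 + (-1) * indicator (- N) u :: complex) \<in> hardy \<mu>"
    using one_in_hardy unfolding hardy_def by (intro closed_lin_span_add closed_lin_span_scale expfun_L2)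
  moreover have "1 + (-1) * indicator (- N) u = (indicator N u :: complex)" for u by (simp add: indicator_def)
  ultimately show ?thesis by simp
qed

lemma null_indicator_multiplier: "(\<lambda>u. indicator N u :: complex) \<in> multipliers \<mu> (expfun ` {0..})"
proof (rule multipliersI[OF expfun_L2, where C=1])
  fix Z assume "Z \<in> expfun ` {0..}"
  then have "(\<lambda>u. Z u * indicator N u) \<in> hardy \<mu>"
    using multipliersD[OF expfun_multiplier, of _ "\<lambda>u. indicator N u"] null_indicator_in_hardy by (auto simp: hardy_def)
  then show "(\<lambda>u. indicator N u * Z u) \<in> closed_lin_span \<mu> (expfun ` {0..})"
    by (simp add: hardy_def mult.commute)
qed (auto simp: indicator_def measurable_eq)

text \<open>The restriction of \<open>\<mu>\<close> to \<open>N\<close> has density 0, so the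
  infinite case applies to it and nonnegative frequencies are dense in its L2. Multiplying the
  approximants by the indicator of \<open>N\<close>, which is a multiplier, leads back to
  \<open>\<mu>\<close>.\<close>

lemma singular_part_in_hardy:
  assumes \<phi>: "\<phi> \<in> L2 \<mu>"
  shows "(\<lambda>u. indicator N u * \<phi> u) \<in> hardy \<mu>"
proof -
  define \<sigma> where "\<sigma> = density \<mu> (\<lambda>u. ennreal (indicator N u))"
  have \<sigma>sets: "sets \<sigma> = sets borel" by (simp add: \<sigma>_def sets_eq)
  have "\<sigma> = density \<mu> (indicator N)" unfolding \<sigma>_def by (simp add: ennreal_indicator)
  then have "emeasure \<sigma> UNIV = emeasure \<mu> (N \<inter> UNIV)"
    by (simp only:) (rule emeasure_restricted, simp_all add: sets_eq)
  also have "\<dots> \<le> emeasure \<mu> UNIV" by (rule emeasure_mono) (simp_all add: sets_eq)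
  also have "emeasure \<mu> UNIV < \<infinity>" by (simp add: emeasure_eq_measure)
  finally have "emeasure \<sigma> (space \<sigma>) \<noteq> \<infinity>" using sets_eq_imp_space_eq[OF \<sigma>sets] by simp
  then have fin: "finite_measure \<sigma>" by (rule finite_measureI)
  interpret s: borel_finite_measure \<sigma>
    using fin \<sigma>sets by (intro borel_finite_measure.intro borel_finite_measure_axioms.intro)
  interpret s: decomposed_measure \<sigma> "\<lambda>_. 0" N
  proof
    have "density \<sigma> (\<lambda>u. ennreal (indicator (- N) u)) = density \<mu> (\<lambda>u. ennreal (indicator N u) * ennreal (indicator (- N) u))"
      unfolding \<sigma>_def by (rule density_density_eq) (simp_all add: measurable_eq)
    also have "(\<lambda>u. ennreal (indicator N u) * ennreal (indicator (- N) u)) = (\<lambda>u. 0)" by (auto simp: indicator_def)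
    also have "density \<mu> (\<lambda>u. 0) = density cauchy_measure (\<lambda>u. ennreal 0)"
      by (rule measure_eqI) (auto simp: sets_eq emeasure_density)
    finally show "density \<sigma> (\<lambda>u. ennreal (indicator (- N) u)) = density cauchy_measure (\<lambda>u. ennreal 0)" .
  qed (use N_null in auto)
  have H: "hardy \<sigma> = L2 \<sigma>"
  proof (rule s.hardy_eq_L2)
    fix C :: real
    \<comment> \<open>For density 0 the integrand is the constant - ln \<delta>, hence this choice
      of \<delta>.\<close>
    have "C \<le> (\<integral>u. - ln (max (min 1 (exp (- C))) (min 1 0)) \<partial>cauchy_measure)"
      by (simp add: cauchy.prob_space[simplified] min_def max_def)
    then show "\<exists>\<delta>>0. \<delta> \<le> 1 \<and> C \<le> (\<integral>u. - ln (max \<delta> (min 1 0)) \<partial>cauchy_measure)"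
      by (intro exI[of _ "min 1 (exp (- C))"]) auto
  qed
  note [measurable] = L2_measurable[OF \<phi>, unfolded measurable_eq]
  have \<phi>\<sigma>: "\<phi> \<in> L2 \<sigma>"
  proof -
    have "integrable \<mu> (\<lambda>u. indicator N u *\<^sub>R (cmod (\<phi> u))\<^sup>2)"
      by (rule integrable_mult_indicator[OF _ L2_integrable[OF \<phi>]]) (simp add: sets_eq)
    then have "integrable \<sigma> (\<lambda>u. (cmod (\<phi> u))\<^sup>2)"
      unfolding \<sigma>_def by (subst integrable_density) (auto simp: measurable_eq)
    then show ?thesis by (simp add: L2_def s.measurable_eq)
  qed
  show ?thesis
    unfolding hardy_def
  proof (rule closed_lin_span_closed[OF expfun_L2])
    show "(\<lambda>u. indicator N u * \<phi> u) \<in> L2 \<mu>" by (rule L2_mult_bounded[OF \<phi>, where C=1]) (auto simp: indicator_def measurable_eq)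
    fix e :: real assume "e > 0"
    have "\<phi> \<in> hardy \<sigma>" using \<phi>\<sigma> H by simp
    then obtain p where p: "p \<in> complex_lin_span (expfun ` {0..})" "L2_dist_sq \<sigma> \<phi> p < e"
      using \<open>e > 0\<close> unfolding hardy_def closed_lin_span_def by blast
    have pH: "p \<in> closed_lin_span \<mu> (expfun ` {0..})" by (rule closed_lin_span_span[OF expfun_L2 p(1)])
    note [measurable] = L2_measurable[OF closed_lin_span_L2[OF pH], unfolded measurable_eq]
    have "L2_dist_sq \<sigma> \<phi> p = (\<integral>u. indicator N u *\<^sub>R (cmod (\<phi> u - p u))\<^sup>2 \<partial>\<mu>)"
      unfolding L2_dist_sq_def \<sigma>_def by (subst integral_density) (auto simp: measurable_eq)
    also have "\<dots> = L2_dist_sq \<mu> (\<lambda>u. indicator N u * \<phi> u) (\<lambda>u. indicator N u * p u)"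
      unfolding L2_dist_sq_def
    proof (rule Bochner_Integration.integral_cong[OF refl])
      fix u show "indicator N u *\<^sub>R (cmod (\<phi> u - p u))\<^sup>2 = (cmod (indicator N u * \<phi> u - indicator N u * p u))\<^sup>2"
        by (cases "u \<in> N") simp_all
    qed
    finally have "L2_dist_sq \<mu> (\<lambda>u. indicator N u * \<phi> u) (\<lambda>u. indicator N u * p u) < e" using p(2) by simp
    then show "\<exists>Y\<in>closed_lin_span \<mu> (expfun ` {0..}). L2_dist_sq \<mu> (\<lambda>u. indicator N u * \<phi> u) Y < e"
      using multipliersD[OF null_indicator_multiplier pH] by blast
  qed
qed

text \<open>The weight \<open>g + \<eta>\<close> controls \<open>\<phi> - p\<close>, while the outer factor \<open>G\<close> with \<open>|G|\<^sup>2\<close> close to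
  \<open>min 1 (j (g + \<eta>))\<close> controls the passage back to the Cauchy measure and tends to \<open>1\<close> as \<open>j\<close> grows.\<close>

lemma hardy_annihilator_bound:
  assumes gpos: "AE u in cauchy_measure. 0 < g u"
    and log: "integrable cauchy_measure (\<lambda>u. ln (min 1 (g u)))"
    and \<phi>m[measurable]: "\<phi> \<in> borel_measurable borel" and \<phi>b: "\<And>u. cmod (\<phi> u) \<le> 1" and \<phi>: "\<phi> \<in> hardy \<mu>"
    and h: "h holomorphic_on UNIV"
    and hb: "\<And>z. Im z \<ge> 0 \<Longrightarrow> cmod z \<ge> 1 \<Longrightarrow> cmod (h z) \<le> K / (cmod z)\<^sup>2"
    and H: "\<And>u. (1 + u\<^sup>2) * cmod (h (of_real u)) \<le> C" "C \<ge> 0"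
    and j: "j \<ge> (1::real)" and e: "0 < e" "e \<le> 1"
  shows "cmod (\<integral>u. \<phi> u * h (of_real u) \<partial>lborel) \<le> pi * C * (sqrt (2 * e * (j + 1)) +
     sqrt (exp (2 * e) + 1 - 2 * exp ((\<integral>u. ln (min 1 (j * g u)) \<partial>cauchy_measure) / 2 - e)))"
    (is "_ \<le> _ * (_ + sqrt ?rhs)")
proof -
  let ?w = "\<lambda>u. cayley (complex_of_real u)"
  let ?c = cauchy_measure
  \<comment> \<open>h relative to the Cauchy density; its boundedness is what the quadratic decay of
    h provides.\<close>
  define H' where "H' u = of_real (pi * (1 + u\<^sup>2)) * h (of_real u)" for u :: real
  have hm[measurable]: "(\<lambda>u. h (of_real u)) \<in> borel_measurable borel"
    by (rule borel_measurable_continuous_onI)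
       (rule continuous_on_compose2[OF holomorphic_on_imp_continuous_on[OF h]], auto intro!: continuous_intros)
  have H'm[measurable]: "H' \<in> borel_measurable borel" unfolding H'_def[abs_def] by measurable
  have H'b: "cmod (H' u) \<le> pi * C" for u
  proof -
    have "cmod (H' u) = pi * ((1 + u\<^sup>2) * cmod (h (of_real u)))"
      by (simp only: H'_def norm_mult norm_of_real) (simp add: abs_mult)
    then show ?thesis using H(1)[of u] by (simp add: mult_left_mono)
  qed
  have toc: "(\<integral>u. F u * H' u \<partial>?c) = (\<integral>u. F u * h (of_real u) \<partial>lborel)" if [measurable]: "F \<in> borel_measurable borel" for F
  proof -
    have "(\<integral>u. F u * H' u \<partial>?c) = (\<integral>u. (1 / (pi * (1 + u\<^sup>2))) *\<^sub>R (F u * H' u) \<partial>lborel)"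
      by (rule integral_cauchy) measurable
    also have "\<dots> = (\<integral>u. F u * h (of_real u) \<partial>lborel)"
    proof (rule Bochner_Integration.integral_cong[OF refl])
      fix u :: real
      have "(1 / (pi * (1 + u\<^sup>2))) *\<^sub>R (F u * H' u) = of_real ((1 / (pi * (1 + u\<^sup>2))) * (pi * (1 + u\<^sup>2))) * (F u * h (of_real u))"
        by (simp only: H'_def scaleR_conv_of_real of_real_mult mult_ac)
      also have "(1 / (pi * (1 + u\<^sup>2))) * (pi * (1 + u\<^sup>2)) = 1" by simp
      finally show "(1 / (pi * (1 + u\<^sup>2))) *\<^sub>R (F u * H' u) = F u * h (of_real u)" by simp
    qed
    finally show ?thesis .
  qed
  obtain p where p: "p \<in> complex_lin_span (expfun ` {0..})" "L2_dist_sq \<mu> \<phi> p < e"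
    using \<phi> e by (auto simp: hardy_def closed_lin_span_def)
  obtain q Cp where q: "q holomorphic_on UNIV" "\<And>u. q (of_real u) = p u" "\<And>z. Im z \<ge> 0 \<Longrightarrow> cmod (q z) \<le> Cp"
    using expfun_span_entire[OF p(1)] by blast
  have Cp: "Cp \<ge> 0" using order_trans[OF norm_ge_zero q(3)[of 0]] by simp
  have pb: "cmod (p u) \<le> Cp" for u using q(3)[of "of_real u"] q(2) by simp
  have pm[measurable]: "p \<in> borel_measurable borel"
    using L2_measurable[OF complex_lin_span_L2[OF expfun_L2 p(1)]] by (simp add: measurable_eq)
  define d where "d u = (cmod (\<phi> u - p u))\<^sup>2" for u
  have dm[measurable]: "d \<in> borel_measurable borel" unfolding d_def[abs_def] by measurable
  have d0: "0 \<le> d u" for u by (simp add: d_def)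
  have db: "d u \<le> (1 + Cp)\<^sup>2" for u
  proof -
    have "cmod (\<phi> u - p u) \<le> 1 + Cp" using norm_triangle_ineq4[of "\<phi> u" "p u"] \<phi>b[of u] pb[of u] by linarith
    then show ?thesis unfolding d_def by (intro power_mono) auto
  qed
  have id\<mu>: "integrable \<mu> d"
    by (rule integrable_const_bound[where B="(1 + Cp)\<^sup>2"]) (use d0 db in \<open>auto simp: measurable_eq\<close>)
  have idc: "integrable ?c d"
    by (rule cauchy.integrable_const_bound[where B="(1 + Cp)\<^sup>2"]) (use d0 db in auto)
  have igd: "integrable ?c (\<lambda>u. g u * d u)" by (rule integral_off_N(1)[OF dm id\<mu>])
  have gd: "(\<integral>u. g u * d u \<partial>?c) < e"
  proof -
    have "(\<integral>u. g u * d u \<partial>?c) = (\<integral>u. indicator (- N) u * d u \<partial>\<mu>)" by (rule integral_off_N(2)[OF dm id\<mu>, symmetric])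
    also have "\<dots> \<le> (\<integral>u. d u \<partial>\<mu>)"
      using integrable_mult_indicator[OF _ id\<mu>, of "- N"]
      by (intro integral_mono id\<mu>) (auto simp: sets_eq indicator_def d0)
    also have "\<dots> = L2_dist_sq \<mu> \<phi> p" by (simp add: L2_dist_sq_def d_def)
    finally show ?thesis using p(2) by simp
  qed
  define D where "D = (\<integral>u. d u \<partial>?c)"
  have D: "D \<ge> 0" unfolding D_def using d0 by simp
  \<comment> \<open>Chosen after p, since D depends on p; \<eta> D \<le> e keeps the error with
    weight g + \<eta> below 2 e.\<close>
  define \<eta> where "\<eta> = e / (D + 1)"
  have \<eta>: "\<eta> > 0" "\<eta> * D \<le> e"
    using D e by (auto simp: \<eta>_def divide_simps mult_left_mono)
  define c where "c u = min 1 (j * (g u + \<eta>))" for u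
  have cm[measurable]: "c \<in> borel_measurable borel" unfolding c_def[abs_def] by measurable
  define c0 where "c0 = min 1 (j * \<eta>)"
  have c0: "c0 > 0" "c0 \<le> c u" "c u \<le> 1" "0 < c u" for u
  proof -
    show "c0 > 0" using j \<eta> by (simp add: c0_def)
    show "c0 \<le> c u" using j g_nonneg[of u] by (auto simp: c0_def c_def min_def mult_left_mono distrib_left intro: add_increasing)
    then show "0 < c u" using \<open>c0 > 0\<close> by linarith
    show "c u \<le> 1" by (simp add: c_def)
  qed
  define v where "v u = ln (c u) / 2" for u
  have vm[measurable]: "v \<in> borel_measurable borel" unfolding v_def[abs_def] by measurable
  have vb: "ln c0 / 2 \<le> v u" "v u \<le> 0" for u using c0 by (auto simp: v_def)
  \<comment> \<open>In the integral of |G|^2 / (g + \<eta>) the error of approximation is divided by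
    at least \<eta>; this choice lets it cost at most 1.\<close>
  define e' where "e' = min e (\<eta> / (2 * exp 2))"
  have e': "e' > 0" "e' \<le> e" "e' \<le> 1" "exp 2 * 2 * e' \<le> \<eta>"
  proof -
    have "e' \<le> \<eta> / (2 * exp 2)" by (simp add: e'_def)
    then show "exp 2 * 2 * e' \<le> \<eta>" by (simp add: pos_le_divide_eq mult_ac)
  qed (use e \<eta> in \<open>auto simp: e'_def\<close>)
  obtain P where P: "Im (poly P 0) = 0"
    "\<And>u. ln c0 / 2 - e' \<le> Re (poly P (?w u))" "\<And>u. Re (poly P (?w u)) \<le> 0 + e'"
    "(\<integral>u. \<bar>v u - Re (poly P (?w u))\<bar> \<partial>?c) < e'"
    by (rule Re_poly_approx[OF cauchy.finite_measure_axioms sets_cauchy vm vb e'(1)]) (use that in blast)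
  define G where "G u = exp (poly P (?w u))" for u
  have Gm[measurable]: "G \<in> borel_measurable borel" unfolding G_def[abs_def] by measurable
  have G2: "(cmod (G u))\<^sup>2 = exp (2 * Re (poly P (?w u)))" for u by (simp add: G_def exp_double)
  have Gb: "cmod (G u) \<le> exp 1" for u using P(3)[of u] e' by (simp add: G_def)
  have vi: "integrable ?c v"
  proof (rule cauchy.integrable_const_bound[where B="- (ln c0 / 2)"])
    show "AE u in ?c. norm (v u) \<le> - (ln c0 / 2)" using vb by (auto simp: abs_le_iff intro: order_trans[OF vb(2)])
  qed simp
  have iD: "integrable ?c (\<lambda>u. \<bar>v u - Re (poly P (?w u))\<bar>)"
    using vi Re_poly_0_eq_integral(2)[of P] by simp
  define Lj where "Lj = (\<integral>u. ln (min 1 (j * g u)) \<partial>?c)"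
  \<comment> \<open>As c is at least min 1 (j g), the mean of v has a lower bound in terms of j and
    g alone, independent of e, p and \<eta>.\<close>
  have Lj: "Lj / 2 \<le> (\<integral>u. v u \<partial>?c)"
  proof -
    have "Lj \<le> (\<integral>u. 2 * v u \<partial>?c)"
      unfolding Lj_def
    proof (rule integral_mono_AE)
      show "integrable ?c (\<lambda>u. ln (min 1 (j * g u)))"
      proof (rule Bochner_Integration.integrable_bound[OF log])
        show "AE u in ?c. norm (ln (min 1 (j * g u))) \<le> norm (ln (min 1 (g u)))"
          using gpos
        proof eventually_elim
          case (elim u)
          have "g u \<le> j * g u" using j elim by simp
          then have "min 1 (g u) \<le> min 1 (j * g u)" "min 1 (j * g u) \<le> 1" by linarith+
          moreover have "0 < min 1 (g u)" using elim by simp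
          ultimately have "ln (min 1 (g u)) \<le> ln (min 1 (j * g u))" "ln (min 1 (j * g u)) \<le> 0"
            by (auto simp del: min_less_iff_conj)
          then show ?case by simp
        qed
      qed simp
      show "AE u in ?c. ln (min 1 (j * g u)) \<le> 2 * v u"
        using gpos
      proof eventually_elim
        case (elim u)
        have "0 < j * g u" using j elim by simp
        moreover have "j * g u \<le> j * (g u + \<eta>)" using j \<eta> by simp
        ultimately have "ln (min 1 (j * g u)) \<le> ln (c u)"
          unfolding c_def by (subst ln_le_cancel_iff) auto
        then show ?case by (simp add: v_def)
      qed
    qed (use vi in auto)
    then show ?thesis by simp
  qed
  have ReP0: "Lj / 2 - e \<le> Re (poly P 0)"
  proof -
    have "(\<integral>u. v u \<partial>?c) - Re (poly P 0) = (\<integral>u. v u - Re (poly P (?w u)) \<partial>?c)"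
      using vi Re_poly_0_eq_integral by simp
    also have "\<dots> \<le> (\<integral>u. \<bar>v u - Re (poly P (?w u))\<bar> \<partial>?c)"
      using vi Re_poly_0_eq_integral(2)[of P] by (intro integral_mono) auto
    finally show ?thesis using P(4) Lj e' by linarith
  qed
  have near1: "(\<integral>u. (cmod (G u - 1))\<^sup>2 \<partial>?c) \<le> ?rhs"
  proof -
    have "(\<integral>u. (cmod (G u - 1))\<^sup>2 \<partial>?c) \<le> exp (2 * e') + 1 - 2 * exp (Re (poly P 0))"
      using exp_poly_near_1(1)[OF P(1), of e'] P(3) unfolding G_def by simp
    moreover have "exp (2 * e') \<le> exp (2 * e)" using e' by simp
    moreover have "exp (Lj / 2 - e) \<le> exp (Re (poly P 0))" using ReP0 by simp
    ultimately show ?thesis unfolding Lj_def by linarith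
  qed
  have giP: "(\<integral>u. (cmod (G u))\<^sup>2 / (g u + \<eta>) \<partial>?c) \<le> j + 1"
    "integrable ?c (\<lambda>u. (cmod (G u))\<^sup>2 / (g u + \<eta>))"
  proof -
    have pw: "(cmod (G u))\<^sup>2 / (g u + \<eta>) \<le> j + (exp 2 * 2 / \<eta>) * \<bar>v u - Re (poly P (?w u))\<bar>" for u
    proof -
      have gp: "g u + \<eta> > 0" using g_nonneg[of u] \<eta> by linarith
      have "exp (2 * Re (poly P (?w u))) \<le> exp (2 * v u) + exp 2 * \<bar>2 * v u - 2 * Re (poly P (?w u))\<bar>"
        by (rule exp_diff_le) (use P(3)[of u] vb(2)[of u] e' in auto)
      moreover have "exp (2 * v u) = c u" using c0(4)[of u] by (simp add: v_def)
      moreover have "\<bar>2 * v u - 2 * Re (poly P (?w u))\<bar> = 2 * \<bar>v u - Re (poly P (?w u))\<bar>"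
        using abs_mult[of 2 "v u - Re (poly P (?w u))"] by (simp add: right_diff_distrib)
      ultimately have "(cmod (G u))\<^sup>2 \<le> c u + exp 2 * 2 * \<bar>v u - Re (poly P (?w u))\<bar>"
        unfolding G2 by simp
      moreover have "c u \<le> j * (g u + \<eta>)" by (simp add: c_def)
      ultimately have "(cmod (G u))\<^sup>2 \<le> j * (g u + \<eta>) + exp 2 * 2 * \<bar>v u - Re (poly P (?w u))\<bar>"
        by linarith
      then have "(cmod (G u))\<^sup>2 / (g u + \<eta>) \<le> (j * (g u + \<eta>) + exp 2 * 2 * \<bar>v u - Re (poly P (?w u))\<bar>) / (g u + \<eta>)"
        using gp by (intro divide_right_mono) auto
      also have "\<dots> = j + exp 2 * 2 * \<bar>v u - Re (poly P (?w u))\<bar> / (g u + \<eta>)"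
        using gp by (simp add: add_divide_distrib)
      also have "exp 2 * 2 * \<bar>v u - Re (poly P (?w u))\<bar> / (g u + \<eta>) \<le> exp 2 * 2 * \<bar>v u - Re (poly P (?w u))\<bar> / \<eta>"
        using \<eta> g_nonneg[of u] gp by (intro divide_left_mono mult_pos_pos) auto
      finally show ?thesis by simp
    qed
    show i: "integrable ?c (\<lambda>u. (cmod (G u))\<^sup>2 / (g u + \<eta>))"
    proof (rule Bochner_Integration.integrable_bound)
      show "integrable ?c (\<lambda>u. j + (exp 2 * 2 / \<eta>) * \<bar>v u - Re (poly P (?w u))\<bar>)" using iD by simp
      show "AE u in ?c. norm ((cmod (G u))\<^sup>2 / (g u + \<eta>)) \<le> norm (j + (exp 2 * 2 / \<eta>) * \<bar>v u - Re (poly P (?w u))\<bar>)"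
      proof (rule AE_I2)
        fix u
        have "0 \<le> (cmod (G u))\<^sup>2 / (g u + \<eta>)" using g_nonneg[of u] \<eta> by simp
        then show "norm ((cmod (G u))\<^sup>2 / (g u + \<eta>)) \<le> norm (j + (exp 2 * 2 / \<eta>) * \<bar>v u - Re (poly P (?w u))\<bar>)"
          by (simp only: real_norm_def abs_of_nonneg) (rule order_trans[OF pw abs_ge_self])
      qed
    qed simp
    have "(\<integral>u. (cmod (G u))\<^sup>2 / (g u + \<eta>) \<partial>?c) \<le> (\<integral>u. j + (exp 2 * 2 / \<eta>) * \<bar>v u - Re (poly P (?w u))\<bar> \<partial>?c)"
      by (intro integral_mono i pw) (use iD in simp)
    also have "\<dots> = j + (exp 2 * 2 / \<eta>) * (\<integral>u. \<bar>v u - Re (poly P (?w u))\<bar> \<partial>?c)"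
      using iD by (simp add: cauchy.prob_space[simplified])
    also have "\<dots> \<le> j + (exp 2 * 2 / \<eta>) * e'"
      using P(4) \<eta> by (intro add_left_mono mult_left_mono) auto
    also have "\<dots> \<le> j + 1" using e'(4) \<eta> by (simp add: field_simps)
    finally show "(\<integral>u. (cmod (G u))\<^sup>2 / (g u + \<eta>) \<partial>?c) \<le> j + 1" .
  qed
  have cL2: "b \<in> L2 ?c" if "b \<in> borel_measurable borel" "\<And>u. cmod (b u) \<le> B" for b B
    using finite_measure.L2_bounded[OF cauchy.finite_measure_axioms, of b B] that by simp
  \<comment> \<open>The extension of p and exp(P(cayley z)) are bounded in the upper half-plane, so
    their product with h inherits the quadratic decay.\<close>
  have T1: "(\<integral>u. p u * G u * H' u \<partial>?c) = 0"
  proof -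
    have "(\<lambda>z. exp (poly P z)) holomorphic_on UNIV" by (intro holomorphic_intros)
    then obtain CG where CG: "CG \<ge> 0" "\<And>z. cmod z \<le> 1 \<Longrightarrow> cmod (exp (poly P z)) \<le> CG"
      by (rule entire_bounded_disc) (rule that)
    have "(\<integral>u. q (of_real u) * exp (poly P (cayley (of_real u))) * h (of_real u) \<partial>lborel) = 0"
    proof (rule integral_real_line_eq_0(2)[where c="-1" and K="Cp * CG * K" and f="\<lambda>z. q z * exp (poly P (cayley z)) * h z"])
      show "(\<lambda>z. q z * exp (poly P (cayley z)) * h z) holomorphic_on {z. Im z > -1}"
        by (intro holomorphic_intros holomorphic_on_subset[OF q(1)] holomorphic_on_subset[OF h] cayley_holomorphic) auto
      fix z assume z: "Im z \<ge> 0" "cmod z \<ge> 1"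
      have "cmod (exp (poly P (cayley z))) \<le> CG" by (intro CG cmod_cayley_le_1 z)
      then have "cmod (q z) * cmod (exp (poly P (cayley z))) * cmod (h z) \<le> Cp * CG * (K / (cmod z)\<^sup>2)"
        using q(3)[OF z(1)] hb[OF z] Cp CG(1) by (intro mult_mono mult_nonneg_nonneg) auto
      then show "cmod (q z * exp (poly P (cayley z)) * h z) \<le> Cp * CG * K / (cmod z)\<^sup>2"
        by (simp add: norm_mult)
    qed simp
    then show ?thesis
      using toc[of "\<lambda>u. p u * G u"] by (simp add: q(2) G_def)
  qed
  \<comment> \<open>Cauchy-Schwarz after multiplying and dividing by sqrt (g + \<eta>): one factor
    sees the small error, the other |G|^2 / (g + \<eta>).\<close>
  have T2: "cmod (\<integral>u. (\<phi> u - p u) * G u * H' u \<partial>?c) \<le> pi * C * sqrt (2 * e * (j + 1))"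
  proof -
    define X where "X u = of_real (sqrt (g u + \<eta>)) * (\<phi> u - p u)" for u
    define Y where "Y u = G u * H' u / of_real (sqrt (g u + \<eta>))" for u
    have gp: "g u + \<eta> > 0" for u using g_nonneg[of u] \<eta> by (simp add: add_nonneg_pos)
    have Xm[measurable]: "X \<in> borel_measurable borel" "Y \<in> borel_measurable borel"
      unfolding X_def[abs_def] Y_def[abs_def] by measurable
    have X2: "(cmod (X u))\<^sup>2 = g u * d u + \<eta> * d u" for u
      using gp[of u] by (simp add: X_def d_def norm_mult power_mult_distrib distrib_right)
    have Y2: "(cmod (Y u))\<^sup>2 \<le> (pi * C)\<^sup>2 * ((cmod (G u))\<^sup>2 / (g u + \<eta>))" for u
    proof -
      have "(cmod (Y u))\<^sup>2 = (cmod (H' u))\<^sup>2 * ((cmod (G u))\<^sup>2 / (g u + \<eta>))"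
        using gp[of u] by (simp add: Y_def norm_mult norm_divide power_mult_distrib power_divide)
      also have "\<dots> \<le> (pi * C)\<^sup>2 * ((cmod (G u))\<^sup>2 / (g u + \<eta>))"
        using gp[of u] H'b[of u] by (intro mult_right_mono power_mono divide_nonneg_pos) auto
      finally show ?thesis .
    qed
    have XL: "X \<in> L2 ?c" using igd idc by (simp add: L2_def X2)
    have YL: "Y \<in> L2 ?c"
    proof -
      have "integrable ?c (\<lambda>u. (cmod (Y u))\<^sup>2)"
      proof (rule Bochner_Integration.integrable_bound[OF integrable_mult_right[OF giP(2), of "(pi * C)\<^sup>2"]])
        show "AE u in ?c. norm ((cmod (Y u))\<^sup>2) \<le> norm ((pi * C)\<^sup>2 * ((cmod (G u))\<^sup>2 / (g u + \<eta>)))"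
          by (rule AE_I2) (simp only: real_norm_def abs_of_nonneg zero_le_power2, rule order_trans[OF Y2 abs_ge_self])
      qed simp
      then show ?thesis by (simp add: L2_def)
    qed
    have XY: "X u * Y u = (\<phi> u - p u) * G u * H' u" for u
      using gp[of u] by (simp add: X_def Y_def)
    have "(\<integral>u. (cmod (X u))\<^sup>2 \<partial>?c) \<le> 2 * e"
      unfolding X2 using igd idc gd \<eta>(2) by (simp add: D_def[symmetric])
    moreover have "(\<integral>u. (cmod (Y u))\<^sup>2 \<partial>?c) \<le> (pi * C)\<^sup>2 * (j + 1)"
    proof -
      have "(\<integral>u. (cmod (Y u))\<^sup>2 \<partial>?c) \<le> (\<integral>u. (pi * C)\<^sup>2 * ((cmod (G u))\<^sup>2 / (g u + \<eta>)) \<partial>?c)"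
        by (intro integral_mono L2_integrable[OF YL] integrable_mult_right giP(2) Y2)
      also have "\<dots> = (pi * C)\<^sup>2 * (\<integral>u. (cmod (G u))\<^sup>2 / (g u + \<eta>) \<partial>?c)"
        by (rule integral_mult_right_zero)
      also have "\<dots> \<le> (pi * C)\<^sup>2 * (j + 1)" by (intro mult_left_mono giP(1)) simp
      finally show ?thesis .
    qed
    ultimately have "(\<integral>u. (cmod (X u))\<^sup>2 \<partial>?c) * (\<integral>u. (cmod (Y u))\<^sup>2 \<partial>?c) \<le> (2 * e) * ((pi * C)\<^sup>2 * (j + 1))"
      using e by (intro mult_mono) auto
    then have "(cmod (\<integral>u. (\<phi> u - p u) * G u * H' u \<partial>?c))\<^sup>2 \<le> (pi * C)\<^sup>2 * (2 * e * (j + 1))"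
      using order_trans[OF L2_Cauchy_Schwarz[OF XL YL]] unfolding XY by (simp only: mult_ac)
    then have "cmod (\<integral>u. (\<phi> u - p u) * G u * H' u \<partial>?c) \<le> sqrt ((pi * C)\<^sup>2 * (2 * e * (j + 1)))"
      by (rule real_le_rsqrt)
    then show ?thesis using H(2) by (simp add: real_sqrt_mult)
  qed
  have T3: "cmod (\<integral>u. \<phi> u * H' u * (1 - G u) \<partial>?c) \<le> pi * C * sqrt ?rhs"
  proof -
    have XL: "(\<lambda>u. \<phi> u * H' u) \<in> L2 ?c"
    proof (rule cL2[where B="pi * C"])
      show "cmod (\<phi> u * H' u) \<le> pi * C" for u
        using mult_mono[OF \<phi>b H'b, of u u] by (simp add: norm_mult)
    qed simp
    have YL: "(\<lambda>u. 1 - G u) \<in> L2 ?c" by (intro L2_diff cL2[OF Gm Gb] cL2[where B=1]) auto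
    have "(\<integral>u. (cmod (\<phi> u * H' u))\<^sup>2 \<partial>?c) \<le> (\<integral>u. (pi * C)\<^sup>2 \<partial>?c)"
    proof (intro integral_mono L2_integrable[OF XL])
      fix u show "(cmod (\<phi> u * H' u))\<^sup>2 \<le> (pi * C)\<^sup>2"
        using mult_mono[OF \<phi>b H'b, of u u] by (intro power_mono) (auto simp: norm_mult)
    qed simp
    then have "(\<integral>u. (cmod (\<phi> u * H' u))\<^sup>2 \<partial>?c) \<le> (pi * C)\<^sup>2" by (simp add: cauchy.prob_space[simplified])
    moreover have "(\<integral>u. (cmod (1 - G u))\<^sup>2 \<partial>?c) \<le> ?rhs" using near1 by (simp add: norm_minus_commute)
    ultimately have "(\<integral>u. (cmod (\<phi> u * H' u))\<^sup>2 \<partial>?c) * (\<integral>u. (cmod (1 - G u))\<^sup>2 \<partial>?c) \<le> (pi * C)\<^sup>2 * ?rhs"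
      by (intro mult_mono) auto
    then have "(cmod (\<integral>u. \<phi> u * H' u * (1 - G u) \<partial>?c))\<^sup>2 \<le> (pi * C)\<^sup>2 * ?rhs"
      using L2_Cauchy_Schwarz[OF XL YL] by linarith
    then have "cmod (\<integral>u. \<phi> u * H' u * (1 - G u) \<partial>?c) \<le> sqrt ((pi * C)\<^sup>2 * ?rhs)"
      by (rule real_le_rsqrt)
    then show ?thesis using H(2) by (simp add: real_sqrt_mult)
  qed
  have bint: "integrable ?c b" if "b \<in> borel_measurable borel" "\<And>u. cmod (b u) \<le> B" for b :: "real \<Rightarrow> complex" and B
    by (rule cauchy.integrable_const_bound[where B=B]) (use that in auto)
  have i1: "integrable ?c (\<lambda>u. p u * G u * H' u)"
    by (rule bint[where B="Cp * exp 1 * (pi * C)"])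
       (use pb Gb H'b Cp in \<open>auto simp: norm_mult intro!: mult_mono\<close>)
  have i2: "integrable ?c (\<lambda>u. (\<phi> u - p u) * G u * H' u)"
  proof (rule bint[where B="(1 + Cp) * exp 1 * (pi * C)"])
    fix u
    have "cmod (\<phi> u - p u) \<le> 1 + Cp" using norm_triangle_ineq4[of "\<phi> u" "p u"] \<phi>b[of u] pb[of u] by linarith
    then show "cmod ((\<phi> u - p u) * G u * H' u) \<le> (1 + Cp) * exp 1 * (pi * C)"
      using Gb[of u] H'b[of u] Cp by (auto simp: norm_mult intro!: mult_mono)
  qed simp
  have i3: "integrable ?c (\<lambda>u. \<phi> u * H' u * (1 - G u))"
  proof (rule bint[where B="1 * (pi * C) * (1 + exp 1)"])
    fix u
    have "cmod (1 - G u) \<le> 1 + exp 1" using norm_triangle_ineq4[of 1 "G u"] Gb[of u] by simp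
    then show "cmod (\<phi> u * H' u * (1 - G u)) \<le> 1 * (pi * C) * (1 + exp 1)"
      using \<phi>b[of u] H'b[of u] H(2) unfolding norm_mult by (intro mult_mono) auto
  qed simp
  \<comment> \<open>\<phi> = p G + (\<phi> - p) G + \<phi> (1 - G); the three terms are treated by
    \<open>T1\<close>, \<open>T2\<close> and \<open>T3\<close>.\<close>
  have "(\<integral>u. \<phi> u * H' u \<partial>?c) = (\<integral>u. p u * G u * H' u + (\<phi> u - p u) * G u * H' u + \<phi> u * H' u * (1 - G u) \<partial>?c)"
    by (intro Bochner_Integration.integral_cong) (auto simp: algebra_simps)
  also have "\<dots> = (\<integral>u. p u * G u * H' u \<partial>?c) + (\<integral>u. (\<phi> u - p u) * G u * H' u \<partial>?c) + (\<integral>u. \<phi> u * H' u * (1 - G u) \<partial>?c)"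
    using i1 i2 i3 by simp
  finally have "cmod (\<integral>u. \<phi> u * H' u \<partial>?c) \<le> pi * C * sqrt (2 * e * (j + 1)) + pi * C * sqrt ?rhs"
    using T1 T2 T3 norm_triangle_ineq[of "\<integral>u. (\<phi> u - p u) * G u * H' u \<partial>?c" "\<integral>u. \<phi> u * H' u * (1 - G u) \<partial>?c"] by simp
  then show ?thesis using toc[OF \<phi>m] by (simp add: distrib_left)
qed

text \<open>The order of limits matters: e -> 0 at fixed j removes
  \<open>sqrt (2 * e * (j + 1))\<close>, and only then j grows. As g > 0 almost everywhere, ln (min
  1 (j g)) tends to 0 under the integrable bound |ln (min 1 g)|.\<close>

lemma hardy_annihilator:
  assumes gpos: "AE u in cauchy_measure. 0 < g u"
    and log: "integrable cauchy_measure (\<lambda>u. ln (min 1 (g u)))"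
    and \<phi>m: "\<phi> \<in> borel_measurable borel" and \<phi>b: "\<And>u. cmod (\<phi> u) \<le> 1" and \<phi>: "\<phi> \<in> hardy \<mu>"
    and h: "h holomorphic_on UNIV"
    and hb: "\<And>z. Im z \<ge> 0 \<Longrightarrow> cmod z \<ge> 1 \<Longrightarrow> cmod (h z) \<le> K / (cmod z)\<^sup>2"
  shows "(\<integral>u. \<phi> u * h (of_real u) \<partial>lborel) = 0"
proof -
  have hc: "continuous_on UNIV (\<lambda>u. h (of_real u))"
    by (rule continuous_on_compose2[OF holomorphic_on_imp_continuous_on[OF h]]) (auto intro!: continuous_intros)
  have decay: "cmod (h (of_real u)) \<le> K / u\<^sup>2" if "\<bar>u\<bar> \<ge> 1" for u
    using hb[of "of_real u"] that by simp
  obtain C where C: "C \<ge> 0" "\<And>u. (1 + u\<^sup>2) * cmod (h (of_real u)) \<le> C"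
    using quadratic_decay_real_line[OF hc decay] by blast
  define I where "I = cmod (\<integral>u. \<phi> u * h (of_real u) \<partial>lborel)"
  define L where "L j = (\<integral>u. ln (min 1 (j * g u)) \<partial>cauchy_measure)" for j :: real
  have 1: "I \<le> pi * C * sqrt (2 - 2 * exp (L j / 2))" if j: "j \<ge> 1" for j
  proof -
    have "(\<lambda>n. pi * C * (sqrt (2 * inverse (real (Suc n)) * (j + 1)) +
        sqrt (exp (2 * inverse (real (Suc n))) + 1 - 2 * exp (L j / 2 - inverse (real (Suc n))))))
      \<longlonglongrightarrow> pi * C * (sqrt (2 * 0 * (j + 1)) + sqrt (exp (2 * 0) + 1 - 2 * exp (L j / 2 - 0)))"
      by (intro tendsto_intros LIMSEQ_inverse_real_of_nat)
    moreover have "I \<le> pi * C * (sqrt (2 * inverse (real (Suc n)) * (j + 1)) +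
        sqrt (exp (2 * inverse (real (Suc n))) + 1 - 2 * exp (L j / 2 - inverse (real (Suc n)))))" for n
    proof -
      have "0 < inverse (real (Suc n))" "inverse (real (Suc n)) \<le> 1" by (auto simp: field_simps)
      from hardy_annihilator_bound[OF gpos log \<phi>m \<phi>b \<phi> h hb C(2,1) j this]
      show ?thesis unfolding I_def L_def .
    qed
    ultimately have "I \<le> pi * C * (sqrt (2 * 0 * (j + 1)) + sqrt (exp (2 * 0) + 1 - 2 * exp (L j / 2 - 0)))"
      by (intro LIMSEQ_le_const) auto
    then show ?thesis by simp
  qed
  have "(\<lambda>n. L (real (Suc n))) \<longlonglongrightarrow> (\<integral>u. 0 \<partial>cauchy_measure)"
    unfolding L_def
  proof (rule integral_dominated_convergence[OF _ _ integrable_norm[OF log]])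
    show "AE u in cauchy_measure. (\<lambda>n. ln (min 1 (real (Suc n) * g u))) \<longlonglongrightarrow> 0"
      using gpos
    proof eventually_elim
      case (elim u)
      then have "\<forall>\<^sub>F n in sequentially. 1 \<le> real (Suc n) * g u" by real_asymp
      then have "\<forall>\<^sub>F n in sequentially. ln (min 1 (real (Suc n) * g u)) = 0"
        by eventually_elim simp
      then show ?case by (rule tendsto_eventually)
    qed
    show "AE u in cauchy_measure. norm (ln (min 1 (real (Suc n) * g u))) \<le> norm (ln (min 1 (g u)))" for n
      using gpos
    proof eventually_elim
      case (elim u)
      have "1 * g u \<le> real (Suc n) * g u" using elim by (intro mult_right_mono) auto
      then have "min 1 (g u) \<le> min 1 (real (Suc n) * g u)" "min 1 (real (Suc n) * g u) \<le> 1" by linarith+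
      moreover have "0 < min 1 (g u)" using elim by simp
      ultimately have "ln (min 1 (g u)) \<le> ln (min 1 (real (Suc n) * g u))" "ln (min 1 (real (Suc n) * g u)) \<le> 0"
        by (auto simp del: min_less_iff_conj of_nat_Suc)
      then show ?case by simp
    qed
  qed simp_all
  then have "(\<lambda>n. pi * C * sqrt (2 - 2 * exp (L (real (Suc n)) / 2))) \<longlonglongrightarrow> pi * C * sqrt (2 - 2 * exp (0 / 2))"
    by (intro tendsto_intros) simp_all
  then have "I \<le> pi * C * sqrt (2 - 2 * exp (0 / 2))"
    by (rule LIMSEQ_le_const) (use 1 in auto)
  then show ?thesis by (simp add: I_def)
qed

end

section \<open>Entire functions of exponential type\<close>

text \<open>|1 - \<i> \<eta> z| is at least 1 in the closed upper half-plane and grows linearly, so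
  dividing by it makes a bounded function at most 1 on large half circles. The maximum principle on
  the half disc applies, and \<eta> -> 0 removes the denominator.\<close>

lemma bounded_phragmen_lindelof:
  assumes f: "f holomorphic_on UNIV" and real: "\<And>x. cmod (f (of_real x)) \<le> 1"
    and bd: "\<And>z. Im z \<ge> 0 \<Longrightarrow> cmod (f z) \<le> B" and z: "Im z \<ge> 0"
  shows "cmod (f z) \<le> 1"
proof -
  have B: "B \<ge> 0" using order_trans[OF norm_ge_zero bd[of 0]] by simp
  have main: "cmod (f z) \<le> cmod (1 - \<i> * of_real \<eta> * z)" if \<eta>: "\<eta> > 0" for \<eta> :: real
  proof -
    \<comment> \<open>At this radius |1 - \<i> \<eta> w| \<ge> \<eta> R - 1 \<ge> B, and z lies in
      the disc.\<close>
    define R where "R = max (cmod z) ((B + 1) / \<eta>)"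
    define S where "S = {w. Im w \<ge> 0} \<inter> cball (0::complex) R"
    define k where "k w = f w / (1 - \<i> * of_real \<eta> * w)" for w
    have re: "cmod (1 - \<i> * of_real \<eta> * w) \<ge> 1" if "Im w \<ge> 0" for w
    proof -
      have "1 \<le> Re (1 - \<i> * of_real \<eta> * w)" using that \<eta> by simp
      then show ?thesis using complex_Re_le_cmod order_trans by blast
    qed
    have nz: "1 - \<i> * of_real \<eta> * w \<noteq> 0" if "Im w \<ge> 0" for w using re[OF that] by auto
    have clS: "closed S" unfolding S_def by (intro closed_Int closed_cball closed_halfspace_Im_ge)
    have "k holomorphic_on S"
      unfolding k_def[abs_def] by (intro holomorphic_intros holomorphic_on_subset[OF f]) (use nz in \<open>auto simp: S_def\<close>)
    then have hol: "k holomorphic_on interior S" "continuous_on (closure S) k"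
      using clS interior_subset[of S] by (auto intro: holomorphic_on_subset holomorphic_on_imp_continuous_on)
    have "cmod (k z) \<le> 1"
    proof (rule maximum_modulus_frontier[OF hol])
      show "bounded S" unfolding S_def by (rule bounded_subset[OF bounded_cball[of 0 R]]) auto
      show "z \<in> S" using z by (simp add: S_def R_def)
      fix w assume w: "w \<in> frontier S"
      have wS: "w \<in> S" using w clS frontier_subset_closed by blast
      then have Imw: "Im w \<ge> 0" by (simp add: S_def)
      consider "Im w = 0" | "cmod w = R"
      proof -
        have "{w. Im w > 0} \<inter> ball 0 R \<subseteq> interior S"
          by (rule interior_maximal) (auto simp: S_def open_halfspace_Im_gt)
        then have "\<not> (Im w > 0 \<and> cmod w < R)" using w by (auto simp: frontier_def)
        then show ?thesis using wS that by (force simp: S_def)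
      qed
      then show "cmod (k w) \<le> 1"
      proof cases
        case 1
        then have "w = of_real (Re w)" by (simp add: complex_eq_iff)
        then have "cmod (f w) \<le> 1" using real[of "Re w"] by simp
        then show ?thesis using re[OF Imw] by (simp add: k_def norm_divide divide_le_eq)
      next
        case 2
        have "\<eta> * R \<ge> B + 1" using \<eta> by (simp add: R_def max_def field_simps)
        have "cmod (\<i> * of_real \<eta> * w) = \<eta> * R" using 2 \<eta> by (simp add: norm_mult)
        then have "cmod (1 - \<i> * of_real \<eta> * w) \<ge> \<eta> * R - 1"
          using norm_triangle_ineq3[of "\<i> * of_real \<eta> * w" 1] by (simp add: norm_minus_commute)
        then have "cmod (f w) \<le> cmod (1 - \<i> * of_real \<eta> * w)"
          using bd[OF Imw] \<open>\<eta> * R \<ge> B + 1\<close> by linarith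
        then show ?thesis using re[OF Imw] by (simp add: k_def norm_divide divide_le_eq)
      qed
    qed
    then show ?thesis using re[OF z] by (simp add: k_def norm_divide divide_le_eq split: if_splits)
  qed
  have "(\<lambda>n. cmod (1 - \<i> * of_real (inverse (real (Suc n))) * z)) \<longlonglongrightarrow> cmod (1 - \<i> * of_real 0 * z)"
    by (intro tendsto_intros LIMSEQ_inverse_real_of_nat)
  then have "cmod (f z) \<le> cmod (1 - \<i> * of_real 0 * z)"
    by (rule LIMSEQ_le_const) (intro exI[of _ 0] allI impI main, simp)
  then show ?thesis by simp
qed

text \<open>For |arg w| \<le> pi/4 the argument of w^(3/2) is at most 3 pi/8 in modulus, so the real
  part is a fixed fraction of |w|^(3/2); 1/10 is a convenient one. With csqrt w = p + \<i> q the
  sector gives 2 |q| \<le> p, and Re (w^(3/2)) = p (p^2 - 3 q^2).\<close>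

lemma csqrt_cube_lower_bound:
  assumes "Re w > 0" "\<bar>Im w\<bar> \<le> Re w"
  shows "cmod w * sqrt (cmod w) / 10 \<le> Re (w * csqrt w)"
proof -
  define p q where "p = Re (csqrt w)" and "q = Im (csqrt w)"
  have cs: "csqrt w = Complex p q" by (rule complex_eqI) (simp_all only: p_def q_def complex.sel)
  have w: "w = Complex p q ^ 2" by (simp only: cs[symmetric] power2_csqrt)
  have Rw: "Re w = p\<^sup>2 - q\<^sup>2" "Im w = 2 * p * q" unfolding w by (simp_all add: power2_eq_square)
  have "p \<ge> 0" using csqrt_principal[of w] unfolding p_def by argo
  moreover have "p \<noteq> 0" using assms(1) Rw by auto
  ultimately have p: "p > 0" by simp
  have "2 * \<bar>q\<bar> \<le> p"
  proof -
    have "p * (2 * \<bar>q\<bar>) \<le> p * p"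
    proof -
      have "2 * p * \<bar>q\<bar> = \<bar>Im w\<bar>" using p Rw by (simp add: abs_mult)
      also have "\<dots> \<le> p\<^sup>2 - q\<^sup>2" using assms Rw by simp
      also have "\<dots> \<le> p * p" by (simp add: power2_eq_square)
      finally show ?thesis by (simp add: mult_ac)
    qed
    then show ?thesis using p by simp
  qed
  then have "(2 * \<bar>q\<bar>)\<^sup>2 \<le> p\<^sup>2" by (intro power_mono) auto
  then have q: "4 * q\<^sup>2 \<le> p\<^sup>2" by (simp add: power_mult_distrib)
  have cw: "cmod w = p\<^sup>2 + q\<^sup>2" unfolding w by (simp add: norm_power complex_norm)
  have "Re (w * csqrt w) = p * (p\<^sup>2 - 3 * q\<^sup>2)"
    by (simp add: cs Rw power2_eq_square algebra_simps)
  moreover have "cmod w \<le> 5/4 * p\<^sup>2" using cw q by simp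
  moreover have "p * (p\<^sup>2 - 3 * q\<^sup>2) \<ge> p * (p\<^sup>2 / 4)" using p q by (intro mult_left_mono) auto
  moreover have "sqrt (cmod w) \<le> 2 * p"
  proof (rule real_le_lsqrt)
    have "(2 * p)\<^sup>2 = 4 * p\<^sup>2" by (simp add: power_mult_distrib)
    then show "cmod w \<le> (2 * p)\<^sup>2" using cw q zero_le_power2[of p] by linarith
  qed (use p in auto)
  moreover have "cmod w * sqrt (cmod w) \<le> (5/4 * p\<^sup>2) * (2 * p)"
    using calculation by (intro mult_mono) auto
  ultimately show ?thesis by (simp add: algebra_simps)
qed

text \<open>A quadrant tolerates growth of order below 2, so growth of order 1 is beaten by exp(-
  \<eta> \<omega>^(3/2)). The quadrant is rotated by - pi/4 to make its bisector the positive axis,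
  and the shift by 1 keeps \<omega> off the branch cut.\<close>

lemma quadrant_phragmen_lindelof:
  assumes f: "f holomorphic_on UNIV" and growth: "\<And>z. cmod (f z) \<le> A * exp (a * cmod z)"
    and re: "\<And>x. x \<ge> 0 \<Longrightarrow> cmod (f (of_real x)) \<le> B" and im: "\<And>y. y \<ge> 0 \<Longrightarrow> cmod (f (\<i> * of_real y)) \<le> B"
    and B: "B > 0" and z: "Re z \<ge> 0" "Im z \<ge> 0"
  shows "cmod (f z) \<le> B"
proof -
  define s where "s = 1 / sqrt 2"
  have s: "s > 0" "s * s = 1 / 2" by (auto simp: s_def)
  define \<omega> where "\<omega> w = Complex s (- s) * w + 1" for w
  have \<omega>: "Re (\<omega> w) = s * (Re w + Im w) + 1" "Im (\<omega> w) = s * (Im w - Re w)" for w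
    by (simp_all add: \<omega>_def algebra_simps)
  define e where "e w = \<omega> w * csqrt (\<omega> w)" for w
  have pos: "Re (\<omega> w) > 0" "\<bar>Im (\<omega> w)\<bar> \<le> Re (\<omega> w)" "cmod w \<le> cmod (\<omega> w)" if "Re w \<ge> 0" "Im w \<ge> 0" for w
  proof -
    show "Re (\<omega> w) > 0" using that s by (simp add: \<omega> add_nonneg_pos)
    have "s * Re w \<ge> 0" "s * Im w \<ge> 0" using that s by auto
    then show "\<bar>Im (\<omega> w)\<bar> \<le> Re (\<omega> w)" unfolding \<omega> by (simp add: right_diff_distrib distrib_left)
    have "(cmod w)\<^sup>2 \<le> (cmod (\<omega> w))\<^sup>2"
    proof -
      have "(cmod (\<omega> w))\<^sup>2 = (s * (Re w + Im w) + 1)\<^sup>2 + (s * (Im w - Re w))\<^sup>2" by (simp add: cmod_power2 \<omega>)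
      also have "\<dots> = s * s * (2 * ((Re w)\<^sup>2 + (Im w)\<^sup>2)) + 2 * (s * (Re w + Im w)) + 1"
        by (simp add: power2_eq_square algebra_simps)
      also have "\<dots> = (cmod w)\<^sup>2 + 2 * (s * Re w + s * Im w) + 1"
        unfolding s(2) by (simp add: cmod_power2 distrib_left)
      finally have *: "(cmod (\<omega> w))\<^sup>2 = (cmod w)\<^sup>2 + 2 * (s * Re w + s * Im w) + 1" .
      have "0 \<le> s * Re w + s * Im w" using \<open>s * Re w \<ge> 0\<close> \<open>s * Im w \<ge> 0\<close> by (rule add_nonneg_nonneg)
      then show ?thesis unfolding * by simp
    qed
    then show "cmod w \<le> cmod (\<omega> w)" by (rule power2_le_imp_le) simp
  qed
  have Ree: "Re (e w) \<ge> cmod w * sqrt (cmod w) / 10" if "Re w \<ge> 0" "Im w \<ge> 0" for w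
  proof -
    have "cmod w * sqrt (cmod w) \<le> cmod (\<omega> w) * sqrt (cmod (\<omega> w))"
      using pos(3)[OF that] by (intro mult_mono) auto
    then show ?thesis using csqrt_cube_lower_bound[OF pos(1,2)[OF that]] unfolding e_def by linarith
  qed
  have Ree0: "Re (e w) \<ge> 0" if "Re w \<ge> 0" "Im w \<ge> 0" for w
    by (rule order_trans[OF _ Ree[OF that]]) simp
  have main: "cmod (f z) \<le> B * exp (\<eta> * Re (e z))" if \<eta>: "\<eta> > 0" for \<eta> :: real
  proof -
    have "\<forall>\<^sub>F R in at_top. A * exp (a * R - \<eta> * (R * sqrt R / 10)) \<le> B"
    proof -
      have "((\<lambda>R. A * exp (a * R - \<eta> * (R * sqrt R / 10))) \<longlongrightarrow> 0) at_top" using \<eta> by real_asymp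
      from order_tendstoD(2)[OF this B] show ?thesis by (rule eventually_mono) simp
    qed
    moreover have "\<forall>\<^sub>F R in at_top. cmod z \<le> R" by (rule eventually_ge_at_top)
    ultimately have "\<forall>\<^sub>F R in at_top. A * exp (a * R - \<eta> * (R * sqrt R / 10)) \<le> B \<and> cmod z \<le> R"
      by (rule eventually_conj)
    then obtain R where R: "A * exp (a * R - \<eta> * (R * sqrt R / 10)) \<le> B" "cmod z \<le> R"
      by (auto simp: eventually_at_top_linorder)
    define S where "S = {w. Re w \<ge> 0} \<inter> {w. Im w \<ge> 0} \<inter> cball (0::complex) R"
    define k where "k w = f w * exp (- of_real \<eta> * e w)" for w
    have clS: "closed S" unfolding S_def by (intro closed_Int closed_cball closed_halfspace_Im_ge closed_halfspace_Re_ge)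
    have "\<omega> w \<notin> \<real>\<^sub>\<le>\<^sub>0" if "w \<in> S" for w
      using pos(1)[of w] that by (auto simp: S_def complex_nonpos_Reals_iff)
    moreover have "\<omega> holomorphic_on S" unfolding \<omega>_def[abs_def] by (intro holomorphic_intros)
    ultimately have "k holomorphic_on S"
      unfolding k_def[abs_def] e_def by (intro holomorphic_intros holomorphic_on_subset[OF f]) auto
    then have hol: "k holomorphic_on interior S" "continuous_on (closure S) k"
      using clS interior_subset[of S] by (auto intro: holomorphic_on_subset holomorphic_on_imp_continuous_on)
    have kn: "cmod (k w) = cmod (f w) * exp (- (\<eta> * Re (e w)))" for w
      by (simp add: k_def norm_mult)
    have "cmod (k z) \<le> B"
    proof (rule maximum_modulus_frontier[OF hol])
      show "bounded S" unfolding S_def by (rule bounded_subset[OF bounded_cball[of 0 R]]) auto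
      show "z \<in> S" using z R by (simp add: S_def)
      fix w assume w: "w \<in> frontier S"
      have wS: "w \<in> S" using w clS frontier_subset_closed by blast
      then have wp: "Re w \<ge> 0" "Im w \<ge> 0" "cmod w \<le> R" by (auto simp: S_def)
      have le1: "exp (- (\<eta> * Re (e w))) \<le> 1" using Ree0[OF wp(1,2)] \<eta> by simp
      consider "Re w = 0" | "Im w = 0" | "cmod w = R"
      proof -
        have "{w. Re w > 0} \<inter> {w. Im w > 0} \<inter> ball 0 R \<subseteq> interior S"
          by (rule interior_maximal) (auto simp: S_def open_halfspace_Im_gt open_halfspace_Re_gt open_Int)
        then have "\<not> (Re w > 0 \<and> Im w > 0 \<and> cmod w < R)" using w by (auto simp: frontier_def)
        then show ?thesis using wp that by force
      qed
      then show "cmod (k w) \<le> B"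
      proof cases
        case 1
        then have "w = \<i> * of_real (Im w)" by (simp add: complex_eq_iff)
        then have "cmod (f w) \<le> B" using im[OF wp(2)] by simp
        then have "cmod (f w) * exp (- (\<eta> * Re (e w))) \<le> B * 1" using le1 B by (intro mult_mono) auto
        then show ?thesis by (simp add: kn)
      next
        case 2
        then have "w = of_real (Re w)" by (simp add: complex_eq_iff)
        then have "cmod (f w) \<le> B" using re[OF wp(1)] by simp
        then have "cmod (f w) * exp (- (\<eta> * Re (e w))) \<le> B * 1" using le1 B by (intro mult_mono) auto
        then show ?thesis by (simp add: kn)
      next
        case 3
        have A: "A \<ge> 0" using order_trans[OF norm_ge_zero growth[of 0]] by simp
        have "\<eta> * (R * sqrt R / 10) \<le> \<eta> * Re (e w)"
          using Ree[OF wp(1,2)] 3 \<eta> by (intro mult_left_mono) auto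
        then have "cmod (f w) * exp (- (\<eta> * Re (e w))) \<le> (A * exp (a * R)) * exp (- (\<eta> * (R * sqrt R / 10)))"
          using growth[of w] 3 A by (intro mult_mono) auto
        also have "\<dots> = A * exp (a * R - \<eta> * (R * sqrt R / 10))"
          by (simp only: mult.assoc exp_add[symmetric] diff_conv_add_uminus)
        also have "\<dots> \<le> B" by (rule R)
        finally show ?thesis by (simp add: kn)
      qed
    qed
    then show ?thesis by (simp add: kn exp_minus field_simps)
  qed
  have "(\<lambda>n. B * exp (inverse (real (Suc n)) * Re (e z))) \<longlonglongrightarrow> B * exp (0 * Re (e z))"
    by (intro tendsto_intros LIMSEQ_inverse_real_of_nat)
  then have "cmod (f z) \<le> B * exp (0 * Re (e z))"
    by (rule LIMSEQ_le_const) (intro exI[of _ 0] allI impI main, simp)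
  then show ?thesis by simp
qed

text \<open>In a half-plane growth of order 1 is critical. The bound on the imaginary axis cuts it
  into two quadrants, and a rotation reduces the second to the first.\<close>

lemma half_plane_phragmen_lindelof:
  assumes f: "f holomorphic_on UNIV" and growth: "\<And>z. cmod (f z) \<le> A * exp (a * cmod z)"
    and re: "\<And>x. cmod (f (of_real x)) \<le> B" and im: "\<And>y. y \<ge> 0 \<Longrightarrow> cmod (f (\<i> * of_real y)) \<le> B"
    and B: "B > 0" and z: "Im z \<ge> 0"
  shows "cmod (f z) \<le> B"
proof (cases "Re z \<ge> 0")
  case True
  show ?thesis by (rule quadrant_phragmen_lindelof[OF f growth re im B True z])
next
  case False
  have "cmod (f (\<i> * (- \<i> * z))) \<le> B"
  proof (rule quadrant_phragmen_lindelof[where f="\<lambda>w. f (\<i> * w)" and A=A and a=a])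
    show "(\<lambda>w. f (\<i> * w)) holomorphic_on UNIV"
      by (rule holomorphic_on_compose_gen[OF _ f, unfolded o_def]) (auto intro: holomorphic_intros)
    show "cmod (f (\<i> * w)) \<le> A * exp (a * cmod w)" for w
      using growth[of "\<i> * w"] by (simp add: norm_mult)
    show "cmod (f (\<i> * (\<i> * of_real y))) \<le> B" for y
      using re[of "- y"] by (simp flip: mult.assoc)
  qed (use False z im B in auto)
  then show ?thesis by (simp flip: mult.assoc)
qed

section \<open>Band-limited densities\<close>

text \<open>A nonempty open set is never Lebesgue null.\<close>

lemma AE_lborel_le_imp_le:
  fixes f :: "real \<Rightarrow> real"
  assumes "continuous_on UNIV f" "AE u in lborel. f u \<le> c"
  shows "f u \<le> c"
proof (rule ccontr)
  assume "\<not> f u \<le> c"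
  define U where "U = f -` {c<..}"
  have U: "open U" unfolding U_def by (rule open_vimage) (use assms(1) in auto)
  have "u \<in> U" using \<open>\<not> f u \<le> c\<close> by (simp add: U_def)
  have "AE u in lborel. u \<notin> U" using assms(2) by eventually_elim (auto simp: U_def)
  then have "U \<in> null_sets lborel" using U by (subst AE_iff_null_sets) auto
  then have "negligible U" by (simp add: negligible_iff_null_sets null_sets_completionI)
  then show False using open_not_negligible[OF U] \<open>u \<in> U\<close> by blast
qed

text \<open>A Paley-Wiener statement for a measurable density. Levy inversion with a characteristic
  function supported in [-T, T] is a finite integral; exchanging it with the integral over x
  exhibits V as a second density of M, and uniqueness of densities gives V = d almost
  everywhere.\<close>

lemma band_limited_density:
  fixes d :: "real \<Rightarrow> real" and T :: real
  assumes dm[measurable]: "d \<in> borel_measurable borel" and d0: "\<And>u. 0 \<le> d u"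
    and M: "real_distribution M" and Md: "M = density lborel (\<lambda>u. ennreal (d u))"
    and T: "T > 0" and supp: "\<And>s. \<bar>s\<bar> \<ge> T \<Longrightarrow> char M s = 0"
  obtains V where "V holomorphic_on UNIV" "\<And>z. cmod (V z) \<le> T / pi * exp (T * \<bar>Im z\<bar>)"
    "AE u in lborel. V (of_real u) = of_real (d u)"
proof -
  interpret real_distribution M by fact
  define V where "V z = of_real (1 / (2 * pi)) * integral {-T..T} (\<lambda>s. char M s * exp (- (\<i> * of_real s * z)))" for z
  have cc: "continuous_on X (char M)" for X by (intro continuous_at_imp_continuous_on ballI isCont_char)
  have cc2: "continuous_on X (\<lambda>p. char M (snd p))" for X :: "('c::topological_space \<times> real) set"
    by (rule continuous_on_compose2[OF cc[of UNIV]]) (auto intro: continuous_intros)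
  have ci: "(\<lambda>s. char M s * exp (- (\<i> * of_real s * z))) integrable_on {-T..T}" for z
    by (intro integrable_continuous_interval continuous_intros cc)
  have "(\<lambda>z. integral (cbox (-T) T) (\<lambda>s. char M s * exp (- (\<i> * of_real s * z)))) holomorphic_on UNIV"
  proof (rule leibniz_rule_holomorphic[where fx="\<lambda>z s. char M s * (exp (- (\<i> * of_real s * z)) * (- (\<i> * of_real s)))"])
    show "((\<lambda>z. char M s * exp (- (\<i> * of_real s * z))) has_field_derivative
        char M s * (exp (- (\<i> * of_real s * z)) * (- (\<i> * of_real s)))) (at z within UNIV)" for z s
      by (auto intro!: derivative_eq_intros)
    show "continuous_on (UNIV \<times> cbox (-T) T) (\<lambda>(z, s). char M s * (exp (- (\<i> * of_real s * z)) * (- (\<i> * of_real s))))"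
      unfolding case_prod_beta by (intro continuous_intros cc2)
  qed (use ci in auto)
  then have V: "V holomorphic_on UNIV" unfolding V_def[abs_def] by (intro holomorphic_intros) simp
  have Vb: "cmod (V z) \<le> T / pi * exp (T * \<bar>Im z\<bar>)" for z
  proof -
    have "cmod (integral {-T..T} (\<lambda>s. char M s * exp (- (\<i> * of_real s * z)))) \<le> integral {-T..T} (\<lambda>s. exp (T * \<bar>Im z\<bar>))"
    proof (rule integral_norm_bound_integral[OF ci])
      fix s assume s: "s \<in> {-T..T}"
      have "s * Im z \<le> \<bar>s\<bar> * \<bar>Im z\<bar>" by (metis abs_ge_self abs_mult)
      also have "\<dots> \<le> T * \<bar>Im z\<bar>" using s by (intro mult_right_mono) auto
      finally have "exp (s * Im z) \<le> exp (T * \<bar>Im z\<bar>)" by simp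
      then have "cmod (char M s) * exp (s * Im z) \<le> 1 * exp (T * \<bar>Im z\<bar>)"
        using cmod_char_le_1[of s] by (intro mult_mono) auto
      then show "cmod (char M s * exp (- (\<i> * of_real s * z))) \<le> exp (T * \<bar>Im z\<bar>)"
        by (simp add: norm_mult)
    qed auto
    also have "\<dots> = 2 * T * exp (T * \<bar>Im z\<bar>)" using T by simp
    finally have "cmod (V z) \<le> 1 / (2 * pi) * (2 * T * exp (T * \<bar>Im z\<bar>))"
    proof -
      have "cmod (of_real (1 / (2 * pi))) = 1 / (2 * pi)" by (simp only: norm_of_real) simp
      moreover assume "cmod (integral {-T..T} (\<lambda>s. char M s * exp (- (\<i> * of_real s * z)))) \<le> 2 * T * exp (T * \<bar>Im z\<bar>)"
      ultimately show ?thesis unfolding V_def norm_mult by (intro mult_mono) simp_all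
    qed
    then show ?thesis by simp
  qed
  have Vc: "continuous_on X (\<lambda>x. V (of_real x))" for X :: "real set"
    by (rule continuous_on_compose2[OF holomorphic_on_imp_continuous_on[OF V]]) (auto intro: continuous_intros)
  have single: "measure M {a} = 0" for a
  proof -
    have "emeasure M {a} = (\<integral>\<^sup>+u. ennreal (d u) * indicator {a} u \<partial>lborel)"
      unfolding Md by (subst emeasure_density) auto
    also have "\<dots> = (\<integral>\<^sup>+(u::real). 0 \<partial>lborel)"
      by (rule nn_integral_cong_AE) (use AE_lborel_singleton[of a] in \<open>eventually_elim, simp\<close>)
    finally show ?thesis by (simp add: measure_def)
  qed
  have inv: "complex_of_real (measure M {a<..b}) = integral {a..b} (\<lambda>x. V (of_real x))" if ab: "a \<le> b" for a b
  proof -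
    define F where "F t = (iexp (-(t * a)) - iexp (-(t * b))) / (\<i> * t)" for t :: real
    have Fm[measurable]: "F \<in> borel_measurable borel" unfolding F_def[abs_def] by measurable
    have Fb: "cmod (F t) \<le> b - a" for t
    proof (cases "t = 0")
      case False
      have "cmod ((iexp (t * - a) - iexp (t * - b)) / (\<i> * t)) \<le> - a - (- b)"
        by (rule Levy_Inversion_aux2) (use ab False in auto)
      then show ?thesis by (simp add: F_def)
    qed (use ab in \<open>simp add: F_def\<close>)
    have si: "set_integrable lborel {-T..T} (\<lambda>t. F t * char M t)"
      unfolding set_integrable_def
    proof (rule integrableI_bounded_set_indicator[where B="b - a"])
      show "AE t in lborel. t \<in> {-T..T} \<longrightarrow> norm (F t * char M t) \<le> b - a"
      proof (rule AE_I2, rule impI)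
        fix t
        have "cmod (F t) * cmod (char M t) \<le> (b - a) * 1"
          using Fb[of t] cmod_char_le_1[of t] ab by (intro mult_mono) auto
        then show "norm (F t * char M t) \<le> b - a" by (simp add: norm_mult)
      qed
    qed (auto simp: emeasure_lborel_Icc_eq)
    \<comment> \<open>Levy's formula is a limit over growing intervals; as \<open>char M\<close>
      vanishes outside [-T, T], the integrals are constant once n \<ge> T.\<close>
    have eqn: "(CLBINT t=- real n..real n. F t * char M t) = integral {-T..T} (\<lambda>t. F t * char M t)"
      if n: "real n \<ge> T" for n :: nat
    proof -
      have "(CLBINT t=- real n..real n. F t * char M t) = (CLBINT t:{- real n..real n}. F t * char M t)"
        using interval_integral_Icc[of "- real n" "real n" "\<lambda>t. F t * char M t"] by simp
      also have "\<dots> = (CLBINT t:{-T..T}. F t * char M t)"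
        unfolding set_lebesgue_integral_def
      proof (rule Bochner_Integration.integral_cong[OF refl])
        fix t
        show "indicat_real {- real n..real n} t *\<^sub>R (F t * char M t) = indicat_real {-T..T} t *\<^sub>R (F t * char M t)"
          using supp[of t] n by (cases "\<bar>t\<bar> \<ge> T") (auto simp: indicator_def abs_if split: if_splits)
      qed
      also have "\<dots> = integral {-T..T} (\<lambda>t. F t * char M t)"
        by (rule set_borel_integral_eq_integral(2)[OF si])
      finally show ?thesis .
    qed
    have "(\<lambda>n::nat. 1 / (2 * pi) * (CLBINT t=- real n..real n. F t * char M t)) \<longlonglongrightarrow> complex_of_real (measure M {a<..b})"
      using Levy_Inversion[OF ab single single] unfolding F_def by simp
    moreover have "\<forall>\<^sub>F n in sequentially. 1 / (2 * pi) * (CLBINT t=- real n..real n. F t * char M t) = 1 / (2 * pi) * integral {-T..T} (\<lambda>t. F t * char M t)"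
      using eventually_ge_at_top[of "nat \<lceil>T\<rceil>"] by eventually_elim (subst eqn, linarith, simp)
    ultimately have "(\<lambda>n::nat. 1 / (2 * pi) * integral {-T..T} (\<lambda>t. F t * char M t)) \<longlonglongrightarrow> complex_of_real (measure M {a<..b})"
      by (rule Lim_transform_eventually)
    then have 1: "complex_of_real (measure M {a<..b}) = 1 / (2 * pi) * integral {-T..T} (\<lambda>t. F t * char M t)"
      by (rule LIMSEQ_unique) simp
    have F: "integral {a..b} (\<lambda>x. char M t * exp (- (\<i> * of_real t * of_real x))) = F t * char M t" if "t \<noteq> 0" for t
    proof -
      have "((\<lambda>x. exp (- (\<i> * of_real t * of_real x))) has_integral
          exp (- (\<i> * of_real t * of_real b)) / (- (\<i> * of_real t)) - exp (- (\<i> * of_real t * of_real a)) / (- (\<i> * of_real t))) {a..b}"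
      proof (rule fundamental_theorem_of_calculus[OF ab])
        fix x
        have "((\<lambda>z. exp (- (\<i> * of_real t * z)) / (- (\<i> * of_real t))) has_field_derivative exp (- (\<i> * of_real t * of_real x))) (at (of_real x))"
          using that by (auto intro!: derivative_eq_intros)
        then show "((\<lambda>x. exp (- (\<i> * of_real t * of_real x)) / (- (\<i> * of_real t))) has_vector_derivative exp (- (\<i> * of_real t * of_real x))) (at x within {a..b})"
          by (rule has_vector_derivative_real_field)
      qed
      from integral_unique[OF has_integral_mult_right[OF this, of "char M t"]]
      show ?thesis using that by (simp add: F_def divide_simps) (simp add: algebra_simps)
    qed
    \<comment> \<open>At t = 0 the quotient \<open>F\<close> has the value 0 instead of its limit b
      - a, so one point has to be discarded.\<close>
    have "integral {-T..T} (\<lambda>t. F t * char M t) = integral {-T..T} (\<lambda>t. integral {a..b} (\<lambda>x. char M t * exp (- (\<i> * of_real t * of_real x))))"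
      by (rule integral_spike[of "{0}"]) (use F in auto)
    also have "\<dots> = integral {a..b} (\<lambda>x. integral {-T..T} (\<lambda>t. char M t * exp (- (\<i> * of_real t * of_real x))))"
      unfolding box_real[symmetric]
    proof (rule integral_swap_continuous)
      have c1: "continuous_on X (\<lambda>p. char M (fst p))" for X :: "(real \<times> real) set"
        by (rule continuous_on_compose2[OF cc[of UNIV]]) (auto intro: continuous_intros)
      show "continuous_on (cbox (- T, a) (T, b)) (\<lambda>(t, x). char M t * exp (- (\<i> * of_real t * of_real x)))"
        unfolding case_prod_beta by (intro continuous_intros c1)
    qed
    finally show ?thesis unfolding 1 V_def by simp
  qed
  define r where "r x = Re (V (of_real x))" for x
  have rc: "continuous_on X r" for X unfolding r_def[abs_def] by (intro continuous_intros Vc)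
  have rm[measurable]: "r \<in> borel_measurable borel" by (rule borel_measurable_continuous_onI[OF rc])
  have rint: "measure M {a<..b} = integral {a..b} r" if "a \<le> b" for a b
  proof -
    have "measure M {a<..b} = Re (integral {a..b} (\<lambda>x. V (of_real x)))" using inv[OF that] by (metis Re_complex_of_real)
    also have "\<dots> = integral {a..b} r"
      unfolding r_def[abs_def]
      by (rule integral_linear[OF _ bounded_linear_Re, unfolded o_def, symmetric]) (intro integrable_continuous_interval Vc)
    finally show ?thesis .
  qed
  have iim: "integral {a..b} (\<lambda>x. Im (V (of_real x))) = 0" if "a \<le> b" for a b
  proof -
    have "Im (integral {a..b} (\<lambda>x. V (of_real x))) = 0" using inv[OF that] by (metis Im_complex_of_real)
    then show ?thesis
      using integral_linear[OF integrable_continuous_interval[OF Vc] bounded_linear_Im, unfolded o_def, of a b] by simp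
  qed
  \<comment> \<open>So far V is known through its integrals over intervals; continuity turns their
    signs into pointwise signs. Applied to Re V, Im V and - Im V, this shows that V is real and
    nonnegative on the line.\<close>
  have pos_int: "0 \<le> h x" if hc: "continuous_on UNIV h" and hi: "\<And>a b. a \<le> b \<Longrightarrow> 0 \<le> integral {a..b} h" for h :: "real \<Rightarrow> real" and x
  proof (rule ccontr)
    assume n: "\<not> 0 \<le> h x"
    have "isCont h x" using hc by (simp add: continuous_on_eq_continuous_at)
    then have "\<forall>\<^sub>F y in at x. h y < h x / 2" using n by (intro order_tendstoD(2)[of h "h x"]) (auto simp: isCont_def)
    then obtain \<delta> where \<delta>: "\<delta> > 0" "\<And>y. y \<noteq> x \<Longrightarrow> dist y x < \<delta> \<Longrightarrow> h y < h x / 2"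
      by (auto simp: eventually_at)
    have le: "h y \<le> h x / 2" if "y \<in> {x..x + \<delta> / 2}" for y
      using \<delta>(2)[of y] that \<delta>(1) n by (cases "y = x") (auto simp: dist_real_def)
    have "integral {x..x + \<delta> / 2} h \<le> integral {x..x + \<delta> / 2} (\<lambda>_. h x / 2)"
      by (rule integral_le) (use le continuous_on_subset[OF hc] in \<open>auto intro: integrable_continuous_interval\<close>)
    also have "\<dots> < 0" using \<delta>(1) n by (simp add: mult_pos_neg)
    finally show False using hi[of x "x + \<delta> / 2"] \<delta>(1) by simp
  qed
  have r0: "0 \<le> r x" for x by (rule pos_int[OF rc]) (use rint in \<open>simp flip: rint\<close>)
  have imc: "continuous_on UNIV (\<lambda>x. Im (V (of_real x)))" by (intro continuous_intros Vc)
  have im0: "Im (V (of_real x)) = 0" for x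
  proof -
    have "0 \<le> Im (V (of_real x))" by (rule pos_int[OF imc]) (simp add: iim)
    moreover have "0 \<le> - Im (V (of_real x))"
      by (rule pos_int[of "\<lambda>x. - Im (V (of_real x))"]) (auto intro: continuous_on_minus imc simp: iim)
    ultimately show ?thesis by simp
  qed
  have em: "emeasure (density lborel (\<lambda>u. ennreal (r u))) {a<..b} = emeasure M {a<..b}" for a b
  proof (cases "a \<le> b")
    case True
    have si: "set_integrable lborel {a<..b} r"
      by (rule set_integrable_subset[OF borel_integrable_atLeastAtMost'[OF rc[of "{a..b}"]]]) auto
    have "emeasure (density lborel (\<lambda>u. ennreal (r u))) {a<..b} = (\<integral>\<^sup>+u. ennreal (indicator {a<..b} u *\<^sub>R r u) \<partial>lborel)"
      by (subst emeasure_density) (auto intro!: nn_integral_cong simp: indicator_def)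
    also have "\<dots> = ennreal (\<integral>u. indicator {a<..b} u *\<^sub>R r u \<partial>lborel)"
      using si r0 by (intro nn_integral_eq_integral) (auto simp: set_integrable_def)
    also have "(\<integral>u. indicator {a<..b} u *\<^sub>R r u \<partial>lborel) = integral {a<..b} r"
      using set_borel_integral_eq_integral(2)[OF si] by (simp add: set_lebesgue_integral_def)
    also have "\<dots> = integral {a..b} r"
      by (rule integral_subset_negligible) (auto intro: negligible_subset[of "{a}"])
    finally show ?thesis using rint[OF True] by (simp add: emeasure_eq_measure)
  qed simp
  have "density lborel (\<lambda>u. ennreal (r u)) = M"
  proof (rule measure_eqI_generator_eq[where E="range (\<lambda>(a, b). {a<..b::real})" and \<Omega>=UNIV and A="\<lambda>n. {- real n<..real n}"])
    show "Int_stable (range (\<lambda>(a, b). {a<..b::real}))"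
      by (auto simp: Int_stable_def intro!: image_eqI)
    show "(\<Union>n. {- real n<..real n}) = UNIV"
    proof (rule UNIV_eq_I[symmetric])
      fix x :: real
      obtain n where "\<bar>x\<bar> < real n" using reals_Archimedean2 by blast
      then show "x \<in> (\<Union>n. {- real n<..real n})" by (intro UN_I[of n]) auto
    qed
  qed (auto simp: em borel_sigma_sets_Ioc emeasure_eq_measure)
  then have "density lborel (\<lambda>u. ennreal (r u)) = density lborel (\<lambda>u. ennreal (d u))" using Md by simp
  then have "AE u in lborel. ennreal (r u) = ennreal (d u)"
  proof (subst (asm) sigma_finite_density_unique)
    show "sigma_finite_measure (density lborel (\<lambda>u. ennreal (r u)))"
      using \<open>density lborel (\<lambda>u. ennreal (r u)) = M\<close> sigma_finite_measure_axioms by simp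
  qed auto
  then have "AE u in lborel. V (of_real u) = of_real (d u)"
    by eventually_elim (use r0 d0 im0 in \<open>auto simp: r_def complex_eq_iff\<close>)
  with V Vb show ?thesis by (rule that)
qed

definition csinc :: "complex \<Rightarrow> complex" where
  "csinc z = (if z = 0 then 1 else sin z / z)"

lemma csinc_holomorphic: "csinc holomorphic_on UNIV"
proof -
  have "(\<lambda>z. if z = 0 then deriv sin 0 else (sin z - sin 0) / (z - 0)) holomorphic_on UNIV"
    by (rule pole_lemma_open) (auto intro: holomorphic_intros)
  moreover have "deriv sin (0 :: complex) = 1" by (rule DERIV_imp_deriv) (auto intro!: derivative_eq_intros)
  ultimately show ?thesis by (simp add: csinc_def[abs_def] cong: if_cong)
qed

lemma csinc_of_real: "csinc (of_real u) = of_real (sinc u)"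
  by (simp add: csinc_def sin_of_real)

lemma cmod_sin_le: "cmod (sin z) \<le> exp \<bar>Im z\<bar>"
proof -
  have "cmod (sin z) = cmod (exp (\<i> * z) - exp (- (\<i> * z))) / 2"
    by (simp add: sin_exp_eq norm_divide norm_mult)
  also have "\<dots> \<le> (cmod (exp (\<i> * z)) + cmod (exp (- (\<i> * z)))) / 2"
    by (intro divide_right_mono norm_triangle_ineq4) simp
  also have "\<dots> \<le> (exp \<bar>Im z\<bar> + exp \<bar>Im z\<bar>) / 2"
    by (intro divide_right_mono add_mono) auto
  finally show ?thesis by simp
qed

text \<open>|sin (\<delta> z)|^2 grows at most like exp(2 \<delta> Im z), which exp(\<i> a z) with a
  \<ge> 2 \<delta> compensates; the denominator (\<delta> z)^2 remains.\<close>

lemma exp_csinc_decay: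
  assumes \<delta>: "\<delta> > 0" and a: "a \<ge> 2 * \<delta>" and z: "Im z \<ge> 0" "cmod z \<ge> 1"
  shows "cmod (exp (\<i> * of_real a * z) * (csinc (of_real \<delta> * z))\<^sup>2) \<le> (1 / \<delta>\<^sup>2) / (cmod z)\<^sup>2"
proof -
  have nz: "z \<noteq> 0" using z by auto
  have "(cmod (sin (of_real \<delta> * z)))\<^sup>2 \<le> (exp (\<delta> * Im z))\<^sup>2"
    using cmod_sin_le[of "of_real \<delta> * z"] \<delta> z by (intro power_mono) (auto simp: abs_mult)
  also have "\<dots> = exp (2 * \<delta> * Im z)" by (simp flip: exp_double)
  finally have "exp (- (a * Im z)) * (cmod (sin (of_real \<delta> * z)))\<^sup>2 \<le> exp (- (a * Im z)) * exp (2 * \<delta> * Im z)"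
    by (intro mult_left_mono) auto
  also have "\<dots> = exp ((2 * \<delta> - a) * Im z)" by (simp add: algebra_simps flip: exp_add)
  also have "\<dots> \<le> 1" using a z by (simp add: mult_nonpos_nonneg)
  finally have "exp (- (a * Im z)) * (cmod (sin (of_real \<delta> * z)))\<^sup>2 \<le> 1" .
  then have "exp (- (a * Im z)) * (cmod (sin (of_real \<delta> * z)))\<^sup>2 / (\<delta>\<^sup>2 * (cmod z)\<^sup>2) \<le> 1 / (\<delta>\<^sup>2 * (cmod z)\<^sup>2)"
    by (intro divide_right_mono) auto
  then show ?thesis
    using nz \<delta> by (simp add: csinc_def norm_mult norm_power norm_divide power_divide power_mult_distrib)
qed

context decomposed_measure
begin

section \<open>From the closed span to entire functions\<close>

text \<open>Annihilation of exp(\<i> (s - t) z) sinc^2(\<delta> z) for s - t \<ge> 2 \<delta> says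
  that the Fourier transform of m sinc^2 vanishes at all s \<ge> t + 2 \<delta>; as m is real, the
  transform is hermitian and vanishes at - s too. Since it is positive at 0, the number t + 2
  \<delta> has to be positive.\<close>

lemma band_limited_multiple:
  fixes m :: "real \<Rightarrow> real"
  assumes gpos: "AE u in cauchy_measure. 0 < g u"
    and log: "integrable cauchy_measure (\<lambda>u. ln (min 1 (g u)))"
    and mm[measurable]: "m \<in> borel_measurable borel" and m: "\<And>u. 0 < m u" "\<And>u. m u \<le> 1"
    and hardy: "(\<lambda>u. expfun t u * of_real (m u)) \<in> hardy \<mu>"
    and \<delta>: "\<delta> > 0"
  shows "t + 2 * \<delta> > 0" and "\<exists>V. V holomorphic_on UNIV \<and> (\<forall>z. cmod (V z) \<le> exp ((t + 2 * \<delta>) * \<bar>Im z\<bar>)) \<and>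
    (AE u in lborel. V (of_real u) = of_real (m u * (sinc (\<delta> * u))\<^sup>2))"
proof -
  define T where "T = t + 2 * \<delta>"
  define S where "S u = (sinc (\<delta> * u))\<^sup>2" for u
  define h where "h a z = exp (\<i> * of_real a * z) * (csinc (of_real \<delta> * z))\<^sup>2" for a :: real and z
  have hh: "h a holomorphic_on UNIV" for a
  proof -
    have "(\<lambda>z. csinc (of_real \<delta> * z)) holomorphic_on UNIV"
      by (rule holomorphic_on_compose_gen[OF _ csinc_holomorphic, unfolded o_def]) (auto intro: holomorphic_intros)
    then show ?thesis unfolding h_def[abs_def] by (intro holomorphic_intros)
  qed
  have hr: "h a (of_real u) = iexp (a * u) * of_real (S u)" for a u
    using csinc_of_real[of "\<delta> * u"] by (simp add: h_def S_def mult.assoc)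
  have hd: "cmod (h a z) \<le> (1 / \<delta>\<^sup>2) / (cmod z)\<^sup>2" if "a \<ge> 2 * \<delta>" "Im z \<ge> 0" "cmod z \<ge> 1" for a z
    unfolding h_def by (rule exp_csinc_decay[OF \<delta> that])
  have S0: "0 \<le> S u" for u by (simp add: S_def)
  have S1: "S u \<le> 1" for u
  proof -
    have "\<bar>sinc (\<delta> * u)\<bar> \<le> 1"
      using abs_sin_x_le_abs_x[of "\<delta> * u"] by (simp add: divide_le_eq_1)
    then show ?thesis by (simp add: S_def abs_square_le_1)
  qed
  have Sc: "continuous_on UNIV S"
  proof -
    have "continuous_on UNIV (\<lambda>u. Re ((csinc (of_real (\<delta> * u)))\<^sup>2))"
      by (intro continuous_intros continuous_on_compose2[OF holomorphic_on_imp_continuous_on[OF csinc_holomorphic]]) auto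
    moreover have "Re ((csinc (of_real (\<delta> * u)))\<^sup>2) = S u" for u
      unfolding csinc_of_real S_def by (simp flip: of_real_power)
    ultimately show ?thesis by simp
  qed
  have Sm[measurable]: "S \<in> borel_measurable borel" by (rule borel_measurable_continuous_onI[OF Sc])
  have Si: "integrable lborel S"
  proof -
    have "integrable lborel (\<lambda>u. h (2 * \<delta>) (of_real u))"
      by (rule integral_real_line_eq_0(1)[where c="-1"]) (auto intro: holomorphic_on_subset[OF hh] hd)
    from integrable_norm[OF this] show ?thesis using S0 by (simp add: hr norm_mult)
  qed
  have mSi: "integrable lborel (\<lambda>u. m u * S u)"
  proof (rule Bochner_Integration.integrable_bound[OF Si])
    show "AE u in lborel. norm (m u * S u) \<le> norm (S u)"
    proof (rule AE_I2)
      fix u show "norm (m u * S u) \<le> norm (S u)"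
        using m[of u] S0[of u] by (simp add: abs_mult mult_left_le_one_le)
    qed
  qed simp
  define c where "c = (\<integral>u. m u * S u \<partial>lborel)"
  have mS0: "0 \<le> m u * S u" for u using m[of u] S0[of u] by simp
  \<comment> \<open>m is positive and sinc^2 is continuous with value 1 at 0, so the normalizing
    constant cannot vanish.\<close>
  have "c \<noteq> 0"
  proof
    assume "c = 0"
    then have "AE u in lborel. m u * S u = 0"
      using integral_nonneg_eq_0_iff_AE[OF mSi] mS0 by (simp add: c_def)
    then have "AE u in lborel. S u \<le> 0"
      by eventually_elim (use m in \<open>auto simp: less_le\<close>)
    from AE_lborel_le_imp_le[OF Sc this, of 0] show False by (simp add: S_def)
  qed
  moreover have "0 \<le> c" unfolding c_def using mS0 by simp
  ultimately have c: "c > 0" by simp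
  define d where "d u = m u * S u / c" for u
  have dm[measurable]: "d \<in> borel_measurable borel" unfolding d_def[abs_def] by measurable
  have d0: "0 \<le> d u" for u using mS0[of u] c by (simp add: d_def)
  define M where "M = density lborel (\<lambda>u. ennreal (d u))"
  have "integrable lborel d" unfolding d_def[abs_def] using mSi by simp
  then have "emeasure M (space M) = ennreal (\<integral>u. d u \<partial>lborel)"
    unfolding M_def using d0 by (subst emeasure_density) (simp_all add: nn_integral_eq_integral)
  also have "(\<integral>u. d u \<partial>lborel) = 1" unfolding d_def using c by (simp add: c_def)
  finally have "prob_space M" by (intro prob_spaceI) simp
  then have M: "real_distribution M"
    by (intro real_distribution.intro real_distribution_axioms.intro) (simp_all add: M_def)
  have charM: "char M s = (\<integral>u. iexp (s * u) * of_real (m u * S u) \<partial>lborel) / of_real c" for s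
  proof -
    have "char M s = (\<integral>u. d u *\<^sub>R iexp (s * u) \<partial>lborel)"
      unfolding char_def M_def by (rule integral_density) (auto simp: d0)
    also have "\<dots> = (\<integral>u. iexp (s * u) * of_real (m u * S u) / of_real c \<partial>lborel)"
      by (rule Bochner_Integration.integral_cong) (auto simp: d_def scaleR_conv_of_real)
    finally show ?thesis by simp
  qed
  have ann: "char M s = 0" if s: "s \<ge> T" for s
  proof -
    have "(\<integral>u. (expfun t u * of_real (m u)) * h (s - t) (of_real u) \<partial>lborel) = 0"
    proof (rule hardy_annihilator[OF gpos log _ _ hardy hh])
      show "cmod (expfun t u * of_real (m u)) \<le> 1" for u using m[of u] by (simp add: norm_mult)
      show "cmod (h (s - t) z) \<le> (1 / \<delta>\<^sup>2) / (cmod z)\<^sup>2" if "Im z \<ge> 0" "cmod z \<ge> 1" for z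
        using hd[OF _ that, of "s - t"] s by (simp add: T_def)
    qed measurable
    moreover have "(expfun t u * of_real (m u)) * h (s - t) (of_real u) = iexp (s * u) * of_real (m u * S u)" for u
    proof -
      have "expfun t u * iexp ((s - t) * u) = iexp (s * u)"
        unfolding expfun_def by (simp add: algebra_simps flip: exp_add)
      then show ?thesis by (simp add: hr mult_ac)
    qed
    ultimately show ?thesis unfolding charM by simp
  qed
  interpret M: real_distribution M by fact
  show T: "t + 2 * \<delta> > 0"
  proof (rule ccontr)
    assume "\<not> t + 2 * \<delta> > 0"
    then have "char M 0 = 0" by (intro ann) (simp add: T_def)
    then show False using M.char_zero by simp
  qed
  have supp: "char M s = 0" if "\<bar>s\<bar> \<ge> T" for s
  proof (cases "s \<ge> T")
    case False
    then have "char M (- s) = 0" using that by (intro ann) linarith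
    moreover have "char M (- s) = cnj (char M s)"
    proof -
      have "cnj (char M s) = (\<integral>u. cnj (iexp (s * u)) \<partial>M)"
        unfolding char_def by (rule Bochner_Integration.integral_cnj[symmetric])
      also have "\<dots> = char M (- s)" unfolding char_def by (simp add: exp_cnj)
      finally show ?thesis by simp
    qed
    ultimately show ?thesis by simp
  qed (rule ann)
  obtain W where W: "W holomorphic_on UNIV" "\<And>z. cmod (W z) \<le> T / pi * exp (T * \<bar>Im z\<bar>)"
    "AE u in lborel. W (of_real u) = of_real (d u)"
    by (rule band_limited_density[OF dm d0 M M_def, of T]) (use T supp that in \<open>auto simp: T_def\<close>)
  define V where "V z = of_real c * W z" for z
  have V: "V holomorphic_on UNIV" unfolding V_def[abs_def] by (intro holomorphic_intros W)
  have Vb: "cmod (V z) \<le> c * (T / pi) * exp (T * \<bar>Im z\<bar>)" for z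
    using mult_left_mono[OF W(2)[of z], of c] c by (simp add: V_def norm_mult)
  have VA: "AE u in lborel. V (of_real u) = of_real (m u * S u)"
    using W(3) by eventually_elim (use c in \<open>simp add: V_def d_def\<close>)
  have Vr: "cmod (V (of_real u)) \<le> 1" for u
  proof (rule AE_lborel_le_imp_le[of "\<lambda>u. cmod (V (of_real u))"])
    show "continuous_on UNIV (\<lambda>u. cmod (V (complex_of_real u)))"
      by (intro continuous_intros continuous_on_compose2[OF holomorphic_on_imp_continuous_on[OF V]]) auto
    show "AE u in lborel. cmod (V (of_real u)) \<le> 1"
      using VA
    proof eventually_elim
      case (elim u)
      have "m u * S u \<le> 1 * 1" using m[of u] S0[of u] S1[of u] by (intro mult_mono) auto
      then show ?case unfolding elim norm_of_real using mS0[of u] by simp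
    qed
  qed
  \<comment> \<open>The bound for V obtained so far contains c, which can grow as \<delta> shrinks.
    Since |V| \<le> 1 on the line, Phragmen-Lindelof replaces the constant by 1, uniformly in
    \<delta>, which prepares the use of Montel's theorem.\<close>
  have half: "cmod (F z) \<le> exp (T * Im z)"
    if F: "F holomorphic_on UNIV" "\<And>u. cmod (F (of_real u)) \<le> 1" "\<And>z. cmod (F z) \<le> B * exp (T * \<bar>Im z\<bar>)"
      and z: "Im z \<ge> 0" for F B z
  proof -
    have "cmod (exp (\<i> * of_real T * z) * F z) \<le> 1"
    proof (rule bounded_phragmen_lindelof[of "\<lambda>z. exp (\<i> * of_real T * z) * F z" B])
      show "(\<lambda>z. exp (\<i> * of_real T * z) * F z) holomorphic_on UNIV" by (intro holomorphic_intros F)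
      show "cmod (exp (\<i> * of_real T * of_real x) * F (of_real x)) \<le> 1" for x
        using F(2)[of x] by (simp add: norm_mult)
      show "cmod (exp (\<i> * of_real T * w) * F w) \<le> B" if "Im w \<ge> 0" for w
      proof -
        have "cmod (exp (\<i> * of_real T * w) * F w) = exp (- (T * Im w)) * cmod (F w)" by (simp add: norm_mult)
        also have "\<dots> \<le> exp (- (T * Im w)) * (B * exp (T * Im w))"
          using F(3)[of w] that by (intro mult_left_mono) auto
        also have "\<dots> = B" by (simp add: exp_minus)
        finally show ?thesis .
      qed
    qed (rule z)
    then have "exp (- (T * Im z)) * cmod (F z) \<le> 1" by (simp add: norm_mult)
    then show ?thesis by (simp add: exp_minus divide_simps mult.commute)
  qed
  have "cmod (V z) \<le> exp (T * \<bar>Im z\<bar>)" for z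
  proof (cases "Im z \<ge> 0")
    case True
    then show ?thesis using half[OF V Vr Vb] by simp
  next
    case False
    have "cmod ((\<lambda>z. V (- z)) (- z)) \<le> exp (T * Im (- z))"
    proof (rule half)
      show "(\<lambda>z. V (- z)) holomorphic_on UNIV"
        by (rule holomorphic_on_compose_gen[OF _ V, unfolded o_def]) (auto intro: holomorphic_intros)
      show "cmod (V (- of_real u)) \<le> 1" for u using Vr[of "- u"] by simp
      show "cmod (V (- w)) \<le> c * (T / pi) * exp (T * \<bar>Im w\<bar>)" for w using Vb[of "- w"] by simp
    qed (use False in simp)
    then show ?thesis using False by simp
  qed
  then show "\<exists>V. V holomorphic_on UNIV \<and> (\<forall>z. cmod (V z) \<le> exp ((t + 2 * \<delta>) * \<bar>Im z\<bar>)) \<and>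
    (AE u in lborel. V (of_real u) = of_real (m u * (sinc (\<delta> * u))\<^sup>2))"
    using V VA unfolding T_def S_def by blast
qed

text \<open>That t is nonnegative is a conclusion: t + 2 \<delta> > 0 passes to the limit. With a
  finite logarithmic integral this excludes equality for negative t.\<close>

lemma entire_extension:
  fixes m :: "real \<Rightarrow> real"
  assumes gpos: "AE u in cauchy_measure. 0 < g u"
    and log: "integrable cauchy_measure (\<lambda>u. ln (min 1 (g u)))"
    and mm: "m \<in> borel_measurable borel" and m: "\<And>u. 0 < m u" "\<And>u. m u \<le> 1"
    and hardy: "(\<lambda>u. expfun t u * of_real (m u)) \<in> hardy \<mu>"
  shows "t \<ge> 0" and "\<exists>V. V holomorphic_on UNIV \<and> (\<forall>z. cmod (V z) \<le> exp (t * \<bar>Im z\<bar>)) \<and>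
    (AE u in lborel. V (of_real u) = of_real (m u))"
proof -
  define \<delta> where "\<delta> n = inverse (real (Suc n))" for n
  have \<delta>: "0 < \<delta> n" "\<delta> n \<le> 1" for n by (auto simp: \<delta>_def field_simps)
  have \<delta>lim: "\<delta> \<longlonglongrightarrow> 0" unfolding \<delta>_def by (rule LIMSEQ_inverse_real_of_nat)
  note B = band_limited_multiple[OF gpos log mm m hardy \<delta>(1)]
  have "(\<lambda>n. t + 2 * \<delta> n) \<longlonglongrightarrow> t + 2 * 0" by (intro tendsto_intros \<delta>lim)
  then have "0 \<le> t + 2 * 0" by (rule LIMSEQ_le_const) (intro exI[of _ 0] allI impI less_imp_le B(1))
  then show t: "t \<ge> 0" by simp
  have "\<exists>V. \<forall>n. V n holomorphic_on UNIV \<and> (\<forall>z. cmod (V n z) \<le> exp ((t + 2 * \<delta> n) * \<bar>Im z\<bar>)) \<and>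
    (AE u in lborel. V n (of_real u) = of_real (m u * (sinc (\<delta> n * u))\<^sup>2))"
    by (intro choice allI B(2))
  then obtain V where V: "\<And>n. V n holomorphic_on UNIV" "\<And>n z. cmod (V n z) \<le> exp ((t + 2 * \<delta> n) * \<bar>Im z\<bar>)"
    "\<And>n. AE u in lborel. V n (of_real u) = of_real (m u * (sinc (\<delta> n * u))\<^sup>2)"
    by blast
  \<comment> \<open>All \<delta> n are at most 1, so t + 2 bounds every type and the family is
    locally bounded.\<close>
  define \<H> where "\<H> = {h. h holomorphic_on UNIV \<and> (\<forall>z. cmod (h z) \<le> exp ((t + 2) * \<bar>Im z\<bar>))}"
  obtain W r where W: "W holomorphic_on UNIV" "strict_mono (r :: nat \<Rightarrow> nat)"
      "\<And>x. x \<in> UNIV \<Longrightarrow> ((\<lambda>n. V (r n) x) \<longlongrightarrow> W x) sequentially"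
  proof (rule Montel[of UNIV \<H> V])
    show "\<And>h. h \<in> \<H> \<Longrightarrow> h holomorphic_on UNIV" by (simp add: \<H>_def)
    show "\<exists>B. \<forall>h\<in>\<H>. \<forall>z\<in>K. cmod (h z) \<le> B" if "compact K" "K \<subseteq> UNIV" for K
    proof -
      have "bounded K" using that(1) by (rule compact_imp_bounded)
      then obtain b where b: "\<And>z. z \<in> K \<Longrightarrow> cmod z \<le> b" by (auto simp: bounded_iff)
      have "cmod (h z) \<le> exp ((t + 2) * b)" if "h \<in> \<H>" "z \<in> K" for h z
      proof -
        have "\<bar>Im z\<bar> \<le> b" using abs_Im_le_cmod[of z] b[OF that(2)] by linarith
        then have "(t + 2) * \<bar>Im z\<bar> \<le> (t + 2) * b" using t by (intro mult_left_mono) auto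
        then have "exp ((t + 2) * \<bar>Im z\<bar>) \<le> exp ((t + 2) * b)" by simp
        moreover have "cmod (h z) \<le> exp ((t + 2) * \<bar>Im z\<bar>)" using that(1) by (simp add: \<H>_def)
        ultimately show ?thesis by linarith
      qed
      then show ?thesis by blast
    qed
    show "range V \<subseteq> \<H>"
    proof (clarsimp simp: \<H>_def V(1))
      fix n z
      have "(t + 2 * \<delta> n) * \<bar>Im z\<bar> \<le> (t + 2) * \<bar>Im z\<bar>" using \<delta>(2)[of n] by (intro mult_right_mono) auto
      then have "exp ((t + 2 * \<delta> n) * \<bar>Im z\<bar>) \<le> exp ((t + 2) * \<bar>Im z\<bar>)" by simp
      then show "cmod (V n z) \<le> exp ((t + 2) * \<bar>Im z\<bar>)" using V(2)[of n z] by linarith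
    qed
  qed (use that in auto)
  have \<delta>r: "(\<lambda>n. \<delta> (r n)) \<longlonglongrightarrow> 0" using LIMSEQ_subseq_LIMSEQ[OF \<delta>lim W(2)] by (simp add: o_def)
  have "cmod (W z) \<le> exp (t * \<bar>Im z\<bar>)" for z
  proof -
    have 1: "(\<lambda>n. exp ((t + 2 * \<delta> (r n)) * \<bar>Im z\<bar>)) \<longlonglongrightarrow> exp ((t + 2 * 0) * \<bar>Im z\<bar>)"
      by (intro tendsto_intros \<delta>r)
    have 2: "(\<lambda>n. cmod (V (r n) z)) \<longlonglongrightarrow> cmod (W z)" by (intro tendsto_intros W(3)) simp
    have "cmod (W z) \<le> exp ((t + 2 * 0) * \<bar>Im z\<bar>)"
      by (rule LIMSEQ_le[OF 2 1]) (intro exI[of _ 0] allI impI V(2))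
    then show ?thesis by simp
  qed
  moreover have "AE u in lborel. W (of_real u) = of_real (m u)"
  proof -
    have "AE u in lborel. \<forall>n. V n (of_real u) = of_real (m u * (sinc (\<delta> n * u))\<^sup>2)"
      using V(3) by (subst AE_all_countable) simp
    then show ?thesis
    proof eventually_elim
      case (elim u)
      have "isCont sinc 0" by (rule isCont_sinc)
      moreover have "(\<lambda>n. \<delta> (r n) * u) \<longlonglongrightarrow> 0 * u" by (intro tendsto_intros \<delta>r)
      ultimately have "(\<lambda>n. sinc (\<delta> (r n) * u)) \<longlonglongrightarrow> sinc 0"
        by (intro isCont_tendsto_compose[of 0 sinc]) simp_all
      then have "(\<lambda>n. complex_of_real (m u * (sinc (\<delta> (r n) * u))\<^sup>2)) \<longlonglongrightarrow> of_real (m u * (sinc 0)\<^sup>2)"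
        by (intro tendsto_intros)
      then have "(\<lambda>n. V (r n) (of_real u)) \<longlonglongrightarrow> of_real (m u)" using elim by simp
      then show ?case using W(3)[of "of_real u"] LIMSEQ_unique by blast
    qed
  qed
  ultimately show "\<exists>V. V holomorphic_on UNIV \<and> (\<forall>z. cmod (V z) \<le> exp (t * \<bar>Im z\<bar>)) \<and>
    (AE u in lborel. V (of_real u) = of_real (m u))" using W(1) by blast
qed

end

section \<open>From entire functions back to the closed span\<close>

text \<open>\<open>N\<close> may be any Lebesgue null set that carries the singular part, so it can
  absorb a further null set, later the one where V and m differ.\<close>

lemma decomposed_measure_enlarge:
  assumes "decomposed_measure \<mu> g N" "N' \<in> null_sets lborel"
  shows "decomposed_measure \<mu> g (N \<union> N')"
proof -
  interpret decomposed_measure \<mu> g N by fact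
  have [measurable]: "N' \<in> sets borel" using assms(2) by auto
  show ?thesis
  proof
    show "N \<union> N' \<in> null_sets lborel" using N_null assms(2) by (rule null_sets.Un)
    have i: "ennreal (indicator (- N) u) * ennreal (indicator (- N') u) = ennreal (indicator (- (N \<union> N')) u)" for u
      by (auto simp: indicator_def)
    have "density \<mu> (\<lambda>u. ennreal (indicator (- (N \<union> N')) u)) = density (density \<mu> (\<lambda>u. ennreal (indicator (- N) u))) (\<lambda>u. ennreal (indicator (- N') u))"
      unfolding i[symmetric] by (rule density_density_eq[symmetric]) (simp_all add: measurable_eq)
    also have "\<dots> = density cauchy_measure (\<lambda>u. ennreal (g u) * ennreal (indicator (- N') u))"
      unfolding dens by (rule density_density_eq) simp_all
    also have "\<dots> = density cauchy_measure (\<lambda>u. ennreal (g u))"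
    proof (rule density_cong)
      have "AE u in cauchy_measure. u \<notin> N'" using assms(2) null_sets_cauchy by (intro AE_not_in) simp
      then show "AE u in cauchy_measure. ennreal (g u) * ennreal (indicator (- N') u) = ennreal (g u)"
        by eventually_elim simp
    qed simp_all
    finally show "density \<mu> (\<lambda>u. ennreal (indicator (- (N \<union> N')) u)) = density cauchy_measure (\<lambda>u. ennreal (g u))" .
  qed (simp_all add: g_nonneg)
qed

context decomposed_measure
begin

text \<open>Exponential type t bounds V by exp((t + e) |z|) only, so exp(\<i> (t + e) u) V(u) is
  shown to be a multiplier first, and e -> 0 is a bounded limit. V and m agree Lebesgue almost
  everywhere, which leaves open what happens on the singular part of \<open>\<mu>\<close>; their
  difference lives on a null set and is covered by \<open>singular_part_in_hardy\<close>.\<close>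

lemma entire_exp_type_in_hardy:
  fixes m :: "real \<Rightarrow> real"
  assumes t: "t \<ge> 0" and V: "entire_of_exp_type t V"
    and mm[measurable]: "m \<in> borel_measurable borel" and m: "\<And>u. 0 < m u" "\<And>u. m u \<le> 1"
    and eq: "AE u in lborel. V (of_real u) = of_real (m u)"
  shows "(\<lambda>u. expfun t u * of_real (m u)) \<in> hardy \<mu>"
proof -
  let ?Mu = "multipliers \<mu> (expfun ` {0..})"
  have Vh: "V holomorphic_on UNIV" using V by (simp add: entire_of_exp_type_def)
  have Vr: "cmod (V (of_real u)) \<le> 1" for u
  proof (rule AE_lborel_le_imp_le[of "\<lambda>u. cmod (V (of_real u))"])
    show "continuous_on UNIV (\<lambda>u. cmod (V (complex_of_real u)))"
      by (intro continuous_intros continuous_on_compose2[OF holomorphic_on_imp_continuous_on[OF Vh]]) auto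
    show "AE u in lborel. cmod (V (of_real u)) \<le> 1"
      using eq by eventually_elim (use m in \<open>auto simp: less_imp_le\<close>)
  qed
  have Vm[measurable]: "(\<lambda>u. V (of_real u)) \<in> borel_measurable borel"
    by (rule borel_measurable_continuous_onI, rule continuous_on_compose2[OF holomorphic_on_imp_continuous_on[OF Vh]])
       (auto intro: continuous_intros)
  have eps: "(\<lambda>u. V (of_real u) * expfun (t + e) u) \<in> ?Mu" if e: "e > 0" for e
  proof -
    obtain C where C: "\<And>z. cmod (V z) \<le> C * exp ((t + e) * cmod z)"
      using V e by (auto simp: entire_of_exp_type_def)
    have C0: "C \<ge> 0" using order_trans[OF norm_ge_zero C[of 0]] by simp
    define F where "F z = V z * exp (\<i> * of_real (t + e) * z)" for z
    have Fh: "F holomorphic_on UNIV" unfolding F_def[abs_def] by (intro holomorphic_intros Vh)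
    have Fn: "cmod (F z) = cmod (V z) * exp (- ((t + e) * Im z))" for z by (simp add: F_def norm_mult)
    have "cmod (F z) \<le> max 1 C" if "Im z \<ge> 0" for z
    proof (rule half_plane_phragmen_lindelof[OF Fh])
      show "cmod (F w) \<le> C * exp ((2 * (t + e)) * cmod w)" for w
      proof -
        have "- ((t + e) * Im w) \<le> (t + e) * \<bar>Im w\<bar>"
          using mult_left_mono[of "- Im w" "\<bar>Im w\<bar>" "t + e"] t e by simp
        also have "\<dots> \<le> (t + e) * cmod w" using t e abs_Im_le_cmod by (intro mult_left_mono) auto
        finally have "exp (- ((t + e) * Im w)) \<le> exp ((t + e) * cmod w)" by simp
        then have "cmod (F w) \<le> (C * exp ((t + e) * cmod w)) * exp ((t + e) * cmod w)"
          unfolding Fn using C[of w] C0 by (intro mult_mono) auto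
        also have "\<dots> = C * exp ((2 * (t + e)) * cmod w)"
          by (simp add: mult.assoc distrib_right flip: exp_add)
        finally show ?thesis .
      qed
      show "cmod (F (of_real x)) \<le> max 1 C" for x using Vr[of x] by (simp add: Fn le_max_iff_disj)
      \<comment> \<open>On the imaginary axis the exponential factor cancels the growth of V
        exactly; this provides the second ray for the quadrants.\<close>
      show "cmod (F (\<i> * of_real y)) \<le> max 1 C" if "y \<ge> 0" for y
      proof -
        have "cmod (F (\<i> * of_real y)) \<le> (C * exp ((t + e) * y)) * exp (- ((t + e) * y))"
          unfolding Fn using C[of "\<i> * of_real y"] that C0 by (intro mult_mono) (auto simp: norm_mult)
        also have "\<dots> = C" by (simp add: exp_minus)
        finally show ?thesis by simp
      qed
    qed (use that in auto)
    then have "(\<lambda>u. F (of_real u)) \<in> ?Mu"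
      by (intro bounded_upper_half_plane_multiplier[OF Fh, where C="max 1 C"]) auto
    moreover have "F (of_real u) = V (of_real u) * expfun (t + e) u" for u
      by (simp add: F_def expfun_def mult.assoc)
    ultimately show ?thesis by simp
  qed
  have lim: "(\<lambda>u. V (of_real u) * expfun t u) \<in> ?Mu"
  proof (rule multipliers_LIMSEQ[OF expfun_L2])
    show "(\<lambda>u. V (of_real u) * expfun (t + inverse (real (Suc n))) u) \<in> ?Mu" for n by (rule eps) simp
    show "cmod (V (of_real u) * expfun (t + inverse (real (Suc n))) u) \<le> 1" for n u
      using Vr[of u] by (simp add: norm_mult)
    have "(\<lambda>n. V (of_real u) * iexp ((t + inverse (real (Suc n))) * u)) \<longlonglongrightarrow> V (of_real u) * iexp ((t + 0) * u)" for u
      by (intro tendsto_intros LIMSEQ_inverse_real_of_nat)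
    then show "(\<lambda>n. V (of_real u) * expfun (t + inverse (real (Suc n))) u) \<longlonglongrightarrow> V (of_real u) * expfun t u" for u
      by (simp add: expfun_def del: of_nat_Suc)
  qed
  define N' where "N' = {u. V (of_real u) \<noteq> of_real (m u)}"
  have [measurable]: "N' \<in> sets borel" unfolding N'_def by measurable
  have "N' \<in> null_sets lborel"
    using eq by (subst AE_iff_null_sets) (auto simp: N'_def)
  then interpret e: decomposed_measure \<mu> g "N \<union> N'"
    by (intro decomposed_measure_enlarge decomposed_measure_axioms)
  define \<psi> where "\<psi> u = expfun t u * of_real (m u) - V (of_real u) * expfun t u" for u
  have "\<psi> \<in> L2 \<mu>"
    unfolding \<psi>_def[abs_def]
  proof (intro L2_diff bounded_L2[where C=1])
    show "cmod (expfun t u * of_real (m u)) \<le> 1" for u using m[of u] by (simp add: norm_mult)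
    show "cmod (V (of_real u) * expfun t u) \<le> 1" for u using Vr[of u] by (simp add: norm_mult)
  qed measurable
  from closed_lin_span_add[OF expfun_L2 multiplier_in_hardy[OF lim, unfolded hardy_def] e.singular_part_in_hardy[OF this, unfolded hardy_def]]
  have "(\<lambda>u. V (of_real u) * expfun t u + indicator (N \<union> N') u * \<psi> u) \<in> hardy \<mu>" by (simp add: hardy_def)
  then show ?thesis
    unfolding hardy_def
  proof (rule closed_lin_span_cong_AE[OF _ expfun_L2])
    show "(\<lambda>u. expfun t u * of_real (m u)) \<in> L2 \<mu>"
    proof (rule bounded_L2[where C=1])
      show "cmod (expfun t u * of_real (m u)) \<le> 1" for u using m[of u] by (simp add: norm_mult)
    qed measurable
    show "AE u in \<mu>. V (of_real u) * expfun t u + indicator (N \<union> N') u * \<psi> u = expfun t u * of_real (m u)"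
      by (rule AE_I2) (auto simp: \<psi>_def N'_def indicator_def)
  qed
qed

end

section \<open>Spectral representation of the prediction errors\<close>

lemma rel_span_mono: "R \<subseteq> R' \<Longrightarrow> rel_span R \<subseteq> rel_span R'"
proof clarify
  fix \<phi> \<xi> assume "R \<subseteq> R'" "(\<phi>, \<xi>) \<in> rel_span R"
  from this(2) show "(\<phi>, \<xi>) \<in> rel_span R'"
    by induction (use \<open>R \<subseteq> R'\<close> in \<open>auto intro: rel_span.intros\<close>)
qed

lemma L2_simple_dense:
  assumes \<phi>: "\<phi> \<in> L2 M" and "e > 0"
  shows "\<exists>g. simple_function M g \<and> L2_dist_sq M \<phi> g < e"
proof -
  note [measurable] = L2_measurable[OF \<phi>]
  obtain F where F: "\<And>i. simple_function M (F i)" "\<And>x. x \<in> space M \<Longrightarrow> (\<lambda>i. F i x) \<longlonglongrightarrow> \<phi> x"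
    "\<And>i x. x \<in> space M \<Longrightarrow> dist (F i x) 0 \<le> 2 * dist (\<phi> x) 0"
    using borel_measurable_implies_sequence_metric[OF L2_measurable[OF \<phi>], of 0] by blast
  note [measurable] = borel_measurable_simple_function[OF F(1)]
  have "(\<lambda>i. \<integral>x. (cmod (\<phi> x - F i x))\<^sup>2 \<partial>M) \<longlonglongrightarrow> (\<integral>x. 0 \<partial>M)"
  \<comment> \<open>The approximants are at most 2 |\<phi>|, hence the error is at most 3
    |\<phi>|.\<close>
  proof (rule integral_dominated_convergence[where w="\<lambda>x. 9 * (cmod (\<phi> x))\<^sup>2"])
    show "integrable M (\<lambda>x. 9 * (cmod (\<phi> x))\<^sup>2)" using L2_integrable[OF \<phi>] by simp
    show "AE x in M. (\<lambda>i. (cmod (\<phi> x - F i x))\<^sup>2) \<longlonglongrightarrow> 0"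
    proof (rule AE_I2)
      fix x assume "x \<in> space M"
      then have "(\<lambda>i. (cmod (\<phi> x - F i x))\<^sup>2) \<longlonglongrightarrow> (cmod (\<phi> x - \<phi> x))\<^sup>2" by (intro tendsto_intros F)
      then show "(\<lambda>i. (cmod (\<phi> x - F i x))\<^sup>2) \<longlonglongrightarrow> 0" by simp
    qed
    show "AE x in M. norm ((cmod (\<phi> x - F i x))\<^sup>2) \<le> 9 * (cmod (\<phi> x))\<^sup>2" for i
    proof (rule AE_I2)
      fix x assume "x \<in> space M"
      then have "cmod (F i x) \<le> 2 * cmod (\<phi> x)" using F(3)[of x i] by simp
      then have "cmod (\<phi> x - F i x) \<le> 3 * cmod (\<phi> x)" using norm_triangle_ineq4[of "\<phi> x" "F i x"] by linarith
      then have "(cmod (\<phi> x - F i x))\<^sup>2 \<le> (3 * cmod (\<phi> x))\<^sup>2" by (intro power_mono) auto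
      then show "norm ((cmod (\<phi> x - F i x))\<^sup>2) \<le> 9 * (cmod (\<phi> x))\<^sup>2" by (simp add: power_mult_distrib)
    qed
  qed simp_all
  then have "(\<lambda>i. L2_dist_sq M \<phi> (F i)) \<longlonglongrightarrow> 0" by (simp add: L2_dist_sq_def)
  from eventually_happens'[OF sequentially_bot order_tendstoD(2)[OF this \<open>e > 0\<close>]]
  show ?thesis using F(1) by blast
qed

context borel_finite_measure
begin

section \<open>The stochastic integral as an isometry\<close>

lemma indicator_L2: "A \<in> sets borel \<Longrightarrow> (\<lambda>u. indicator A u) \<in> L2 \<mu>"
  by (rule bounded_L2[where C=1]) (auto simp: indicator_def)

lemma indicator_inner:
  assumes "A \<in> sets borel" "C \<in> sets borel"
  shows "L2_inner \<mu> (\<lambda>u. indicator A u) (\<lambda>u. indicator C u) = of_real (measure \<mu> (A \<inter> C))"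
proof -
  have "L2_inner \<mu> (\<lambda>u. indicator A u) (\<lambda>u. indicator C u) = (\<integral>u. of_real (indicator (A \<inter> C) u) \<partial>\<mu>)"
    unfolding L2_inner_def by (intro Bochner_Integration.integral_cong) (auto simp: indicator_def)
  also have "\<dots> = of_real (\<integral>u. indicator (A \<inter> C) u \<partial>\<mu>)" by (rule integral_complex_of_real)
  finally show ?thesis using assms by (simp add: sets_eq)
qed

definition simple_graph :: "'b measure \<Rightarrow> (real set \<Rightarrow> 'b \<Rightarrow> complex) \<Rightarrow> ((real \<Rightarrow> complex) \<times> ('b \<Rightarrow> complex)) set" where
  "simple_graph M W = {(g, simple_stoch_integral \<mu> W g) | g. simple_function \<mu> g}"

lemma has_stoch_integral_iff: "has_stoch_integral M \<mu> W \<phi> \<xi> \<longleftrightarrow> (\<phi>, \<xi>) \<in> rel_closure \<mu> M (simple_graph M W)"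
  unfolding has_stoch_integral_def rel_closure_def simple_graph_def by blast

text \<open>Writing a simple function over its level sets puts its integral into the linear
  extension of A -> \<open>W A\<close>, from which the isometry is inherited.\<close>

lemma simple_graph_subset:
  "simple_graph M W \<subseteq> rel_span {(\<lambda>u. indicator A u, W A) | A. A \<in> sets borel}"
proof (clarsimp simp: simple_graph_def)
  fix g :: "real \<Rightarrow> complex" assume g: "simple_function \<mu> g"
  let ?R = "{(\<lambda>u. indicator A u, W A) | A. A \<in> sets borel}"
  have fin: "finite (range g)" using simple_functionD(1)[OF g] by simp
  have "g -` {z} \<in> sets borel" for z using simple_functionD(2)[OF g, of "{z}"] by (simp add: sets_eq)
  then have "(\<lambda>u. \<Sum>z\<in>range g. z * indicator (g -` {z}) u, \<lambda>\<omega>. \<Sum>z\<in>range g. z * W (g -` {z}) \<omega>) \<in> rel_span ?R"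
    by (intro rel_span_sum fin) blast
  moreover have "(\<lambda>u. \<Sum>z\<in>range g. z * indicator (g -` {z}) u) = g"
  proof
    fix u
    have "(\<Sum>z\<in>range g. z * indicator (g -` {z}) u) = (\<Sum>z\<in>{g u}. z * indicator (g -` {z}) u)"
      using fin by (intro sum.mono_neutral_right) (auto simp: indicator_def)
    then show "(\<Sum>z\<in>range g. z * indicator (g -` {z}) u) = g u" by simp
  qed
  ultimately show "(g, simple_stoch_integral \<mu> W g) \<in> rel_span ?R"
    by (simp add: simple_stoch_integral_def)
qed

text \<open>The definition speaks of disjoint sets and of countable sums in mean square. Finite
  additivity almost surely is read off from the family A, C, {}, {}, ..., whose partial sums become
  almost surely constant because \<open>W {}\<close> has norm 0. Splitting both sets at A \<inter> C
  then leaves only the squared norm of \<open>W (A \<inter> C)\<close>.\<close>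

lemma orthogonal_random_measure_inner:
  assumes W: "orthogonal_random_measure M \<mu> W" and A: "A \<in> sets borel" and C: "C \<in> sets borel"
  shows "L2_inner M (W A) (W C) = of_real (measure \<mu> (A \<inter> C))"
proof -
  have WL: "W A \<in> L2 M" and Wn: "(\<integral>\<omega>. (cmod (W A \<omega>))\<^sup>2 \<partial>M) = measure \<mu> A" if "A \<in> sets borel" for A
    using W that by (auto simp: orthogonal_random_measure_def sets_eq)
  have Wo: "L2_inner M (W A) (W C) = 0" if "A \<in> sets borel" "C \<in> sets borel" "A \<inter> C = {}" for A C
    using W that by (auto simp: orthogonal_random_measure_def sets_eq L2_inner_def)
  have W0: "AE \<omega> in M. W {} \<omega> = 0"
    using L2_dist_sq_eq_0_iff[OF WL[of "{}"] L2_zero] Wn[of "{}"] by (simp add: L2_dist_sq_def)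
  have add: "AE \<omega> in M. W (A \<union> C) \<omega> = W A \<omega> + W C \<omega>" if A: "A \<in> sets borel" and C: "C \<in> sets borel" and disj: "A \<inter> C = {}" for A C
  proof -
    define F where "F k = (if k = 0 then A else if k = 1 then C else {})" for k :: nat
    have F: "range F \<subseteq> sets \<mu>" "disjoint_family F" "(\<Union>k. F k) = A \<union> C"
      using A C disj by (auto simp: F_def sets_eq disjoint_family_on_def split: if_splits)
    have lim: "(\<lambda>n. L2_dist_sq M (W (\<Union>k. F k)) (\<lambda>\<omega>. \<Sum>k<n. W (F k) \<omega>)) \<longlonglongrightarrow> 0"
      using W F(1,2) by (auto simp: orthogonal_random_measure_def)
    have AC: "A \<union> C \<in> sets borel" using A C by auto
    have Fb: "F k \<in> sets borel" for k using A C by (simp add: F_def)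
    have "L2_dist_sq M (W (\<Union>k. F k)) (\<lambda>\<omega>. \<Sum>k<n. W (F k) \<omega>) = L2_dist_sq M (W (A \<union> C)) (\<lambda>\<omega>. W A \<omega> + W C \<omega>)" if n: "n \<ge> 2" for n
      unfolding F(3)
    proof (rule L2_dist_sq_cong_AE)
      show "AE \<omega> in M. (\<Sum>k<n. W (F k) \<omega>) = W A \<omega> + W C \<omega>"
        using W0
      proof eventually_elim
        case (elim \<omega>)
        have "(\<Sum>k<n. W (F k) \<omega>) = (\<Sum>k\<in>{0, 1}. W (F k) \<omega>)"
          using n elim by (intro sum.mono_neutral_right) (auto simp: F_def)
        then show ?case by (simp add: F_def)
      qed
    qed (use L2_measurable[OF WL[OF AC]] L2_measurable[OF L2_add[OF WL[OF A] WL[OF C]]]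
        L2_measurable[OF L2_sum[of "{..<n}" "\<lambda>k. W (F k)", OF WL[OF Fb]]] in auto)
    then have "\<forall>\<^sub>F n in sequentially. L2_dist_sq M (W (\<Union>k. F k)) (\<lambda>\<omega>. \<Sum>k<n. W (F k) \<omega>) = L2_dist_sq M (W (A \<union> C)) (\<lambda>\<omega>. W A \<omega> + W C \<omega>)"
      by (intro eventually_sequentiallyI[of 2]) blast
    from Lim_transform_eventually[OF lim this]
    have "(\<lambda>n::nat. L2_dist_sq M (W (A \<union> C)) (\<lambda>\<omega>. W A \<omega> + W C \<omega>)) \<longlonglongrightarrow> 0" .
    then have "L2_dist_sq M (W (A \<union> C)) (\<lambda>\<omega>. W A \<omega> + W C \<omega>) = 0" by (simp add: LIMSEQ_const_iff)
    then show ?thesis using L2_dist_sq_eq_0_iff[OF WL[OF AC] L2_add[OF WL[OF A] WL[OF C]]] by simp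
  qed
  define D where "D = A \<inter> C"
  have D: "D \<in> sets borel" "A - C \<in> sets borel" "C - A \<in> sets borel" using A C by (auto simp: D_def)
  have eA: "AE \<omega> in M. W A \<omega> = W D \<omega> + W (A - C) \<omega>"
  proof -
    have "D \<union> (A - C) = A" "D \<inter> (A - C) = {}" by (auto simp: D_def)
    then show ?thesis using add[OF D(1,2)] by simp
  qed
  have eC: "AE \<omega> in M. W C \<omega> = W D \<omega> + W (C - A) \<omega>"
  proof -
    have "D \<union> (C - A) = C" "D \<inter> (C - A) = {}" by (auto simp: D_def)
    then show ?thesis using add[OF D(1,3)] by simp
  qed
  note L = WL[OF D(1)] WL[OF D(2)] WL[OF D(3)]
  have "L2_inner M (W A) (W C) = L2_inner M (\<lambda>\<omega>. W D \<omega> + W (A - C) \<omega>) (\<lambda>\<omega>. W D \<omega> + W (C - A) \<omega>)"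
    by (rule L2_inner_cong_AE[OF eA eC]) (intro L2_measurable WL L2_add A C D)+
  also have "\<dots> = L2_inner M (W D) (W D) + L2_inner M (W D) (W (C - A)) + (L2_inner M (W (A - C)) (W D) + L2_inner M (W (A - C)) (W (C - A)))"
    using L by (simp add: L2_inner_add_left L2_inner_add_right L2_add)
  also have "L2_inner M (W D) (W (C - A)) = 0" by (rule Wo[OF D(1,3)]) (auto simp: D_def)
  also have "L2_inner M (W (A - C)) (W D) = 0" by (rule Wo[OF D(2,1)]) (auto simp: D_def)
  also have "L2_inner M (W (A - C)) (W (C - A)) = 0" by (rule Wo[OF D(2,3)]) auto
  also have "L2_inner M (W D) (W D) = of_real (measure \<mu> D)" using Wn[OF D(1)] by (simp add: L2_inner_self)
  finally show ?thesis by (simp add: D_def)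
qed

lemma indicator_rel_isometric:
  assumes W: "\<And>A. A \<in> sets borel \<Longrightarrow> W A \<in> L2 M"
    "\<And>A C. A \<in> sets borel \<Longrightarrow> C \<in> sets borel \<Longrightarrow> L2_inner M (W A) (W C) = of_real (measure \<mu> (A \<inter> C))"
  shows "isometric_on \<mu> M {(\<lambda>u. indicator A u, W A) | A. A \<in> sets borel}"
  by (rule isometric_onI) (auto simp: indicator_L2 indicator_inner W)

lemma stoch_integral_isometric:
  assumes W: "orthogonal_random_measure M \<mu> W"
  shows "isometric_on \<mu> M {(\<phi>, \<xi>). has_stoch_integral M \<mu> W \<phi> \<xi>}" (is ?iso)
    and "\<phi> \<in> L2 \<mu> \<Longrightarrow> \<exists>\<xi>. has_stoch_integral M \<mu> W \<phi> \<xi>"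
proof -
  have "isometric_on \<mu> M {(\<lambda>u. indicator A u, W A) | A. A \<in> sets borel}"
    by (rule indicator_rel_isometric)
       (use W orthogonal_random_measure_inner[OF W] in \<open>auto simp: orthogonal_random_measure_def sets_eq\<close>)
  from isometric_on_subset[OF isometric_rel_span[OF this] simple_graph_subset]
  have iso: "isometric_on \<mu> M (simple_graph M W)" .
  show ?iso unfolding has_stoch_integral_iff using isometric_rel_closure[OF iso] by simp
  show "\<exists>\<xi>. has_stoch_integral M \<mu> W \<phi> \<xi>" if \<phi>: "\<phi> \<in> L2 \<mu>"
  proof -
    obtain \<xi> where "(\<phi>, \<xi>) \<in> rel_closure \<mu> M (simple_graph M W)"
    proof (rule rel_closure_total[OF iso \<phi>])
      fix e :: real assume "e > 0"
      then obtain g where "simple_function \<mu> g" "L2_dist_sq \<mu> \<phi> g < e" using L2_simple_dense[OF \<phi>] by blast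
      then show "\<exists>(\<psi>, \<eta>)\<in>simple_graph M W. L2_dist_sq \<mu> \<phi> \<psi> < e" by (auto simp: simple_graph_def)
    qed (use that in auto)
    then show ?thesis unfolding has_stoch_integral_iff by blast
  qed
qed

text \<open>Polynomials in w come from nonnegative frequencies and their conjugates from nonpositive
  ones; the sums of the two kinds are dense.\<close>

lemma expfun_span_dense: "closed_lin_span \<mu> (range expfun) = L2 \<mu>"
proof -
  have "\<phi> \<in> closed_lin_span \<mu> (range expfun)" if \<phi>: "\<phi> \<in> L2 \<mu>" for \<phi>
  proof (rule closed_lin_span_closed[OF expfun_L2 \<phi>])
    fix e :: real assume "e > 0"
    then obtain P Q where PQ: "L2_dist_sq \<mu> \<phi> (\<lambda>u. poly P (cayley (of_real u)) + cnj (poly Q (cayley (of_real u)))) < e"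
      using L2_poly_dense[OF \<phi>] by blast
    have P: "(\<lambda>u. poly P (cayley (of_real u))) \<in> hardy \<mu>" for P
      by (rule multiplier_in_hardy, rule entire_cayley_multiplier) (intro holomorphic_intros)
    have "hardy \<mu> \<subseteq> closed_lin_span \<mu> (range expfun)"
      unfolding hardy_def by (rule closed_lin_span_mono) auto
    then have 1: "(\<lambda>u. poly P (cayley (of_real u))) \<in> closed_lin_span \<mu> (range expfun)" using P by blast
    have "(\<lambda>Z u. cnj (Z u)) ` expfun ` {0..} \<subseteq> range expfun"
      by (auto simp: cnj_expfun)
    then have 2: "(\<lambda>u. cnj (poly Q (cayley (of_real u)))) \<in> closed_lin_span \<mu> (range expfun)"
      using closed_lin_span_cnj[OF P[of Q, unfolded hardy_def]] closed_lin_span_mono by blast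
    show "\<exists>Y\<in>closed_lin_span \<mu> (range expfun). L2_dist_sq \<mu> \<phi> Y < e"
      using closed_lin_span_add[OF expfun_L2 1 2] PQ by blast
  qed
  then show ?thesis using closed_lin_span_L2 by blast
qed

text \<open>The choice in \<open>spectral_random_measure\<close> is meaningful only if a witness
  exists. The relation exp(\<i> t u) -> B(t) preserves inner products, because the covariance is the
  Fourier transform of \<open>\<mu>\<close>; its closure reaches all of L2(\<open>\<mu>\<close>),
  and \<open>W A\<close> is an image of the indicator of A.\<close>

lemma spectral_random_measure_exists:
  assumes B: "\<And>s. B s \<in> L2 M" and K: "\<And>t s. (\<integral>\<omega>. B (t + s) \<omega> * cnj (B s \<omega>) \<partial>M) = char \<mu> t"
  shows "\<exists>W. orthogonal_random_measure M \<mu> W \<and> (\<forall>t. has_stoch_integral M \<mu> W (expfun t) (B t))"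
proof -
  define R0 where "R0 = {(expfun s, B s) | s. True}"
  have "L2_inner \<mu> (expfun s) (expfun r) = L2_inner M (B s) (B r)" for s r
  proof -
    have "L2_inner \<mu> (expfun s) (expfun r) = (\<integral>u. iexp ((s - r) * u) \<partial>\<mu>)"
      unfolding L2_inner_def cnj_expfun expfun_add[symmetric] by (simp add: expfun_def)
    also have "\<dots> = L2_inner M (B s) (B r)"
      using K[of "s - r" r] by (simp add: L2_inner_def char_def)
    finally show ?thesis .
  qed
  then have R0: "isometric_on \<mu> M R0"
    using expfun_L2[of UNIV] B by (intro isometric_onI) (auto simp: R0_def)
  define R1 where "R1 = rel_closure \<mu> M (rel_span R0)"
  have R1: "isometric_on \<mu> M R1" unfolding R1_def by (intro isometric_rel_closure isometric_rel_span R0)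
  have total: "\<exists>\<xi>. (\<phi>, \<xi>) \<in> R1" if \<phi>: "\<phi> \<in> L2 \<mu>" for \<phi>
  proof -
    obtain \<xi> where "(\<phi>, \<xi>) \<in> R1"
      unfolding R1_def
    proof (rule rel_closure_total[OF isometric_rel_span[OF R0] \<phi>])
      fix e :: real assume "e > 0"
      moreover have "\<phi> \<in> closed_lin_span \<mu> (range expfun)" using \<phi> expfun_span_dense by simp
      ultimately obtain p where p: "p \<in> complex_lin_span (range expfun)" "L2_dist_sq \<mu> \<phi> p < e"
        unfolding closed_lin_span_def by blast
      have "\<exists>Y\<in>complex_lin_span (range B). (p, Y) \<in> rel_span R0"
        by (rule complex_lin_span_transfer[OF _ p(1)]) (auto simp: R0_def)
      then show "\<exists>(\<psi>, \<eta>)\<in>rel_span R0. L2_dist_sq \<mu> \<phi> \<psi> < e" using p(2) by blast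
    qed (use that in auto)
    then show ?thesis by blast
  qed
  define W where "W A = (SOME X. ((\<lambda>u. indicator A u), X) \<in> R1)" for A
  have WR: "((\<lambda>u. indicator A u), W A) \<in> R1" if "A \<in> sets borel" for A
    unfolding W_def by (rule someI_ex[OF total[OF indicator_L2[OF that]]])
  have WL: "W A \<in> L2 M" if "A \<in> sets borel" for A by (rule isometric_onD(2)[OF R1 WR[OF that]])
  have Wi: "L2_inner M (W A) (W C) = of_real (measure \<mu> (A \<inter> C))" if "A \<in> sets borel" "C \<in> sets borel" for A C
    using isometric_onD(3)[OF R1 WR[OF that(1)] WR[OF that(2)]] indicator_inner[OF that] by simp
  have "orthogonal_random_measure M \<mu> W"
    unfolding orthogonal_random_measure_def
  proof (intro conjI ballI allI impI)
    fix A assume A: "A \<in> sets \<mu>"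
    then show "W A \<in> L2 M" using WL by (simp add: sets_eq)
    have "complex_of_real (\<integral>\<omega>. (cmod (W A \<omega>))\<^sup>2 \<partial>M) = of_real (measure \<mu> A)"
      using Wi[of A A] A by (simp add: sets_eq L2_inner_self)
    then show "(\<integral>\<omega>. (cmod (W A \<omega>))\<^sup>2 \<partial>M) = measure \<mu> A" by simp
  next
    fix A C assume "A \<in> sets \<mu>" "C \<in> sets \<mu>" "A \<inter> C = {}"
    then show "(\<integral>\<omega>. W A \<omega> * cnj (W C \<omega>) \<partial>M) = 0" using Wi[of A C] by (simp add: sets_eq L2_inner_def)
  next
    fix A :: "nat \<Rightarrow> real set" assume A: "range A \<subseteq> sets \<mu> \<and> disjoint_family A"
    then have Ab: "A k \<in> sets borel" for k by (auto simp: sets_eq)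
    have Ub: "(\<Union>k. A k) \<in> sets borel" using Ab by auto
    have pn: "((\<lambda>u. \<Sum>k<n. indicator (A k) u), \<lambda>\<omega>. \<Sum>k<n. W (A k) \<omega>) \<in> rel_span R1" for n
      using rel_span_sum[of "{..<n}" "\<lambda>k u. indicator (A k) u" "\<lambda>k. W (A k)" R1 "\<lambda>_. 1"] WR[OF Ab] by simp
    \<comment> \<open>By isometry the distance is the measure of the remaining union, which tends to
      0 by continuity of \<open>\<mu>\<close>.\<close>
    have "L2_dist_sq M (W (\<Union>k. A k)) (\<lambda>\<omega>. \<Sum>k<n. W (A k) \<omega>) = measure \<mu> (\<Union>k. A k) - measure \<mu> (\<Union>k<n. A k)" for n
    proof -
      have "L2_dist_sq M (W (\<Union>k. A k)) (\<lambda>\<omega>. \<Sum>k<n. W (A k) \<omega>) = L2_dist_sq \<mu> (\<lambda>u. indicator (\<Union>k. A k) u) (\<lambda>u. \<Sum>k<n. indicator (A k) u)"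
        using isometric_on_dist[OF isometric_rel_span[OF R1] rel_span_base[OF WR[OF Ub]] pn] by simp
      also have "\<dots> = (\<integral>u. indicator ((\<Union>k. A k) - (\<Union>k<n. A k)) u \<partial>\<mu>)"
        unfolding L2_dist_sq_def
      proof (rule Bochner_Integration.integral_cong[OF refl])
        fix u
        have "(\<Sum>k<n. indicator (A k) u :: complex) = indicator (\<Union>k<n. A k) u"
          by (rule indicator_UN_disjoint[symmetric]) (use A in \<open>auto simp: disjoint_family_on_def\<close>)
        then show "(cmod (indicator (\<Union>k. A k) u - (\<Sum>k<n. indicator (A k) u)))\<^sup>2 = indicator ((\<Union>k. A k) - (\<Union>k<n. A k)) u"
          by (auto simp: indicator_def)
      qed
      also have "\<dots> = measure \<mu> ((\<Union>k. A k) - (\<Union>k<n. A k))" using Ab by (simp add: sets_eq)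
      also have "\<dots> = measure \<mu> (\<Union>k. A k) - measure \<mu> (\<Union>k<n. A k)"
        using Ab by (intro finite_measure_Diff) (auto simp: sets_eq)
      finally show ?thesis .
    qed
    moreover have "(\<lambda>n. measure \<mu> (\<Union>k. A k) - measure \<mu> (\<Union>k<n. A k)) \<longlonglongrightarrow> measure \<mu> (\<Union>k. A k) - measure \<mu> (\<Union>n. \<Union>k<n. A k)"
      by (intro tendsto_intros finite_Lim_measure_incseq)
         (use Ab in \<open>auto simp: incseq_def sets_eq intro: order_less_le_trans\<close>)
    moreover have "(\<Union>n. \<Union>k<n. A k) = (\<Union>k. A k)" by auto
    ultimately show "(\<lambda>n. L2_dist_sq M (W (\<Union>k. A k)) (\<lambda>\<omega>. \<Sum>k<n. W (A k) \<omega>)) \<longlonglongrightarrow> 0" by simp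
  qed
  moreover have "has_stoch_integral M \<mu> W (expfun t) (B t)" for t
    unfolding has_stoch_integral_def
  proof (intro conjI allI impI)
    have eB: "(expfun t, B t) \<in> R1"
      unfolding R1_def by (rule subsetD[OF rel_closure_subset[OF isometric_rel_span[OF R0]]], rule rel_span_base) (auto simp: R0_def)
    show "expfun t \<in> L2 \<mu>" "B t \<in> L2 M" using isometric_onD(1,2)[OF R1 eB] by auto
    fix e :: real assume "e > 0"
    then obtain g where g: "simple_function \<mu> g" "L2_dist_sq \<mu> (expfun t) g < e"
      using L2_simple_dense[OF \<open>expfun t \<in> L2 \<mu>\<close>] by blast
    have "{(\<lambda>u. indicator A u, W A) | A. A \<in> sets borel} \<subseteq> R1" using WR by auto
    then have mono: "rel_span {(\<lambda>u. indicator A u, W A) | A. A \<in> sets borel} \<subseteq> rel_span R1"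
      by (intro rel_span_mono)
    have "(g, simple_stoch_integral \<mu> W g) \<in> simple_graph M W" using g(1) by (auto simp: simple_graph_def)
    then have "(g, simple_stoch_integral \<mu> W g) \<in> rel_span R1" using simple_graph_subset mono by blast
    from isometric_on_dist[OF isometric_rel_span[OF R1] rel_span_base[OF eB] this] g
    show "\<exists>g. simple_function \<mu> g \<and> L2_dist_sq \<mu> (expfun t) g < e \<and> L2_dist_sq M (B t) (simple_stoch_integral \<mu> W g) < e"
      by auto
  qed
  ultimately show ?thesis by blast
qed

section \<open>Minimization of the filter functional\<close>

lemma filter_functional_identity:
  fixes \<ll> \<phi> :: complex
  defines "m \<equiv> 1 / (1 + (cmod \<ll>)\<^sup>2)"
  shows "(cmod (\<phi> - 1))\<^sup>2 + (cmod (\<ll> * \<phi>))\<^sup>2 = (cmod \<ll>)\<^sup>2 / (1 + (cmod \<ll>)\<^sup>2) + (1 + (cmod \<ll>)\<^sup>2) * (cmod (\<phi> - of_real m))\<^sup>2"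
proof -
  let ?a = "(cmod \<ll>)\<^sup>2"
  have am: "(1 + ?a) * m = 1" by (simp add: m_def)
  have "(1 + ?a) * (cmod (\<phi> - of_real m))\<^sup>2 = (1 + ?a) * (cmod \<phi>)\<^sup>2 - 2 * ((1 + ?a) * m) * Re \<phi> + ((1 + ?a) * m) * m"
    by (simp add: cmod_power2) (simp add: power2_eq_square algebra_simps)
  also have "\<dots> = (1 + ?a) * (cmod \<phi>)\<^sup>2 - 2 * Re \<phi> + m" unfolding am by simp
  moreover have "(cmod (\<phi> - 1))\<^sup>2 = (cmod \<phi>)\<^sup>2 - 2 * Re \<phi> + 1"
    by (simp add: cmod_power2) (simp add: power2_eq_square algebra_simps)
  moreover have "?a / (1 + ?a) = 1 - m" by (simp add: m_def field_simps)
  ultimately show ?thesis by (simp add: norm_mult power_mult_distrib algebra_simps)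
qed

text \<open>Both infima run over the same set of real numbers. In one direction the chosen
  representative of Y is used; in the other a given \<phi> is compared with the chosen
  representative of its image, to which it is equal almost everywhere.\<close>

lemma prediction_error_spectral:
  assumes B: "\<And>s. B s \<in> L2 M" and K: "\<And>t s. (\<integral>\<omega>. B (t + s) \<omega> * cnj (B s \<omega>) \<partial>M) = char \<mu> t"
    and \<ll>m[measurable]: "\<ll> \<in> borel_measurable borel"
  shows "prediction_error_over M B \<mu> \<ll> (closed_lin_span M (B ` T)) =
    (INF \<phi>\<in>closed_lin_span \<mu> (expfun ` T) \<inter> {\<phi>. integrable \<mu> (\<lambda>u. (cmod (\<ll> u * \<phi> u))\<^sup>2)}.
      (\<integral>u. (cmod (\<phi> u - 1))\<^sup>2 \<partial>\<mu>) + (\<integral>u. (cmod (\<ll> u * \<phi> u))\<^sup>2 \<partial>\<mu>))"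
proof -
  define W where "W = spectral_random_measure M B \<mu>"
  have ex: "\<exists>W. orthogonal_random_measure M \<mu> W \<and> (\<forall>t. has_stoch_integral M \<mu> W (\<lambda>u. iexp (t * u)) (B t))"
    using spectral_random_measure_exists[OF B K] unfolding expfun_def[abs_def] by blast
  have "orthogonal_random_measure M \<mu> W \<and> (\<forall>t. has_stoch_integral M \<mu> W (\<lambda>u. iexp (t * u)) (B t))"
    unfolding W_def spectral_random_measure_def by (rule someI_ex[OF ex])
  then have W: "orthogonal_random_measure M \<mu> W" and eB: "has_stoch_integral M \<mu> W (expfun t) (B t)" for t
    by (auto simp: expfun_def[abs_def])
  define H where "H = {(\<phi>, \<xi>). has_stoch_integral M \<mu> W \<phi> \<xi>}"
  have iso: "isometric_on \<mu> M H" unfolding H_def by (rule stoch_integral_isometric(1)[OF W])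
  have total: "\<exists>\<xi>. (\<phi>, \<xi>) \<in> H" if "\<phi> \<in> L2 \<mu>" for \<phi>
    using stoch_integral_isometric(2)[OF W that] by (simp add: H_def)
  have eBH: "(expfun t, B t) \<in> H" for t using eB by (simp add: H_def)
  have to: "\<xi> \<in> closed_lin_span M (B ` T)" if "(\<phi>, \<xi>) \<in> H" "\<phi> \<in> closed_lin_span \<mu> (expfun ` T)" for \<phi> \<xi> T
    by (rule isometric_on_closed_lin_span[OF iso _ that]) (use eBH in blast)
  have from_M: "\<phi> \<in> closed_lin_span \<mu> (expfun ` T)" if "(\<phi>, \<xi>) \<in> H" "\<xi> \<in> closed_lin_span M (B ` T)" for \<phi> \<xi> T
    by (rule isometric_on_closed_lin_span[OF isometric_on_converse[OF iso], of "B ` T" _ \<xi>]) (use eBH that in blast)+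
  \<comment> \<open>Being an integral of \<phi> depends on \<xi> only up to almost sure
    equality.\<close>
  have AE_resp: "(\<phi>, \<xi>') \<in> H" if p: "(\<phi>, \<xi>) \<in> H" and \<xi>': "\<xi>' \<in> L2 M" and dist0: "L2_dist_sq M \<xi> \<xi>' = 0" for \<phi> \<xi> \<xi>'
  proof -
    have \<xi>: "\<xi> \<in> L2 M" by (rule isometric_onD(2)[OF iso p])
    have AE: "AE \<omega> in M. \<xi> \<omega> = \<xi>' \<omega>" using dist0 L2_dist_sq_eq_0_iff[OF \<xi> \<xi>'] by simp
    have WL: "W A \<in> L2 M" if "A \<in> sets borel" for A
      using W that by (auto simp: orthogonal_random_measure_def sets_eq)
    have "L2_dist_sq M \<xi> (simple_stoch_integral \<mu> W g) = L2_dist_sq M \<xi>' (simple_stoch_integral \<mu> W g)" if g: "simple_function \<mu> g" for g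
    proof (rule L2_dist_sq_cong_AE[OF AE])
      have "g -` {z} \<in> sets borel" for z using simple_functionD(2)[OF g, of "{z}"] by (simp add: sets_eq)
      then have "simple_stoch_integral \<mu> W g \<in> L2 M"
        unfolding simple_stoch_integral_def by (auto intro!: L2_sum L2_scale WL)
      then show "simple_stoch_integral \<mu> W g \<in> borel_measurable M" by (rule L2_measurable)
      then show "simple_stoch_integral \<mu> W g \<in> borel_measurable M" .
    qed (use L2_measurable[OF \<xi>] L2_measurable[OF \<xi>'] in auto)
    note eq = this
    have p': "\<phi> \<in> L2 \<mu>" "\<And>e. e > 0 \<Longrightarrow> \<exists>g. simple_function \<mu> g \<and> L2_dist_sq \<mu> \<phi> g < e \<and>
        L2_dist_sq M \<xi> (simple_stoch_integral \<mu> W g) < e"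
      using p by (auto simp: H_def has_stoch_integral_def)
    show ?thesis
      unfolding H_def has_stoch_integral_def
    proof (intro CollectI case_prodI conjI allI impI p'(1) \<xi>')
      fix e :: real assume "e > 0"
      then obtain g where "simple_function \<mu> g" "L2_dist_sq \<mu> \<phi> g < e" "L2_dist_sq M \<xi> (simple_stoch_integral \<mu> W g) < e"
        using p'(2) by blast
      then show "\<exists>g. simple_function \<mu> g \<and> L2_dist_sq \<mu> \<phi> g < e \<and> L2_dist_sq M \<xi>' (simple_stoch_integral \<mu> W g) < e"
        using eq[of g] by (intro exI[of _ g]) simp
    qed
  qed
  define \<phi>\<^sub>Y where "\<phi>\<^sub>Y Y = spectral_repr M B \<mu> Y" for Y
  \<comment> \<open>Y lies in the closed span of B, but a preimage under \<open>H\<close> has to be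
    produced: completeness of L2(\<open>\<mu>\<close>) gives \<phi> in the closure of the converse
    relation, and an integral of \<phi> has distance 0 from Y.\<close>
  have repr: "(\<phi>\<^sub>Y Y, Y) \<in> H" if Y: "Y \<in> process_space M B" for Y
  proof -
    have YL: "Y \<in> L2 M" using closed_lin_span_L2 Y unfolding process_space_def by blast
    obtain \<phi> where \<phi>: "(Y, \<phi>) \<in> rel_closure M \<mu> (rel_span (H\<inverse>))"
    proof (rule rel_closure_total[OF isometric_rel_span[OF isometric_on_converse[OF iso]] YL])
      fix e :: real assume "e > 0"
      then obtain X where X: "X \<in> complex_lin_span (range B)" "L2_dist_sq M Y X < e"
        using Y unfolding process_space_def closed_lin_span_def by blast
      have "\<exists>p\<in>complex_lin_span (range expfun). (X, p) \<in> rel_span (H\<inverse>)"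
        by (rule complex_lin_span_transfer[OF _ X(1)]) (use eBH in blast)
      then show "\<exists>(\<psi>, \<eta>)\<in>rel_span (H\<inverse>). L2_dist_sq M Y \<psi> < e" using X(2) by blast
    qed (use that in auto)
    have isoC: "isometric_on M \<mu> (rel_closure M \<mu> (rel_span (H\<inverse>)))"
      by (intro isometric_rel_closure isometric_rel_span isometric_on_converse iso)
    have \<phi>L: "\<phi> \<in> L2 \<mu>" by (rule isometric_onD(2)[OF isoC \<phi>])
    obtain \<xi> where \<xi>: "(\<phi>, \<xi>) \<in> H" using total[OF \<phi>L] by blast
    have "(\<xi>, \<phi>) \<in> rel_closure M \<mu> (rel_span (H\<inverse>))"
      by (rule subsetD[OF rel_closure_subset[OF isometric_rel_span[OF isometric_on_converse[OF iso]]]], rule rel_span_base)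
         (use \<xi> in auto)
    from isometric_on_dist[OF isoC this \<phi>] have "L2_dist_sq M \<xi> Y = 0" by simp
    then have "(\<phi>, Y) \<in> H" by (rule AE_resp[OF \<xi> YL])
    then have "\<exists>\<phi>. has_stoch_integral M \<mu> W \<phi> Y" unfolding H_def by blast
    then have "has_stoch_integral M \<mu> W (SOME \<phi>. has_stoch_integral M \<mu> W \<phi> Y) Y" by (rule someI_ex)
    then show ?thesis by (simp add: \<phi>\<^sub>Y_def spectral_repr_def H_def W_def)
  qed
  have dom: "Y \<in> filter_domain M B \<mu> \<ll> \<longleftrightarrow> Y \<in> process_space M B \<and> integrable \<mu> (\<lambda>u. (cmod (\<ll> u * \<phi>\<^sub>Y Y u))\<^sup>2)" for Y
    by (simp add: filter_domain_def \<phi>\<^sub>Y_def)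
  have lf: "(\<integral>\<omega>. (cmod (linear_filter M B \<mu> \<ll> Y \<omega>))\<^sup>2 \<partial>M) = (\<integral>u. (cmod (\<ll> u * \<phi>\<^sub>Y Y u))\<^sup>2 \<partial>\<mu>)"
    if Y: "Y \<in> filter_domain M B \<mu> \<ll>" for Y
  proof -
    have "\<phi>\<^sub>Y Y \<in> L2 \<mu>" using Y dom isometric_onD(1)[OF iso repr] by blast
    moreover from this have [measurable]: "\<phi>\<^sub>Y Y \<in> borel_measurable borel" by (simp add: L2_def measurable_eq)
    have "(\<lambda>u. \<ll> u * \<phi>\<^sub>Y Y u) \<in> borel_measurable borel" by measurable
    ultimately have "(\<lambda>u. \<ll> u * \<phi>\<^sub>Y Y u) \<in> L2 \<mu>" using Y dom by (simp add: L2_def measurable_eq)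
    from someI_ex[OF stoch_integral_isometric(2)[OF W this]]
    have "((\<lambda>u. \<ll> u * \<phi>\<^sub>Y Y u), linear_filter M B \<mu> \<ll> Y) \<in> H"
      by (simp add: H_def linear_filter_def stoch_integral_def \<phi>\<^sub>Y_def W_def)
    from isometric_on_norm[OF iso this] show ?thesis by simp
  qed
  have e0: "expfun 0 = (\<lambda>u. 1)" by (simp add: fun_eq_iff)
  have d0: "(\<integral>\<omega>. (cmod (Y \<omega> - B 0 \<omega>))\<^sup>2 \<partial>M) = (\<integral>u. (cmod (\<phi> u - 1))\<^sup>2 \<partial>\<mu>)" if "(\<phi>, Y) \<in> H" for \<phi> Y
    using isometric_on_dist[OF iso that eBH[of 0]] by (simp add: L2_dist_sq_def e0)
  define J where "J \<phi> = (\<integral>u. (cmod (\<phi> u - 1))\<^sup>2 \<partial>\<mu>) + (\<integral>u. (cmod (\<ll> u * \<phi> u))\<^sup>2 \<partial>\<mu>)" for \<phi>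
  have sub: "closed_lin_span M (B ` T) \<subseteq> process_space M B"
    unfolding process_space_def by (rule closed_lin_span_mono) auto
  have val: "(\<integral>\<omega>. (cmod (Y \<omega> - B 0 \<omega>))\<^sup>2 \<partial>M) + (\<integral>\<omega>. (cmod (linear_filter M B \<mu> \<ll> Y \<omega>))\<^sup>2 \<partial>M) = J (\<phi>\<^sub>Y Y)"
    if "Y \<in> filter_domain M B \<mu> \<ll>" for Y
    using d0[OF repr] lf[OF that] that dom by (simp add: J_def)
  have "(\<lambda>Y. (\<integral>\<omega>. (cmod (Y \<omega> - B 0 \<omega>))\<^sup>2 \<partial>M) + (\<integral>\<omega>. (cmod (linear_filter M B \<mu> \<ll> Y \<omega>))\<^sup>2 \<partial>M)) `
      (closed_lin_span M (B ` T) \<inter> filter_domain M B \<mu> \<ll>)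
    = J ` (closed_lin_span \<mu> (expfun ` T) \<inter> {\<phi>. integrable \<mu> (\<lambda>u. (cmod (\<ll> u * \<phi> u))\<^sup>2)})" (is "?L = ?R")
  proof (intro equalityI subsetI)
    fix x assume "x \<in> ?L"
    then obtain Y where Y: "Y \<in> closed_lin_span M (B ` T)" "Y \<in> filter_domain M B \<mu> \<ll>" "x = J (\<phi>\<^sub>Y Y)"
      using val by auto
    then have "\<phi>\<^sub>Y Y \<in> closed_lin_span \<mu> (expfun ` T)" using from_M[OF repr] dom by blast
    then show "x \<in> ?R" using Y dom by blast
  next
    fix x assume "x \<in> ?R"
    then obtain \<phi> where \<phi>: "\<phi> \<in> closed_lin_span \<mu> (expfun ` T)" "integrable \<mu> (\<lambda>u. (cmod (\<ll> u * \<phi> u))\<^sup>2)" "x = J \<phi>" by blast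
    have \<phi>L: "\<phi> \<in> L2 \<mu>" by (rule closed_lin_span_L2[OF \<phi>(1)])
    obtain Y where Y: "(\<phi>, Y) \<in> H" using total[OF \<phi>L] by blast
    have YT: "Y \<in> closed_lin_span M (B ` T)" by (rule to[OF Y \<phi>(1)])
    have rY: "(\<phi>\<^sub>Y Y, Y) \<in> H" by (rule repr) (use YT sub in blast)
    have "L2_dist_sq \<mu> \<phi> (\<phi>\<^sub>Y Y) = 0" using isometric_on_dist[OF iso Y rY] by simp
    then have AE: "AE u in \<mu>. \<phi> u = \<phi>\<^sub>Y Y u"
      using L2_dist_sq_eq_0_iff[OF \<phi>L isometric_onD(1)[OF iso rY]] by simp
    note [measurable] = L2_measurable[OF \<phi>L, unfolded measurable_eq] L2_measurable[OF isometric_onD(1)[OF iso rY], unfolded measurable_eq]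
    have "integrable \<mu> (\<lambda>u. (cmod (\<ll> u * \<phi> u))\<^sup>2) \<longleftrightarrow> integrable \<mu> (\<lambda>u. (cmod (\<ll> u * \<phi>\<^sub>Y Y u))\<^sup>2)"
      by (rule integrable_cong_AE) (use AE in \<open>auto simp: measurable_eq elim: eventually_mono\<close>)
    then have Yd: "Y \<in> filter_domain M B \<mu> \<ll>" using \<phi>(2) YT sub dom by blast
    have "J \<phi> = J (\<phi>\<^sub>Y Y)"
      unfolding J_def
      by (intro arg_cong2[where f="(+)"] integral_cong_AE) (use AE in \<open>auto simp: measurable_eq elim: eventually_mono\<close>)
    then show "x \<in> ?L" using val[OF Yd] YT Yd \<phi>(3) by (intro image_eqI[of _ _ Y]) auto
  qed
  then show ?thesis unfolding prediction_error_over_def J_def by simp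
qed

text \<open>The excess of the functional over c is the squared distance of \<phi> to m with weight 1
  + |\<ll>|^2. The weight is at least 1, so a minimizing sequence with limit value c converges to m
  in L2(\<open>\<mu>\<close>); conversely |\<ll> m|^2 \<le> 1 puts m in the domain, where the excess
  vanishes. For the full span the value c is always reached, because the exponentials are
  dense.\<close>

lemma prediction_error_iff:
  assumes B: "\<And>s. B s \<in> L2 M" and K: "\<And>t s. (\<integral>\<omega>. B (t + s) \<omega> * cnj (B s \<omega>) \<partial>M) = char \<mu> t"
    and \<ll>m[measurable]: "\<ll> \<in> borel_measurable borel"
  shows "(prediction_error M B \<mu> \<ll> t = prediction_error_infinity M B \<mu> \<ll> \<and>
      prediction_error_infinity M B \<mu> \<ll> = (\<integral>u. (cmod (\<ll> u))\<^sup>2 / (1 + (cmod (\<ll> u))\<^sup>2) \<partial>\<mu>))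
    \<longleftrightarrow> (\<lambda>u. of_real (1 / (1 + (cmod (\<ll> u))\<^sup>2))) \<in> closed_lin_span \<mu> (expfun ` {..t})"
proof -
  define m where "m u = 1 / (1 + (cmod (\<ll> u))\<^sup>2)" for u
  define c where "c = (\<integral>u. (cmod (\<ll> u))\<^sup>2 / (1 + (cmod (\<ll> u))\<^sup>2) \<partial>\<mu>)"
  define D where "D T = closed_lin_span \<mu> (expfun ` T) \<inter> {\<phi>. integrable \<mu> (\<lambda>u. (cmod (\<ll> u * \<phi> u))\<^sup>2)}" for T
  define J where "J \<phi> = (\<integral>u. (cmod (\<phi> u - 1))\<^sup>2 \<partial>\<mu>) + (\<integral>u. (cmod (\<ll> u * \<phi> u))\<^sup>2 \<partial>\<mu>)" for \<phi>
  have m1: "0 < m u" "m u \<le> 1" for u by (auto simp: m_def divide_le_eq_1 add_pos_nonneg)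
  have mm[measurable]: "m \<in> borel_measurable borel" unfolding m_def[abs_def] by measurable
  have "cmod (of_real (m u)) \<le> 1" for u using m1[of u] by simp
  then have mL: "(\<lambda>u. of_real (m u)) \<in> L2 \<mu>" by (intro bounded_L2[where C=1]) auto
  have ic: "integrable \<mu> (\<lambda>u. (cmod (\<ll> u))\<^sup>2 / (1 + (cmod (\<ll> u))\<^sup>2))"
    by (rule integrable_const_bound[where B=1]) (auto simp: measurable_eq divide_le_eq_1 add_pos_nonneg intro!: AE_I2)
  have J: "J \<phi> = c + (\<integral>u. (1 + (cmod (\<ll> u))\<^sup>2) * (cmod (\<phi> u - of_real (m u)))\<^sup>2 \<partial>\<mu>)"
    "integrable \<mu> (\<lambda>u. (1 + (cmod (\<ll> u))\<^sup>2) * (cmod (\<phi> u - of_real (m u)))\<^sup>2)"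
    if \<phi>: "\<phi> \<in> D T" for \<phi> T
  proof -
    have \<phi>L: "\<phi> \<in> L2 \<mu>" using \<phi> closed_lin_span_L2 unfolding D_def by blast
    have i1: "integrable \<mu> (\<lambda>u. (cmod (\<phi> u - 1))\<^sup>2)"
      by (rule L2_integrable[OF L2_diff[OF \<phi>L bounded_L2[where C=1]]]) auto
    have i2: "integrable \<mu> (\<lambda>u. (cmod (\<ll> u * \<phi> u))\<^sup>2)" using \<phi> by (simp add: D_def)
    have id: "(cmod (\<phi> u - 1))\<^sup>2 + (cmod (\<ll> u * \<phi> u))\<^sup>2 - (cmod (\<ll> u))\<^sup>2 / (1 + (cmod (\<ll> u))\<^sup>2)
      = (1 + (cmod (\<ll> u))\<^sup>2) * (cmod (\<phi> u - of_real (m u)))\<^sup>2" for u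
      using filter_functional_identity[of "\<phi> u" "\<ll> u"] by (simp add: m_def)
    show "integrable \<mu> (\<lambda>u. (1 + (cmod (\<ll> u))\<^sup>2) * (cmod (\<phi> u - of_real (m u)))\<^sup>2)"
      unfolding id[symmetric] using i1 i2 ic by simp
    show "J \<phi> = c + (\<integral>u. (1 + (cmod (\<ll> u))\<^sup>2) * (cmod (\<phi> u - of_real (m u)))\<^sup>2 \<partial>\<mu>)"
      unfolding id[symmetric] J_def c_def using i1 i2 ic by simp
  qed
  have Jc: "c \<le> J \<phi>" if "\<phi> \<in> D T" for \<phi> T
    unfolding J(1)[OF that] by (simp add: add_nonneg_nonneg)
  have bdd: "bdd_below (J ` D T)" for T using Jc by (intro bdd_belowI2[of _ c]) auto
  have over: "prediction_error_over M B \<mu> \<ll> (closed_lin_span M (B ` T)) = (INF \<phi>\<in>D T. J \<phi>)" for T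
    unfolding D_def J_def by (rule prediction_error_spectral[OF B K \<ll>m])
  have mem: "(INF \<phi>\<in>D T. J \<phi>) = c" if "(\<lambda>u. of_real (m u)) \<in> closed_lin_span \<mu> (expfun ` T)" for T
  proof -
    have "integrable \<mu> (\<lambda>u. (cmod (\<ll> u * of_real (m u)))\<^sup>2)"
    proof (rule integrable_const_bound[where B=1])
      show "AE u in \<mu>. norm ((cmod (\<ll> u * of_real (m u)))\<^sup>2) \<le> 1"
      proof (rule AE_I2)
        fix u
        have "(cmod (\<ll> u * of_real (m u)))\<^sup>2 = ((cmod (\<ll> u))\<^sup>2 * m u) * m u"
          using m1[of u] by (simp add: norm_mult power_mult_distrib power2_eq_square)
        also have "\<dots> \<le> 1 * 1"
          using m1[of u] by (intro mult_mono) (auto simp: m_def divide_le_eq_1 add_pos_nonneg)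
        finally show "norm ((cmod (\<ll> u * of_real (m u)))\<^sup>2) \<le> 1" by simp
      qed
    qed (simp add: measurable_eq)
    then have mD: "(\<lambda>u. of_real (m u)) \<in> D T" using that by (simp add: D_def)
    have "(INF \<phi>\<in>D T. J \<phi>) \<le> J (\<lambda>u. of_real (m u))" by (rule cINF_lower[OF bdd mD])
    also have "\<dots> = c" using J(1)[OF mD] by simp
    finally have "(INF \<phi>\<in>D T. J \<phi>) \<le> c" .
    moreover have "c \<le> (INF \<phi>\<in>D T. J \<phi>)" using mD Jc by (intro cINF_greatest) auto
    ultimately show ?thesis by simp
  qed
  have conv: "(\<lambda>u. of_real (m u)) \<in> closed_lin_span \<mu> (expfun ` T)" if eq: "(INF \<phi>\<in>D T. J \<phi>) = c" for T
  proof (rule closed_lin_span_closed[OF expfun_L2 mL])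
    fix e :: real assume "e > 0"
    have "(\<lambda>u. 0) \<in> D T"
      using closed_lin_span_span[OF expfun_L2 complex_lin_span_zero] by (simp add: D_def)
    then have ne: "D T \<noteq> {}" by blast
    have "(INF \<phi>\<in>D T. J \<phi>) < c + e" using eq \<open>e > 0\<close> by simp
    then obtain \<phi> where \<phi>: "\<phi> \<in> D T" "J \<phi> < c + e" using cINF_less_iff[OF ne bdd] by blast
    have \<phi>L: "\<phi> \<in> L2 \<mu>" using \<phi>(1) closed_lin_span_L2 unfolding D_def by blast
    have "L2_dist_sq \<mu> \<phi> (\<lambda>u. of_real (m u)) \<le> (\<integral>u. (1 + (cmod (\<ll> u))\<^sup>2) * (cmod (\<phi> u - of_real (m u)))\<^sup>2 \<partial>\<mu>)"
      unfolding L2_dist_sq_def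
    proof (intro integral_mono J(2)[OF \<phi>(1)] L2_integrable[OF L2_diff[OF \<phi>L mL]])
      fix u show "(cmod (\<phi> u - of_real (m u)))\<^sup>2 \<le> (1 + (cmod (\<ll> u))\<^sup>2) * (cmod (\<phi> u - of_real (m u)))\<^sup>2"
        by (simp add: distrib_right)
    qed
    also have "\<dots> < e" using \<phi> J(1)[OF \<phi>(1)] by simp
    finally show "\<exists>Y\<in>closed_lin_span \<mu> (expfun ` T). L2_dist_sq \<mu> (\<lambda>u. of_real (m u)) Y < e"
      using \<phi>(1) by (intro bexI[of _ \<phi>]) (auto simp: D_def L2_dist_sq_commute)
  qed
  have inf: "prediction_error_infinity M B \<mu> \<ll> = c"
    unfolding prediction_error_infinity_def process_space_def over by (rule mem) (simp add: expfun_span_dense mL)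
  have "prediction_error M B \<mu> \<ll> t = (INF \<phi>\<in>D {..t}. J \<phi>)"
    unfolding prediction_error_def past_space_def over ..
  then show ?thesis unfolding inf using mem conv by (auto simp: c_def m_def)
qed

lemma past_span_iff_hardy:
  fixes m :: "real \<Rightarrow> real"
  shows "(\<lambda>u. of_real (m u)) \<in> closed_lin_span \<mu> (expfun ` {..t}) \<longleftrightarrow> (\<lambda>u. expfun t u * of_real (m u)) \<in> hardy \<mu>"
proof
  assume "(\<lambda>u. of_real (m u)) \<in> closed_lin_span \<mu> (expfun ` {..t})"
  from closed_lin_span_cnj[OF this]
  have 1: "(\<lambda>u. of_real (m u)) \<in> closed_lin_span \<mu> ((\<lambda>Z u. cnj (Z u)) ` expfun ` {..t})" by simp
  have "(\<lambda>Z u. cnj (Z u)) ` expfun ` {..t} \<subseteq> expfun ` {-t..}"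
    by (auto simp: cnj_expfun)
  then have 2: "(\<lambda>u. of_real (m u)) \<in> closed_lin_span \<mu> (expfun ` {-t..})"
    using 1 closed_lin_span_mono by blast
  show "(\<lambda>u. expfun t u * of_real (m u)) \<in> hardy \<mu>"
    unfolding hardy_def
  proof (rule closed_lin_span_multI[OF expfun_L2 expfun_L2 _ _ _ 2, where C=1])
    fix Z assume "Z \<in> expfun ` {-t..}"
    then obtain s where "s \<ge> -t" "Z = expfun s" by auto
    then have "(\<lambda>u. expfun t u * Z u) = expfun (t + s)" "t + s \<ge> 0" by (auto simp: expfun_add fun_eq_iff)
    then show "(\<lambda>u. expfun t u * Z u) \<in> closed_lin_span \<mu> (expfun ` {0..})"
      by (auto intro: closed_lin_span_base[OF expfun_L2])
  qed (simp_all add: measurable_eq)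
next
  assume h: "(\<lambda>u. expfun t u * of_real (m u)) \<in> hardy \<mu>"
  have "(\<lambda>u. expfun (-t) u * (expfun t u * of_real (m u))) \<in> closed_lin_span \<mu> (expfun ` {-t..})"
  proof (rule closed_lin_span_multI[OF expfun_L2 expfun_L2 _ _ _ h[unfolded hardy_def], where C=1])
    fix Z assume "Z \<in> expfun ` {0..}"
    then obtain s where "s \<ge> 0" "Z = expfun s" by auto
    then have "(\<lambda>u. expfun (-t) u * Z u) = expfun (-t + s)" "-t + s \<ge> -t" by (auto simp: fun_eq_iff simp flip: expfun_add)
    then show "(\<lambda>u. expfun (-t) u * Z u) \<in> closed_lin_span \<mu> (expfun ` {-t..})"
      by (auto intro: closed_lin_span_base[OF expfun_L2])
  qed (simp_all add: measurable_eq)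
  moreover have "expfun (-t) u * (expfun t u * of_real (m u)) = of_real (m u)" for u
    by (simp add: mult.assoc[symmetric] expfun_add[symmetric])
  ultimately have "(\<lambda>u. of_real (m u)) \<in> closed_lin_span \<mu> (expfun ` {-t..})" by simp
  from closed_lin_span_cnj[OF this]
  have 1: "(\<lambda>u. of_real (m u)) \<in> closed_lin_span \<mu> ((\<lambda>Z u. cnj (Z u)) ` expfun ` {-t..})" by simp
  have "(\<lambda>Z u. cnj (Z u)) ` expfun ` {-t..} \<subseteq> expfun ` {..t}"
    by (auto simp: cnj_expfun)
  then show "(\<lambda>u. of_real (m u)) \<in> closed_lin_span \<mu> (expfun ` {..t})"
    using 1 closed_lin_span_mono by blast
qed

end

section \<open>The logarithmic integral\<close>

lemma nn_integral_inverse_three_halves: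
  "(\<integral>\<^sup>+u. ennreal ((1 + \<bar>u\<bar>) powr (-3/2)) \<partial>lborel) < \<infinity>"
proof -
  let ?h = "\<lambda>u::real. ennreal ((1 + u) powr (-3/2)) * indicator {0..} u"
  have half: "(\<integral>\<^sup>+u. ?h u \<partial>lborel) = ennreal (0 - (- 2 * (1 + 0) powr (-1/2)))"
  proof (rule nn_integral_FTC_atLeast[where F="\<lambda>u. - 2 * (1 + u) powr (-1/2)"])
    show "DERIV (\<lambda>u. - 2 * (1 + u) powr (- 1 / 2)) u :> (1 + u) powr (- 3 / 2)" if "0 \<le> u" for u :: real
      using that by (auto intro!: derivative_eq_intros simp: powr_diff field_simps)
    show "((\<lambda>u::real. - 2 * (1 + u) powr (- 1 / 2)) \<longlongrightarrow> 0) at_top" by real_asymp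
  qed auto
  have "(\<integral>\<^sup>+u. ennreal ((1 + \<bar>u\<bar>) powr (-3/2)) \<partial>lborel) \<le> (\<integral>\<^sup>+u. ?h u + ?h (- u) \<partial>lborel)"
    by (intro nn_integral_mono) (auto simp: indicator_def)
  also have "\<dots> = (\<integral>\<^sup>+u. ?h u \<partial>lborel) + (\<integral>\<^sup>+u. ?h (- u) \<partial>lborel)"
    by (rule nn_integral_add) simp_all
  also have "(\<integral>\<^sup>+u. ?h (- u) \<partial>lborel) = (\<integral>\<^sup>+u. ?h u \<partial>lborel)"
    using nn_integral_real_affine[of ?h "-1" 0] by simp
  also have "(\<integral>\<^sup>+u. ?h u \<partial>lborel) + (\<integral>\<^sup>+u. ?h u \<partial>lborel) < \<infinity>"
    unfolding half by (simp flip: ennreal_plus)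
  finally show ?thesis .
qed

text \<open>The factor pi (1 + u^2) between the densities with respect to Lebesgue and Cauchy
  measure must not change whether the logarithmic integral is finite. With y = 1 + |u|, the chain ln
  (1 + u^2) \<le> 4 ln (sqrt y) \<le> 4 sqrt y leaves an integrand of order y^(-3/2).\<close>

lemma integrable_log_weight: "integrable cauchy_measure (\<lambda>u. ln (pi * (1 + u\<^sup>2)))"
proof -
  have bound: "ln (1 + u\<^sup>2) / (1 + u\<^sup>2) \<le> 8 * (1 + \<bar>u\<bar>) powr (-3/2)" for u :: real
  proof -
    define y where "y = 1 + \<bar>u\<bar>"
    have y: "y \<ge> 1" by (simp add: y_def)
    have 1: "1 + u\<^sup>2 \<le> y\<^sup>2" by (simp add: y_def power2_sum)
    have 2: "y\<^sup>2 \<le> 2 * (1 + u\<^sup>2)"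
      using sum_squares_bound[of 1 "\<bar>u\<bar>"] by (simp add: y_def power2_sum)
    have "ln (1 + u\<^sup>2) \<le> ln (y\<^sup>2)" using 1 by (subst ln_le_cancel_iff) (use y in auto)
    also have "\<dots> = 4 * ln (sqrt y)" using y by (simp add: ln_realpow ln_sqrt)
    also have "\<dots> \<le> 4 * sqrt y" using y ln_le_minus_one[of "sqrt y"] by simp
    finally have "ln (1 + u\<^sup>2) / (1 + u\<^sup>2) \<le> 4 * sqrt y / (1 + u\<^sup>2)" by (intro divide_right_mono) auto
    also have "\<dots> \<le> 4 * sqrt y / (y\<^sup>2 / 2)"
      using 2 y by (intro divide_left_mono mult_pos_pos) auto
    also have "\<dots> = 8 * (sqrt y / y\<^sup>2)" by simp
    also have "sqrt y / y\<^sup>2 = y powr (-3/2)"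
    proof -
      have "sqrt y / y\<^sup>2 = y powr (1/2) / y powr 2" using y by (simp add: powr_half_sqrt)
      also have "\<dots> = y powr (1/2 - 2)" by (rule powr_diff[symmetric])
      finally show ?thesis by simp
    qed
    finally show ?thesis by (simp add: y_def)
  qed
  have hi: "integrable lborel (\<lambda>u::real. 8 * (1 + \<bar>u\<bar>) powr (-3/2))"
    by (intro integrable_mult_right integrableI_nonneg) (use nn_integral_inverse_three_halves in auto)
  have "integrable lborel (\<lambda>u::real. ln (1 + u\<^sup>2) / (1 + u\<^sup>2))"
  proof (rule Bochner_Integration.integrable_bound[OF hi])
    show "AE u in lborel. norm (ln (1 + u\<^sup>2) / (1 + u\<^sup>2)) \<le> norm (8 * (1 + \<bar>u\<bar>) powr (- 3 / 2) :: real)"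
    proof (rule AE_I2)
      fix u :: real
      have "0 \<le> ln (1 + u\<^sup>2) / (1 + u\<^sup>2)" by (intro divide_nonneg_pos ln_ge_zero) (auto simp: add_pos_nonneg)
      with bound[of u] show "norm (ln (1 + u\<^sup>2) / (1 + u\<^sup>2)) \<le> norm (8 * (1 + \<bar>u\<bar>) powr (- 3 / 2) :: real)" by simp
    qed
  qed measurable
  then have "integrable lborel (\<lambda>u::real. (1 / pi) * (ln (1 + u\<^sup>2) / (1 + u\<^sup>2)))" by (rule integrable_mult_right)
  then have "integrable cauchy_measure (\<lambda>u. ln (1 + u\<^sup>2))"
    by (subst integrable_cauchy_iff) auto
  then have "integrable cauchy_measure (\<lambda>u. ln pi + ln (1 + u\<^sup>2))" by simp
  then show ?thesis by (simp add: ln_mult)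
qed

lemma measurable_abs_ln [measurable]: "abs_ln \<in> borel_measurable borel"
  unfolding abs_ln_def[abs_def] by measurable

lemma log_integral_cauchy:
  assumes [measurable]: "f \<in> borel_measurable borel"
  shows "log_integral f = ennreal pi * (\<integral>\<^sup>+u. abs_ln (f u) \<partial>cauchy_measure)"
proof -
  have "(\<integral>\<^sup>+u. abs_ln (f u) \<partial>cauchy_measure) = (\<integral>\<^sup>+u. ennreal (1 / (pi * (1 + u\<^sup>2))) * abs_ln (f u) \<partial>lborel)"
    unfolding cauchy_measure_def by (rule nn_integral_density) simp_all
  then have "ennreal pi * (\<integral>\<^sup>+u. abs_ln (f u) \<partial>cauchy_measure)
      = (\<integral>\<^sup>+u. ennreal pi * (ennreal (1 / (pi * (1 + u\<^sup>2))) * abs_ln (f u)) \<partial>lborel)"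
    by (simp only:) (rule nn_integral_cmult[symmetric], measurable)
  also have "\<dots> = log_integral f"
    unfolding log_integral_def
  proof (rule nn_integral_cong)
    fix u :: real
    have "ennreal pi * ennreal (1 / (pi * (1 + u\<^sup>2))) = ennreal (1 / (1 + u\<^sup>2))"
      by (subst ennreal_mult[symmetric]) (auto intro!: mult_nonneg_nonneg)
    also have "\<dots> = inverse (ennreal (1 + u\<^sup>2))" by (subst inverse_ennreal) (auto simp: inverse_eq_divide add_pos_nonneg)
    finally have "ennreal pi * ennreal (1 / (pi * (1 + u\<^sup>2))) * abs_ln (f u) = inverse (ennreal (1 + u\<^sup>2)) * abs_ln (f u)"
      by (rule arg_cong)
    then show "ennreal pi * (ennreal (1 / (pi * (1 + u\<^sup>2))) * abs_ln (f u)) = abs_ln (f u) / ennreal (1 + u\<^sup>2)"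
      unfolding divide_ennreal_def mult.assoc by (simp only: mult.commute)
  qed
  finally show ?thesis by simp
qed

text \<open>The value \<infinity> of \<open>abs_ln\<close> at 0 forces f > 0 almost everywhere;
  after that ln g is the sum of ln f and the integrable logarithm of pi (1 + u^2).\<close>

lemma log_integral_finiteD:
  assumes fm[measurable]: "f \<in> borel_measurable borel" and f0: "\<And>u. 0 \<le> f u" and fin: "log_integral f < \<infinity>"
  defines "g \<equiv> \<lambda>u. pi * (1 + u\<^sup>2) * f u"
  shows "AE u in cauchy_measure. 0 < g u" and "integrable cauchy_measure (\<lambda>u. ln (min 1 (g u)))"
proof -
  have I: "(\<integral>\<^sup>+u. abs_ln (f u) \<partial>cauchy_measure) < \<infinity>"
  proof (rule ccontr)
    assume "\<not> (\<integral>\<^sup>+u. abs_ln (f u) \<partial>cauchy_measure) < \<infinity>"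
    then have "(\<integral>\<^sup>+u. abs_ln (f u) \<partial>cauchy_measure) = \<top>"
      unfolding infinity_ennreal_def less_top[symmetric] by simp
    then have "log_integral f = \<top>" unfolding log_integral_cauchy[OF fm] by (simp add: ennreal_mult_top)
    then show False using fin by simp
  qed
  then have "AE u in cauchy_measure. abs_ln (f u) \<noteq> \<infinity>"
    by (intro nn_integral_noteq_infinite) auto
  then have fpos: "AE u in cauchy_measure. 0 < f u"
    by eventually_elim (use f0 in \<open>auto simp: abs_ln_def less_le\<close>)
  then show "AE u in cauchy_measure. 0 < g u"
    by eventually_elim (simp add: g_def)
  have gm[measurable]: "g \<in> borel_measurable borel" unfolding g_def by measurable
  have "(\<integral>\<^sup>+u. ennreal \<bar>ln (f u)\<bar> \<partial>cauchy_measure) \<le> (\<integral>\<^sup>+u. abs_ln (f u) \<partial>cauchy_measure)"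
    by (intro nn_integral_mono) (simp add: abs_ln_def)
  then have "integrable cauchy_measure (\<lambda>u. \<bar>ln (f u)\<bar>)"
    using I by (intro integrableI_nonneg) auto
  then have i: "integrable cauchy_measure (\<lambda>u. \<bar>ln (f u)\<bar> + \<bar>ln (pi * (1 + u\<^sup>2))\<bar>)"
    using integrable_log_weight by simp
  show "integrable cauchy_measure (\<lambda>u. ln (min 1 (g u)))"
  proof (rule Bochner_Integration.integrable_bound[OF i])
    show "AE u in cauchy_measure. norm (ln (min 1 (g u))) \<le> norm (\<bar>ln (f u)\<bar> + \<bar>ln (pi * (1 + u\<^sup>2))\<bar>)"
      using fpos
    proof eventually_elim
      case (elim u)
      have "ln (g u) = ln (pi * (1 + u\<^sup>2)) + ln (f u)" unfolding g_def using elim by (intro ln_mult_pos) (auto intro!: mult_pos_pos add_pos_nonneg)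
      then show ?case by (auto simp: min_def)
    qed
  qed simp
qed

text \<open>The positive part of ln g is at most g, which is integrable, so an infinite integral
  must come from small values of g. Monotone convergence along \<delta> = 1 / (n + 1) recovers that
  part, including the set f = 0, where the supremum is infinite.\<close>

lemma log_integral_infiniteD:
  assumes fm[measurable]: "f \<in> borel_measurable borel" and f0: "\<And>u. 0 \<le> f u" and inf: "log_integral f = \<infinity>"
    and gi: "integrable cauchy_measure (\<lambda>u. pi * (1 + u\<^sup>2) * f u)"
  defines "g \<equiv> \<lambda>u. pi * (1 + u\<^sup>2) * f u"
  shows "\<exists>\<delta>>0. \<delta> \<le> 1 \<and> C \<le> (\<integral>u. - ln (max \<delta> (min 1 (g u))) \<partial>cauchy_measure)"
proof (rule ccontr)
  assume neg: "\<not> ?thesis"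
  have gm[measurable]: "g \<in> borel_measurable borel" unfolding g_def by measurable
  have g0: "0 \<le> g u" for u using f0[of u] by (simp add: g_def)
  define \<delta> where "\<delta> n = 1 / real (Suc n)" for n
  have \<delta>: "0 < \<delta> n" "\<delta> n \<le> 1" for n by (auto simp: \<delta>_def)
  define h where "h n u = - ln (max (\<delta> n) (min 1 (g u)))" for n u
  have hm[measurable]: "h n \<in> borel_measurable borel" for n unfolding h_def[abs_def] by measurable
  have h0: "0 \<le> h n u" "h n u \<le> - ln (\<delta> n)" for n u using \<delta>[of n] by (auto simp: h_def)
  have hi: "integrable cauchy_measure (h n)" for n
    by (rule cauchy.integrable_const_bound[where B="- ln (\<delta> n)"]) (use h0 in auto)
  have "C > (\<integral>u. h n u \<partial>cauchy_measure)" for n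
    using neg \<delta>[of n] by (auto simp: h_def not_le)
  then have hC: "(\<integral>\<^sup>+u. ennreal (h n u) \<partial>cauchy_measure) \<le> ennreal C" for n
    using hi h0 by (simp add: nn_integral_eq_integral less_imp_le ennreal_leI)
  have mono: "incseq (\<lambda>n u. ennreal (h n u))"
  proof (intro incseq_SucI le_funI ennreal_leI)
    fix n u
    have "\<delta> (Suc n) \<le> \<delta> n" by (auto simp: \<delta>_def field_simps)
    then have "max (\<delta> (Suc n)) (min 1 (g u)) \<le> max (\<delta> n) (min 1 (g u))" by auto
    then have "ln (max (\<delta> (Suc n)) (min 1 (g u))) \<le> ln (max (\<delta> n) (min 1 (g u)))"
      using \<delta>[of "Suc n"] \<delta>[of n] by (subst ln_le_cancel_iff) (auto simp: less_max_iff_disj)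
    then show "h n u \<le> h (Suc n) u" by (simp add: h_def)
  qed
  have "(\<integral>\<^sup>+u. (SUP n. ennreal (h n u)) \<partial>cauchy_measure) = (SUP n. \<integral>\<^sup>+u. ennreal (h n u) \<partial>cauchy_measure)"
    by (rule nn_integral_monotone_convergence_SUP[OF mono]) simp
  also have "\<dots> \<le> ennreal C" by (rule SUP_least) (rule hC)
  finally have L: "(\<integral>\<^sup>+u. (SUP n. ennreal (h n u)) \<partial>cauchy_measure) \<le> ennreal C" .
  have le: "abs_ln (f u) \<le> (SUP n. ennreal (h n u)) + (ennreal (g u) + ennreal (ln (pi * (1 + u\<^sup>2))))" for u
  proof (cases "f u = 0")
    case True
    then have hz: "h n u = ln (real (Suc n))" for n by (simp add: h_def g_def \<delta>_def max_def ln_div)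
    have "(SUP n. ennreal (h n u)) = \<top>"
    proof (rule ennreal_SUP_eq_top)
      fix k :: nat
      have "real k \<le> ln (real (Suc (nat \<lceil>exp (real k)\<rceil>)))"
      proof -
        have "exp (real k) \<le> real (Suc (nat \<lceil>exp (real k)\<rceil>))" by linarith
        then show ?thesis by (subst ln_ge_iff) linarith+
      qed
      then show "\<exists>n\<in>UNIV. of_nat k \<le> ennreal (h n u)"
        unfolding hz by (intro bexI[of _ "nat \<lceil>exp (real k)\<rceil>"]) (simp_all add: ennreal_of_nat_eq_real_of_nat ennreal_leI)
    qed
    then show ?thesis unfolding \<open>(SUP n. ennreal (h n u)) = \<top>\<close> by simp
  next
    case False
    then have fp: "f u > 0" using f0[of u] by simp
    then have gp: "g u > 0" by (simp add: g_def)
    have pw: "0 \<le> ln (pi * (1 + u\<^sup>2))"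
    proof (rule ln_ge_zero)
      have "1 * 1 \<le> pi * (1 + u\<^sup>2)" using pi_ge_two by (intro mult_mono) auto
      then show "1 \<le> pi * (1 + u\<^sup>2)" by simp
    qed
    obtain n where n: "\<delta> n \<le> g u"
    proof -
      obtain n where "1 / g u < real n" using reals_Archimedean2 by blast
      then have "1 < real (Suc n) * g u" using gp by (simp add: field_simps add_pos_pos)
      then have "\<delta> n \<le> g u" using gp by (simp add: \<delta>_def divide_le_eq mult.commute)
      then show ?thesis by (rule that)
    qed
    have hn: "h n u = - ln (min 1 (g u))"
      using n \<delta>[of n] by (simp add: h_def max_absorb2)
    have "ln (g u) = ln (pi * (1 + u\<^sup>2)) + ln (f u)" unfolding g_def using fp by (intro ln_mult_pos) (auto intro!: mult_pos_pos add_pos_nonneg)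
    moreover have "\<bar>ln (g u)\<bar> \<le> - ln (min 1 (g u)) + g u"
    proof (cases "g u \<le> 1")
      case True
      then show ?thesis using gp by (simp add: min_def ln_le_zero_iff)
    next
      case False
      then show ?thesis using ln_le_minus_one[OF gp] by (simp add: min_def)
    qed
    ultimately have "\<bar>ln (f u)\<bar> \<le> h n u + (g u + ln (pi * (1 + u\<^sup>2)))"
      unfolding hn using pw by linarith
    then have "ennreal \<bar>ln (f u)\<bar> \<le> ennreal (h n u) + (ennreal (g u) + ennreal (ln (pi * (1 + u\<^sup>2))))"
      using h0[of n u] g0[of u] pw by (simp add: ennreal_leI flip: ennreal_plus)
    also have "\<dots> \<le> (SUP n. ennreal (h n u)) + (ennreal (g u) + ennreal (ln (pi * (1 + u\<^sup>2))))"
      by (intro add_right_mono SUP_upper) simp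
    finally show ?thesis using fp by (simp add: abs_ln_def)
  qed
  have "(\<integral>\<^sup>+u. abs_ln (f u) \<partial>cauchy_measure) \<le>
      (\<integral>\<^sup>+u. (SUP n. ennreal (h n u)) + (ennreal (g u) + ennreal (ln (pi * (1 + u\<^sup>2)))) \<partial>cauchy_measure)"
    by (intro nn_integral_mono le)
  also have "\<dots> = (\<integral>\<^sup>+u. (SUP n. ennreal (h n u)) \<partial>cauchy_measure) +
      ((\<integral>\<^sup>+u. ennreal (g u) \<partial>cauchy_measure) + (\<integral>\<^sup>+u. ennreal (ln (pi * (1 + u\<^sup>2))) \<partial>cauchy_measure))"
    by (simp add: nn_integral_add)
  also have "\<dots> < \<infinity>"
  proof -
    have "(\<integral>\<^sup>+u. ennreal (g u) \<partial>cauchy_measure) < \<infinity>"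
      using gi g0 by (simp add: g_def nn_integral_eq_integral)
    moreover have "(\<integral>\<^sup>+u. ennreal (ln (pi * (1 + u\<^sup>2))) \<partial>cauchy_measure) < \<infinity>"
      using integrable_log_weight by (simp add: integrable_iff_bounded) (metis (no_types, lifting) ennreal_leI abs_ge_self le_less_trans nn_integral_mono)
    moreover have "(\<integral>\<^sup>+u. (SUP n. ennreal (h n u)) \<partial>cauchy_measure) < \<infinity>"
      using L by (simp add: le_less_trans)
    ultimately show ?thesis by (simp add: less_top)
  qed
  finally show False using inf by (simp add: log_integral_cauchy[OF fm] ennreal_mult_eq_top_iff)
qed

text \<open>\<open>N\<close> is a Lebesgue null set carrying the singular component \<nu>; off
  \<open>N\<close> the measure has Lebesgue density f, which is the density pi (1 + u^2) f with
  respect to the Cauchy measure.\<close>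

lemma ac_density_decomposed:
  assumes \<mu>: "finite_measure \<mu>" "sets \<mu> = sets borel" and f: "ac_density \<mu> f"
  obtains N where "decomposed_measure \<mu> (\<lambda>u. pi * (1 + u\<^sup>2) * f u) N"
proof -
  have [measurable]: "f \<in> borel_measurable borel" and f0: "\<And>u. 0 \<le> f u"
    using f by (auto simp: ac_density_def)
  obtain \<nu> N where \<nu>: "sets \<nu> = sets borel" "N \<in> null_sets lborel" "emeasure \<nu> (- N) = 0"
    "\<And>A. A \<in> sets borel \<Longrightarrow> emeasure \<mu> A = emeasure (density lborel (\<lambda>u. ennreal (f u))) A + emeasure \<nu> A"
    using f unfolding ac_density_def by blast
  have [measurable]: "N \<in> sets borel" using \<nu>(2) by auto
  let ?g = "\<lambda>u. pi * (1 + u\<^sup>2) * f u"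
  have b: "borel_finite_measure \<mu>"
    using \<mu> by (intro borel_finite_measure.intro borel_finite_measure_axioms.intro)
  have cd: "density cauchy_measure (\<lambda>u. ennreal (?g u)) = density lborel (\<lambda>u. ennreal (f u))"
  proof -
    have "density cauchy_measure (\<lambda>u. ennreal (?g u)) = density lborel (\<lambda>u. ennreal (1 / (pi * (1 + u\<^sup>2))) * ennreal (?g u))"
      unfolding cauchy_measure_def by (rule density_density_eq) simp_all
    also have "(\<lambda>u. ennreal (1 / (pi * (1 + u\<^sup>2))) * ennreal (?g u)) = (\<lambda>u. ennreal (f u))"
    proof
      fix u
      have "ennreal (1 / (pi * (1 + u\<^sup>2))) * ennreal (?g u) = ennreal (1 / (pi * (1 + u\<^sup>2)) * ?g u)"
        using f0[of u] by (intro ennreal_mult[symmetric]) (auto intro!: mult_nonneg_nonneg)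
      also have "1 / (pi * (1 + u\<^sup>2)) * ?g u = f u" by simp
      finally show "ennreal (1 / (pi * (1 + u\<^sup>2))) * ennreal (?g u) = ennreal (f u)" .
    qed
    finally show ?thesis .
  qed
  have null: "N \<in> null_sets (density lborel (\<lambda>u. ennreal (f u)))"
    using absolutely_continuousI_density[of "\<lambda>u. ennreal (f u)" lborel] \<nu>(2) by (auto simp: absolutely_continuous_def)
  have "density \<mu> (\<lambda>u. ennreal (indicator (- N) u)) = density lborel (\<lambda>u. ennreal (f u))"
  proof (rule measure_eqI)
    show "sets (density \<mu> (\<lambda>u. ennreal (indicator (- N) u))) = sets (density lborel (\<lambda>u. ennreal (f u)))"
      by (simp add: \<mu>(2))
    fix A assume "A \<in> sets (density \<mu> (\<lambda>u. ennreal (indicator (- N) u)))"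
    then have A[measurable]: "A \<in> sets borel" by (simp add: \<mu>(2))
    have "emeasure (density \<mu> (\<lambda>u. ennreal (indicator (- N) u))) A = emeasure \<mu> (- N \<inter> A)"
      unfolding ennreal_indicator by (rule emeasure_restricted) (simp_all add: \<mu>(2))
    also have "\<dots> = emeasure (density lborel (\<lambda>u. ennreal (f u))) (A - N) + emeasure \<nu> (- N \<inter> A)"
      by (subst \<nu>(4)) (simp_all add: Diff_eq Int_commute)
    also have "emeasure \<nu> (- N \<inter> A) = 0"
      using emeasure_mono[of "- N \<inter> A" "- N" \<nu>] \<nu>(1,3) by simp
    also have "emeasure (density lborel (\<lambda>u. ennreal (f u))) (A - N) = emeasure (density lborel (\<lambda>u. ennreal (f u))) A"
      by (rule emeasure_Diff_null_set[OF null]) simp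
    finally show "emeasure (density \<mu> (\<lambda>u. ennreal (indicator (- N) u))) A = emeasure (density lborel (\<lambda>u. ennreal (f u))) A" by simp
  qed
  then have "decomposed_measure \<mu> ?g N"
    by (intro decomposed_measure.intro b decomposed_measure_axioms.intro) (simp_all add: f0 \<nu>(2) cd)
  then show ?thesis by (rule that)
qed

theorem theorem5p4:
  fixes M :: "'a measure" and B :: "real \<Rightarrow> 'a \<Rightarrow> complex" and \<mu> :: "real measure"
    and f\<^sub>a :: "real \<Rightarrow> real" and \<ll> :: "real \<Rightarrow> complex" and t :: real
  assumes "prob_space M"
    and "wide_sense_stationary M B"
    and "mean_square_continuous M B"
    and "spectral_measure M B \<mu>"
    and "ac_density \<mu> f\<^sub>a"
    and "\<ll> \<in> borel_measurable borel"
  shows "(prediction_error M B \<mu> \<ll> t = prediction_error_infinity M B \<mu> \<ll> \<and>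
          prediction_error_infinity M B \<mu> \<ll> = (\<integral>u. (cmod (\<ll> u))\<^sup>2 / (1 + (cmod (\<ll> u))\<^sup>2) \<partial>\<mu>))
     \<longleftrightarrow>
         (log_integral f\<^sub>a = \<infinity>
          \<or> (log_integral f\<^sub>a < \<infinity> \<and> t > 0 \<and>
              (\<exists>V. entire_of_exp_type t V \<and>
                   (AE u in lborel. complex_of_real (1 / (1 + (cmod (\<ll> u))\<^sup>2)) = V (complex_of_real u))))
          \<or> (log_integral f\<^sub>a < \<infinity> \<and> t = 0 \<and>
              (\<exists>c. AE u in lborel. cmod (\<ll> u) = c)))"
proof -
  have \<mu>: "finite_measure \<mu>" "sets \<mu> = sets borel"
    and K: "\<And>t s. (\<integral>\<omega>. B (t + s) \<omega> * cnj (B s \<omega>) \<partial>M) = char \<mu> t"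
    using assms(4) by (auto simp: spectral_measure_def)
  have BL: "\<And>s. B s \<in> L2 M" using assms(2) by (simp add: wide_sense_stationary_def)
  have fm: "f\<^sub>a \<in> borel_measurable borel" and f0: "\<And>u. 0 \<le> f\<^sub>a u"
    using assms(5) by (auto simp: ac_density_def)
  note [measurable] = assms(6)
  define g where "g = (\<lambda>u. pi * (1 + u\<^sup>2) * f\<^sub>a u)"
  obtain N where "decomposed_measure \<mu> g N"
    using ac_density_decomposed[OF \<mu> assms(5)] unfolding g_def by blast
  then interpret decomposed_measure \<mu> g N .
  define m where "m u = 1 / (1 + (cmod (\<ll> u))\<^sup>2)" for u
  have m: "0 < m u" "m u \<le> 1" for u by (auto simp: m_def divide_le_eq_1 add_pos_nonneg)
  have mm[measurable]: "m \<in> borel_measurable borel" unfolding m_def[abs_def] by measurable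
  have L: "(prediction_error M B \<mu> \<ll> t = prediction_error_infinity M B \<mu> \<ll> \<and>
          prediction_error_infinity M B \<mu> \<ll> = (\<integral>u. (cmod (\<ll> u))\<^sup>2 / (1 + (cmod (\<ll> u))\<^sup>2) \<partial>\<mu>))
      \<longleftrightarrow> (\<lambda>u. expfun t u * of_real (m u)) \<in> hardy \<mu>"
    unfolding prediction_error_iff[OF BL K assms(6)] past_span_iff_hardy[symmetric] m_def ..
  show ?thesis
  proof (cases "log_integral f\<^sub>a = \<infinity>")
    case True
    have "hardy \<mu> = L2 \<mu>"
    proof (rule hardy_eq_L2)
      show "\<exists>\<delta>>0. \<delta> \<le> 1 \<and> C \<le> (\<integral>u. - ln (max \<delta> (min 1 (g u))) \<partial>cauchy_measure)" for C
        unfolding g_def by (rule log_integral_infiniteD[OF fm f0 True g_integrable[unfolded g_def]])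
    qed
    moreover have "(\<lambda>u. expfun t u * of_real (m u)) \<in> L2 \<mu>"
    proof (rule bounded_L2[where C=1])
      show "cmod (expfun t u * of_real (m u)) \<le> 1" for u using m[of u] by (simp add: norm_mult)
    qed measurable
    ultimately show ?thesis using L True by simp
  next
    case False
    then have fin: "log_integral f\<^sub>a < \<infinity>" by (simp add: less_top)
    have gpos: "AE u in cauchy_measure. 0 < g u" and log: "integrable cauchy_measure (\<lambda>u. ln (min 1 (g u)))"
      using log_integral_finiteD[OF fm f0 fin] by (simp_all add: g_def)
    have "(\<lambda>u. expfun t u * of_real (m u)) \<in> hardy \<mu> \<longleftrightarrow>
        (t > 0 \<and> (\<exists>V. entire_of_exp_type t V \<and> (AE u in lborel. complex_of_real (m u) = V (complex_of_real u))))
        \<or> (t = 0 \<and> (\<exists>c. AE u in lborel. cmod (\<ll> u) = c))" (is "?H \<longleftrightarrow> ?R")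
    proof
      assume ?H
      note ext = entire_extension[OF gpos log mm m this]
      obtain V where V: "V holomorphic_on UNIV" "\<And>z. cmod (V z) \<le> exp (t * \<bar>Im z\<bar>)"
        "AE u in lborel. V (of_real u) = of_real (m u)"
        using ext(2) by blast
      \<comment> \<open>Negative t is excluded by the first conclusion of
        \<open>entire_extension\<close>.\<close>
      consider "t > 0" | "t = 0" using ext(1) by linarith
      then show ?R
      proof cases
        case 1
        have "cmod (V z) \<le> 1 * exp ((t + e) * cmod z)" if "e > 0" for e z
        proof -
          have "t * \<bar>Im z\<bar> \<le> (t + e) * cmod z" using 1 that abs_Im_le_cmod[of z] by (intro mult_mono) auto
          then have "exp (t * \<bar>Im z\<bar>) \<le> exp ((t + e) * cmod z)" by simp
          then show ?thesis using V(2)[of z] by linarith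
        qed
        then have "entire_of_exp_type t V" using V(1) unfolding entire_of_exp_type_def by blast
        moreover have "AE u in lborel. complex_of_real (m u) = V (complex_of_real u)"
          using V(3) by eventually_elim simp
        ultimately show ?thesis using 1 by blast
      next
        case 2
        have "bounded (range V)" using V(2) 2 by (auto simp: bounded_iff)
        then obtain k where k: "\<And>z. V z = k" using Liouville_theorem[OF V(1)] by (auto simp: constant_on_def)
        \<comment> \<open>The constant comes from solving 1 / (1 + |\<ll>|^2) = k for
          |\<ll>|.\<close>
        have "AE u in lborel. cmod (\<ll> u) = sqrt (1 / Re k - 1)"
          using V(3)
        proof eventually_elim
          case (elim u)
          then have "Re k = m u" by (simp add: k)
          then have "1 / Re k - 1 = (cmod (\<ll> u))\<^sup>2" by (simp add: m_def)
          then show ?case by simp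
        qed
        then show ?thesis using 2 by blast
      qed
    next
      assume ?R
      then consider V where "t > 0" "entire_of_exp_type t V" "AE u in lborel. complex_of_real (m u) = V (complex_of_real u)"
        | c where "t = 0" "AE u in lborel. cmod (\<ll> u) = c" by blast
      then show ?H
      proof cases
        case 1
        show ?thesis
          by (rule entire_exp_type_in_hardy[OF _ 1(2) mm m]) (use 1 in \<open>auto elim: eventually_mono\<close>)
      next
        case 2
        \<comment> \<open>A constant is entire of exponential type not exceeding 0, so the argument
          for t > 0 also covers t = 0.\<close>
        let ?V = "\<lambda>z::complex. complex_of_real (1 / (1 + c\<^sup>2))"
        have "cmod (?V z) \<le> 1 * exp ((0 + e) * cmod z)" if "e > 0" for e z
        proof -
          have "cmod (?V z) \<le> 1" unfolding norm_of_real by (simp add: divide_le_eq_1)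
          also have "1 \<le> exp ((0 + e) * cmod z)" using that by simp
          finally show ?thesis by simp
        qed
        then have "entire_of_exp_type t ?V" unfolding entire_of_exp_type_def 2(1)
          by (intro conjI allI impI holomorphic_on_const) blast
        moreover have "AE u in lborel. ?V (of_real u) = of_real (m u)"
          using 2(2) by eventually_elim (simp add: m_def)
        ultimately show ?thesis using 2(1) by (intro entire_exp_type_in_hardy[OF _ _ mm m, of t ?V]) auto
      qed
    qed
    then show ?thesis using L fin False unfolding m_def by simp
  qed
qed

end
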